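(* Let $\Gamma=\langle S\rangle$ be a finitely generated group, with $S$ a finite symmetric generating set containing the identity, and let $\Gamma$ act by quasi-symmetric homeomorphisms with bounded measure distortion on a compact Riemannian manifold $(M,\varrho)$. Then one (equivalently, every) unbounded sequence of level sets $M\times\{t_n\}$, $t_n\to\infty$, of the warped cone $\mathcal{O}_\Gamma(M)$, with the restriction of the warped metric $\delta_\Gamma$, forms a family of expanders if and only if the action $\Gamma\curvearrowright M$ is expanding in measure.
   Context: Let $d$ be the distance and $\nu$ the measure on $M$ induced by $\varrho$. A homeomorphism $f\colon M\to M$ is \emph{quasi-symmetric} if there is an increasing homeomorphism $\eta\colon[0,\infty)\to[0,\infty)$ with $\frac{d(f(x),f(y))}{d(f(x),f(z))}\le\eta\big(\frac{d(x,y)}{d(x,z)}\big)$ for all $x,y,z$ with $z\ne x\ne y$. A map $f$ has \emph{bounded measure distortion} if there is $\Theta\ge1$ with $\frac1\Theta\nu(A)\le\nu(f(A))\le\Theta\nu(A)$ for all measurable $A$. An action has one of these properties if each group element does (no uniformity in the group element is required). The action is \emph{expanding in measure} if there is $\alpha>0$ with $\nu(S\cdot A)\ge(1+\alpha)\nu(A)$ for every measurable $A\subset M$ with $\nu(A)\le\nu(M)/2$, where $S\cdot A=\bigcup_{s\in S}s\cdot A$. \emph{Warped cone}: the open cone is $\mathcal{O}(M)=M\times[1,\infty)$ with the distance $d_{\mathcal O}$ induced by the Riemannian metric $t^2\varrho+dt^2$; $\Gamma$ acts on it by $g\cdot(x,t)=(g\cdot x,t)$. The warped cone $\mathcal{O}_\Gamma(M)$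 is $\mathcal{O}(M)$ with the warped metric $\delta_\Gamma$, the largest distance such that $\delta_\Gamma(z,w)\le d_{\mathcal O}(z,w)$ and $\delta_\Gamma(z,s\cdot z)\le1$ for all $z,w\in\mathcal{O}(M)$, $s\in S$. A sequence of finite graphs $\mathcal{G}_n$ is a \emph{family of expanders} if $|V(\mathcal{G}_n)|\to\infty$ and there are $C,\varepsilon>0$ such that every $\mathcal{G}_n$ has all degrees at most $C$ and Cheeger constant $h(\mathcal{G}_n)\ge\varepsilon$, where $h(\mathcal{G})=\inf\{|\partial W|/|W| : \emptyset\ne W\subset V(\mathcal{G}),\ |W|\le\frac12|V(\mathcal{G})|\}$ and $\partial W$ is the set of vertices outside $W$ adjacent to $W$. A sequence of metric spaces $(X_n,d_n)$ \emph{forms a family of expanders} if it is uniformly quasi-isometric to a family of expander graphs $\mathcal{X}_n$ (with path metrics): there are $L,A$ independent of $n$ and maps $f_n\colon X_n\to\mathcal{X}_n$ with $\frac1Ld_n(x,x')-A\le d(f_n(x),f_n(x'))\le Ld_n(x,x')+A$ for all $x,x'$, and every point of $\mathcal{X}_n$ within distance $A$ of $f_n(X_n)$. *)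

theory Defs
  imports "HOL-Analysis.Analysis" "HOL-Algebra.Group_Action" "HOL-Algebra.Generated_Groups"
begin

section \<open>Smooth manifolds and Riemannian metrics\<close>

text \<open>k-fold continuous differentiability on an open set S.\<close>

primrec Ck_on :: "nat \<Rightarrow> 'a::real_normed_vector set \<Rightarrow> ('a \<Rightarrow> 'b::real_normed_vector) \<Rightarrow> bool" where
  "Ck_on 0 S f \<longleftrightarrow> continuous_on S f"
| "Ck_on (Suc k) S f \<longleftrightarrow>
     (\<forall>x\<in>S. f differentiable (at x)) \<and> (\<forall>v. Ck_on k S (\<lambda>x. frechet_derivative f (at x) v))"

definition smooth_on :: "'a::real_normed_vector set \<Rightarrow> ('a \<Rightarrow> 'b::real_normed_vector) \<Rightarrow> bool" where
  "smooth_on S f \<longleftrightarrow> (\<forall>k. Ck_on k S f)"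

type_synonym ('a, 'n) chart = "'a set \<times> ('a \<Rightarrow> real^'n)"

text \<open>A smooth atlas of a manifold without boundary, of dimension \<open>CARD('n) \<ge> 1\<close>.\<close>

definition smooth_atlas :: "'a::topological_space set \<Rightarrow> ('a, 'n::finite) chart set \<Rightarrow> bool" where
  "smooth_atlas M \<A> \<longleftrightarrow>
     (\<forall>(U, \<phi>)\<in>\<A>. openin (top_of_set M) U \<and> open (\<phi> ` U) \<and> (\<exists>\<phi>'. homeomorphism U (\<phi> ` U) \<phi> \<phi>')) \<and>
     \<Union>(fst ` \<A>) = M \<and>
     (\<forall>(U, \<phi>)\<in>\<A>. \<forall>(V, \<psi>)\<in>\<A>. smooth_on (\<phi> ` (U \<inter> V)) (\<psi> \<circ> inv_into U \<phi>))"

text \<open>A Riemannian metric is given by its Gram matrices: \<open>\<rho> c p\<close> is the matrix of the inner product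
  on the tangent space at \<open>p\<close> in the basis of coordinate vector fields of the chart \<open>c\<close>. The last
  clause is the transformation law of a (0,2)-tensor under changes of charts.\<close>

definition riemannian_metric ::
    "('a, 'n::finite) chart set \<Rightarrow> (('a, 'n) chart \<Rightarrow> 'a \<Rightarrow> real^'n^'n) \<Rightarrow> bool" where
  "riemannian_metric \<A> \<rho> \<longleftrightarrow>
     (\<forall>(U, \<phi>)\<in>\<A>.
        smooth_on (\<phi> ` U) (\<lambda>x. \<rho> (U, \<phi>) (inv_into U \<phi> x)) \<and>
        (\<forall>p\<in>U. transpose (\<rho> (U, \<phi>) p) = \<rho> (U, \<phi>) p \<and>
               (\<forall>v. v \<noteq> 0 \<longrightarrow> v \<bullet> (\<rho> (U, \<phi>) p *v v) > 0))) \<and>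
     (\<forall>(U, \<phi>)\<in>\<A>. \<forall>(V, \<psi>)\<in>\<A>. \<forall>p\<in>U \<inter> V.
        let J = matrix (frechet_derivative (\<psi> \<circ> inv_into U \<phi>) (at (\<phi> p)))
        in \<rho> (U, \<phi>) p = transpose J ** \<rho> (V, \<psi>) p ** J)"

text \<open>Connectedness makes the Riemannian distance finite. Second countability is automatic for
  compact M.\<close>

definition compact_riemannian_manifold ::
    "'a::t2_space set \<Rightarrow> ('a, 'n::finite) chart set \<Rightarrow> (('a, 'n) chart \<Rightarrow> 'a \<Rightarrow> real^'n^'n) \<Rightarrow> bool" where
  "compact_riemannian_manifold M \<A> \<rho> \<longleftrightarrow>
     M \<noteq> {} \<and> compact M \<and> connected M \<and> smooth_atlas M \<A> \<and> riemannian_metric \<A> \<rho>"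


section \<open>Length, distance and volume\<close>

definition C1_on :: "real \<Rightarrow> real \<Rightarrow> (real \<Rightarrow> 'b::real_normed_vector) \<Rightarrow> bool" where
  "C1_on a b f \<longleftrightarrow>
     (\<exists>D. continuous_on {a..b} D \<and> (\<forall>s\<in>{a..b}. (f has_vector_derivative D s) (at s within {a..b})))"

definition C1_curve_on ::
    "'a::topological_space set \<Rightarrow> ('a, 'n::finite) chart set \<Rightarrow> real \<Rightarrow> real \<Rightarrow> (real \<Rightarrow> 'a) \<Rightarrow> bool" where
  "C1_curve_on M \<A> a b \<gamma> \<longleftrightarrow>
     continuous_on {a..b} \<gamma> \<and> \<gamma> ` {a..b} \<subseteq> M \<and>
     (\<forall>(U, \<phi>)\<in>\<A>. \<forall>a' b'. a \<le> a' \<and> a' \<le> b' \<and> b' \<le> b \<and> \<gamma> ` {a'..b'} \<subseteq> U \<longrightarrow> C1_on a' b' (\<phi> \<circ> \<gamma>))"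

text \<open>\<open>P\<close> holds on each piece of some finite subdivision of the unit interval.\<close>

definition piecewise :: "(real \<Rightarrow> real \<Rightarrow> bool) \<Rightarrow> bool" where
  "piecewise P \<longleftrightarrow>
     (\<exists>K. finite K \<and> {0, 1} \<subseteq> K \<and> K \<subseteq> {0..1} \<and>
          (\<forall>a\<in>K. \<forall>b\<in>K. a < b \<and> K \<inter> {a<..<b} = {} \<longrightarrow> P a b))"

text \<open>The squared Riemannian norm of the velocity. By the transformation law it does not depend on
  the chosen chart; at the finitely many break points of a piecewise C1 curve its value is
  irrelevant.\<close>

definition sq_speed ::
    "('a, 'n::finite) chart set \<Rightarrow> (('a, 'n) chart \<Rightarrow> 'a \<Rightarrow> real^'n^'n) \<Rightarrow> (real \<Rightarrow> 'a) \<Rightarrow> real \<Rightarrow> real" where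
  "sq_speed \<A> \<rho> \<gamma> s =
     (let c = (SOME c. c \<in> \<A> \<and> \<gamma> s \<in> fst c);
          v = vector_derivative (snd c \<circ> \<gamma>) (at s within {0..1})
      in v \<bullet> (\<rho> c (\<gamma> s) *v v))"

definition riem_dist ::
    "'a::topological_space set \<Rightarrow> ('a, 'n::finite) chart set \<Rightarrow> (('a, 'n) chart \<Rightarrow> 'a \<Rightarrow> real^'n^'n) \<Rightarrow>
     'a \<Rightarrow> 'a \<Rightarrow> real" where
  "riem_dist M \<A> \<rho> x y =
     Inf {integral {0..1} (\<lambda>s. sqrt (sq_speed \<A> \<rho> \<gamma> s)) | \<gamma>.
            piecewise (\<lambda>a b. C1_curve_on M \<A> a b \<gamma>) \<and> \<gamma> 0 = x \<and> \<gamma> 1 = y}"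

text \<open>The Riemannian volume is the unique Borel measure on M with density \<open>sqrt (det \<rho>)\<close> with
  respect to the Lebesgue measure in every chart.\<close>

definition riem_measure ::
    "'a::topological_space set \<Rightarrow> ('a, 'n::finite) chart set \<Rightarrow> (('a, 'n) chart \<Rightarrow> 'a \<Rightarrow> real^'n^'n) \<Rightarrow>
     'a measure" where
  "riem_measure M \<A> \<rho> =
     (THE \<nu>. space \<nu> = M \<and> sets \<nu> = sets (restrict_space borel M) \<and>
        (\<forall>(U, \<phi>)\<in>\<A>. \<forall>B\<in>sets \<nu>. B \<subseteq> U \<longrightarrow>
           emeasure \<nu> B = (\<integral>\<^sup>+x\<in>\<phi> ` B. ennreal (sqrt (det (\<rho> (U, \<phi>) (inv_into U \<phi> x)))) \<partial>lborel)))"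


section \<open>Properties of maps and actions\<close>

definition quasi_symmetric ::
    "'a::topological_space set \<Rightarrow> ('a \<Rightarrow> 'a \<Rightarrow> real) \<Rightarrow> ('a \<Rightarrow> 'a) \<Rightarrow> bool" where
  "quasi_symmetric M d f \<longleftrightarrow>
     (\<exists>f'. homeomorphism M M f f') \<and>
     (\<exists>\<eta> \<eta>'. homeomorphism {0::real..} {0::real..} \<eta> \<eta>' \<and> strict_mono_on {0..} \<eta> \<and>
        (\<forall>x\<in>M. \<forall>y\<in>M. \<forall>z\<in>M. z \<noteq> x \<and> x \<noteq> y \<longrightarrow>
           d (f x) (f y) / d (f x) (f z) \<le> \<eta> (d x y / d x z)))"

definition bounded_measure_distortion :: "'a measure \<Rightarrow> ('a \<Rightarrow> 'a) \<Rightarrow> bool" where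
  "bounded_measure_distortion \<nu> f \<longleftrightarrow>
     (\<exists>\<Theta>::real\<ge>1. \<forall>A\<in>sets \<nu>. 1 / \<Theta> * measure \<nu> A \<le> measure \<nu> (f ` A) \<and>
                          measure \<nu> (f ` A) \<le> \<Theta> * measure \<nu> A)"

definition expanding_in_measure :: "'a measure \<Rightarrow> 'g set \<Rightarrow> ('g \<Rightarrow> 'a \<Rightarrow> 'a) \<Rightarrow> bool" where
  "expanding_in_measure \<nu> S act \<longleftrightarrow>
     (\<exists>\<alpha>::real>0. \<forall>A\<in>sets \<nu>. measure \<nu> A \<le> measure \<nu> (space \<nu>) / 2 \<longrightarrow>
        measure \<nu> (\<Union>s\<in>S. act s ` A) \<ge> (1 + \<alpha>) * measure \<nu> A)"

definition finite_symmetric_generating_set :: "('g, 'z) monoid_scheme \<Rightarrow> 'g set \<Rightarrow> bool" where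
  "finite_symmetric_generating_set G S \<longleftrightarrow>
     finite S \<and> S \<subseteq> carrier G \<and> \<one>\<^bsub>G\<^esub> \<in> S \<and> (\<forall>s\<in>S. inv\<^bsub>G\<^esub> s \<in> S) \<and> generate G S = carrier G"


section \<open>Warped cones\<close>

definition open_cone :: "'a set \<Rightarrow> ('a \<times> real) set" where
  "open_cone M = M \<times> {1..}"

text \<open>The distance of the metric \<open>t\<^sup>2 \<rho> + dt\<^sup>2\<close>: a curve in the open cone is a pair consisting of a
  curve \<open>\<gamma>\<close> in M and a function \<open>r \<ge> 1\<close>.\<close>

definition cone_dist ::
    "'a::topological_space set \<Rightarrow> ('a, 'n::finite) chart set \<Rightarrow> (('a, 'n) chart \<Rightarrow> 'a \<Rightarrow> real^'n^'n) \<Rightarrow>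
     'a \<times> real \<Rightarrow> 'a \<times> real \<Rightarrow> real" where
  "cone_dist M \<A> \<rho> z w =
     Inf {integral {0..1} (\<lambda>s. sqrt ((r s)\<^sup>2 * sq_speed \<A> \<rho> \<gamma> s +
                                    (vector_derivative r (at s within {0..1}))\<^sup>2)) | \<gamma> r.
            piecewise (\<lambda>a b. C1_curve_on M \<A> a b \<gamma> \<and> C1_on a b r) \<and> r ` {0..1} \<subseteq> {1..} \<and>
            (\<gamma> 0, r 0) = z \<and> (\<gamma> 1, r 1) = w}"

text \<open>The pointwise supremum of all distances satisfying the two bounds; it is itself such a
  distance, hence the largest one.\<close>

definition warped_dist ::
    "'a::topological_space set \<Rightarrow> ('a, 'n::finite) chart set \<Rightarrow> (('a, 'n) chart \<Rightarrow> 'a \<Rightarrow> real^'n^'n) \<Rightarrow>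
     'g set \<Rightarrow> ('g \<Rightarrow> 'a \<Rightarrow> 'a) \<Rightarrow> 'a \<times> real \<Rightarrow> 'a \<times> real \<Rightarrow> real" where
  "warped_dist M \<A> \<rho> S act z w =
     Sup {D z w | D. Metric_space (open_cone M) D \<and>
            (\<forall>p\<in>open_cone M. \<forall>q\<in>open_cone M. D p q \<le> cone_dist M \<A> \<rho> p q) \<and>
            (\<forall>x t. (x, t) \<in> open_cone M \<longrightarrow> (\<forall>s\<in>S. D (x, t) (act s x, t) \<le> 1))}"


section \<open>Expanders\<close>

text \<open>A graph is a pair of a vertex set and a symmetric irreflexive adjacency relation.\<close>

type_synonym 'v graph = "'v set \<times> ('v \<times> 'v) set"

definition finite_simple_graph :: "'v graph \<Rightarrow> bool" where
  "finite_simple_graph = (\<lambda>(V, E). finite V \<and> E \<subseteq> V \<times> V \<and> sym E \<and> irrefl E)"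

definition vertex_boundary :: "'v graph \<Rightarrow> 'v set \<Rightarrow> 'v set" where
  "vertex_boundary = (\<lambda>(V, E) W. E `` W - W)"

text \<open>The value lies in \<open>ereal\<close> so that the infimum over the empty set, which occurs for graphs with
  at most one vertex, is infinity.\<close>

definition cheeger :: "'v graph \<Rightarrow> ereal" where
  "cheeger \<G> = (INF W \<in> {W. W \<noteq> {} \<and> W \<subseteq> fst \<G> \<and> real (card W) \<le> 1 / 2 * real (card (fst \<G>))}.
                  ereal (real (card (vertex_boundary \<G> W)) / real (card W)))"

definition expander_family :: "(nat \<Rightarrow> 'v graph) \<Rightarrow> bool" where
  "expander_family \<G> \<longleftrightarrow>
     (\<forall>n. finite_simple_graph (\<G> n)) \<and>
     filterlim (\<lambda>n. card (fst (\<G> n))) at_top sequentially \<and>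
     (\<exists>C::nat. \<exists>\<epsilon>::real>0. \<forall>n.
        (\<forall>v\<in>fst (\<G> n). card (snd (\<G> n) `` {v}) \<le> C) \<and> cheeger (\<G> n) \<ge> ereal \<epsilon>)"

text \<open>The length of a shortest walk. Only meaningful for connected graphs, but a graph with positive
  Cheeger constant is connected.\<close>

definition path_dist :: "'v graph \<Rightarrow> 'v \<Rightarrow> 'v \<Rightarrow> nat" where
  "path_dist \<G> u v = (LEAST k. (u, v) \<in> snd \<G> ^^ k)"

text \<open>Since all graphs are finite, it is no restriction to take natural numbers as vertices.\<close>

definition forms_expander_family :: "(nat \<Rightarrow> 'b set) \<Rightarrow> (nat \<Rightarrow> 'b \<Rightarrow> 'b \<Rightarrow> real) \<Rightarrow> bool" where
  "forms_expander_family X d \<longleftrightarrow>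
     (\<exists>\<G> :: nat \<Rightarrow> nat graph. expander_family \<G> \<and>
       (\<exists>L::real\<ge>1. \<exists>A::real\<ge>0. \<exists>f. \<forall>n.
          f n ` X n \<subseteq> fst (\<G> n) \<and>
          (\<forall>x\<in>X n. \<forall>x'\<in>X n.
             1 / L * d n x x' - A \<le> real (path_dist (\<G> n) (f n x) (f n x')) \<and>
             real (path_dist (\<G> n) (f n x) (f n x')) \<le> L * d n x x' + A) \<and>
          (\<forall>v\<in>fst (\<G> n). \<exists>x\<in>X n. real (path_dist (\<G> n) v (f n x)) \<le> A)))"

definition level_sequence :: "(nat \<Rightarrow> real) \<Rightarrow> bool" where
  "level_sequence t \<longleftrightarrow> (\<forall>n. t n \<ge> 1) \<and> filterlim t at_top sequentially"

end

theory Submission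
  imports Defs
begin

text \<open>
  The Riemannian volume is Ahlfors regular: balls of radius \<open>r \<le> 1\<close> have measure comparable to
  \<open>r\<^sup>n\<close>. Comparing the volumes of a ball and of its image, a quasi-symmetric homeomorphism with bounded
  measure distortion is therefore bi-Lipschitz as soon as its inverse is of the same kind, so all
  generators are bi-Lipschitz. Consequently the level set \<open>M \<times> {t}\<close> of the warped cone is, uniformly in
  \<open>t\<close>, quasi-isometric to the graph on \<open>M\<close> in which a step moves by at most \<open>1/t\<close> or jumps along a
  generator, and hence to the graph of the cells of a Voronoi partition at scale \<open>1/t\<close>. The cells have
  comparable measures and the graph has bounded degree, so expansion in measure, applied to unions of
  cells, bounds its Cheeger constant from below.

  Conversely, let level sets be quasi-isometric to expanders. A measurable set \<open>A\<close> is enclosed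
  between sets \<open>K \<subseteq> A \<subseteq> U\<close> at positive distance with \<open>U - K\<close> small. For large \<open>t\<close> the points of \<open>K\<close> give
  a vertex set of the expander whose boundary vertices carry balls of radius \<open>1/t\<close> in \<open>S\<^sup>m U - K\<close>
  with \<open>m\<close> independent of \<open>t\<close>. So \<open>S\<^sup>m A\<close> is larger than \<open>A\<close> by a definite factor, and bounded measure
  distortion passes the growth down to \<open>S A\<close>.
\<close>

section \<open>Curves\<close>

text \<open>The warped metric is a supremum, so bounding it from below means exhibiting competitors.
  For each level and base point the step distance is smoothed to a function that is Lipschitz with
  constant t for the distance of M and changes by at most 2 along generators; it is extended to the
  cone by a radial cutoff, and its scaled increments are averaged with a truncated metric.

  A measurable set has no scale of its own, whereas the expander at level t sees nothing below 1/t.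
  The separated pair K, U supplies a scale: the level is chosen after the pair, while m and all
  constants come from the quasi-isometry and the expanders alone. This independence is what allows
  the error of the approximation to tend to 0 at the end.

  The passage from S^m down to S rests on the inclusion of S^(m+1) A - A in the union of S (S^m A -
  A) and S A - A; iterating it gives a geometric sum with ratio the largest factor by which S can
  enlarge a measure.

  Every fact about the Riemannian distance and volume is derived from a two-sided comparison with
  the Euclidean metric in small coordinate balls.\<close>

definition hereditary :: "(real \<Rightarrow> real \<Rightarrow> bool) \<Rightarrow> bool" where
  "hereditary P \<longleftrightarrow> (\<forall>a b a' b'. P a b \<and> a \<le> a' \<and> a' \<le> b' \<and> b' \<le> b \<longrightarrow> P a' b')"

lemma hereditaryD: "hereditary P \<Longrightarrow> P a b \<Longrightarrow> a \<le> a' \<Longrightarrow> a' \<le> b' \<Longrightarrow> b' \<le> b \<Longrightarrow> P a' b'"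
  unfolding hereditary_def by blast

lemma hereditary_C1_on: "hereditary (\<lambda>a b. C1_on a b f)"
  unfolding hereditary_def
proof (intro allI impI, elim conjE)
  fix a b a' b' assume h: "C1_on a b f" "a \<le> a'" "a' \<le> b'" "b' \<le> b"
  then obtain D where D: "continuous_on {a..b} D" "\<And>s. s\<in>{a..b} \<Longrightarrow> (f has_vector_derivative D s) (at s within {a..b})"
    unfolding C1_on_def by blast
  have sub: "{a'..b'} \<subseteq> {a..b}" using h by auto
  show "C1_on a' b' f" unfolding C1_on_def
    by (rule exI[of _ D])
      (use D sub in \<open>blast intro: continuous_on_subset has_vector_derivative_within_subset\<close>)
qed

lemma hereditary_C1_curve_on: "hereditary (\<lambda>a b. C1_curve_on M \<A> a b \<gamma>)"
  unfolding hereditary_def C1_curve_on_def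
proof (intro allI impI, elim conjE, intro conjI)
  fix a b a' b'
  assume 1: "continuous_on {a..b} \<gamma>" "\<gamma> ` {a..b} \<subseteq> M" "a \<le> a'" "a' \<le> b'" "b' \<le> b"
    and 2: "\<forall>(U, \<phi>)\<in>\<A>. \<forall>a' b'. a \<le> a' \<and> a' \<le> b' \<and> b' \<le> b \<and> \<gamma> ` {a'..b'} \<subseteq> U \<longrightarrow> C1_on a' b' (\<phi> \<circ> \<gamma>)"
  show "continuous_on {a'..b'} \<gamma>" using 1 by (auto intro: continuous_on_subset)
  show "\<gamma> ` {a'..b'} \<subseteq> M" using 1 by fastforce
  show "\<forall>(U, \<phi>)\<in>\<A>. \<forall>a'' b''. a' \<le> a'' \<and> a'' \<le> b'' \<and> b'' \<le> b' \<and> \<gamma> ` {a''..b''} \<subseteq> U \<longrightarrow> C1_on a'' b'' (\<phi> \<circ> \<gamma>)"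
  proof (clarify)
    fix U \<phi> a'' b''
    assume "(U,\<phi>)\<in>\<A>" "a' \<le> a''" "a'' \<le> b''" "b'' \<le> b'" "\<gamma> ` {a''..b''} \<subseteq> U"
    then show "C1_on a'' b'' (\<phi> \<circ> \<gamma>)"
      using 1(3-) bspec[OF 2 \<open>(U,\<phi>)\<in>\<A>\<close>] by simp
  qed
qed

text \<open>For a hereditary property the break set may be any finite set of reals, with or without
  the end points and possibly with points outside the unit interval. Break sets can then be united
  and pulled back along affine maps without bookkeeping.\<close>

lemma piecewise_iff:
  assumes "hereditary P"
  shows "piecewise P \<longleftrightarrow> (\<exists>K. finite K \<and> (\<forall>a b. 0 \<le> a \<and> a < b \<and> b \<le> 1 \<and> K \<inter> {a<..<b} = {} \<longrightarrow> P a b))"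
proof
  assume "piecewise P"
  then obtain K where K': "finite K \<and> {0, 1} \<subseteq> K \<and> K \<subseteq> {0..1} \<and>
      (\<forall>a\<in>K. \<forall>b\<in>K. a < b \<and> K \<inter> {a<..<b} = {} \<longrightarrow> P a b)"
    unfolding piecewise_def by (elim exE) (rule that)
  then have K: "finite K" "{0, 1} \<subseteq> K" "K \<subseteq> {0..1}"
      and P: "\<And>a b. a \<in> K \<Longrightarrow> b \<in> K \<Longrightarrow> a < b \<Longrightarrow> K \<inter> {a<..<b} = {} \<Longrightarrow> P a b"
    by simp_all
  have "P a b" if ab: "0 \<le> a" "a < b" "b \<le> 1" "K \<inter> {a<..<b} = {}" for a b
  proof -
    define a0 where "a0 = Max {k\<in>K. k \<le> a}"
    define b0 where "b0 = Min {k\<in>K. b \<le> k}"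
    have a0: "a0 \<in> {k\<in>K. k \<le> a}" unfolding a0_def using K ab by (intro Max_in) auto
    have b0: "b0 \<in> {k\<in>K. b \<le> k}" unfolding b0_def using K ab by (intro Min_in) auto
    have a0': "k \<le> a0" if "k \<in> K" "k \<le> a" for k unfolding a0_def using K that by auto
    have b0': "b0 \<le> k" if "k \<in> K" "b \<le> k" for k unfolding b0_def using K that by auto
    have "K \<inter> {a0<..<b0} = {}"
    proof (rule ccontr)
      assume "K \<inter> {a0<..<b0} \<noteq> {}"
      then obtain k where k: "k \<in> K" "a0 < k" "k < b0" by auto
      then have "a < k" "k < b" using a0'[of k] b0'[of k] by fastforce+
      with k ab(4) show False by auto
    qed
    then have "P a0 b0" using a0 b0 ab by (intro P) auto
    then show ?thesis using hereditaryD[OF assms] a0 b0 ab by simp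
  qed
  with K show "\<exists>K. finite K \<and> (\<forall>a b. 0 \<le> a \<and> a < b \<and> b \<le> 1 \<and> K \<inter> {a<..<b} = {} \<longrightarrow> P a b)"
    by (intro exI[of _ K]) simp
next
  assume "\<exists>K. finite K \<and> (\<forall>a b. 0 \<le> a \<and> a < b \<and> b \<le> 1 \<and> K \<inter> {a<..<b} = {} \<longrightarrow> P a b)"
  then obtain K where "finite K \<and> (\<forall>a b. 0 \<le> a \<and> a < b \<and> b \<le> 1 \<and> K \<inter> {a<..<b} = {} \<longrightarrow> P a b)"
    by (elim exE) (rule that)
  then have K: "finite K"
    and P: "\<And>a b. 0 \<le> a \<Longrightarrow> a < b \<Longrightarrow> b \<le> 1 \<Longrightarrow> K \<inter> {a<..<b} = {} \<Longrightarrow> P a b"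
    by simp_all
  show "piecewise P" unfolding piecewise_def
  proof (intro exI[of _ "insert 0 (insert 1 (K \<inter> {0..1}))"] conjI ballI impI)
    fix a b assume "a \<in> insert 0 (insert 1 (K \<inter> {0..1}))" "b \<in> insert 0 (insert 1 (K \<inter> {0..1}))"
      "a < b \<and> insert 0 (insert 1 (K \<inter> {0..1})) \<inter> {a<..<b} = {}"
    moreover from this have "K \<inter> {a<..<b} = {}" by auto
    ultimately show "P a b" by (intro P) auto
  qed (use K in auto)
qed

lemma piecewise_local:
  assumes "hereditary P" "piecewise P" "0 \<le> s" "s \<le> 1"
  obtains \<delta> where "\<delta> > 0" "\<And>u v. 0 \<le> u \<Longrightarrow> u \<le> s \<Longrightarrow> s \<le> v \<Longrightarrow> v \<le> 1 \<Longrightarrow> s - \<delta> < u \<Longrightarrow> v < s + \<delta> \<Longrightarrow> P u s \<and> P s v"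
proof -
  obtain K where "finite K \<and> (\<forall>a b. 0 \<le> a \<and> a < b \<and> b \<le> 1 \<and> K \<inter> {a<..<b} = {} \<longrightarrow> P a b)"
    using assms(2) unfolding piecewise_iff[OF assms(1)] by (elim exE) (rule that)
  then have K: "finite K"
    and P: "\<And>a b. 0 \<le> a \<Longrightarrow> a < b \<Longrightarrow> b \<le> 1 \<Longrightarrow> K \<inter> {a<..<b} = {} \<Longrightarrow> P a b"
    by simp_all
  obtain \<delta> where d: "\<delta> > 0" "\<And>k. k \<in> K \<Longrightarrow> k \<noteq> s \<Longrightarrow> \<delta> \<le> dist s k"
    using finite_set_avoid[OF K, of s] by metis
  have av: "K \<inter> {u<..<s} = {}" if "s - \<delta> < u" for u
    using d(2) that by (fastforce simp: dist_real_def)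
  have av': "K \<inter> {s<..<v} = {}" if "v < s + \<delta>" for v
    using d(2) that by (fastforce simp: dist_real_def)
  have L: "P u s" if "0 \<le> u" "u < s" "s - \<delta> < u" for u
    using that av[of u] assms by (intro P) auto
  have R: "P s v" if "v \<le> 1" "s < v" "v < s + \<delta>" for v
    using that av'[of v] assms by (intro P) auto
  \<comment> \<open>The characterisation by a break set speaks of proper intervals only, so the
    degenerate interval is reached by shrinking a one-sided neighbourhood. At an end point of the
    unit interval only one side is available.\<close>
  have Z: "P s s"
  proof (cases "s > 0")
    case True
    then have "P (max 0 (s - \<delta>/2)) s" using d by (intro L) auto
    then show ?thesis using hereditaryD[OF assms(1)] True d by auto
  next
    case False
    then have "P s (min 1 (s + \<delta>/2))" using d assms by (intro R) auto
    then show ?thesis using hereditaryD[OF assms(1)] False d by auto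
  qed
  show ?thesis
  proof (rule that[OF d(1)])
    fix u v assume "0 \<le> u" "u \<le> s" "s \<le> v" "v \<le> 1" "s - \<delta> < u" "v < s + \<delta>"
    then show "P u s \<and> P s v" using L[of u] R[of v] Z by (cases "u = s"; cases "s = v") auto
  qed
qed

lemma piecewise_continuous:
  assumes "piecewise (\<lambda>a b. continuous_on {a..b} (f::real \<Rightarrow> 'b::topological_space))"
  shows "continuous_on {0..1} f"
proof -
  have her: "hereditary (\<lambda>a b. continuous_on {a..b} f)"
    unfolding hereditary_def by (auto intro: continuous_on_subset)
  show ?thesis unfolding continuous_on_eq_continuous_within
  proof
    fix s :: real assume s: "s \<in> {0..1}"
    then obtain \<delta> where d: "\<delta> > 0" "\<And>u v. 0 \<le> u \<Longrightarrow> u \<le> s \<Longrightarrow> s \<le> v \<Longrightarrow> v \<le> 1 \<Longrightarrow> s - \<delta> < u \<Longrightarrow> v < s + \<delta> \<Longrightarrow>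
         continuous_on {u..s} f \<and> continuous_on {s..v} f"
      using piecewise_local[OF her assms, of s] by auto
    define u v where "u = max 0 (s - \<delta>/2)" and "v = min 1 (s + \<delta>/2)"
    have uv: "0 \<le> u" "u \<le> s" "s \<le> v" "v \<le> 1" "s - \<delta> < u" "v < s + \<delta>"
      using d(1) s by (auto simp: u_def v_def)
    have "continuous_on ({u..s} \<union> {s..v}) f" using d(2)[OF uv] by (intro continuous_on_closed_Un) auto
    also have "{u..s} \<union> {s..v} = {u..v}" using uv by auto
    finally have c: "continuous (at s within {u..v}) f" using uv by (auto simp: continuous_on_eq_continuous_within)
    have "at s within {u..v} = at s within {0..1}"
      by (rule at_within_nhd[of _ "ball s (\<delta>/2)"])
      (use d(1) in \<open>auto simp: u_def v_def dist_real_def abs_if split: if_splits\<close>)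
    then show "continuous (at s within {0..1}) f" using c by simp
  qed
qed

lemma piecewise_mono: "piecewise P \<Longrightarrow> (\<And>a b. P a b \<Longrightarrow> Q a b) \<Longrightarrow> piecewise Q"
  unfolding piecewise_def by (elim exE, rule exI, elim conjE, intro conjI) (assumption+, simp)

section \<open>Charts\<close>

locale riem_manifold =
  fixes M :: "'a::t2_space set" and \<A> :: "('a, 'n::finite) chart set"
    and \<rho> :: "('a, 'n) chart \<Rightarrow> 'a \<Rightarrow> real^'n^'n"
  assumes manifold: "compact_riemannian_manifold M \<A> \<rho>"
begin

lemma M_facts: "M \<noteq> {}" "compact M" "connected M" "smooth_atlas M \<A>" "riemannian_metric \<A> \<rho>"
  using manifold by (auto simp: compact_riemannian_manifold_def)

lemma ex_chart: "p \<in> M \<Longrightarrow> \<exists>U \<phi>. (U, \<phi>) \<in> \<A> \<and> p \<in> U"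
  using M_facts(4) unfolding smooth_atlas_def by fastforce

text \<open>The atlas provides some inverse, while transition maps and metric coefficients are
  written with \<open>inv_into\<close>. The two agree on the image because a homeomorphism is
  injective.\<close>

lemma chart_homeo:
  assumes "(U, \<phi>) \<in> \<A>"
  shows "homeomorphism U (\<phi> ` U) \<phi> (inv_into U \<phi>)"
proof -
  obtain \<phi>' where h: "homeomorphism U (\<phi> ` U) \<phi> \<phi>'"
    using M_facts(4) assms unfolding smooth_atlas_def by blast
  have "inv_into U \<phi> y = \<phi>' y" if "y \<in> \<phi> ` U" for y
  proof -
    from that obtain x where x: "x \<in> U" "y = \<phi> x" by blast
    have "inj_on \<phi> U" using h by (intro inj_on_inverseI[of _ \<phi>']) (auto simp: homeomorphism_def)
    then show ?thesis using x h by (simp add: homeomorphism_def)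
  qed
  then show ?thesis using h by (auto intro: homeomorphism_cong)
qed

lemma chart_open:
  assumes "(U, \<phi>) \<in> \<A>"
  shows "openin (top_of_set M) U" "open (\<phi> ` U)" "U \<subseteq> M" "inj_on \<phi> U"
    "continuous_on U \<phi>" "continuous_on (\<phi> ` U) (inv_into U \<phi>)"
proof -
  show 1: "openin (top_of_set M) U" "open (\<phi> ` U)"
    using M_facts(4) assms unfolding smooth_atlas_def by blast+
  show "U \<subseteq> M" using 1(1) openin_imp_subset by blast
  show "inj_on \<phi> U" using chart_homeo[OF assms] by (intro inj_on_inverseI) (auto simp: homeomorphism_def)
  show "continuous_on U \<phi>" "continuous_on (\<phi> ` U) (inv_into U \<phi>)"
    using chart_homeo[OF assms] by (auto simp: homeomorphism_def)
qed

lemma chart_sub_open: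
  assumes "(U, \<phi>) \<in> \<A>" "openin (top_of_set M) W"
  shows "open (\<phi> ` (U \<inter> W))"
proof -
  have "openin (top_of_set U) (U \<inter> W)"
    using assms(2) chart_open(3)[OF assms(1)] unfolding openin_open by blast
  then have "openin (top_of_set (\<phi> ` U)) (\<phi> ` (U \<inter> W))"
    using homeomorphism_imp_open_map[OF chart_homeo[OF assms(1)]] by blast
  then show ?thesis using chart_open(2)[OF assms(1)] openin_open_trans by blast
qed

lemma chart_preimage_openin:
  assumes "(U, \<phi>) \<in> \<A>" "open T"
  shows "openin (top_of_set M) {q\<in>U. \<phi> q \<in> T}"
proof -
  have "openin (top_of_set U) (U \<inter> \<phi> -` T)"
    using continuous_openin_preimage_gen[OF chart_open(5)[OF assms(1)] assms(2)] .
  then have "openin (top_of_set M) (U \<inter> \<phi> -` T)"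
    using chart_open(1)[OF assms(1)] openin_trans by blast
  moreover have "U \<inter> \<phi> -` T = {q\<in>U. \<phi> q \<in> T}" by auto
  ultimately show ?thesis by simp
qed

lemma transition_C1:
  assumes "(U, \<phi>) \<in> \<A>" "(V, \<psi>) \<in> \<A>"
  defines "T \<equiv> \<psi> \<circ> inv_into U \<phi>"
  shows "open (\<phi> ` (U \<inter> V))"
    "\<And>x. x \<in> \<phi> ` (U \<inter> V) \<Longrightarrow> T differentiable (at x)"
    "\<And>v. continuous_on (\<phi> ` (U \<inter> V)) (\<lambda>x. frechet_derivative T (at x) v)"
proof -
  have "smooth_on (\<phi> ` (U \<inter> V)) T" using M_facts(4) assms unfolding smooth_atlas_def by blast
  then have "Ck_on (Suc 0) (\<phi> ` (U \<inter> V)) T" unfolding smooth_on_def by blast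
  then show "\<And>x. x \<in> \<phi> ` (U \<inter> V) \<Longrightarrow> T differentiable (at x)"
    "\<And>v. continuous_on (\<phi> ` (U \<inter> V)) (\<lambda>x. frechet_derivative T (at x) v)" by auto
  show "open (\<phi> ` (U \<inter> V))" using chart_sub_open[OF assms(1)] chart_open(1)[OF assms(2)] by blast
qed

lemma metric_continuous: "(U, \<phi>) \<in> \<A> \<Longrightarrow> continuous_on (\<phi> ` U) (\<lambda>x. \<rho> (U, \<phi>) (inv_into U \<phi> x))"
proof -
  assume "(U, \<phi>) \<in> \<A>"
  then have "smooth_on (\<phi> ` U) (\<lambda>x. \<rho> (U, \<phi>) (inv_into U \<phi> x))"
    using M_facts(5) unfolding riemannian_metric_def by blast
  then have "Ck_on 0 (\<phi> ` U) (\<lambda>x. \<rho> (U, \<phi>) (inv_into U \<phi> x))" unfolding smooth_on_def by blast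
  then show ?thesis by simp
qed

lemma metric_pos: "(U, \<phi>) \<in> \<A> \<Longrightarrow> p \<in> U \<Longrightarrow> v \<noteq> 0 \<Longrightarrow> v \<bullet> (\<rho> (U, \<phi>) p *v v) > 0"
  using M_facts(5) unfolding riemannian_metric_def by blast

lemma metric_nonneg: "(U, \<phi>) \<in> \<A> \<Longrightarrow> p \<in> U \<Longrightarrow> v \<bullet> (\<rho> (U, \<phi>) p *v v) \<ge> 0"
  using metric_pos[of U \<phi> p v] by (cases "v = 0") (auto simp: less_imp_le)

lemma metric_trans:
  assumes "(U, \<phi>) \<in> \<A>" "(V, \<psi>) \<in> \<A>" "p \<in> U" "p \<in> V"
  defines "J \<equiv> matrix (frechet_derivative (\<psi> \<circ> inv_into U \<phi>) (at (\<phi> p)))"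
  shows "\<rho> (U, \<phi>) p = transpose J ** \<rho> (V, \<psi>) p ** J"
proof -
  have "\<forall>(U, \<phi>)\<in>\<A>. \<forall>(V, \<psi>)\<in>\<A>. \<forall>p\<in>U \<inter> V.
        let J = matrix (frechet_derivative (\<psi> \<circ> inv_into U \<phi>) (at (\<phi> p)))
        in \<rho> (U, \<phi>) p = transpose J ** \<rho> (V, \<psi>) p ** J"
    using M_facts(5) unfolding riemannian_metric_def by blast
  from bspec[OF this assms(1)] have "\<forall>(V, \<psi>)\<in>\<A>. \<forall>p\<in>U \<inter> V.
        let J = matrix (frechet_derivative (\<psi> \<circ> inv_into U \<phi>) (at (\<phi> p)))
        in \<rho> (U, \<phi>) p = transpose J ** \<rho> (V, \<psi>) p ** J" by simp
  from bspec[OF this assms(2)] show ?thesis using assms(3,4) by (simp add: Let_def J_def)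
qed

text \<open>A relation instead of \<open>vector_derivative\<close>, so that it carries the existence
  of a two-sided derivative. Staying in the chart near \<open>s\<close> is part of it because the
  chart map has no meaning outside its domain.\<close>

definition velocity :: "'a set \<Rightarrow> ('a \<Rightarrow> real^'n) \<Rightarrow> (real \<Rightarrow> 'a) \<Rightarrow> real \<Rightarrow> real^'n \<Rightarrow> bool" where
  "velocity U \<phi> \<gamma> s v \<longleftrightarrow> (\<forall>\<^sub>F u in nhds s. \<gamma> u \<in> U) \<and> ((\<phi> \<circ> \<gamma>) has_vector_derivative v) (at s)"

lemma has_vector_derivative_transform_at_ev:
  assumes "(f has_vector_derivative D) (at s)" "\<forall>\<^sub>F u in nhds s. f u = g u"
  shows "(g has_vector_derivative D) (at s)"
proof -
  have "f s = g s" using assms(2) by (rule eventually_nhds_x_imp_x)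
  then show ?thesis
    using has_derivative_transform_eventually[of f "\<lambda>x. x *\<^sub>R D" s UNIV g] assms
    by (simp add: has_vector_derivative_def eventually_nhds_conv_at)
qed

lemma velocity_in: "velocity U \<phi> \<gamma> s v \<Longrightarrow> \<gamma> s \<in> U"
  unfolding velocity_def using eventually_nhds_x_imp_x by blast

text \<open>The chain rule applies the Jacobian to the velocity, and the transformation law of the
  metric compensates exactly for it, so the quadratic form has the same value in both
  charts.\<close>

lemma velocity_transition:
  assumes "(U, \<phi>) \<in> \<A>" "(V, \<psi>) \<in> \<A>" "velocity U \<phi> \<gamma> s v" "\<gamma> s \<in> V"
  defines "D \<equiv> frechet_derivative (\<psi> \<circ> inv_into U \<phi>) (at (\<phi> (\<gamma> s)))"
  shows "velocity V \<psi> \<gamma> s (D v)" "D v \<bullet> (\<rho> (V, \<psi>) (\<gamma> s) *v D v) = v \<bullet> (\<rho> (U, \<phi>) (\<gamma> s) *v v)"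
proof -
  let ?T = "\<psi> \<circ> inv_into U \<phi>"
  have sU: "\<gamma> s \<in> U" using velocity_in assms by blast
  have inU: "\<forall>\<^sub>F u in nhds s. \<gamma> u \<in> U" and der: "((\<phi> \<circ> \<gamma>) has_vector_derivative v) (at s)"
    using assms(3) by (auto simp: velocity_def)
  note T = transition_C1[OF assms(1,2)]
  \<comment> \<open>\<open>velocity\<close> controls the coordinate expression only. Its continuity
    is enough to stay in \<open>V\<close>, since the image of \<open>U \<inter> V\<close> under
    \<open>\<phi>\<close> is open and \<open>\<phi>\<close> is injective on
    \<open>U\<close>.\<close>
  have cont: "isCont (\<phi> \<circ> \<gamma>) s" using der has_vector_derivative_continuous by blast
  have "\<forall>\<^sub>F u in nhds s. (\<phi> \<circ> \<gamma>) u \<in> \<phi> ` (U \<inter> V)"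
    using cont T(1) sU assms(4) unfolding continuous_at continuous_within tendsto_at_iff_tendsto_nhds
    by (elim topological_tendstoD) auto
  with inU have inV: "\<forall>\<^sub>F u in nhds s. \<gamma> u \<in> V"
  proof eventually_elim
    case (elim u)
    then show ?case using chart_open(4)[OF assms(1)] by (auto simp: inj_on_def)
  qed
  have Dd: "(?T has_derivative D) (at (\<phi> (\<gamma> s)))"
    unfolding D_def using T(2)[of "\<phi> (\<gamma> s)"] sU assms(4) frechet_derivative_works by blast
  have "(?T \<circ> (\<phi> \<circ> \<gamma>) has_derivative D \<circ> (\<lambda>h. h *\<^sub>R v)) (at s)"
    by (rule diff_chain_at) (use der Dd in \<open>auto simp: has_vector_derivative_def\<close>)
  then have "(?T \<circ> (\<phi> \<circ> \<gamma>) has_vector_derivative D v) (at s)"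
    unfolding has_vector_derivative_def
    using linear_scale[OF has_derivative_linear[OF Dd]] by (simp add: o_def)
  moreover have "\<forall>\<^sub>F u in nhds s. (?T \<circ> (\<phi> \<circ> \<gamma>)) u = (\<psi> \<circ> \<gamma>) u"
    using inU by eventually_elim (use chart_open(4)[OF assms(1)] in simp)
  ultimately have "(\<psi> \<circ> \<gamma> has_vector_derivative D v) (at s)"
    by (rule has_vector_derivative_transform_at_ev)
  with inV show "velocity V \<psi> \<gamma> s (D v)" by (simp add: velocity_def)
  let ?J = "matrix D"
  have JD: "?J *v w = D w" for w
    using matrix_vector_mul(2)[OF has_derivative_linear[OF Dd]] by (simp add: fun_eq_iff)
  have "v \<bullet> (\<rho> (U, \<phi>) (\<gamma> s) *v v) = v \<bullet> (transpose ?J *v (\<rho> (V, \<psi>) (\<gamma> s) *v (?J *v v)))"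
    using metric_trans[OF assms(1,2) sU assms(4)] by (simp add: D_def matrix_vector_mul_assoc matrix_mul_assoc)
  also have "\<dots> = (?J *v v) \<bullet> (\<rho> (V, \<psi>) (\<gamma> s) *v (?J *v v))"
    by (metis dot_lmul_matrix inner_commute transpose_matrix_vector)
  finally show "D v \<bullet> (\<rho> (V, \<psi>) (\<gamma> s) *v D v) = v \<bullet> (\<rho> (U, \<phi>) (\<gamma> s) *v v)" by (simp add: JD)
qed

abbreviation "sqs \<equiv> sq_speed \<A> \<rho>"

text \<open>\<open>sq_speed\<close> picks an arbitrary chart around the point; by
  \<open>velocity_transition\<close> the choice does not matter. At interior times the one-sided
  derivative in its definition is the two-sided one.\<close>

lemma sq_speed_velocity:
  assumes "(U, \<phi>) \<in> \<A>" "velocity U \<phi> \<gamma> s v" "0 < s" "s < 1"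
  shows "sqs \<gamma> s = v \<bullet> (\<rho> (U, \<phi>) (\<gamma> s) *v v)"
proof -
  define c where "c = (SOME c. c \<in> \<A> \<and> \<gamma> s \<in> fst c)"
  have "c \<in> \<A> \<and> \<gamma> s \<in> fst c"
    unfolding c_def by (rule someI[of _ "(U,\<phi>)"]) (use assms velocity_in in auto)
  then obtain V \<psi> where c: "c = (V,\<psi>)" "(V,\<psi>) \<in> \<A>" "\<gamma> s \<in> V" by (cases c) auto
  note v = velocity_transition[OF assms(1) c(2) assms(2) c(3)]
  have "vector_derivative (\<psi> \<circ> \<gamma>) (at s within {0..1}) = frechet_derivative (\<psi> \<circ> inv_into U \<phi>) (at (\<phi> (\<gamma> s))) v"
    by (rule vector_derivative_at_within_ivl) (use v(1) assms in \<open>auto simp: velocity_def\<close>)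
  then show ?thesis unfolding sq_speed_def Let_def c_def[symmetric] using v(2) by (simp add: c)
qed

text \<open>This covers the break points: where no derivative exists, the form is evaluated at an
  unspecified vector and is still nonnegative.\<close>

lemma sq_speed_nonneg: "\<gamma> s \<in> M \<Longrightarrow> sqs \<gamma> s \<ge> 0"
proof -
  assume "\<gamma> s \<in> M"
  then obtain c where "c \<in> \<A> \<and> \<gamma> s \<in> fst c" using ex_chart by fastforce
  then have "(SOME c. c \<in> \<A> \<and> \<gamma> s \<in> fst c) \<in> \<A> \<and> \<gamma> s \<in> fst (SOME c. c \<in> \<A> \<and> \<gamma> s \<in> fst c)" by (rule someI)
  then show ?thesis unfolding sq_speed_def Let_def
    using metric_nonneg[of "fst (SOME c. c \<in> \<A> \<and> \<gamma> s \<in> fst c)" "snd (SOME c. c \<in> \<A> \<and> \<gamma> s \<in> fst c)"] by simp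
qed

lemma C1_curve_velocity:
  assumes "C1_curve_on M \<A> a b \<gamma>" "a < s" "s < b" "(U, \<phi>) \<in> \<A>" "\<gamma> s \<in> U"
  shows "\<exists>v. velocity U \<phi> \<gamma> s v"
proof -
  have cont: "continuous_on {a..b} \<gamma>" and im: "\<gamma> ` {a..b} \<subseteq> M" using assms by (auto simp: C1_curve_on_def)
  obtain W where W: "open W" "U = M \<inter> W" using chart_open(1)[OF assms(4)] by (auto simp: openin_open)
  have "isCont \<gamma> s" using cont assms by (auto intro!: continuous_on_interior)
  then have "\<forall>\<^sub>F u in nhds s. \<gamma> u \<in> W" using W assms(5)
    unfolding continuous_at continuous_within tendsto_at_iff_tendsto_nhds by (auto elim: topological_tendstoD)
  moreover have "\<forall>\<^sub>F u in nhds s. u \<in> {a<..<b}" using assms by (intro eventually_nhds_in_open) auto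
  ultimately have ev: "\<forall>\<^sub>F u in nhds s. u \<in> {a<..<b} \<and> \<gamma> u \<in> U"
    by eventually_elim (use im W in fastforce)
  then obtain e where e: "e > 0" "\<And>u. dist u s < e \<Longrightarrow> u \<in> {a<..<b} \<and> \<gamma> u \<in> U"
    unfolding eventually_nhds_metric by blast
  define a' b' where "a' = s - e/2" and "b' = s + e/2"
  have *: "u \<in> {a<..<b} \<and> \<gamma> u \<in> U" if "u \<in> {a'..b'}" for u
    using e that by (intro e(2)) (auto simp: a'_def b'_def dist_real_def)
  have "C1_on a' b' (\<phi> \<circ> \<gamma>)"
  proof -
    have ab: "a' \<le> b'" using e by (simp add: a'_def b'_def)
    then have le: "a \<le> a'" "a' \<le> b'" "b' \<le> b" using *[of a'] *[of b'] by auto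
    have "\<forall>(U, \<phi>)\<in>\<A>. \<forall>a' b'. a \<le> a' \<and> a' \<le> b' \<and> b' \<le> b \<and> \<gamma> ` {a'..b'} \<subseteq> U \<longrightarrow> C1_on a' b' (\<phi> \<circ> \<gamma>)"
      using assms(1) unfolding C1_curve_on_def by simp
    from bspec[OF this assms(4)] show ?thesis using le * by (simp add: image_subset_iff)
  qed
  then obtain D where "\<forall>s\<in>{a'..b'}. (\<phi> \<circ> \<gamma> has_vector_derivative D s) (at s within {a'..b'})"
    unfolding C1_on_def by blast
  then have "(\<phi> \<circ> \<gamma> has_vector_derivative D s) (at s within {a'..b'})"
    using e by (simp add: a'_def b'_def)
  moreover have "at s within {a'..b'} = at s" using e by (intro at_within_interior) (auto simp: a'_def b'_def)
  ultimately show ?thesis unfolding velocity_def using ev by (auto elim: eventually_mono)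
qed

end

section \<open>Increments, C1 pieces and affine reparametrisation\<close>

lemma norm_increment_le:
  fixes f :: "real \<Rightarrow> 'b::banach" and g :: "real \<Rightarrow> real"
  assumes "finite K" "a \<le> b" "continuous_on {a..b} f" "g integrable_on {a..b}" "\<And>s. s \<in> {a..b} \<Longrightarrow> 0 \<le> g s"
    and d: "\<And>s. s \<in> {a<..<b} - K \<Longrightarrow> \<exists>v. (f has_vector_derivative v) (at s) \<and> norm v \<le> g s"
  shows "norm (f b - f a) \<le> integral {a..b} g"
proof -
  obtain D where D: "\<And>s. s \<in> {a<..<b} - K \<Longrightarrow> (f has_vector_derivative D s) (at s) \<and> norm (D s) \<le> g s"
    using d by metis
  \<comment> \<open>With the value 0 at the exceptional points the derivative is dominated by the
    nonnegative \<open>g\<close> everywhere, and finitely many points do not affect its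
    integral.\<close>
  define D' where "D' s = (if s \<in> {a<..<b} - K then D s else 0)" for s
  have "(D' has_integral (f b - f a)) {a..b}"
    by (rule fundamental_theorem_of_calculus_interior_strong[OF assms(1,2)]) (use D assms in \<open>auto simp: D'_def\<close>)
  moreover have "norm (integral {a..b} D') \<le> integral {a..b} g"
    by (rule integral_norm_bound_integral) (use calculation assms D in \<open>auto simp: D'_def integrable_on_def\<close>)
  ultimately show ?thesis by (simp add: integral_unique)
qed

lemma C1_on_continuous: "C1_on a b f \<Longrightarrow> continuous_on {a..b} f"
  unfolding C1_on_def continuous_on_eq_continuous_within using has_vector_derivative_continuous by blast

lemma C1_on_interior:
  assumes "C1_on a b f"
  obtains D where "continuous_on {a..b} D" "\<And>s. a < s \<Longrightarrow> s < b \<Longrightarrow> (f has_vector_derivative D s) (at s)"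
proof -
  obtain D where D: "continuous_on {a..b} D" "\<forall>s\<in>{a..b}. (f has_vector_derivative D s) (at s within {a..b})"
    using assms unfolding C1_on_def by blast
  have "(f has_vector_derivative D s) (at s)" if "a < s" "s < b" for s
  proof -
    have "at s within {a..b} = at s" using that by (intro at_within_interior) auto
    then show ?thesis using D(2) that by (metis atLeastAtMost_iff less_imp_le)
  qed
  then show ?thesis using that D(1) by blast
qed

lemma C1_on_affine:
  assumes "C1_on a b f" "\<And>s. s \<in> {a'..b'} \<Longrightarrow> m * s + c \<in> {a..b}"
  shows "C1_on a' b' (\<lambda>s. f (m * s + c))"
proof -
  obtain D where D: "continuous_on {a..b} D" "\<And>s. s\<in>{a..b} \<Longrightarrow> (f has_vector_derivative D s) (at s within {a..b})"
    using assms(1) unfolding C1_on_def by blast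
  have "((\<lambda>s. f (m * s + c)) has_vector_derivative m *\<^sub>R D (m * s + c)) (at s within {a'..b'})" if "s \<in> {a'..b'}" for s
  proof -
    have "((\<lambda>s. m * s + c) has_vector_derivative m) (at s within {a'..b'})"
      by (auto intro!: derivative_eq_intros)
    moreover have "(f has_vector_derivative D (m * s + c)) (at (m * s + c) within (\<lambda>s. m * s + c) ` {a'..b'})"
      by (rule has_vector_derivative_within_subset[OF D(2)]) (use assms(2) that in auto)
    ultimately show ?thesis using vector_diff_chain_within by (fastforce simp: o_def)
  qed
  moreover have "continuous_on {a'..b'} (\<lambda>s. m *\<^sub>R D (m * s + c))"
    by (intro continuous_intros continuous_on_compose2[OF D(1)]) (use assms(2) in auto)
  ultimately show ?thesis unfolding C1_on_def by (intro exI[of _ "\<lambda>s. m *\<^sub>R D (m * s + c)"]) simp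
qed

lemma C1_on_cong:
  assumes "C1_on a b f" "\<And>s. s \<in> {a..b} \<Longrightarrow> g s = f s"
  shows "C1_on a b g"
proof -
  obtain D where D: "continuous_on {a..b} D" "\<And>s. s\<in>{a..b} \<Longrightarrow> (f has_vector_derivative D s) (at s within {a..b})"
    using assms(1) unfolding C1_on_def by blast
  then show ?thesis unfolding C1_on_def
    by (intro exI[of _ D]) (use assms(2) in \<open>auto intro: has_vector_derivative_transform\<close>)
qed

lemma C1_curve_on_affine:
  assumes "C1_curve_on M \<A> a b \<gamma>" "\<And>s. s \<in> {a'..b'} \<Longrightarrow> m * s + c \<in> {a..b}"
  shows "C1_curve_on M \<A> a' b' (\<lambda>s. \<gamma> (m * s + c))"
proof -
  have g: "continuous_on {a..b} \<gamma>" "\<gamma> ` {a..b} \<subseteq> M"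
    and C: "\<And>U \<phi> a' b'. (U,\<phi>)\<in>\<A> \<Longrightarrow> a \<le> a' \<Longrightarrow> a' \<le> b' \<Longrightarrow> b' \<le> b \<Longrightarrow> \<gamma> ` {a'..b'} \<subseteq> U \<Longrightarrow> C1_on a' b' (\<phi> \<circ> \<gamma>)"
    using assms(1) unfolding C1_curve_on_def by auto
  have 1: "continuous_on {a'..b'} (\<lambda>s. \<gamma> (m * s + c))"
    by (intro continuous_on_compose2[OF g(1)] continuous_intros) (use assms(2) in auto)
  have 2: "(\<lambda>s. \<gamma> (m * s + c)) ` {a'..b'} \<subseteq> M" using assms(2) g(2) by blast
  have 3: "C1_on p q (\<phi> \<circ> (\<lambda>s. \<gamma> (m * s + c)))"
    if ch: "(U,\<phi>)\<in>\<A>" and pq: "a' \<le> p" "p \<le> q" "q \<le> b'" and im: "(\<lambda>s. \<gamma> (m * s + c)) ` {p..q} \<subseteq> U" for U \<phi> p q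
  proof -
    \<comment> \<open>The slope may be negative or zero, so the end points of the image interval
      have to be sorted.\<close>
    define P Q where "P = min (m * p + c) (m * q + c)" and "Q = max (m * p + c) (m * q + c)"
    have img: "(\<lambda>s. m * s + c) ` {p..q} = {P..Q}"
    proof (cases "m \<ge> 0")
      case True
      then have "m * p \<le> m * q" using pq by (intro mult_left_mono)
      then show ?thesis using True pq image_affinity_atLeastAtMost[of m c p q] by (simp add: P_def Q_def)
    next
      case False
      then have "m * q \<le> m * p" using pq by (intro mult_left_mono_neg) auto
      then show ?thesis using False pq image_affinity_atLeastAtMost[of m c p q] by (simp add: P_def Q_def)
    qed
    have "P \<in> {a..b}" "Q \<in> {a..b}" using assms(2)[of p] assms(2)[of q] pq by (auto simp: P_def Q_def min_def max_def)
    moreover have "P \<le> Q" by (simp add: P_def Q_def)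
    moreover have "\<gamma> ` {P..Q} \<subseteq> U" using im unfolding img[symmetric] by auto
    ultimately have "C1_on P Q (\<phi> \<circ> \<gamma>)" using ch by (intro C[of U]) auto
    then have "C1_on p q (\<lambda>s. (\<phi> \<circ> \<gamma>) (m * s + c))" by (rule C1_on_affine) (use img in blast)
    then show ?thesis by (simp add: o_def)
  qed
  show ?thesis unfolding C1_curve_on_def using 1 2 3 by auto
qed

lemma C1_curve_on_cong:
  assumes "C1_curve_on M \<A> a b f" "\<And>s. s \<in> {a..b} \<Longrightarrow> g s = f s"
  shows "C1_curve_on M \<A> a b g"
proof -
  have g: "continuous_on {a..b} f" "f ` {a..b} \<subseteq> M"
    and C: "\<And>U \<phi> a' b'. (U,\<phi>)\<in>\<A> \<Longrightarrow> a \<le> a' \<Longrightarrow> a' \<le> b' \<Longrightarrow> b' \<le> b \<Longrightarrow> f ` {a'..b'} \<subseteq> U \<Longrightarrow> C1_on a' b' (\<phi> \<circ> f)"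
    using assms(1) unfolding C1_curve_on_def by auto
  have "continuous_on {a..b} g" using g(1) assms(2) continuous_on_cong[of "{a..b}" "{a..b}" g f] by blast
  moreover have "g ` {a..b} \<subseteq> M" using g(2) assms(2) by auto
  moreover have "C1_on p q (\<phi> \<circ> g)"
    if ch: "(U,\<phi>)\<in>\<A>" and pq: "a \<le> p" "p \<le> q" "q \<le> b" and im: "g ` {p..q} \<subseteq> U" for U \<phi> p q
    by (rule C1_on_cong[OF C[OF ch pq]]) (use assms(2) pq im in fastforce)+
  ultimately show ?thesis unfolding C1_curve_on_def by auto
qed

section \<open>Admissible curves and integrability of their speed\<close>

context riem_manifold begin

definition admissible :: "(real \<Rightarrow> 'a) \<Rightarrow> bool" where
  "admissible \<gamma> \<longleftrightarrow> piecewise (\<lambda>a b. C1_curve_on M \<A> a b \<gamma>)"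

definition cone_admissible :: "(real \<Rightarrow> 'a) \<Rightarrow> (real \<Rightarrow> real) \<Rightarrow> bool" where
  "cone_admissible \<gamma> r \<longleftrightarrow> piecewise (\<lambda>a b. C1_curve_on M \<A> a b \<gamma> \<and> C1_on a b r)"

abbreviation speed :: "(real \<Rightarrow> 'a) \<Rightarrow> real \<Rightarrow> real" where
  "speed \<gamma> s \<equiv> sqrt (sqs \<gamma> s)"

definition cone_speed :: "(real \<Rightarrow> 'a) \<Rightarrow> (real \<Rightarrow> real) \<Rightarrow> real \<Rightarrow> real" where
  "cone_speed \<gamma> r s = sqrt ((r s)\<^sup>2 * sqs \<gamma> s + (vector_derivative r (at s within {0..1}))\<^sup>2)"

lemma hereditary_cone: "hereditary (\<lambda>a b. C1_curve_on M \<A> a b \<gamma> \<and> C1_on a b r)"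
  using hereditary_C1_on[of r] hereditary_C1_curve_on[of M \<A> \<gamma>] unfolding hereditary_def by blast

lemma cone_admissible_admissible: "cone_admissible \<gamma> r \<Longrightarrow> admissible \<gamma>"
  unfolding cone_admissible_def admissible_def by (erule piecewise_mono) simp

text \<open>A curve in \<open>M\<close> is a cone curve of constant height. Continuity, existence of
  velocities and integrability of the speed are proved for cone curves and specialised through this
  lemma.\<close>

lemma admissible_cone: "admissible \<gamma> \<Longrightarrow> cone_admissible \<gamma> (\<lambda>_. t)"
  unfolding cone_admissible_def admissible_def
  by (erule piecewise_mono) (auto simp: C1_on_def intro!: exI[of _ "\<lambda>_. 0"])

lemma cone_admissible_continuous:
  assumes "cone_admissible \<gamma> r"
  shows "continuous_on {0..1} \<gamma>" "continuous_on {0..1} r"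
proof -
  show "continuous_on {0..1} \<gamma>"
    by (rule piecewise_continuous, rule piecewise_mono[OF assms[unfolded cone_admissible_def]])
      (simp add: C1_curve_on_def)
  show "continuous_on {0..1} r"
    by (rule piecewise_continuous, rule piecewise_mono[OF assms[unfolded cone_admissible_def]])
      (simp add: C1_on_continuous)
qed

lemma admissible_local:
  assumes "admissible \<gamma>" "0 \<le> s" "s \<le> 1"
  shows "C1_curve_on M \<A> s s \<gamma>" "\<gamma> s \<in> M"
proof -
  obtain \<delta> where "\<delta> > 0" "\<And>u v. 0 \<le> u \<Longrightarrow> u \<le> s \<Longrightarrow> s \<le> v \<Longrightarrow> v \<le> 1 \<Longrightarrow> s - \<delta> < u \<Longrightarrow> v < s + \<delta> \<Longrightarrow>
      C1_curve_on M \<A> u s \<gamma> \<and> C1_curve_on M \<A> s v \<gamma>"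
    using piecewise_local[OF hereditary_C1_curve_on assms(1)[unfolded admissible_def] assms(2,3)] by metis
  from this(1) this(2)[of s s] assms show "C1_curve_on M \<A> s s \<gamma>" by simp
  then show "\<gamma> s \<in> M" by (simp add: C1_curve_on_def)
qed

lemma admissible_continuous: "admissible \<gamma> \<Longrightarrow> continuous_on {0..1} \<gamma>"
  using cone_admissible_continuous(1) admissible_cone by blast

lemma cone_admissible_velocity:
  assumes "cone_admissible \<gamma> r"
  obtains K where "finite K"
    "\<And>s U \<phi>. 0 < s \<Longrightarrow> s < 1 \<Longrightarrow> s \<notin> K \<Longrightarrow> (U,\<phi>) \<in> \<A> \<Longrightarrow> \<gamma> s \<in> U \<Longrightarrow> \<exists>v. velocity U \<phi> \<gamma> s v"
    "\<And>s. 0 < s \<Longrightarrow> s < 1 \<Longrightarrow> s \<notin> K \<Longrightarrow> \<exists>v. (r has_vector_derivative v) (at s)"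
proof -
  obtain K where K: "finite K \<and> (\<forall>a b. 0 \<le> a \<and> a < b \<and> b \<le> 1 \<and> K \<inter> {a<..<b} = {} \<longrightarrow>
     C1_curve_on M \<A> a b \<gamma> \<and> C1_on a b r)"
    using assms unfolding cone_admissible_def piecewise_iff[OF hereditary_cone] by (elim exE) (rule that)
  have *: "\<exists>a b. a < s \<and> s < b \<and> C1_curve_on M \<A> a b \<gamma> \<and> C1_on a b r" if s: "0 < s" "s < 1" "s \<notin> K" for s
  proof -
    obtain \<delta> where d: "\<delta> > 0" "\<And>k. k \<in> K \<Longrightarrow> k \<noteq> s \<Longrightarrow> \<delta> \<le> dist s k"
      using finite_set_avoid[of K s] K by metis
    define a b where "a = max 0 (s - \<delta>)" and "b = min 1 (s + \<delta>)"
    have "K \<inter> {a<..<b} = {}"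
    proof (rule ccontr)
      assume "K \<inter> {a<..<b} \<noteq> {}"
      then obtain k where k: "k \<in> K" "a < k" "k < b" by auto
      then show False using d(2)[of k] s by (cases "k = s") (auto simp: a_def b_def dist_real_def abs_if split: if_splits)
    qed
    moreover have "a < s" "s < b" "0 \<le> a" "b \<le> 1" using s d by (auto simp: a_def b_def)
    ultimately show ?thesis using K by (intro exI[of _ a] exI[of _ b]) simp
  qed
  show ?thesis
  proof (rule that[of K])
    show "finite K" using K by simp
    fix s :: real assume s: "0 < s" "s < 1" "s \<notin> K"
    obtain a b where ab: "a < s" "s < b" "C1_curve_on M \<A> a b \<gamma>" "C1_on a b r" using *[OF s] by blast
    then show "\<exists>v. (r has_vector_derivative v) (at s)" using C1_on_interior[OF ab(4)] by metis
    fix U \<phi> assume "(U,\<phi>) \<in> \<A>" "\<gamma> s \<in> U"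
    then show "\<exists>v. velocity U \<phi> \<gamma> s v" using C1_curve_velocity[OF ab(3,1,2)] by blast
  qed
qed

text \<open>Inside one chart the speed equals, except possibly at the two end points, a continuous
  function built from coordinate derivatives and metric coefficients.\<close>

lemma cone_speed_integrable_piece:
  assumes "C1_curve_on M \<A> a b \<gamma>" "C1_on a b r" "(U, \<phi>) \<in> \<A>" "\<gamma> ` {a..b} \<subseteq> U" "0 \<le> a" "a \<le> b" "b \<le> 1"
  shows "cone_speed \<gamma> r integrable_on {a..b}"
proof -
  have "\<forall>(U, \<phi>)\<in>\<A>. \<forall>a' b'. a \<le> a' \<and> a' \<le> b' \<and> b' \<le> b \<and> \<gamma> ` {a'..b'} \<subseteq> U \<longrightarrow> C1_on a' b' (\<phi> \<circ> \<gamma>)"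
    using assms(1) unfolding C1_curve_on_def by simp
  from bspec[OF this assms(3)] have C1: "C1_on a b (\<phi> \<circ> \<gamma>)" using assms by simp
  obtain D where D: "continuous_on {a..b} D" "\<And>s. a < s \<Longrightarrow> s < b \<Longrightarrow> (\<phi> \<circ> \<gamma> has_vector_derivative D s) (at s)"
    using C1_on_interior[OF C1] by metis
  obtain E where E: "continuous_on {a..b} E" "\<And>s. a < s \<Longrightarrow> s < b \<Longrightarrow> (r has_vector_derivative E s) (at s)"
    using C1_on_interior[OF assms(2)] by metis
  define R where "R s = \<rho> (U,\<phi>) (\<gamma> s)" for s
  have "continuous_on {a..b} (\<lambda>s. \<rho> (U,\<phi>) (inv_into U \<phi> ((\<phi> \<circ> \<gamma>) s)))"
    by (rule continuous_on_compose2[OF metric_continuous[OF assms(3)] C1_on_continuous[OF C1]]) (use assms in auto)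
  moreover have "\<rho> (U,\<phi>) (inv_into U \<phi> ((\<phi> \<circ> \<gamma>) s)) = R s" if "s \<in> {a..b}" for s
    using that assms(4) chart_open(4)[OF assms(3)] inv_into_f_f[of \<phi> U "\<gamma> s"]
    by (auto simp: R_def image_subset_iff)
  ultimately have Rc: "continuous_on {a..b} R" by (rule continuous_on_eq)
  define G where "G s = sqrt ((r s)\<^sup>2 * (D s \<bullet> (R s *v D s)) + (E s)\<^sup>2)" for s
  have "continuous_on {a..b} G"
    unfolding G_def inner_vec_def matrix_vector_mult_def
    using C1_on_continuous[OF assms(2)] D(1) E(1) Rc
    by (auto intro!: continuous_intros)
  then have "G integrable_on {a..b}" by (rule integrable_continuous_real)
  moreover have "cone_speed \<gamma> r s = G s" if s: "s \<in> {a..b} - {a,b}" for s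
  proof -
    have s': "a < s" "s < b" "0 < s" "s < 1" using s assms by auto
    have "\<forall>\<^sub>F u in nhds s. u \<in> {a<..<b}" using s' by (intro eventually_nhds_in_open) auto
    then have "\<forall>\<^sub>F u in nhds s. \<gamma> u \<in> U" by eventually_elim (use assms(4) in auto)
    then have "velocity U \<phi> \<gamma> s (D s)" using D(2)[OF s'(1,2)] by (simp add: velocity_def)
    then have "sqs \<gamma> s = D s \<bullet> (R s *v D s)" using sq_speed_velocity[OF assms(3) _ s'(3,4)] by (simp add: R_def)
    moreover have "vector_derivative r (at s within {0..1}) = E s"
      by (rule vector_derivative_at_within_ivl[OF E(2)]) (use s' in auto)
    ultimately show ?thesis by (simp add: cone_speed_def G_def)
  qed
  ultimately show ?thesis using integrable_spike_finite[of "{a,b}" "{a..b}" "cone_speed \<gamma> r" G] by simp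
qed

text \<open>Integrability is a local matter. Near a time \<open>s\<close> the curve stays in one
  chart and \<open>s\<close> is the only possible break point, so every small interval around
  \<open>s\<close> splits at \<open>s\<close> into two pieces of the previous kind.\<close>

lemma cone_speed_integrable:
  assumes "cone_admissible \<gamma> r"
  shows "cone_speed \<gamma> r integrable_on {0..1}"
proof -
  have "cone_speed \<gamma> r integrable_on cbox 0 1"
  proof (rule integrable_on_little_subintervals, rule ballI)
    fix s :: real assume "s \<in> cbox 0 1"
    then have s: "0 \<le> s" "s \<le> 1" by auto
    obtain \<delta> where d: "\<delta> > 0" "\<And>u v. 0 \<le> u \<Longrightarrow> u \<le> s \<Longrightarrow> s \<le> v \<Longrightarrow> v \<le> 1 \<Longrightarrow> s - \<delta> < u \<Longrightarrow> v < s + \<delta> \<Longrightarrow>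
      (C1_curve_on M \<A> u s \<gamma> \<and> C1_on u s r) \<and> (C1_curve_on M \<A> s v \<gamma> \<and> C1_on s v r)"
      using piecewise_local[OF hereditary_cone assms(1)[unfolded cone_admissible_def] s] by metis
    note ad = cone_admissible_admissible[OF assms]
    have gM: "\<gamma> ` {0..1} \<subseteq> M" using admissible_local(2)[OF ad] by auto
    then have "\<gamma> s \<in> M" using s by auto
    then obtain U \<phi> where U: "(U,\<phi>) \<in> \<A>" "\<gamma> s \<in> U" using ex_chart by blast
    obtain W where W: "open W" "U = M \<inter> W" using chart_open(1)[OF U(1)] by (auto simp: openin_open)
    obtain A where A: "open A" "A \<inter> {0..1} = \<gamma> -` W \<inter> {0..1}"
      using continuous_on_open_invariant[THEN iffD1, rule_format, OF admissible_continuous[OF ad] W(1)] by auto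
    have "s \<in> A \<inter> {0..1}" unfolding A(2) using U(2) W(2) s by simp
    then obtain e where e: "e > 0" "ball s e \<subseteq> A" using openE[OF A(1), of s] by blast
    show "\<exists>d>0. \<forall>u v. s \<in> cbox u v \<and> cbox u v \<subseteq> ball s d \<and> cbox u v \<subseteq> cbox 0 1 \<longrightarrow> cone_speed \<gamma> r integrable_on cbox u v"
    proof (intro exI[of _ "min \<delta> e"] conjI allI impI)
      show "0 < min \<delta> e" using d e by simp
      fix u v assume uv: "s \<in> cbox u v \<and> cbox u v \<subseteq> ball s (min \<delta> e) \<and> cbox u v \<subseteq> cbox 0 1"
      then have us: "u \<le> s" "s \<le> v" "u \<le> v" by simp_all
      have "u \<in> cbox u v" "v \<in> cbox u v" using us by simp_all
      then have uv': "u \<in> ball s (min \<delta> e)" "v \<in> ball s (min \<delta> e)" "u \<in> cbox 0 1" "v \<in> cbox 0 1"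
        using uv by (meson subsetD)+
      then have uv1: "0 \<le> u" "v \<le> 1" "s - \<delta> < u" "v < s + \<delta>" by (simp_all add: dist_real_def abs_less_iff)
      have P: "(C1_curve_on M \<A> u s \<gamma> \<and> C1_on u s r) \<and> (C1_curve_on M \<A> s v \<gamma> \<and> C1_on s v r)"
        by (rule d(2)[OF uv1(1) us(1,2) uv1(2-4)])
      have gU: "\<gamma> x \<in> U" if "x \<in> {u..v}" for x
      proof -
        have "x \<in> ball s (min \<delta> e)" "x \<in> cbox 0 1" using uv that by (metis cbox_interval subsetD)+
        then have "x \<in> A \<inter> {0..1}" using e(2) by auto
        then have "x \<in> \<gamma> -` W \<inter> {0..1}" unfolding A(2) .
        then show ?thesis using gM unfolding W(2) by blast
      qed
      have i1: "cone_speed \<gamma> r integrable_on {u..s}"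
        by (rule cone_speed_integrable_piece[OF conjunct1[OF conjunct1[OF P]] conjunct2[OF conjunct1[OF P]] U(1)])
          (use gU us uv1 s in auto)
      have i2: "cone_speed \<gamma> r integrable_on {s..v}"
        by (rule cone_speed_integrable_piece[OF conjunct1[OF conjunct2[OF P]] conjunct2[OF conjunct2[OF P]] U(1)])
          (use gU us uv1 s in auto)
      show "cone_speed \<gamma> r integrable_on cbox u v"
        using Henstock_Kurzweil_Integration.integrable_combine[OF us(1,2) i1 i2] by simp
    qed
  qed
  then show ?thesis by simp
qed

lemma cone_speed_const: "s \<in> {0..1} \<Longrightarrow> cone_speed \<gamma> (\<lambda>_. t) s = \<bar>t\<bar> * speed \<gamma> s"
  using vector_derivative_within_closed_interval[of 0 1 s "\<lambda>_. t" 0]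
  by (simp add: cone_speed_def real_sqrt_mult)

lemma speed_integrable: "admissible \<gamma> \<Longrightarrow> speed \<gamma> integrable_on {0..1}"
  using cone_speed_integrable[OF admissible_cone[of \<gamma> 1]]
  by (rule integrable_spike_finite[of "{}", rotated 2]) (auto simp: cone_speed_const)

lemma speed_integrable': "admissible \<gamma> \<Longrightarrow> 0 \<le> a \<Longrightarrow> b \<le> 1 \<Longrightarrow> speed \<gamma> integrable_on {a..b}"
  using speed_integrable integrable_subinterval_real[of "speed \<gamma>" 0 1 a b] by auto

lemma speed_nonneg: "admissible \<gamma> \<Longrightarrow> 0 \<le> s \<Longrightarrow> s \<le> 1 \<Longrightarrow> 0 \<le> speed \<gamma> s"
  using sq_speed_nonneg admissible_local(2) by simp

lemma admissible_affine_piece: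
  assumes "admissible \<gamma>" and K: "\<And>a b. 0 \<le> a \<Longrightarrow> a < b \<Longrightarrow> b \<le> 1 \<Longrightarrow> K \<inter> {a<..<b} = {} \<Longrightarrow> C1_curve_on M \<A> a b \<gamma>"
    and "a < b" "\<And>s. s \<in> {a..b} \<Longrightarrow> m * s + c \<in> {0..1}"
    and nK: "\<And>s. a < s \<Longrightarrow> s < b \<Longrightarrow> m \<noteq> 0 \<Longrightarrow> m * s + c \<notin> K"
  shows "C1_curve_on M \<A> a b (\<lambda>s. \<gamma> (m * s + c))"
proof -
  define P Q where "P = min (m * a + c) (m * b + c)" and "Q = max (m * a + c) (m * b + c)"
  have PQ: "0 \<le> P" "Q \<le> 1" using assms(3) assms(4)[of a] assms(4)[of b] by (auto simp: P_def Q_def)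
  have "C1_curve_on M \<A> P Q \<gamma>"
  \<comment> \<open>Slope 0 gives a constant curve, which is covered by the degenerate piece of
    \<open>\<gamma>\<close> at time \<open>c\<close>.\<close>
  proof (cases "m = 0")
    case True
    then show ?thesis using admissible_local(1)[OF assms(1), of c] assms(4)[of a] assms(3) by (simp add: P_def Q_def)
  next
    case False
    have "K \<inter> {P<..<Q} = {}"
    proof (rule ccontr)
      assume "K \<inter> {P<..<Q} \<noteq> {}"
      then obtain k where k: "k \<in> K" "P < k" "k < Q" by auto
      define s where "s = (k - c) / m"
      have "k = m * s + c" using False by (simp add: s_def)
      moreover from this have "a < s \<and> s < b"
      proof (cases "m > 0")
        case True
        then have "m * a < m * b" using assms(3) by simp
        then have "m * a < m * s" "m * s < m * b" using k \<open>k = m * s + c\<close> by (auto simp: P_def Q_def)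
        then show ?thesis using True by (simp add: mult_less_cancel_left)
      next
        case f: False
        then have "m < 0" using False by simp
        then have "m * b < m * a" using assms(3) by (simp add: mult_less_cancel_left)
        then have "m * b < m * s" "m * s < m * a" using k \<open>k = m * s + c\<close> by (auto simp: P_def Q_def)
        then show ?thesis using \<open>m < 0\<close> by (simp add: mult_less_cancel_left)
      qed
      ultimately show False using nK[of s] False k(1) by simp
    qed
    moreover have "m * a \<noteq> m * b" using False assms(3) by simp
    then have "m * a < m * b \<or> m * b < m * a" by linarith
    then have "P < Q" by (auto simp: P_def Q_def)
    ultimately show ?thesis using K PQ by simp
  qed
  then show ?thesis
  proof (rule C1_curve_on_affine)
    fix s assume s: "s \<in> {a..b}"
    show "m * s + c \<in> {P..Q}"
    proof (cases "m \<ge> 0")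
      case True
      then have "m * a \<le> m * s" "m * s \<le> m * b" using s by (auto intro: mult_left_mono)
      then show ?thesis by (auto simp: P_def Q_def)
    next
      case False
      then have "m * b \<le> m * s" "m * s \<le> m * a" using s by (auto intro: mult_left_mono_neg)
      then show ?thesis by (auto simp: P_def Q_def)
    qed
  qed
qed

text \<open>With arbitrary slopes one lemma serves all operations on curves: slope 2 for
  concatenation, -1 for reversal, 0 for stopping or waiting.\<close>

lemma admissible_glue:
  assumes "admissible \<gamma>1" "admissible \<gamma>2" "0 \<le> h" "h \<le> 1"
    and s1: "\<And>s. s \<in> {0..h} \<Longrightarrow> m1 * s + c1 \<in> {0..1}"
    and s2: "\<And>s. s \<in> {h..1} \<Longrightarrow> m2 * s + c2 \<in> {0..1}"
    and eq: "\<gamma>1 (m1 * h + c1) = \<gamma>2 (m2 * h + c2)"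
  defines "\<gamma> \<equiv> \<lambda>s. if s \<le> h then \<gamma>1 (m1 * s + c1) else \<gamma>2 (m2 * s + c2)"
  shows "admissible \<gamma>"
proof -
  obtain K1 where K1: "finite K1 \<and> (\<forall>a b. 0 \<le> a \<and> a < b \<and> b \<le> 1 \<and> K1 \<inter> {a<..<b} = {} \<longrightarrow> C1_curve_on M \<A> a b \<gamma>1)"
    using assms(1) unfolding admissible_def piecewise_iff[OF hereditary_C1_curve_on] by (elim exE) (rule that)
  obtain K2 where K2: "finite K2 \<and> (\<forall>a b. 0 \<le> a \<and> a < b \<and> b \<le> 1 \<and> K2 \<inter> {a<..<b} = {} \<longrightarrow> C1_curve_on M \<A> a b \<gamma>2)"
    using assms(2) unfolding admissible_def piecewise_iff[OF hereditary_C1_curve_on] by (elim exE) (rule that)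
  \<comment> \<open>The break points are the gluing time and the preimages of the old ones. For
    slope 0 the division by 0 yields 0, a harmless additional point.\<close>
  define K where "K = insert h ((\<lambda>k. (k - c1) / m1) ` K1 \<union> (\<lambda>k. (k - c2) / m2) ` K2)"
  have "C1_curve_on M \<A> a b \<gamma>" if ab: "0 \<le> a" "a < b" "b \<le> 1" "K \<inter> {a<..<b} = {}" for a b
  proof -
    have hab: "b \<le> h \<or> h \<le> a" using ab(4) by (force simp: K_def)
    have n1: "m1 * s + c1 \<notin> K1" if "a < s" "s < b" "m1 \<noteq> 0" for s
    proof
      assume "m1 * s + c1 \<in> K1"
      then have "((m1 * s + c1) - c1) / m1 \<in> K" unfolding K_def by blast
      then show False using that ab(4) by auto
    qed
    have n2: "m2 * s + c2 \<notin> K2" if "a < s" "s < b" "m2 \<noteq> 0" for s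
    proof
      assume "m2 * s + c2 \<in> K2"
      then have "((m2 * s + c2) - c2) / m2 \<in> K" unfolding K_def by blast
      then show False using that ab(4) by auto
    qed
    from hab show ?thesis
    proof
      assume "b \<le> h"
      have "C1_curve_on M \<A> a b (\<lambda>s. \<gamma>1 (m1 * s + c1))"
        by (rule admissible_affine_piece[OF assms(1), of K1]) (use K1 ab n1 s1 \<open>b \<le> h\<close> in auto)
      then show ?thesis by (rule C1_curve_on_cong) (use \<open>b \<le> h\<close> in \<open>auto simp: \<gamma>_def\<close>)
    next
      assume "h \<le> a"
      have "C1_curve_on M \<A> a b (\<lambda>s. \<gamma>2 (m2 * s + c2))"
        by (rule admissible_affine_piece[OF assms(2), of K2]) (use K2 ab n2 s2 \<open>h \<le> a\<close> in auto)
      then show ?thesis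
      proof (rule C1_curve_on_cong)
        fix s assume "s \<in> {a..b}"
        then show "\<gamma> s = \<gamma>2 (m2 * s + c2)" using \<open>h \<le> a\<close> eq by (cases "s = h") (auto simp: \<gamma>_def)
      qed
    qed
  qed
  moreover have "finite K" using K1 K2 by (simp add: K_def)
  ultimately show ?thesis unfolding admissible_def piecewise_iff[OF hereditary_C1_curve_on]
    by (intro exI[of _ K]) simp
qed

text \<open>Substitution in the integral: the speed is multiplied by the absolute value of the
  slope. Writing the right-hand side over the image of the interval also covers slope 0, where the
  image is a point and the length is 0.\<close>

lemma length_affine:
  assumes "admissible \<gamma>" "0 \<le> a" "a \<le> b" "b \<le> 1"
    and s1: "\<And>s. s \<in> {a..b} \<Longrightarrow> m * s + c \<in> {0..1}"
    and eq: "\<And>s. a < s \<Longrightarrow> s < b \<Longrightarrow> \<gamma>' s = \<gamma> (m * s + c)"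
  shows "integral {a..b} (speed \<gamma>') = integral ((\<lambda>s. m * s + c) ` {a..b}) (speed \<gamma>)"
proof (cases "a = b")
  case True
  then show ?thesis by simp
next
  case False
  then have ab: "a < b" using assms by simp
  obtain K where K: "finite K" "\<And>s U \<phi>. 0 < s \<Longrightarrow> s < 1 \<Longrightarrow> s \<notin> K \<Longrightarrow> (U,\<phi>) \<in> \<A> \<Longrightarrow> \<gamma> s \<in> U \<Longrightarrow> \<exists>v. velocity U \<phi> \<gamma> s v"
    using cone_admissible_velocity[OF admissible_cone[OF assms(1)]] by metis
  have near: "\<forall>\<^sub>F u in nhds s. \<gamma>' u = \<gamma> (m * u + c)" if "a < s" "s < b" for s
  proof -
    have "\<forall>\<^sub>F u in nhds s. u \<in> {a<..<b}" using that by (intro eventually_nhds_in_open) auto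
    then show ?thesis by eventually_elim (use eq in auto)
  qed
  show ?thesis
  proof (cases "m = 0")
    case True
    have "speed \<gamma>' s = 0" if "a < s" "s < b" for s
    proof -
      have "\<gamma>' s = \<gamma> c" "c \<in> {0..1}" using eq[OF that] s1[of s] that True by auto
      then have "\<gamma>' s \<in> M" using admissible_local(2)[OF assms(1), of c] by auto
      then obtain U \<phi> where U: "(U,\<phi>) \<in> \<A>" "\<gamma>' s \<in> U" using ex_chart by blast
      have ev: "\<forall>\<^sub>F u in nhds s. \<gamma>' u = \<gamma>' s" using near[OF that] \<open>\<gamma>' s = \<gamma> c\<close> by (auto simp: True elim: eventually_mono)
      have "(\<phi> \<circ> \<gamma>' has_vector_derivative 0) (at s)"
        by (rule has_vector_derivative_transform_at_ev[of "\<lambda>_. \<phi> (\<gamma>' s)"])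
          (use ev in \<open>auto elim: eventually_mono\<close>)
      then have "velocity U \<phi> \<gamma>' s 0" unfolding velocity_def using ev U by (auto elim: eventually_mono)
      then show ?thesis using sq_speed_velocity[OF U(1), of \<gamma>' s 0] that assms by simp
    qed
    then have "integral {a..b} (speed \<gamma>') = integral {a..b} (\<lambda>_. 0::real)"
      by (intro integral_spike[of "{a,b}"]) auto
    moreover have "(\<lambda>s. m * s + c) ` {a..b} = {c}" using True ab by (simp add: image_constant_conv)
    ultimately show ?thesis by simp
  next
    case m: False
    have int: "0 < m * s + c \<and> m * s + c < 1" if s: "a < s" "s < b" for s
    proof (cases "m > 0")
      case True
      then have "m * a < m * s" "m * s < m * b" using s by auto
      then show ?thesis using s1[of a] s1[of b] ab by auto
    next
      case False
      then have "m < 0" using m by simp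
      then have "m * b < m * s" "m * s < m * a" using s by (auto simp: mult_less_cancel_left)
      then show ?thesis using s1[of a] s1[of b] ab by auto
    qed
    have sp: "speed \<gamma>' s = \<bar>m\<bar> * speed \<gamma> (m * s + c)" if s: "a < s" "s < b" "m * s + c \<notin> K" for s
    proof -
      note i = int[OF s(1,2)]
      have "\<gamma> (m * s + c) \<in> M" using admissible_local(2)[OF assms(1), of "m * s + c"] i by simp
      then obtain U \<phi> where U: "(U,\<phi>) \<in> \<A>" "\<gamma> (m * s + c) \<in> U" using ex_chart by blast
      obtain v where v: "velocity U \<phi> \<gamma> (m * s + c) v" using K(2)[OF _ _ s(3) U] i by blast
      have dl: "((\<lambda>s. m * s + c) has_vector_derivative m) (at s)" by (auto intro!: derivative_eq_intros)
      have "((\<phi> \<circ> \<gamma>) \<circ> (\<lambda>s. m * s + c) has_vector_derivative m *\<^sub>R v) (at s)"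
        by (rule vector_diff_chain_at[OF dl]) (use v in \<open>simp add: velocity_def\<close>)
      then have d: "(\<phi> \<circ> \<gamma>' has_vector_derivative m *\<^sub>R v) (at s)"
        by (rule has_vector_derivative_transform_at_ev) (use near[OF s(1,2)] in \<open>auto elim: eventually_mono\<close>)
      have "filterlim (\<lambda>s. m * s + c) (nhds (m * s + c)) (nhds s)"
        by (intro tendsto_add tendsto_mult tendsto_const filterlim_ident)
      moreover have "\<forall>\<^sub>F u in nhds (m * s + c). \<gamma> u \<in> U" using v by (simp add: velocity_def)
      ultimately have "\<forall>\<^sub>F u in nhds s. \<gamma> (m * u + c) \<in> U" by (rule eventually_compose_filterlim[rotated])
      with near[OF s(1,2)] have "\<forall>\<^sub>F u in nhds s. \<gamma>' u \<in> U" by eventually_elim simp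
      with d have v': "velocity U \<phi> \<gamma>' s (m *\<^sub>R v)" by (simp add: velocity_def)
      have "sqs \<gamma>' s = m\<^sup>2 * sqs \<gamma> (m * s + c)"
        using sq_speed_velocity[OF U(1) v'] sq_speed_velocity[OF U(1) v] i s assms eq[OF s(1,2)]
        by (simp add: matrix_vector_mult_scaleR power2_eq_square)
      then show ?thesis by (simp add: real_sqrt_mult)
    qed
    define P Q where "P = min (m * a + c) (m * b + c)" and "Q = max (m * a + c) (m * b + c)"
    have img: "(\<lambda>s. m * s + c) ` {a..b} = {P..Q}"
    proof (cases "m \<ge> 0")
      case True
      then have "m * a \<le> m * b" using ab by (intro mult_left_mono) auto
      then show ?thesis using True ab image_affinity_atLeastAtMost[of m c a b] by (simp add: P_def Q_def)
    next
      case False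
      then have "m * b \<le> m * a" using ab by (intro mult_left_mono_neg) auto
      then show ?thesis using False ab image_affinity_atLeastAtMost[of m c a b] by (simp add: P_def Q_def)
    qed
    have PQ: "0 \<le> P" "Q \<le> 1" using ab s1[of a] s1[of b] by (auto simp: P_def Q_def)
    have "(speed \<gamma> has_integral integral {P..Q} (speed \<gamma>)) (cbox P Q)"
      using speed_integrable'[OF assms(1) PQ] by (simp add: integrable_integral)
    from has_integral_affinity[OF this m, of c]
    have h: "((\<lambda>x. speed \<gamma> (m * x + c)) has_integral (1 / \<bar>m\<bar>) * integral {P..Q} (speed \<gamma>))
        ((\<lambda>x. (1 / m) * x + - ((1 / m) * c)) ` {P..Q})" by simp
    have "(\<lambda>x. (1 / m) * x + - ((1 / m) * c)) ` {P..Q} = {a..b}"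
      unfolding img[symmetric] image_image using m by (simp add: field_simps)
    with h have "((\<lambda>x. \<bar>m\<bar> * speed \<gamma> (m * x + c)) has_integral \<bar>m\<bar> * ((1 / \<bar>m\<bar>) * integral {P..Q} (speed \<gamma>))) {a..b}"
      by (intro has_integral_mult_right) simp
    then have h2: "((\<lambda>x. \<bar>m\<bar> * speed \<gamma> (m * x + c)) has_integral integral {P..Q} (speed \<gamma>)) {a..b}" using m by simp
    have "(speed \<gamma>' has_integral integral {P..Q} (speed \<gamma>)) {a..b}"
    proof (rule has_integral_spike_finite[OF _ _ h2])
      show "finite ({a,b} \<union> (\<lambda>k. (k - c) / m) ` K)" using K by simp
      fix x assume x: "x \<in> {a..b} - ({a,b} \<union> (\<lambda>k. (k - c) / m) ` K)"
      have "m * x + c \<notin> K"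
      proof
        assume "m * x + c \<in> K"
        then have "((m * x + c) - c) / m \<in> (\<lambda>k. (k - c) / m) ` K" by blast
        then show False using x m by simp
      qed
      then show "speed \<gamma>' x = \<bar>m\<bar> * speed \<gamma> (m * x + c)" using x by (intro sp) auto
    qed
    then show ?thesis unfolding img by (rule integral_unique)
  qed
qed

section \<open>Length, concatenation, reversal and splitting of curves\<close>

abbreviation curve_length :: "(real \<Rightarrow> 'a) \<Rightarrow> real" where
  "curve_length \<gamma> \<equiv> integral {0..1} (speed \<gamma>)"

abbreviation rd :: "'a \<Rightarrow> 'a \<Rightarrow> real" where "rd \<equiv> riem_dist M \<A> \<rho>"

lemma riem_dist_eq: "rd x y = Inf {curve_length \<gamma> |\<gamma>. admissible \<gamma> \<and> \<gamma> 0 = x \<and> \<gamma> 1 = y}"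
  unfolding riem_dist_def admissible_def ..

lemma length_nonneg: "admissible \<gamma> \<Longrightarrow> 0 \<le> curve_length \<gamma>"
  by (intro integral_nonneg speed_integrable) (simp_all add: speed_nonneg[simplified])

lemma length_mono:
  assumes "admissible \<gamma>" "0 \<le> a" "a \<le> b" "b \<le> 1"
  shows "integral {a..b} (speed \<gamma>) \<le> curve_length \<gamma>"
  by (rule integral_subset_le) (use assms speed_integrable speed_integrable' speed_nonneg in auto)

lemma riem_dist_le_length: "admissible \<gamma> \<Longrightarrow> rd (\<gamma> 0) (\<gamma> 1) \<le> curve_length \<gamma>"
  unfolding riem_dist_eq by (rule cInf_lower) (auto intro!: bdd_belowI[of _ 0] length_nonneg)

text \<open>Until connectedness is exploited, the set of curves between two points may be empty and
  the infimum over it unspecified. Facts that need a curve carry this hypothesis.\<close>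

definition joined :: "'a \<Rightarrow> 'a \<Rightarrow> bool" where
  "joined x y \<longleftrightarrow> (\<exists>\<gamma>. admissible \<gamma> \<and> \<gamma> 0 = x \<and> \<gamma> 1 = y)"

lemma riem_dist_lessD:
  assumes "joined x y" "rd x y < c"
  obtains \<gamma> where "admissible \<gamma>" "\<gamma> 0 = x" "\<gamma> 1 = y" "curve_length \<gamma> < c"
proof -
  have "{curve_length \<gamma> |\<gamma>. admissible \<gamma> \<and> \<gamma> 0 = x \<and> \<gamma> 1 = y} \<noteq> {}" using assms(1) unfolding joined_def by auto
  from cInf_lessD[OF this] assms(2) that show ?thesis unfolding riem_dist_eq by auto
qed

lemma riem_dist_nonneg: "joined x y \<Longrightarrow> 0 \<le> rd x y"
  unfolding riem_dist_eq joined_def by (rule cInf_greatest) (auto intro: length_nonneg)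

lemma concat_curve:
  assumes "admissible \<gamma>1" "admissible \<gamma>2" "\<gamma>1 1 = \<gamma>2 0"
  obtains \<gamma> where "admissible \<gamma>" "\<gamma> 0 = \<gamma>1 0" "\<gamma> 1 = \<gamma>2 1" "curve_length \<gamma> = curve_length \<gamma>1 + curve_length \<gamma>2"
proof -
  define \<gamma> where "\<gamma> s = (if s \<le> 1/2 then \<gamma>1 (2 * s + 0) else \<gamma>2 (2 * s + (-1)))" for s :: real
  have ad: "admissible \<gamma>"
    unfolding \<gamma>_def by (rule admissible_glue[OF assms(1,2)]) (use assms(3) in auto)
  have 1: "integral {0..1/2} (speed \<gamma>) = integral ((\<lambda>s. 2 * s + 0) ` {0..1/2}) (speed \<gamma>1)"
    by (rule length_affine[OF assms(1)]) (auto simp: \<gamma>_def)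
  have 2: "integral {1/2..1} (speed \<gamma>) = integral ((\<lambda>s. 2 * s + (-1)) ` {1/2..1}) (speed \<gamma>2)"
    by (rule length_affine[OF assms(2)]) (auto simp: \<gamma>_def)
  have i1: "(\<lambda>s. 2 * s + 0) ` {0..1/2} = {0..1::real}" using image_affinity_atLeastAtMost[of 2 0 0 "1/2::real"] by simp
  have i2: "(\<lambda>s. 2 * s + (-1)) ` {1/2..1} = {0..1::real}" using image_affinity_atLeastAtMost[of 2 "-1" "1/2::real" 1] by simp
  have "curve_length \<gamma> = integral {0..1/2} (speed \<gamma>) + integral {1/2..1} (speed \<gamma>)"
    by (rule Henstock_Kurzweil_Integration.integral_combine[symmetric]) (use speed_integrable[OF ad] in auto)
  then have "curve_length \<gamma> = curve_length \<gamma>1 + curve_length \<gamma>2" using 1 2 i1 i2 by simp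
  then show ?thesis using that[of \<gamma>] ad assms(3) by (simp add: \<gamma>_def)
qed

lemma reverse_curve:
  assumes "admissible \<gamma>1"
  obtains \<gamma> where "admissible \<gamma>" "\<gamma> 0 = \<gamma>1 1" "\<gamma> 1 = \<gamma>1 0" "curve_length \<gamma> = curve_length \<gamma>1"
proof -
  define \<gamma> where "\<gamma> s = (if s \<le> 1 then \<gamma>1 ((-1) * s + 1) else \<gamma>1 ((-1) * s + 1))" for s :: real
  have ad: "admissible \<gamma>"
    unfolding \<gamma>_def by (rule admissible_glue[OF assms(1,1)]) auto
  have 1: "integral {0..1} (speed \<gamma>) = integral ((\<lambda>s. (-1) * s + 1) ` {0..1}) (speed \<gamma>1)"
    by (rule length_affine[OF assms(1)]) (auto simp: \<gamma>_def)
  have i1: "(\<lambda>s. (-1) * s + 1) ` {0..1} = {0..1::real}" using image_affinity_atLeastAtMost[of "-1" 1 0 "1::real"] by simp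
  show ?thesis using that[of \<gamma>] ad 1 i1 by (simp add: \<gamma>_def)
qed

text \<open>Stopping a curve at time \<open>u\<close>, respectively waiting until time \<open>u\<close>, splits it without a
  reparametrisation.\<close>

lemma split_curve:
  assumes "admissible \<gamma>" "0 \<le> u" "u \<le> 1"
  shows "rd (\<gamma> 0) (\<gamma> u) \<le> integral {0..u} (speed \<gamma>)" "rd (\<gamma> u) (\<gamma> 1) \<le> integral {u..1} (speed \<gamma>)"
proof -
  define \<gamma>1 where "\<gamma>1 s = (if s \<le> u then \<gamma> (1 * s + 0) else \<gamma> (0 * s + u))" for s
  define \<gamma>2 where "\<gamma>2 s = (if s \<le> u then \<gamma> (0 * s + u) else \<gamma> (1 * s + 0))" for s
  have ad1: "admissible \<gamma>1" unfolding \<gamma>1_def by (rule admissible_glue[OF assms(1,1,2,3)]) (use assms in auto)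
  have ad2: "admissible \<gamma>2" unfolding \<gamma>2_def by (rule admissible_glue[OF assms(1,1,2,3)]) (use assms in auto)
  have z: "(\<lambda>s. 0 * s + u) ` {a..b} = {u}" if "a \<le> b" for a b :: real using that by (auto simp: image_iff)
  have a1: "integral {0..u} (speed \<gamma>1) = integral ((\<lambda>s. 1 * s + 0) ` {0..u}) (speed \<gamma>)"
    by (rule length_affine[OF assms(1)]) (use assms in \<open>auto simp: \<gamma>1_def\<close>)
  have a2: "integral {u..1} (speed \<gamma>1) = integral ((\<lambda>s. 0 * s + u) ` {u..1}) (speed \<gamma>)"
    by (rule length_affine[OF assms(1)]) (use assms in \<open>auto simp: \<gamma>1_def\<close>)
  have b1: "integral {0..u} (speed \<gamma>2) = integral ((\<lambda>s. 0 * s + u) ` {0..u}) (speed \<gamma>)"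
    by (rule length_affine[OF assms(1)]) (use assms in \<open>auto simp: \<gamma>2_def\<close>)
  have b2: "integral {u..1} (speed \<gamma>2) = integral ((\<lambda>s. 1 * s + 0) ` {u..1}) (speed \<gamma>)"
    by (rule length_affine[OF assms(1)]) (use assms in \<open>auto simp: \<gamma>2_def\<close>)
  have c1: "curve_length \<gamma>1 = integral {0..u} (speed \<gamma>1) + integral {u..1} (speed \<gamma>1)"
    by (rule Henstock_Kurzweil_Integration.integral_combine[symmetric]) (use speed_integrable[OF ad1] assms in auto)
  have c2: "curve_length \<gamma>2 = integral {0..u} (speed \<gamma>2) + integral {u..1} (speed \<gamma>2)"
    by (rule Henstock_Kurzweil_Integration.integral_combine[symmetric]) (use speed_integrable[OF ad2] assms in auto)
  have e: "\<gamma>1 0 = \<gamma> 0" "\<gamma>1 1 = \<gamma> u" "\<gamma>2 0 = \<gamma> u" "\<gamma>2 1 = \<gamma> 1"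
    using assms by (auto simp: \<gamma>1_def \<gamma>2_def)
  show "rd (\<gamma> 0) (\<gamma> u) \<le> integral {0..u} (speed \<gamma>)"
    using riem_dist_le_length[OF ad1] a1 a2 c1 e z[of u 1] assms by simp
  show "rd (\<gamma> u) (\<gamma> 1) \<le> integral {u..1} (speed \<gamma>)"
    using riem_dist_le_length[OF ad2] b1 b2 c2 e z[of 0 u] assms by simp
qed

section \<open>Comparison with the Euclidean metric in charts\<close>

lemma line_curve:
  assumes ch: "(U,\<phi>) \<in> \<A>" "p \<in> U" "q \<in> U" and seg: "closed_segment (\<phi> p) (\<phi> q) \<subseteq> \<phi> ` U"
  obtains \<gamma> where "admissible \<gamma>" "\<gamma> 0 = p" "\<gamma> 1 = q"
    "\<And>L. 0 \<le> L \<Longrightarrow> (\<And>y v. y \<in> U \<Longrightarrow> \<phi> y \<in> closed_segment (\<phi> p) (\<phi> q) \<Longrightarrow> v \<bullet> (\<rho> (U,\<phi>) y *v v) \<le> (L * norm v)\<^sup>2)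
       \<Longrightarrow> curve_length \<gamma> \<le> L * dist (\<phi> p) (\<phi> q)"
proof -
  define l where "l s = \<phi> p + s *\<^sub>R (\<phi> q - \<phi> p)" for s :: real
  define \<gamma> where "\<gamma> s = inv_into U \<phi> (l s)" for s
  have lseg: "l s \<in> closed_segment (\<phi> p) (\<phi> q)" if "0 \<le> s" "s \<le> 1" for s
    unfolding closed_segment_def using that by (auto simp: l_def algebra_simps intro!: exI[of _ s])
  then have lU: "l s \<in> \<phi> ` U" if "0 \<le> s" "s \<le> 1" for s using seg that by blast
  have gU: "\<gamma> s \<in> U" "\<phi> (\<gamma> s) = l s" if "0 \<le> s" "s \<le> 1" for s
    using lU[OF that] by (auto simp: \<gamma>_def inv_into_into f_inv_into_f)
  have dl: "(l has_vector_derivative (\<phi> q - \<phi> p)) (at s within T)" for s T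
    unfolding l_def by (auto intro!: derivative_eq_intros)
  have lc: "continuous_on T l" for T unfolding l_def by (intro continuous_intros)
  have C1: "C1_curve_on M \<A> 0 1 \<gamma>"
  proof -
    have "continuous_on {0..1} \<gamma>" unfolding \<gamma>_def
      by (rule continuous_on_compose2[OF chart_open(6)[OF ch(1)] lc]) (use lU in auto)
    moreover have "\<gamma> ` {0..1} \<subseteq> M" using gU chart_open(3)[OF ch(1)] by auto
    moreover have "C1_on a b (\<psi> \<circ> \<gamma>)" if V: "(V,\<psi>) \<in> \<A>" "0 \<le> a" "a \<le> b" "b \<le> 1" "\<gamma> ` {a..b} \<subseteq> V" for V \<psi> a b
    proof -
      let ?T = "\<psi> \<circ> inv_into U \<phi>"
      note T = transition_C1[OF ch(1) V(1)]
      have lUV: "l s \<in> \<phi> ` (U \<inter> V)" if "s \<in> {a..b}" for s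
        using gU[of s] V that by (auto intro!: image_eqI[of _ _ "\<gamma> s"])
      define D where "D s = frechet_derivative ?T (at (l s)) (\<phi> q - \<phi> p)" for s
      have "continuous_on {a..b} D" unfolding D_def
        by (rule continuous_on_compose2[OF T(3) lc]) (use lUV in auto)
      moreover have "(\<psi> \<circ> \<gamma> has_vector_derivative D s) (at s within {a..b})" if s: "s \<in> {a..b}" for s
      proof -
        have "(?T has_derivative frechet_derivative ?T (at (l s))) (at (l s))"
          using T(2)[OF lUV[OF s]] frechet_derivative_works by blast
        then have "(?T has_derivative frechet_derivative ?T (at (l s))) (at (l s) within l ` {a..b})"
          by (rule has_derivative_at_withinI)
        from vector_derivative_diff_chain_within[OF dl this]
        show ?thesis by (simp add: D_def \<gamma>_def o_def)
      qed
      ultimately show ?thesis unfolding C1_on_def by blast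
    qed
    ultimately show ?thesis unfolding C1_curve_on_def by auto
  qed
  have ad: "admissible \<gamma>"
    unfolding admissible_def piecewise_iff[OF hereditary_C1_curve_on]
    by (rule exI[of _ "{}"]) (use hereditaryD[OF hereditary_C1_curve_on C1] in auto)
  have ends: "\<gamma> 0 = p" "\<gamma> 1 = q" using ch(2,3) chart_open(4)[OF ch(1)] by (auto simp: \<gamma>_def l_def)
  show ?thesis
  proof (rule that[OF ad ends])
    fix L assume L: "0 \<le> L" "\<And>y v. y \<in> U \<Longrightarrow> \<phi> y \<in> closed_segment (\<phi> p) (\<phi> q) \<Longrightarrow> v \<bullet> (\<rho> (U,\<phi>) y *v v) \<le> (L * norm v)\<^sup>2"
    have sp: "speed \<gamma> s \<le> L * dist (\<phi> p) (\<phi> q)" if s: "0 < s" "s < 1" for s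
    proof -
      have "\<forall>\<^sub>F u in nhds s. u \<in> {0<..<1}" using s by (intro eventually_nhds_in_open) auto
      then have ev: "\<forall>\<^sub>F u in nhds s. \<gamma> u \<in> U \<and> l u = (\<phi> \<circ> \<gamma>) u" by eventually_elim (use gU in auto)
      have "(\<phi> \<circ> \<gamma> has_vector_derivative (\<phi> q - \<phi> p)) (at s)"
        by (rule has_vector_derivative_transform_at_ev[OF dl]) (use ev in \<open>auto elim: eventually_mono\<close>)
      then have "velocity U \<phi> \<gamma> s (\<phi> q - \<phi> p)" using ev by (auto simp: velocity_def elim: eventually_mono)
      from sq_speed_velocity[OF ch(1) this s]
      have "sqs \<gamma> s \<le> (L * norm (\<phi> q - \<phi> p))\<^sup>2" using L(2)[of "\<gamma> s" "\<phi> q - \<phi> p"] gU[of s] lseg[of s] s by simp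
      then have "speed \<gamma> s \<le> sqrt ((L * norm (\<phi> q - \<phi> p))\<^sup>2)" by (rule real_sqrt_le_mono)
      then show ?thesis using L(1) by (simp add: dist_norm norm_minus_commute)
    qed
    have "curve_length \<gamma> = integral {0<..<1} (speed \<gamma>)" by (simp add: integral_open_interval_real)
    also have "\<dots> \<le> integral {0<..<1} (\<lambda>_::real. L * dist (\<phi> p) (\<phi> q))"
      by (rule integral_le) (use sp speed_integrable[OF ad] in \<open>auto simp: integrable_on_open_interval_real\<close>)
    also have "\<dots> = L * dist (\<phi> p) (\<phi> q)" by (simp add: integral_open_interval_real[symmetric])
    finally show "curve_length \<gamma> \<le> L * dist (\<phi> p) (\<phi> q)" .
  qed
qed

text \<open>On the coordinate ball of radius \<open>3 * r\<close> the Riemannian norm lies between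
  \<open>l\<close> and \<open>L\<close> times the Euclidean one. The factor 3 leaves room for
  curves: one that starts within \<open>r\<close> of the centre and is shorter than
  \<open>2 * l * r\<close> cannot leave that ball.\<close>

definition good_chart :: "'a \<Rightarrow> 'a set \<Rightarrow> ('a \<Rightarrow> real^'n) \<Rightarrow> real \<Rightarrow> real \<Rightarrow> real \<Rightarrow> bool" where
  "good_chart p U \<phi> r l L \<longleftrightarrow> (U,\<phi>) \<in> \<A> \<and> p \<in> U \<and> 0 < r \<and> 0 < l \<and> 0 < L \<and> cball (\<phi> p) (3 * r) \<subseteq> \<phi> ` U \<and>
     (\<forall>q\<in>U. \<phi> q \<in> cball (\<phi> p) (3 * r) \<longrightarrow>
        (\<forall>v. (l * norm v)\<^sup>2 \<le> v \<bullet> (\<rho> (U,\<phi>) q *v v) \<and> v \<bullet> (\<rho> (U,\<phi>) q *v v) \<le> (L * norm v)\<^sup>2))"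

text \<open>The bounds come from the extrema of the quadratic form over the compact product of a
  coordinate ball and the unit sphere. Positive definiteness makes the minimum positive, and
  homogeneity removes the restriction to unit vectors.\<close>

lemma ex_good_chart:
  assumes "p \<in> M"
  shows "\<exists>U \<phi> r l L. good_chart p U \<phi> r l L"
proof -
  obtain U \<phi> where ch: "(U,\<phi>) \<in> \<A>" "p \<in> U" using ex_chart assms by blast
  obtain e where e: "e > 0" "cball (\<phi> p) e \<subseteq> \<phi> ` U"
    using chart_open(2)[OF ch(1)] ch(2) open_contains_cball by (metis imageI)
  define B where "B = cball (\<phi> p) e \<times> sphere (0::real^'n) 1"
  define f where "f = (\<lambda>z. snd z \<bullet> (\<rho> (U,\<phi>) (inv_into U \<phi> (fst z)) *v snd z))"
  have "compact B" unfolding B_def by (intro compact_Times compact_cball compact_sphere)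
  have "sphere (0::real^'n) 1 \<noteq> {}" by simp
  then have "B \<noteq> {}" using e by (auto simp: B_def)
  have Rc: "continuous_on B (\<lambda>z. \<rho> (U,\<phi>) (inv_into U \<phi> (fst z)))"
    by (rule continuous_on_compose2[OF metric_continuous[OF ch(1)]]) (use e in \<open>auto simp: B_def intro!: continuous_intros\<close>)
  have fc: "continuous_on B f"
    unfolding f_def inner_vec_def matrix_vector_mult_def using Rc by (auto intro!: continuous_intros)
  obtain z0 where z0: "z0 \<in> B" "\<And>z. z \<in> B \<Longrightarrow> f z0 \<le> f z"
    using continuous_attains_inf[OF \<open>compact B\<close> \<open>B \<noteq> {}\<close> fc] by blast
  obtain z1 where z1: "z1 \<in> B" "\<And>z. z \<in> B \<Longrightarrow> f z \<le> f z1"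
    using continuous_attains_sup[OF \<open>compact B\<close> \<open>B \<noteq> {}\<close> fc] by blast
  have pos: "f z0 > 0"
  proof -
    have "inv_into U \<phi> (fst z0) \<in> U" using z0(1) e by (intro inv_into_into) (auto simp: B_def)
    moreover have "snd z0 \<noteq> 0" using z0(1) by (auto simp: B_def)
    ultimately show ?thesis unfolding f_def using metric_pos[OF ch(1)] by blast
  qed
  have pos1: "f z1 > 0" using pos z1(2)[OF z0(1)] by simp
  have bd: "(sqrt (f z0) * norm v)\<^sup>2 \<le> v \<bullet> (\<rho> (U,\<phi>) q *v v) \<and> v \<bullet> (\<rho> (U,\<phi>) q *v v) \<le> (sqrt (f z1) * norm v)\<^sup>2"
    if q: "q \<in> U" "\<phi> q \<in> cball (\<phi> p) e" for q v
  proof (cases "v = 0")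
    case False
    define u where "u = v /\<^sub>R norm v"
    have v: "v = norm v *\<^sub>R u" using False by (simp add: u_def)
    have "norm u = 1" using False by (simp add: u_def)
    then have "(\<phi> q, u) \<in> B" using q by (auto simp: B_def)
    moreover have "f (\<phi> q, u) = u \<bullet> (\<rho> (U,\<phi>) q *v u)" using q(1) chart_open(4)[OF ch(1)] by (simp add: f_def)
    moreover have "v \<bullet> (\<rho> (U,\<phi>) q *v v) = (norm v)\<^sup>2 * (u \<bullet> (\<rho> (U,\<phi>) q *v u))"
      by (subst (1 2) v) (simp add: matrix_vector_mult_scaleR power2_eq_square)
    ultimately show ?thesis using z0(2)[of "(\<phi> q, u)"] z1(2)[of "(\<phi> q, u)"] pos pos1
      by (simp add: power_mult_distrib mult.commute[of "f _"] mult_left_mono)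
  qed simp
  have "good_chart p U \<phi> (e/3) (sqrt (f z0)) (sqrt (f z1))"
    unfolding good_chart_def using ch e pos pos1 bd by simp
  then show ?thesis by blast
qed

lemma good_chart_nbhd:
  assumes "good_chart p U \<phi> r l L"
  shows "openin (top_of_set M) {q\<in>U. \<phi> q \<in> ball (\<phi> p) s}" "0 < s \<Longrightarrow> p \<in> {q\<in>U. \<phi> q \<in> ball (\<phi> p) s}"
proof -
  have "(U,\<phi>) \<in> \<A>" "p \<in> U" using assms by (auto simp: good_chart_def)
  then show "openin (top_of_set M) {q\<in>U. \<phi> q \<in> ball (\<phi> p) s}" "0 < s \<Longrightarrow> p \<in> {q\<in>U. \<phi> q \<in> ball (\<phi> p) s}"
    using chart_preimage_openin[of U \<phi> "ball (\<phi> p) s"] by auto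
qed

lemma good_chart_upper:
  assumes g: "good_chart p U \<phi> r l L" and x: "x \<in> U" "\<phi> x \<in> ball (\<phi> p) (3 * r)" and y: "y \<in> U" "\<phi> y \<in> ball (\<phi> p) (3 * r)"
  shows "joined x y" "rd x y \<le> L * dist (\<phi> x) (\<phi> y)"
proof -
  have ch: "(U,\<phi>) \<in> \<A>" and c: "cball (\<phi> p) (3 * r) \<subseteq> \<phi> ` U" and L: "0 < L"
    and b: "\<And>q v. q \<in> U \<Longrightarrow> \<phi> q \<in> cball (\<phi> p) (3 * r) \<Longrightarrow> v \<bullet> (\<rho> (U,\<phi>) q *v v) \<le> (L * norm v)\<^sup>2"
    using g unfolding good_chart_def by auto
  have seg: "closed_segment (\<phi> x) (\<phi> y) \<subseteq> cball (\<phi> p) (3 * r)"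
    by (rule closed_segment_subset) (use x y in auto)
  then have "closed_segment (\<phi> x) (\<phi> y) \<subseteq> \<phi> ` U" using c by blast
  from line_curve[OF ch x(1) y(1) this]
  obtain \<gamma> where \<gamma>: "admissible \<gamma>" "\<gamma> 0 = x" "\<gamma> 1 = y"
    and len: "0 \<le> L \<Longrightarrow> (\<And>q v. q \<in> U \<Longrightarrow> \<phi> q \<in> closed_segment (\<phi> x) (\<phi> y) \<Longrightarrow> v \<bullet> (\<rho> (U,\<phi>) q *v v) \<le> (L * norm v)\<^sup>2)
      \<Longrightarrow> curve_length \<gamma> \<le> L * dist (\<phi> x) (\<phi> y)" by metis
  then show "joined x y" unfolding joined_def by blast
  have "curve_length \<gamma> \<le> L * dist (\<phi> x) (\<phi> y)" by (rule len) (use L b seg in auto)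
  then show "rd x y \<le> L * dist (\<phi> x) (\<phi> y)" using riem_dist_le_length[OF \<gamma>(1)] \<gamma> by simp
qed

lemma good_chart_curve_inside:
  assumes g: "good_chart p U \<phi> r l L" and ad: "admissible \<gamma>" and b: "0 \<le> b" "b \<le> 1"
    and im: "\<And>s. 0 \<le> s \<Longrightarrow> s \<le> b \<Longrightarrow> \<gamma> s \<in> U \<and> \<phi> (\<gamma> s) \<in> cball (\<phi> p) (3 * r)"
  shows "l * dist (\<phi> (\<gamma> 0)) (\<phi> (\<gamma> b)) \<le> curve_length \<gamma>"
proof -
  have ch: "(U,\<phi>) \<in> \<A>" and l: "0 < l"
    and bd: "\<And>q v. q \<in> U \<Longrightarrow> \<phi> q \<in> cball (\<phi> p) (3 * r) \<Longrightarrow> (l * norm v)\<^sup>2 \<le> v \<bullet> (\<rho> (U,\<phi>) q *v v)"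
    using g unfolding good_chart_def by auto
  obtain K where K: "finite K" "\<And>s U \<phi>. 0 < s \<Longrightarrow> s < 1 \<Longrightarrow> s \<notin> K \<Longrightarrow> (U,\<phi>) \<in> \<A> \<Longrightarrow> \<gamma> s \<in> U \<Longrightarrow> \<exists>v. velocity U \<phi> \<gamma> s v"
    using cone_admissible_velocity[OF admissible_cone[OF ad]] by metis
  have "norm ((\<phi> \<circ> \<gamma>) b - (\<phi> \<circ> \<gamma>) 0) \<le> integral {0..b} (\<lambda>s. inverse l * speed \<gamma> s)"
  proof (rule norm_increment_le[OF K(1) b(1)])
    have "continuous_on {0..b} (\<lambda>s. \<phi> (\<gamma> s))"
      by (rule continuous_on_compose2[OF chart_open(5)[OF ch] continuous_on_subset[OF admissible_continuous[OF ad]]])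
        (use b im in auto)
    then show "continuous_on {0..b} (\<phi> \<circ> \<gamma>)" by (simp add: o_def)
    show "(\<lambda>s. inverse l * speed \<gamma> s) integrable_on {0..b}"
      by (rule integrable_on_mult_right[OF speed_integrable'[OF ad]]) (use b in auto)
    show "0 \<le> inverse l * speed \<gamma> s" if "s \<in> {0..b}" for s
    proof -
      have "0 \<le> speed \<gamma> s" by (rule speed_nonneg[OF ad]) (use that b in auto)
      then show ?thesis using l by (intro mult_nonneg_nonneg) auto
    qed
    fix s assume s: "s \<in> {0<..<b} - K"
    have U: "\<gamma> s \<in> U" "\<phi> (\<gamma> s) \<in> cball (\<phi> p) (3 * r)" using im[of s] s by auto
    obtain v where v: "velocity U \<phi> \<gamma> s v" using K(2)[of s U \<phi>] ch U s b by auto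
    have "(l * norm v)\<^sup>2 \<le> sqs \<gamma> s" using sq_speed_velocity[OF ch v] bd[OF U] s b by simp
    then have "sqrt ((l * norm v)\<^sup>2) \<le> speed \<gamma> s" by (rule real_sqrt_le_mono)
    then have "l * norm v \<le> speed \<gamma> s" using l by simp
    then have "norm v \<le> inverse l * speed \<gamma> s" using l by (simp add: field_simps)
    then show "\<exists>v. (\<phi> \<circ> \<gamma> has_vector_derivative v) (at s) \<and> norm v \<le> inverse l * speed \<gamma> s"
      using v unfolding velocity_def by blast
  qed
  also have "\<dots> = inverse l * integral {0..b} (speed \<gamma>)" by simp
  also have "\<dots> \<le> inverse l * curve_length \<gamma>"
    by (rule mult_left_mono[OF length_mono[OF ad]]) (use b l in auto)
  finally show ?thesis using l by (simp add: field_simps dist_norm norm_minus_commute)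
qed

text \<open>First exit time. Before it the curve lies in a compact, hence closed, part of the chart
  of coordinate radius less than \<open>3 * r\<close>. By continuity the exit point lies there too,
  a contradiction.\<close>

lemma good_chart_curve_stays:
  assumes g: "good_chart p U \<phi> r l L" and ad: "admissible \<gamma>" and x: "\<gamma> 0 \<in> U" "\<phi> (\<gamma> 0) \<in> ball (\<phi> p) r"
    and len: "curve_length \<gamma> < 2 * l * r" and s: "0 \<le> s" "s \<le> 1"
  shows "\<gamma> s \<in> U \<and> \<phi> (\<gamma> s) \<in> ball (\<phi> p) (3 * r)"
proof (rule ccontr)
  assume neg: "\<not> ?thesis"
  have ch: "(U,\<phi>) \<in> \<A>" and c: "cball (\<phi> p) (3 * r) \<subseteq> \<phi> ` U" and l: "0 < l" "0 < r"
    using g unfolding good_chart_def by auto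
  define B where "B = {q\<in>U. \<phi> q \<in> ball (\<phi> p) (3 * r)}"
  have "openin (top_of_set M) B" unfolding B_def using good_chart_nbhd(1)[OF g] .
  then obtain W where W: "open W" "B = M \<inter> W" by (auto simp: openin_open)
  have "closed ({0..1} \<inter> \<gamma> -` (- W))"
    using continuous_closed_preimage[OF admissible_continuous[OF ad]] W(1) by auto
  then have "compact ({0..1} \<inter> \<gamma> -` (- W))"
    by (metis compact_Icc compact_Int_closed inf.left_idem)
  moreover have "\<gamma> s \<notin> B" using neg by (simp add: B_def)
  then have "s \<in> {0..1} \<inter> \<gamma> -` (- W)" using s admissible_local(2)[OF ad s] W(2) by auto
  ultimately obtain u where u: "u \<in> {0..1} \<inter> \<gamma> -` (- W)" "\<And>t. t \<in> {0..1} \<inter> \<gamma> -` (- W) \<Longrightarrow> u \<le> t"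
    using compact_attains_inf[of "{0..1} \<inter> \<gamma> -` (- W)"] by blast
  have uB: "\<gamma> u \<notin> B" using u(1) W(2) by auto
  have inB: "\<gamma> t \<in> B" if t: "0 \<le> t" "t < u" for t
  proof (rule ccontr)
    assume "\<gamma> t \<notin> B"
    moreover have "t \<in> {0..1}" using t u(1) by auto
    ultimately have "t \<in> {0..1} \<inter> \<gamma> -` (- W)" using admissible_local(2)[OF ad, of t] W(2) by auto
    from u(2)[OF this] show False using t by simp
  qed
  have "\<gamma> 0 \<in> B" using x l by (auto simp: B_def)
  then have u0: "0 < u" using uB u(1) by (cases "u = 0") auto
  \<comment> \<open>The starting point is within \<open>r\<close> of the centre, and up to any time
    before \<open>u\<close> the curve moves in coordinates by at most its length divided by
    \<open>l\<close>.\<close>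
  define R where "R = r + curve_length \<gamma> / l"
  have R: "R < 3 * r" using len l by (simp add: R_def field_simps)
  define C where "C = inv_into U \<phi> ` cball (\<phi> p) R"
  have cR: "cball (\<phi> p) R \<subseteq> \<phi> ` U" using c R by (meson less_imp_le order_trans subset_cball)
  have "compact C" unfolding C_def
    by (rule compact_continuous_image[OF continuous_on_subset[OF chart_open(6)[OF ch] cR] compact_cball])
  then have clC: "closed C" by (rule compact_imp_closed)
  have CB: "C \<subseteq> B" using cR R
    by (auto simp: C_def B_def f_inv_into_f inv_into_into subset_iff)
  have inC: "\<gamma> t \<in> C" if t: "0 \<le> t" "t < u" for t
  proof -
    have "l * dist (\<phi> (\<gamma> 0)) (\<phi> (\<gamma> t)) \<le> curve_length \<gamma>"
      by (rule good_chart_curve_inside[OF g ad]) (use t u(1) inB in \<open>auto simp: B_def less_imp_le\<close>)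
    then have "dist (\<phi> (\<gamma> 0)) (\<phi> (\<gamma> t)) \<le> curve_length \<gamma> / l" using l by (simp add: field_simps)
    moreover have "dist (\<phi> p) (\<phi> (\<gamma> t)) \<le> dist (\<phi> p) (\<phi> (\<gamma> 0)) + dist (\<phi> (\<gamma> 0)) (\<phi> (\<gamma> t))" by (rule dist_triangle)
    ultimately have "\<phi> (\<gamma> t) \<in> cball (\<phi> p) R" using x by (simp add: R_def)
    moreover have "inv_into U \<phi> (\<phi> (\<gamma> t)) = \<gamma> t"
      using inB[OF t] chart_open(4)[OF ch] by (auto simp: B_def)
    ultimately show ?thesis unfolding C_def by (metis imageI)
  qed
  have "closed ({0..1} \<inter> \<gamma> -` C)" using continuous_closed_preimage[OF admissible_continuous[OF ad]] clC by auto
  then have "closure {0..<u} \<subseteq> {0..1} \<inter> \<gamma> -` C"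
    by (rule closure_minimal[rotated]) (use inC u(1) in auto)
  moreover have "u \<in> closure {0..<u}" using u0 by simp
  ultimately have "\<gamma> u \<in> C" by blast
  then show False using CB uB by blast
qed

lemma good_chart_lower:
  assumes g: "good_chart p U \<phi> r l L" and x: "x \<in> U" "\<phi> x \<in> ball (\<phi> p) r" and j: "joined x y" and d: "rd x y < 2 * l * r"
  shows "y \<in> U" "\<phi> y \<in> ball (\<phi> p) (3 * r)" "l * dist (\<phi> x) (\<phi> y) \<le> rd x y"
proof -
  \<comment> \<open>The infimum need not be attained, so curves of length below an arbitrary
    \<open>c\<close> are used. The last claim then follows by letting \<open>c\<close> decrease to
    the distance.\<close>
  have *: "y \<in> U \<and> \<phi> y \<in> ball (\<phi> p) (3 * r) \<and> l * dist (\<phi> x) (\<phi> y) < c" if c: "rd x y < c" "c \<le> 2 * l * r" for c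
  proof -
    obtain \<gamma> where \<gamma>: "admissible \<gamma>" "\<gamma> 0 = x" "\<gamma> 1 = y" "curve_length \<gamma> < c" using riem_dist_lessD[OF j c(1)] by blast
    have st: "\<gamma> s \<in> U \<and> \<phi> (\<gamma> s) \<in> ball (\<phi> p) (3 * r)" if "0 \<le> s" "s \<le> 1" for s
      by (rule good_chart_curve_stays[OF g \<gamma>(1) _ _ _ that]) (use \<gamma> x c in auto)
    have "l * dist (\<phi> (\<gamma> 0)) (\<phi> (\<gamma> 1)) \<le> curve_length \<gamma>"
      by (rule good_chart_curve_inside[OF g \<gamma>(1)]) (use st in \<open>auto simp: less_imp_le\<close>)
    then show ?thesis using st[of 1] \<gamma> by simp
  qed
  from *[of "2 * l * r"] d show "y \<in> U" "\<phi> y \<in> ball (\<phi> p) (3 * r)" by auto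
  show "l * dist (\<phi> x) (\<phi> y) \<le> rd x y"
  proof (rule field_le_epsilon)
    fix e :: real assume "0 < e"
    then show "l * dist (\<phi> x) (\<phi> y) \<le> rd x y + e" using *[of "min (rd x y + e) (2 * l * r)"] d by auto
  qed
qed

section \<open>The Riemannian distance as a length metric inducing the topology\<close>

lemma joined_sym: "joined x y \<Longrightarrow> joined y x"
  unfolding joined_def using reverse_curve by metis

lemma joined_trans: "joined x y \<Longrightarrow> joined y z \<Longrightarrow> joined x z"
  unfolding joined_def using concat_curve by metis

lemma joined_all:
  assumes "x \<in> M" "y \<in> M"
  shows "joined x y"
proof (rule connected_equivalence_relation[OF M_facts(3) assms])
  fix p assume "p \<in> M"
  then obtain U \<phi> r l L where g: "good_chart p U \<phi> r l L" using ex_good_chart by metis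
  then have "0 < r" "p \<in> U" by (auto simp: good_chart_def)
  then show "\<exists>T. openin (top_of_set M) T \<and> p \<in> T \<and> (\<forall>x\<in>T. joined p x)"
    using good_chart_nbhd[OF g, of "3 * r"] good_chart_upper(1)[OF g]
    by (intro exI[of _ "{q\<in>U. \<phi> q \<in> ball (\<phi> p) (3 * r)}"]) auto
qed (use joined_sym joined_trans in blast)+

text \<open>Outside of \<open>M\<close> the infimum defining the distance is taken over the empty set; \<open>dst\<close> removes
  this junk value.\<close>

definition dst :: "'a \<Rightarrow> 'a \<Rightarrow> real" where
  "dst x y = (if x \<in> M \<and> y \<in> M then rd x y else 0)"

lemma riem_dist_triangle:
  assumes "x \<in> M" "y \<in> M" "z \<in> M"
  shows "rd x z \<le> rd x y + rd y z"
proof (rule field_le_epsilon)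
  fix e :: real assume e: "0 < e"
  obtain \<gamma>1 where 1: "admissible \<gamma>1" "\<gamma>1 0 = x" "\<gamma>1 1 = y" "curve_length \<gamma>1 < rd x y + e/2"
    using riem_dist_lessD[OF joined_all[OF assms(1,2)], of "rd x y + e/2"] e by auto
  obtain \<gamma>2 where 2: "admissible \<gamma>2" "\<gamma>2 0 = y" "\<gamma>2 1 = z" "curve_length \<gamma>2 < rd y z + e/2"
    using riem_dist_lessD[OF joined_all[OF assms(2,3)], of "rd y z + e/2"] e by auto
  obtain \<gamma> where "admissible \<gamma>" "\<gamma> 0 = x" "\<gamma> 1 = z" "curve_length \<gamma> = curve_length \<gamma>1 + curve_length \<gamma>2"
    using concat_curve[OF 1(1) 2(1)] 1 2 by metis
  then show "rd x z \<le> rd x y + rd y z + e" using riem_dist_le_length[of \<gamma>] 1 2 by simp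
qed

lemma riem_dist_sym_le:
  assumes "x \<in> M" "y \<in> M"
  shows "rd x y \<le> rd y x"
proof (rule field_le_epsilon)
  fix e :: real assume e: "0 < e"
  obtain \<gamma>1 where 1: "admissible \<gamma>1" "\<gamma>1 0 = y" "\<gamma>1 1 = x" "curve_length \<gamma>1 < rd y x + e"
    using riem_dist_lessD[OF joined_all[OF assms(2,1)], of "rd y x + e"] e by auto
  obtain \<gamma> where "admissible \<gamma>" "\<gamma> 0 = x" "\<gamma> 1 = y" "curve_length \<gamma> = curve_length \<gamma>1"
    using reverse_curve[OF 1(1)] 1 by metis
  then show "rd x y \<le> rd y x + e" using riem_dist_le_length[of \<gamma>] 1 by simp
qed

text \<open>A point at distance 0 from \<open>x\<close> is forced into the chart around
  \<open>x\<close>, where the distance dominates a multiple of the Euclidean distance of the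
  coordinates.\<close>

lemma riem_dist_zero_iff:
  assumes "x \<in> M" "y \<in> M"
  shows "rd x y = 0 \<longleftrightarrow> x = y"
proof -
  obtain U \<phi> r l L where g: "good_chart x U \<phi> r l L" using ex_good_chart[OF assms(1)] by metis
  then have r: "0 < r" "0 < l" "x \<in> U" "(U,\<phi>) \<in> \<A>" by (auto simp: good_chart_def)
  have "rd x x \<le> 0" using good_chart_upper(2)[OF g, of x x] r by simp
  then have "rd x x = 0" using riem_dist_nonneg[OF joined_all[OF assms(1,1)]] by simp
  moreover have "x = y" if "rd x y = 0"
  proof -
    have "y \<in> U" "l * dist (\<phi> x) (\<phi> y) \<le> 0"
      using good_chart_lower[OF g _ _ joined_all[OF assms]] r that by auto
    then have "\<phi> x = \<phi> y" using r by (simp add: mult_le_0_iff)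
    then show ?thesis using chart_open(4)[OF r(4)] r(3) \<open>y \<in> U\<close> by (auto dest: inj_onD)
  qed
  ultimately show ?thesis by auto
qed

sublocale dM: Metric_space M dst
proof
  show "0 \<le> dst x y" for x y by (auto simp: dst_def intro: riem_dist_nonneg joined_all)
  show "dst x y = dst y x" for x y
    using riem_dist_sym_le[of x y] riem_dist_sym_le[of y x] by (auto simp: dst_def)
  show "dst x y = 0 \<longleftrightarrow> x = y" if "x \<in> M" "y \<in> M" for x y using riem_dist_zero_iff that by (simp add: dst_def)
  show "dst x z \<le> dst x y + dst y z" if "x \<in> M" "y \<in> M" "z \<in> M" for x y z
    using riem_dist_triangle that by (simp add: dst_def)
qed

text \<open>Cut an almost shortest curve where its length is divided in the ratio
  \<open>a : b\<close>. Such a time exists because the length up to time \<open>u\<close> is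
  continuous in \<open>u\<close>.\<close>

lemma dst_length_space:
  assumes "x \<in> M" "y \<in> M" "0 < a" "0 < b" "dst x y < a + b"
  obtains z where "z \<in> M" "dst x z < a" "dst z y < b"
proof -
  obtain \<gamma> where \<gamma>: "admissible \<gamma>" "\<gamma> 0 = x" "\<gamma> 1 = y" "curve_length \<gamma> < a + b"
    using riem_dist_lessD[OF joined_all[OF assms(1,2)]] assms by (auto simp: dst_def)
  define F where "F u = integral {0..u} (speed \<gamma>)" for u
  have "continuous_on {0..1} F" unfolding F_def
    by (rule indefinite_integral_continuous_1[OF speed_integrable[OF \<gamma>(1)]])
  moreover have "F 0 \<le> a * curve_length \<gamma> / (a + b)" using length_nonneg[OF \<gamma>(1)] assms by (simp add: F_def)
  moreover have "a * curve_length \<gamma> / (a + b) \<le> F 1" using length_nonneg[OF \<gamma>(1)] assms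
    by (simp add: F_def field_simps)
  ultimately obtain u where u: "0 \<le> u" "u \<le> 1" "F u = a * curve_length \<gamma> / (a + b)"
    using IVT'[of F 0 "a * curve_length \<gamma> / (a + b)" 1] by auto
  have c: "curve_length \<gamma> = F u + integral {u..1} (speed \<gamma>)" unfolding F_def
    by (rule Henstock_Kurzweil_Integration.integral_combine[symmetric]) (use speed_integrable[OF \<gamma>(1)] u in auto)
  have uM: "\<gamma> u \<in> M" using admissible_local(2)[OF \<gamma>(1) u(1,2)] .
  have "F u < a"
  proof -
    have "a * curve_length \<gamma> < a * (a + b)" using \<gamma>(4) assms by (intro mult_strict_left_mono) auto
    then show ?thesis unfolding u(3) using assms by (simp add: field_simps)
  qed
  moreover have "integral {u..1} (speed \<gamma>) < b"
  proof -
    have "integral {u..1} (speed \<gamma>) = b * curve_length \<gamma> / (a + b)" using c u(3) assms by (simp add: field_simps)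
    moreover have "b * curve_length \<gamma> < b * (a + b)" using \<gamma>(4) assms by (intro mult_strict_left_mono) auto
    moreover have "b * curve_length \<gamma> / (a + b) < b * (a + b) / (a + b)"
      by (rule divide_strict_right_mono[OF calculation(2)]) (use assms in simp)
    moreover have "b * (a + b) / (a + b) = b" using assms by simp
    ultimately show ?thesis by linarith
  qed
  ultimately show ?thesis using that[OF uM] split_curve[OF \<gamma>(1) u(1,2)] \<gamma> uM assms by (simp add: dst_def F_def)
qed

text \<open>The lower bound in a good chart puts small metric balls into coordinate neighbourhoods,
  and the upper bound puts small coordinate balls into metric balls.\<close>

lemma openin_iff_dst:
  "openin (top_of_set M) W \<longleftrightarrow> W \<subseteq> M \<and> (\<forall>x\<in>W. \<exists>e>0. \<forall>y\<in>M. dst x y < e \<longrightarrow> y \<in> W)"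
proof
  assume W: "openin (top_of_set M) W"
  then have WM: "W \<subseteq> M" by (rule openin_imp_subset)
  moreover have "\<exists>e>0. \<forall>y\<in>M. dst x y < e \<longrightarrow> y \<in> W" if x: "x \<in> W" for x
  proof -
    have xM: "x \<in> M" using x WM by blast
    obtain U \<phi> r l L where g: "good_chart x U \<phi> r l L" using ex_good_chart[OF xM] by metis
    then have r: "0 < r" "0 < l" "x \<in> U" "(U,\<phi>) \<in> \<A>" by (auto simp: good_chart_def)
    have "open (\<phi> ` (U \<inter> W))" using chart_sub_open[OF r(4) W] .
    then obtain e where e: "e > 0" "ball (\<phi> x) e \<subseteq> \<phi> ` (U \<inter> W)" using r x openE by (metis IntI imageI)
    show ?thesis
    \<comment> \<open>The first radius keeps \<open>y\<close> in the chart, the second keeps its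
      coordinates within \<open>e\<close> of those of \<open>x\<close>.\<close>
    proof (intro exI[of _ "min (2 * l * r) (l * e)"] conjI ballI impI)
      show "0 < min (2 * l * r) (l * e)" using r e by simp
      fix y assume y: "y \<in> M" "dst x y < min (2 * l * r) (l * e)"
      then have d: "rd x y < 2 * l * r" "rd x y < l * e" using xM by (auto simp: dst_def)
      have "y \<in> U" "l * dist (\<phi> x) (\<phi> y) \<le> rd x y"
        using good_chart_lower[OF g r(3) _ joined_all[OF xM y(1)] d(1)] r by auto
      then have "l * dist (\<phi> x) (\<phi> y) < l * e" using d by simp
      then have "\<phi> y \<in> \<phi> ` (U \<inter> W)" using e r by auto
      then show "y \<in> W" using \<open>y \<in> U\<close> chart_open(4)[OF r(4)] by (auto dest: inj_onD)
    qed
  qed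
  ultimately show "W \<subseteq> M \<and> (\<forall>x\<in>W. \<exists>e>0. \<forall>y\<in>M. dst x y < e \<longrightarrow> y \<in> W)" by blast
next
  assume W: "W \<subseteq> M \<and> (\<forall>x\<in>W. \<exists>e>0. \<forall>y\<in>M. dst x y < e \<longrightarrow> y \<in> W)"
  show "openin (top_of_set M) W"
  proof (subst openin_subopen, rule ballI)
    fix x assume x: "x \<in> W"
    then obtain e where e: "e > 0" "\<And>y. y \<in> M \<Longrightarrow> dst x y < e \<Longrightarrow> y \<in> W" using W by blast
    have xM: "x \<in> M" using x W by blast
    obtain U \<phi> r l L where g: "good_chart x U \<phi> r l L" using ex_good_chart[OF xM] by metis
    then have r: "0 < r" "0 < L" "x \<in> U" "(U,\<phi>) \<in> \<A>" by (auto simp: good_chart_def)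
    define s where "s = min (3 * r) (e / L)"
    have s: "0 < s" "s \<le> 3 * r" "s \<le> e / L" using r e by (auto simp: s_def)
    show "\<exists>T. openin (top_of_set M) T \<and> x \<in> T \<and> T \<subseteq> W"
    proof (intro exI[of _ "{q\<in>U. \<phi> q \<in> ball (\<phi> x) s}"] conjI subsetI)
      fix y assume y: "y \<in> {q\<in>U. \<phi> q \<in> ball (\<phi> x) s}"
      have yM: "y \<in> M" using y chart_open(3)[OF r(4)] by auto
      have "rd x y \<le> L * dist (\<phi> x) (\<phi> y)" using good_chart_upper(2)[OF g r(3), of y] y s r by auto
      also have "\<dots> < L * s" using y r by auto
      also have "\<dots> \<le> e" using s r by (simp add: field_simps)
      finally show "y \<in> W" using e(2)[OF yM] xM yM by (simp add: dst_def)
    qed (use good_chart_nbhd[OF g, of s] s in auto)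
  qed
qed

section \<open>The cone distance\<close>

abbreviation cd :: "'a \<times> real \<Rightarrow> 'a \<times> real \<Rightarrow> real" where "cd \<equiv> cone_dist M \<A> \<rho>"

lemma cone_dist_eq:
  "cd z w = Inf {integral {0..1} (cone_speed \<gamma> r) |\<gamma> r.
     cone_admissible \<gamma> r \<and> r ` {0..1} \<subseteq> {1..} \<and> (\<gamma> 0, r 0) = z \<and> (\<gamma> 1, r 1) = w}"
  unfolding cone_dist_def cone_admissible_def cone_speed_def ..

lemma cone_speed_nonneg:
  assumes "cone_admissible \<gamma> r" "s \<in> {0..1}"
  shows "0 \<le> cone_speed \<gamma> r s"
  unfolding cone_speed_def
  using sq_speed_nonneg[OF admissible_local(2)[OF cone_admissible_admissible[OF assms(1)]]] assms(2) by simp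

lemma cone_dist_le:
  assumes "cone_admissible \<gamma> r" "r ` {0..1} \<subseteq> {1..}"
  shows "cd (\<gamma> 0, r 0) (\<gamma> 1, r 1) \<le> integral {0..1} (cone_speed \<gamma> r)"
  unfolding cone_dist_eq
proof (rule cInf_lower)
  show "bdd_below {integral {0..1} (cone_speed \<gamma>' r') |\<gamma>' r'. cone_admissible \<gamma>' r' \<and> r' ` {0..1} \<subseteq> {1..} \<and>
      (\<gamma>' 0, r' 0) = (\<gamma> 0, r 0) \<and> (\<gamma>' 1, r' 1) = (\<gamma> 1, r 1)}"
  proof (rule bdd_belowI[of _ 0], clarify)
    fix \<gamma>' r' assume "cone_admissible \<gamma>' r'"
    then show "0 \<le> integral {0..1} (cone_speed \<gamma>' r')"
      by (intro integral_nonneg cone_speed_integrable cone_speed_nonneg)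
  qed
qed (use assms in auto)

text \<open>A curve of \<open>M\<close> traversed at constant height \<open>t\<close> has
  \<open>t\<close> times its length in the cone.\<close>

lemma cone_dist_level:
  assumes "x \<in> M" "y \<in> M" "1 \<le> t"
  shows "cd (x, t) (y, t) \<le> t * dst x y"
proof (rule field_le_epsilon)
  fix e :: real assume e: "0 < e"
  then have "0 < e / t" using assms by simp
  then obtain \<gamma> where \<gamma>: "admissible \<gamma>" "\<gamma> 0 = x" "\<gamma> 1 = y" "curve_length \<gamma> < rd x y + e / t"
    using riem_dist_lessD[OF joined_all[OF assms(1,2)], of "rd x y + e / t"] by auto
  have "integral {0..1} (cone_speed \<gamma> (\<lambda>_. t)) = integral {0..1} (\<lambda>s. t * speed \<gamma> s)"
    by (rule Henstock_Kurzweil_Integration.integral_cong) (use assms in \<open>simp add: cone_speed_const\<close>)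
  also have "\<dots> = t * curve_length \<gamma>" by simp
  also have "\<dots> \<le> t * (rd x y + e / t)" using \<gamma> assms by (intro mult_left_mono) auto
  also have "\<dots> = t * dst x y + e" using assms by (simp add: dst_def algebra_simps)
  finally have *: "integral {0..1} (cone_speed \<gamma> (\<lambda>_. t)) \<le> t * dst x y + e" .
  have "(\<lambda>_. t) ` {0..1::real} \<subseteq> {1..}" using assms by (simp add: image_subset_iff)
  from cone_dist_le[OF admissible_cone[OF \<gamma>(1), of t] this] * show "cd (x, t) (y, t) \<le> t * dst x y + e"
    using \<gamma> by simp
qed

text \<open>The point of a cone curve closest to the tip controls its length from below, both through the
  radial motion and through the motion in \<open>M\<close>.\<close>

lemma cone_length_lower:
  assumes ad: "cone_admissible \<gamma> r" and r1: "r ` {0..1} \<subseteq> {1..}"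
  obtains m where "1 \<le> m" "m \<le> r 0" "m \<le> r 1" "m * dst (\<gamma> 0) (\<gamma> 1) \<le> integral {0..1} (cone_speed \<gamma> r)"
    "(r 0 - m) + (r 1 - m) \<le> integral {0..1} (cone_speed \<gamma> r)"
proof -
  note ad' = cone_admissible_admissible[OF ad]
  note int = cone_speed_integrable[OF ad]
  obtain s0 where s0: "s0 \<in> {0..1}" "\<And>s. s \<in> {0..1} \<Longrightarrow> r s0 \<le> r s"
    using continuous_attains_inf[OF _ _ cone_admissible_continuous(2)[OF ad]] by auto
  have m: "1 \<le> r s0" using r1 s0(1) by (metis atLeast_iff image_subset_iff)
  have "r s0 * curve_length \<gamma> = integral {0..1} (\<lambda>s. r s0 * speed \<gamma> s)" by simp
  also have "\<dots> \<le> integral {0..1} (cone_speed \<gamma> r)"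
  proof (rule integral_le)
    show "(\<lambda>s. r s0 * speed \<gamma> s) integrable_on {0..1}" by (rule integrable_on_mult_right[OF speed_integrable[OF ad']])
    fix s :: real assume s: "s \<in> {0..1}"
    have nn: "0 \<le> sqs \<gamma> s" using sq_speed_nonneg admissible_local(2)[OF ad'] s by auto
    have "r s0 * speed \<gamma> s = sqrt ((r s0)\<^sup>2 * sqs \<gamma> s)" using m by (simp add: real_sqrt_mult)
    also have "\<dots> \<le> cone_speed \<gamma> r s" unfolding cone_speed_def
    proof (rule real_sqrt_le_mono)
      have "(r s0)\<^sup>2 \<le> (r s)\<^sup>2" using s0(2)[OF s] m by (intro power_mono) auto
      then have "(r s0)\<^sup>2 * sqs \<gamma> s \<le> (r s)\<^sup>2 * sqs \<gamma> s" using nn by (intro mult_right_mono)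
      then show "(r s0)\<^sup>2 * sqs \<gamma> s \<le> (r s)\<^sup>2 * sqs \<gamma> s + (vector_derivative r (at s within {0..1}))\<^sup>2"
        by (simp add: add_increasing2)
    qed
    finally show "r s0 * speed \<gamma> s \<le> cone_speed \<gamma> r s" .
  qed (rule int)
  finally have 1: "r s0 * curve_length \<gamma> \<le> integral {0..1} (cone_speed \<gamma> r)" .
  have "dst (\<gamma> 0) (\<gamma> 1) \<le> curve_length \<gamma>"
    using riem_dist_le_length[OF ad'] length_nonneg[OF ad'] by (simp add: dst_def)
  then have "r s0 * dst (\<gamma> 0) (\<gamma> 1) \<le> r s0 * curve_length \<gamma>" using m by (intro mult_left_mono) auto
  with 1 have A: "r s0 * dst (\<gamma> 0) (\<gamma> 1) \<le> integral {0..1} (cone_speed \<gamma> r)" by simp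
  obtain K where K: "finite K" "\<And>s. 0 < s \<Longrightarrow> s < 1 \<Longrightarrow> s \<notin> K \<Longrightarrow> \<exists>v. (r has_vector_derivative v) (at s)"
    using cone_admissible_velocity[OF ad] by metis
  have rad: "norm (r b - r a) \<le> integral {a..b} (cone_speed \<gamma> r)" if ab: "0 \<le> a" "a \<le> b" "b \<le> 1" for a b
  proof (rule norm_increment_le[OF K(1) ab(2)])
    show "continuous_on {a..b} r" using cone_admissible_continuous(2)[OF ad] by (rule continuous_on_subset) (use ab in auto)
    show "cone_speed \<gamma> r integrable_on {a..b}" using int by (rule integrable_subinterval_real) (use ab in auto)
    show "0 \<le> cone_speed \<gamma> r s" if "s \<in> {a..b}" for s using cone_speed_nonneg[OF ad] that ab by auto
    fix s assume s: "s \<in> {a<..<b} - K"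
    then obtain v where v: "(r has_vector_derivative v) (at s)" using K(2)[of s] ab by auto
    have "vector_derivative r (at s within {0..1}) = v"
      by (rule vector_derivative_at_within_ivl[OF v]) (use s ab in auto)
    moreover have "0 \<le> (r s)\<^sup>2 * sqs \<gamma> s" using sq_speed_nonneg admissible_local(2)[OF ad', of s] s ab by auto
    ultimately have "sqrt (v\<^sup>2) \<le> cone_speed \<gamma> r s" unfolding cone_speed_def by (intro real_sqrt_le_mono) simp
    then show "\<exists>v. (r has_vector_derivative v) (at s) \<and> norm v \<le> cone_speed \<gamma> r s" using v by auto
  qed
  have "integral {0..1} (cone_speed \<gamma> r) = integral {0..s0} (cone_speed \<gamma> r) + integral {s0..1} (cone_speed \<gamma> r)"
    by (rule Henstock_Kurzweil_Integration.integral_combine[symmetric]) (use int s0 in auto)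
  moreover have "r 0 - r s0 \<le> integral {0..s0} (cone_speed \<gamma> r)" using rad[of 0 s0] s0(1) by auto
  moreover have "r 1 - r s0 \<le> integral {s0..1} (cone_speed \<gamma> r)" using rad[of s0 1] s0(1) by auto
  ultimately have B: "(r 0 - r s0) + (r 1 - r s0) \<le> integral {0..1} (cone_speed \<gamma> r)" by simp
  show ?thesis by (rule that[of "r s0", OF m _ _ A B]) (use s0 in auto)
qed

lemma cone_dist_lower:
  assumes "x \<in> M" "y \<in> M" "1 \<le> t" "1 \<le> t'" "0 < e"
  obtains m where "1 \<le> m" "m \<le> t" "m \<le> t'" "m * dst x y \<le> cd (x, t) (y, t') + e"
    "(t - m) + (t' - m) \<le> cd (x, t) (y, t') + e"
proof -
  let ?S = "{integral {0..1} (cone_speed \<gamma> r) |\<gamma> r.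
     cone_admissible \<gamma> r \<and> r ` {0..1} \<subseteq> {1..} \<and> (\<gamma> 0, r 0) = (x, t) \<and> (\<gamma> 1, r 1) = (y, t')}"
  obtain \<gamma>0 where \<gamma>0: "admissible \<gamma>0" "\<gamma>0 0 = x" "\<gamma>0 1 = y" using joined_all[OF assms(1,2)] unfolding joined_def by blast
  \<comment> \<open>Linear interpolation of the heights never drops below 1. Together with any curve
    in \<open>M\<close> it shows that the set of lengths is nonempty, without which its infimum says
    nothing.\<close>
  define r0 where "r0 s = t + s * (t' - t)" for s :: real
  have "C1_on a b r0" for a b unfolding C1_on_def r0_def
    by (rule exI[of _ "\<lambda>_. t' - t"]) (auto intro!: derivative_eq_intros)
  then have "cone_admissible \<gamma>0 r0" using \<gamma>0(1) unfolding cone_admissible_def admissible_def by (auto elim: piecewise_mono)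
  moreover have "r0 ` {0..1} \<subseteq> {1..}"
  proof clarify
    fix s :: real assume "s \<in> {0..1}"
    then have "0 \<le> (1 - s) * (t - 1) + s * (t' - 1)" using assms by (intro add_nonneg_nonneg mult_nonneg_nonneg) auto
    then show "1 \<le> r0 s" by (simp add: r0_def algebra_simps)
  qed
  moreover have "(\<gamma>0 0, r0 0) = (x, t)" "(\<gamma>0 1, r0 1) = (y, t')" using \<gamma>0 by (simp_all add: r0_def)
  ultimately have "integral {0..1} (cone_speed \<gamma>0 r0) \<in> ?S" by blast
  then have "?S \<noteq> {}" by blast
  moreover have "Inf ?S < cd (x, t) (y, t') + e" using assms(5) by (simp add: cone_dist_eq)
  ultimately obtain L where L: "L \<in> ?S" "L < cd (x, t) (y, t') + e" by (rule cInf_lessD[elim_format]) blast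
  then obtain \<gamma> r where c: "cone_admissible \<gamma> r" "r ` {0..1} \<subseteq> {1..}" "\<gamma> 0 = x" "r 0 = t" "\<gamma> 1 = y" "r 1 = t'"
    "integral {0..1} (cone_speed \<gamma> r) < cd (x, t) (y, t') + e" by auto
  obtain m where "1 \<le> m" "m \<le> r 0" "m \<le> r 1" "m * dst (\<gamma> 0) (\<gamma> 1) \<le> integral {0..1} (cone_speed \<gamma> r)"
    "(r 0 - m) + (r 1 - m) \<le> integral {0..1} (cone_speed \<gamma> r)"
    using cone_length_lower[OF c(1,2)] .
  then show ?thesis using c(3-7) by (intro that[of m]) simp_all
qed

end

section \<open>Change of variables\<close>

text \<open>Conjugation by a bijection sends transpositions to transpositions, also between
  different index types; induction over products of transpositions gives the rest.\<close>

lemma sign_conj_bij: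
  fixes b :: "'m::finite \<Rightarrow> 'n::finite"
  assumes "bij b" "p permutes UNIV"
  shows "sign (inv_into UNIV b \<circ> p \<circ> b) = sign p"
  using assms(2) finite[of UNIV]
proof (induction rule: permutes_induct)
  case id
  have "inv_into UNIV b \<circ> id \<circ> b = id" using assms(1) by (auto simp: fun_eq_iff bij_is_inj)
  then show ?case by (metis sign_id)
next
  case (swap x y p)
  have pp: "permutation p" using swap.hyps by (auto simp: permutation_permutes)
  have p': "(inv_into UNIV b \<circ> p \<circ> b) permutes UNIV"
    using assms(1) permutes_bij[OF swap.hyps(4)]
    by (intro bij_imp_permutes) (auto intro!: bij_comp simp: bij_imp_bij_inv)
  have tr: "inv_into UNIV b \<circ> Transposition.transpose x y \<circ> b = Transposition.transpose (inv_into UNIV b x) (inv_into UNIV b y)"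
  proof
    fix z
    have "inv_into UNIV b (b z) = z" using assms(1) by (simp add: bij_is_inj)
    moreover have "z = inv_into UNIV b w \<longleftrightarrow> b z = w" for w using bij_inv_eq_iff[OF assms(1)] .
    ultimately show "(inv_into UNIV b \<circ> Transposition.transpose x y \<circ> b) z =
        Transposition.transpose (inv_into UNIV b x) (inv_into UNIV b y) z"
      by (simp add: Transposition.transpose_def)
  qed
  have ne: "inv_into UNIV b x \<noteq> inv_into UNIV b y" using swap.hyps(3) assms(1) by (metis bij_inv_eq_iff)
  have "inv_into UNIV b \<circ> (Transposition.transpose x y \<circ> p) \<circ> b = (inv_into UNIV b \<circ> Transposition.transpose x y \<circ> b) \<circ> (inv_into UNIV b \<circ> p \<circ> b)"
    using assms(1) by (auto simp: fun_eq_iff bij_is_surj surj_f_inv_f)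
  then have "sign (inv_into UNIV b \<circ> (Transposition.transpose x y \<circ> p) \<circ> b) = sign (Transposition.transpose (inv_into UNIV b x) (inv_into UNIV b y) \<circ> (inv_into UNIV b \<circ> p \<circ> b))"
    by (simp add: tr)
  also have "\<dots> = sign (Transposition.transpose (inv_into UNIV b x) (inv_into UNIV b y)) * sign (inv_into UNIV b \<circ> p \<circ> b)"
    by (rule sign_compose[OF permutation_swap_id]) (use p' in \<open>auto simp: permutation_permutes\<close>)
  also have "\<dots> = sign (Transposition.transpose x y) * sign p"
    by (simp only: swap.IH sign_swap_id ne swap.hyps(3) if_False)
  also have "\<dots> = sign (Transposition.transpose x y \<circ> p)"
    by (rule sign_compose[symmetric]) (use pp in \<open>auto simp: permutation_swap_id\<close>)
  finally show ?case .
qed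

lemma det_reindex:
  fixes A :: "real^'n^'n" and b :: "'m::finite \<Rightarrow> 'n::finite"
  assumes "bij b"
  shows "det (\<chi> i j. A $ b i $ b j) = det A"
proof -
  have bb: "b (inv_into UNIV b x) = x" "inv_into UNIV b (b y) = y" for x y
    using assms by (auto simp: bij_is_surj surj_f_inv_f bij_is_inj)
  have c1: "inv_into UNIV b \<circ> p \<circ> b permutes UNIV" if "p permutes UNIV" for p
    using assms permutes_bij[OF that] by (intro bij_imp_permutes) (auto intro!: bij_comp simp: bij_imp_bij_inv)
  have c2: "b \<circ> p \<circ> inv_into UNIV b permutes UNIV" if "p permutes UNIV" for p
    using assms permutes_bij[OF that] by (intro bij_imp_permutes) (auto intro!: bij_comp simp: bij_imp_bij_inv)
  show ?thesis unfolding det_def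
  proof (rule sum.reindex_bij_witness[of _ "\<lambda>p. inv_into UNIV b \<circ> p \<circ> b" "\<lambda>p. b \<circ> p \<circ> inv_into UNIV b"])
    fix p :: "'m \<Rightarrow> 'm" assume p: "p \<in> {p. p permutes UNIV}"
    show e: "inv_into UNIV b \<circ> (b \<circ> p \<circ> inv_into UNIV b) \<circ> b = p" by (simp add: fun_eq_iff bb)
    show "b \<circ> p \<circ> inv_into UNIV b \<in> {p. p permutes UNIV}" using c2 p by simp
    have "sign (b \<circ> p \<circ> inv_into UNIV b) = sign p" using sign_conj_bij[OF assms c2[of p]] p e by simp
    moreover have "(\<Prod>i\<in>UNIV. A $ i $ (b \<circ> p \<circ> inv_into UNIV b) i) = (\<Prod>i\<in>UNIV. A $ b i $ b (p i))"
      using prod.reindex_bij_betw[of b UNIV UNIV "\<lambda>i. A $ i $ (b \<circ> p \<circ> inv_into UNIV b) i"] assms by (simp add: bb)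
    ultimately show "of_int (sign (b \<circ> p \<circ> inv_into UNIV b)) * (\<Prod>i\<in>UNIV. A $ i $ (b \<circ> p \<circ> inv_into UNIV b) i) =
        of_int (sign p) * (\<Prod>i\<in>UNIV. (\<chi> i j. A $ b i $ b j) $ i $ p i)" by simp
  next
    fix p :: "'n \<Rightarrow> 'n" assume p: "p \<in> {p. p permutes UNIV}"
    show "b \<circ> (inv_into UNIV b \<circ> p \<circ> b) \<circ> inv_into UNIV b = p" by (simp add: fun_eq_iff bb)
    show "inv_into UNIV b \<circ> p \<circ> b \<in> {p. p permutes UNIV}" using c1 p by simp
  qed
qed

text \<open>The segment from \<open>A\<close> to the identity consists of positive definite
  matrices, so the determinant has no zero on it and keeps the sign it has at the identity.\<close>

lemma det_pos_definite:
  fixes A :: "real^'n::finite^'n"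
  assumes "\<And>v. v \<noteq> 0 \<Longrightarrow> v \<bullet> (A *v v) > 0"
  shows "det A > 0"
proof -
  define B where "B t = (1 - t) *\<^sub>R A + t *\<^sub>R mat 1" for t :: real
  have nz: "det (B t) \<noteq> 0" if t: "0 \<le> t" "t \<le> 1" for t
  proof -
    have "B t *v v \<noteq> 0" if v: "v \<noteq> 0" for v
    proof
      assume 0: "B t *v v = 0"
      have "v \<bullet> (B t *v v) = (1 - t) * (v \<bullet> (A *v v)) + t * (v \<bullet> v)"
        by (simp add: B_def matrix_vector_mult_add_rdistrib scaleR_matrix_vector_assoc[symmetric] inner_add_right)
      moreover have "\<dots> > 0"
      proof (cases "t = 1")
        case False
        then have "(1 - t) * (v \<bullet> (A *v v)) > 0" using t assms[OF v] by simp
        then show ?thesis using t by (simp add: add_pos_nonneg)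
      qed (use v in simp)
      ultimately show False using 0 by simp
    qed
    then have "invertible (B t)" by (metis invertible_left_inverse matrix_left_invertible_ker)
    then show ?thesis by (simp add: invertible_det_nz)
  qed
  have cont: "continuous_on {0..1} (\<lambda>t. det (B t))"
    unfolding det_def B_def by (intro continuous_intros)
  show ?thesis
  proof (rule ccontr)
    assume "\<not> ?thesis"
    then have "det (B 0) \<le> 0" by (simp add: B_def)
    moreover have "0 \<le> det (B 1)" by (simp add: B_def)
    ultimately obtain t where "0 \<le> t" "t \<le> 1" "det (B t) = 0"
      using IVT'[of "\<lambda>t. det (B t)" 0 0 1] cont by auto
    then show False using nz by blast
  qed
qed

text \<open>The library proves the change of variables formula for well-ordered index types only; the
  type \<open>'n widx\<close> is a well-ordered copy of \<open>'n\<close>.\<close>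

typedef (overloaded) ('n::finite) widx = "{..<CARD('n)} :: nat set"
  by (rule exI[of _ 0]) (simp add: card_gt_0_iff)

instance widx :: (finite) finite
proof
  have "inj Rep_widx" by (auto intro!: injI simp: Rep_widx_inject)
  moreover have "finite (range (Rep_widx :: 'a widx \<Rightarrow> nat))"
    by (rule finite_subset[of _ "{..<CARD('a)}"]) (use Rep_widx in auto)
  ultimately show "finite (UNIV :: 'a widx set)" using finite_imageD by blast
qed

instantiation widx :: (finite) wellorder
begin
definition less_eq_widx :: "'a widx \<Rightarrow> 'a widx \<Rightarrow> bool" where "less_eq_widx x y \<longleftrightarrow> Rep_widx x \<le> Rep_widx y"
definition less_widx :: "'a widx \<Rightarrow> 'a widx \<Rightarrow> bool" where "less_widx x y \<longleftrightarrow> Rep_widx x < Rep_widx y"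
instance
proof
  fix P :: "'a widx \<Rightarrow> bool" and a
  assume s: "\<And>x. (\<And>y. y < x \<Longrightarrow> P y) \<Longrightarrow> P x"
  show "P a"
    by (induction "Rep_widx a" arbitrary: a rule: less_induct) (use s in \<open>auto simp: less_widx_def\<close>)
qed (auto simp: less_eq_widx_def less_widx_def Rep_widx_inject)
end

lemma ex_widx_bij: "\<exists>b :: 'n::finite widx \<Rightarrow> 'n. bij b"
proof -
  have "bij_betw (Rep_widx :: 'n widx \<Rightarrow> nat) UNIV {..<CARD('n)}"
    using type_definition.Rep_range[OF type_definition_widx] by (auto simp: bij_betw_def inj_def Rep_widx_inject)
  then have "CARD('n widx) = CARD('n)" using bij_betw_same_card by fastforce
  then show ?thesis using finite_same_card_bij[of "UNIV :: 'n widx set" "UNIV :: 'n set"] by auto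
qed

text \<open>The formula for integrable functions is applied on the part of \<open>S\<close> where
  \<open>f (g x)\<close> and the norm of \<open>g x\<close> are at most \<open>k\<close>; monotone
  convergence in \<open>k\<close> removes the bound.\<close>

lemma nn_change_of_variables_wellorder:
  fixes g :: "real^'m::{finite,wellorder} \<Rightarrow> real^'m::_" and f h :: "real^'m::_ \<Rightarrow> real"
  assumes S: "S \<in> sets borel" and gS: "g ` S \<in> sets borel" and inj: "inj_on g S"
    and der: "\<And>x. x \<in> S \<Longrightarrow> (g has_derivative g' x) (at x within S)"
    and f: "f \<in> borel_measurable borel" "\<And>y. 0 \<le> f y" and h: "h \<in> borel_measurable borel"
    and hf: "\<And>x. x \<in> S \<Longrightarrow> h x = \<bar>det (matrix (g' x))\<bar> * f (g x)"
  shows "(\<integral>\<^sup>+x\<in>S. ennreal (h x) \<partial>lborel) = (\<integral>\<^sup>+y\<in>g ` S. ennreal (f y) \<partial>lborel)"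
proof -
  define Z where "Z k = {y. f y \<le> real k} \<inter> cball 0 (real k)" for k
  define Sk where "Sk k = S \<inter> g -` Z k" for k
  have Zb: "Z k \<in> sets borel" for k unfolding Z_def using f(1) by measurable
  have img: "g ` Sk k = g ` S \<inter> Z k" for k by (auto simp: Sk_def)
  have cont: "continuous_on S g"
    using der has_derivative_continuous unfolding continuous_on_eq_continuous_within by blast
  have Skb: "Sk k \<in> sets borel" for k
  proof -
    have "g \<in> borel_measurable (restrict_space borel S)" by (rule borel_measurable_continuous_on_restrict[OF cont])
    from measurable_sets[OF this Zb[of k]] have "g -` Z k \<inter> S \<in> sets (restrict_space borel S)"
      by (simp add: space_restrict_space)
    then show ?thesis using S by (auto simp: sets_restrict_space_iff Sk_def Int_commute)
  qed
  have inc: "incseq Sk" unfolding incseq_def Sk_def Z_def by force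
  have uni: "(\<Union>k. Sk k) = S"
  proof
    show "S \<subseteq> (\<Union>k. Sk k)"
    proof
      fix x assume x: "x \<in> S"
      obtain k where "max (f (g x)) (norm (g x)) \<le> real k" using real_arch_simple by blast
      then show "x \<in> (\<Union>k. Sk k)" using x by (auto simp: Sk_def Z_def intro!: exI[of _ k])
    qed
  qed (auto simp: Sk_def)
  have step: "(\<integral>\<^sup>+x\<in>Sk k. ennreal (h x) \<partial>lborel) = (\<integral>\<^sup>+y\<in>g ` S \<inter> Z k. ennreal (f y) \<partial>lborel)" for k
  proof -
    let ?T = "g ` S \<inter> Z k"
    have Tb: "?T \<in> sets borel" using gS Zb by blast
    have "bounded ?T" by (rule bounded_subset[OF bounded_cball[of 0 "real k"]]) (auto simp: Z_def)
    then have fin: "emeasure lborel ?T < \<infinity>" by (rule emeasure_bounded_finite)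
    have "integrable lborel (\<lambda>y. indicator ?T y *\<^sub>R f y)"
      by (rule integrableI_bounded_set_indicator[where B="real k"]) (use Tb fin f in \<open>auto simp: Z_def\<close>)
    then have "set_integrable lebesgue ?T f"
      unfolding set_integrable_def using Tb f(1) by (subst integrable_completion) auto
    then have ai: "f absolutely_integrable_on (g ` Sk k)" using img by simp
    have der': "(g has_derivative g' x) (at x within Sk k)" if "x \<in> Sk k" for x
      by (rule has_derivative_subset[OF der]) (use that in \<open>auto simp: Sk_def\<close>)
    have inj': "inj_on g (Sk k)" by (rule inj_on_subset[OF inj]) (auto simp: Sk_def)
    have Skl: "Sk k \<in> sets lebesgue" using Skb by simp
    \<comment> \<open>The formula applied below integrates functions with values in a space of
      vectors, so the scalar function is wrapped in a single coordinate.\<close>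
    define F :: "real^'m::_ \<Rightarrow> real^1" where "F y = vec (f y)" for y
    have bl: "bounded_linear (vec :: real \<Rightarrow> real^1)"
      by (intro linear_conv_bounded_linear[THEN iffD1] linearI) (simp_all add: vec_eq_iff)
    have bl1: "bounded_linear (\<lambda>v :: real^1. v $ 1)" by (rule bounded_linear_vec_nth)
    have Fai: "F absolutely_integrable_on (g ` Sk k)"
      using absolutely_integrable_linear[OF ai bl] unfolding F_def[abs_def] o_def .
    have cv: "(\<lambda>x. \<bar>det (matrix (g' x))\<bar> *\<^sub>R F (g x)) absolutely_integrable_on Sk k \<and>
       integral (Sk k) (\<lambda>x. \<bar>det (matrix (g' x))\<bar> *\<^sub>R F (g x)) = integral (g ` Sk k) F"
      using has_absolute_integral_change_of_variables[OF Skl der' inj', of F "integral (g ` Sk k) F"] Fai by simp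
    have Fi: "(F has_integral integral (g ` Sk k) F) (g ` Sk k)"
      using set_lebesgue_integral_eq_integral(1)[OF Fai] by (rule integrable_integral)
    have "((\<lambda>x. \<bar>det (matrix (g' x))\<bar> *\<^sub>R F (g x)) has_integral integral (g ` Sk k) F) (Sk k)"
      using integrable_integral[OF set_lebesgue_integral_eq_integral(1)[OF conjunct1[OF cv]]] conjunct2[OF cv] by simp
    from has_integral_linear[OF this bl1]
    have hi: "(h has_integral integral (g ` Sk k) F $ 1) (Sk k)"
      by (rule has_integral_eq[rotated]) (use hf in \<open>auto simp: Sk_def F_def\<close>)
    from has_integral_linear[OF Fi bl1]
    have fi: "(f has_integral integral (g ` Sk k) F $ 1) (g ` Sk k)"
      by (rule has_integral_eq[rotated]) (simp add: F_def)
    have "0 \<le> h x" if "x \<in> Sk k" for x using that hf f(2) by (auto simp: Sk_def)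
    from nn_integral_has_integral_lebesgue'[OF this hi] nn_integral_has_integral_lebesgue'[OF f(2) fi]
    show ?thesis by (simp add: img)
  qed
  have "(\<integral>\<^sup>+x\<in>S. ennreal (h x) \<partial>lborel) = (SUP k. \<integral>\<^sup>+x\<in>Sk k. ennreal (h x) \<partial>lborel)"
    using SUP_emeasure_incseq[of Sk "density lborel h", OF _ inc] Skb h S
    by (simp add: emeasure_density uni image_subset_iff)
  also have "\<dots> = (SUP k. \<integral>\<^sup>+y\<in>g ` S \<inter> Z k. ennreal (f y) \<partial>lborel)" by (simp add: step)
  also have "\<dots> = (\<integral>\<^sup>+y\<in>g ` S. ennreal (f y) \<partial>lborel)"
  proof -
    have Tb: "g ` S \<inter> Z k \<in> sets borel" for k using gS Zb by (rule sets.Int)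
    have 1: "incseq (\<lambda>k. g ` S \<inter> Z k)" unfolding incseq_def Z_def by force
    have "(\<Union>k. g ` S \<inter> Z k) = (\<Union>k. g ` Sk k)" by (simp add: img)
    also have "\<dots> = g ` (\<Union>k. Sk k)" by (rule image_UN[symmetric])
    finally have 2: "(\<Union>k. g ` S \<inter> Z k) = g ` S" by (simp add: uni)
    show ?thesis
      using SUP_emeasure_incseq[of "\<lambda>k. g ` S \<inter> Z k" "density lborel f", OF _ 1] Tb gS f(1)
      unfolding 2 by (simp add: emeasure_density image_subset_iff)
  qed
  finally show ?thesis .
qed

lemma prod_Basis_vec: "(\<Prod>b\<in>(Basis :: (real^'n::finite) set). x \<bullet> b) = (\<Prod>i\<in>UNIV. x $ i)"
proof -
  have "(Basis :: (real^'n) set) = range (\<lambda>i. axis i 1)" by (auto simp: Basis_vec_def)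
  moreover have "inj (\<lambda>i::'n. axis i (1::real))" by (auto simp: inj_def axis_eq_axis)
  ultimately show ?thesis using prod.reindex[of "\<lambda>i::'n. axis i (1::real)" UNIV "\<lambda>b. x \<bullet> b"]
    by (simp add: inner_axis o_def)
qed

lemma nn_change_of_variables:
  fixes g :: "real^'n::finite \<Rightarrow> real^'n" and f h :: "real^'n \<Rightarrow> real"
  assumes S: "S \<in> sets borel" and gS: "g ` S \<in> sets borel" and inj: "inj_on g S"
    and der: "\<And>x. x \<in> S \<Longrightarrow> (g has_derivative g' x) (at x within S)"
    and f: "f \<in> borel_measurable borel" "\<And>y. 0 \<le> f y" and h: "h \<in> borel_measurable borel"
    and hf: "\<And>x. x \<in> S \<Longrightarrow> h x = \<bar>det (matrix (g' x))\<bar> * f (g x)"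
  shows "(\<integral>\<^sup>+x\<in>S. ennreal (h x) \<partial>lborel) = (\<integral>\<^sup>+y\<in>g ` S. ennreal (f y) \<partial>lborel)"
proof -
  obtain b :: "'n widx \<Rightarrow> 'n" where b: "bij b" using ex_widx_bij by blast
  have bb: "b (inv_into UNIV b x) = x" "inv_into UNIV b (b y) = y" for x y
    using b by (auto simp: bij_is_surj surj_f_inv_f bij_is_inj)
  define T :: "real^'n \<Rightarrow> real^'n widx" where "T x = (\<chi> i. x $ b i)" for x
  define R :: "real^'n widx \<Rightarrow> real^'n" where "R y = (\<chi> j. y $ inv_into UNIV b j)" for y
  have RT [simp]: "R (T x) = x" and TR [simp]: "T (R y) = y" for x y by (simp_all add: T_def R_def bb vec_eq_iff)
  have blT: "bounded_linear T" and blR: "bounded_linear R"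
    by (intro linear_conv_bounded_linear[THEN iffD1] linearI; simp add: T_def R_def vec_eq_iff)+
  have mT: "T \<in> borel_measurable borel" and mR: "R \<in> borel_measurable borel"
    using blT blR by (auto intro!: borel_measurable_continuous_onI linear_continuous_on)
  \<comment> \<open>Renaming coordinates maps boxes to boxes with the same edge lengths, and a Borel
    measure with the right values on boxes is Lebesgue measure.\<close>
  have lb: "lborel = distr lborel borel T"
  proof (rule lborel_eqI)
    fix l u :: "real^'n widx"
    assume le: "\<And>b. b \<in> Basis \<Longrightarrow> l \<bullet> b \<le> u \<bullet> b"
    have le': "l $ i \<le> u $ i" for i using le[of "axis i 1"] by (simp add: inner_axis axis_in_Basis_iff)
    have "T -` box l u = box (R l) (R u)"
    proof -
      have "(\<forall>i. l $ i < x $ b i \<and> x $ b i < u $ i) \<longleftrightarrow> (\<forall>j. R l $ j < x $ j \<and> x $ j < R u $ j)" for x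
        unfolding R_def by simp (metis bb)
      then show ?thesis by (auto simp: box_vec_eq_empty mem_box_cart T_def set_eq_iff)
    qed
    then have "emeasure (distr lborel borel T) (box l u) = emeasure lborel (box (R l) (R u))"
      using mT by (simp add: emeasure_distr)
    also have "\<dots> = (\<Prod>b\<in>Basis. (R u - R l) \<bullet> b)"
      by (rule emeasure_lborel_box) (auto simp: Basis_vec_def inner_axis R_def le')
    also have "(\<Prod>b\<in>Basis. (R u - R l) \<bullet> b) = (\<Prod>j\<in>UNIV. (R u - R l) $ j)" by (rule prod_Basis_vec)
    also have "\<dots> = (\<Prod>i\<in>UNIV. (R u - R l) $ b i)"
      using prod.reindex_bij_betw[of b UNIV UNIV "\<lambda>j. (R u - R l) $ j"] b by simp
    also have "\<dots> = (\<Prod>b\<in>Basis. (u - l) \<bullet> b)" unfolding prod_Basis_vec by (simp add: R_def bb)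
    finally show "emeasure (distr lborel borel T) (box l u) = (\<Prod>b\<in>Basis. (u - l) \<bullet> b)" .
  qed simp
  have tr: "(\<integral>\<^sup>+y. F (R y) \<partial>lborel) = (\<integral>\<^sup>+x. F x \<partial>lborel)" if "F \<in> borel_measurable borel" for F :: "real^'n \<Rightarrow> ennreal"
  proof -
    have "(\<lambda>y. F (R y)) \<in> borel_measurable borel" using that mR by measurable
    then show ?thesis by (subst lb, subst nn_integral_distr) (use mT in auto)
  qed
  have imT: "T ` X = R -` X" for X by (auto simp: image_iff) (metis TR)
  have bT: "T ` X \<in> sets borel" if "X \<in> sets borel" for X
    using measurable_sets[OF mR that] by (simp add: imT)
  define g2 where "g2 = T \<circ> g \<circ> R"
  have g2S: "g2 ` (T ` S) = T ` (g ` S)" by (auto simp: g2_def image_iff)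
  have "(\<integral>\<^sup>+y\<in>T ` S. ennreal (h (R y)) \<partial>lborel) = (\<integral>\<^sup>+y\<in>g2 ` (T ` S). ennreal (f (R y)) \<partial>lborel)"
  proof (rule nn_change_of_variables_wellorder[where g' = "\<lambda>y. T \<circ> g' (R y) \<circ> R"])
    show "T ` S \<in> sets borel" "g2 ` (T ` S) \<in> sets borel" using bT S gS by (simp_all add: g2S)
    show "inj_on g2 (T ` S)"
    proof (rule inj_onI, clarify)
      fix x y assume "x \<in> S" "y \<in> S" "g2 (T x) = g2 (T y)"
      then have "T (g x) = T (g y)" by (simp add: g2_def)
      then have "R (T (g x)) = R (T (g y))" by simp
      then show "T x = T y" using inj \<open>x \<in> S\<close> \<open>y \<in> S\<close> by (simp add: inj_on_eq_iff)
    qed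
    fix y assume "y \<in> T ` S"
    then have y: "R y \<in> S" by auto
    have RS: "R ` (T ` S) = S" by (auto simp: image_iff)
    have "(g \<circ> R has_derivative g' (R y) \<circ> R) (at y within T ` S)"
      by (rule diff_chain_within) (use der[OF y] RS blR in \<open>auto intro: bounded_linear_imp_has_derivative\<close>)
    from diff_chain_within[OF this bounded_linear_imp_has_derivative[OF blT]]
    show "(g2 has_derivative T \<circ> g' (R y) \<circ> R) (at y within T ` S)" by (simp add: g2_def o_assoc)
    have Rax: "R (axis j 1) = axis (b j) 1" for j
    proof -
      have "inv_into UNIV b i = j \<longleftrightarrow> i = b j" for i using bb by metis
      then show ?thesis by (simp add: R_def axis_def vec_eq_iff)
    qed
    have "matrix (T \<circ> g' (R y) \<circ> R) = (\<chi> i j. matrix (g' (R y)) $ b i $ b j)"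
      by (simp add: matrix_def T_def Rax)
    then have "det (matrix (T \<circ> g' (R y) \<circ> R)) = det (matrix (g' (R y)))" using det_reindex[OF b] by simp
    then show "h (R y) = \<bar>det (matrix (T \<circ> g' (R y) \<circ> R))\<bar> * f (R (g2 y))" using hf[OF y] by (simp add: g2_def)
  qed (use f h mR in \<open>auto intro: measurable_compose\<close>)
  moreover have "(\<integral>\<^sup>+y\<in>T ` S. ennreal (h (R y)) \<partial>lborel) = (\<integral>\<^sup>+x\<in>S. ennreal (h x) \<partial>lborel)"
    using tr[of "\<lambda>x. ennreal (h x) * indicator S x"] h S by (simp add: imT indicator_vimage[symmetric] indicator_def)
  moreover have "(\<integral>\<^sup>+y\<in>T ` (g ` S). ennreal (f (R y)) \<partial>lborel) = (\<integral>\<^sup>+x\<in>g ` S. ennreal (f x) \<partial>lborel)"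
    using tr[of "\<lambda>x. ennreal (f x) * indicator (g ` S) x"] f gS by (simp add: imT indicator_vimage[symmetric] indicator_def)
  ultimately show ?thesis by (simp add: g2S)
qed

section \<open>The Riemannian volume\<close>

text \<open>Turns a local constant into a global one: \<open>P\<close> only gets weaker as its
  parameter decreases, so the least constant of a finite subcover works everywhere.\<close>

lemma compact_uniform:
  fixes M :: "'a::topological_space set"
  assumes "compact M" and loc: "\<And>p. p \<in> M \<Longrightarrow> \<exists>T. openin (top_of_set M) T \<and> p \<in> T \<and> (\<exists>e>0. \<forall>x\<in>T. P (e::real) x)"
    and anti: "\<And>e e' x. P e x \<Longrightarrow> 0 < e' \<Longrightarrow> e' \<le> e \<Longrightarrow> P e' x"
  shows "\<exists>e>0. \<forall>x\<in>M. P e x"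
proof -
  obtain T e where T: "\<And>p. p \<in> M \<Longrightarrow> openin (top_of_set M) (T p) \<and> p \<in> T p \<and> e p > 0 \<and> (\<forall>x\<in>T p. P (e p) x)"
    using loc by metis
  have "(\<forall>c\<in>T ` M. openin (top_of_set M) c) \<and> M \<subseteq> \<Union> (T ` M)" using T by blast
  with assms(1) obtain D where D: "D \<subseteq> T ` M" "finite D" "M \<subseteq> \<Union>D" unfolding compact_eq_openin_cover by meson
  then obtain Q where Q: "finite Q" "Q \<subseteq> M" "D = T ` Q" by (meson finite_subset_image)
  define e0 where "e0 = Min (insert 1 (e ` Q))"
  have e0: "e0 > 0" "\<And>q. q \<in> Q \<Longrightarrow> e0 \<le> e q" using Q T by (auto simp: e0_def subset_iff)
  have "P e0 x" if "x \<in> M" for x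
  proof -
    from that D(3) Q(3) obtain q where "q \<in> Q" "x \<in> T q" by blast
    then show ?thesis using anti[of "e q" x e0] T[of q] Q(2) e0 by auto
  qed
  then show ?thesis using e0 by blast
qed

context riem_manifold begin

section \<open>Volume in charts and its globalisation\<close>

abbreviation borel_M :: "'a measure" where "borel_M \<equiv> restrict_space borel M"

lemma sets_borel_M: "B \<in> sets borel_M \<longleftrightarrow> B \<in> sets borel \<and> B \<subseteq> M"
  using borel_closed[OF compact_imp_closed[OF M_facts(2)]] by (subst sets_restrict_space_iff) auto

lemma openin_borel_M: "openin (top_of_set M) W \<Longrightarrow> W \<in> sets borel_M"
  unfolding openin_open sets_borel_M
  using borel_closed[OF compact_imp_closed[OF M_facts(2)]] by (auto intro: sets.Int)

lemma chart_image_borel: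
  assumes "(U,\<phi>) \<in> \<A>" "B \<in> sets borel_M" "B \<subseteq> U"
  shows "\<phi> ` B \<in> sets borel"
proof -
  have "inv_into U \<phi> \<in> borel_measurable (restrict_space borel (\<phi> ` U))"
    by (rule borel_measurable_continuous_on_restrict[OF chart_open(6)[OF assms(1)]])
  moreover have "B \<in> sets borel" using assms(2) by (simp add: sets_borel_M)
  ultimately have "inv_into U \<phi> -` B \<inter> \<phi> ` U \<in> sets (restrict_space borel (\<phi> ` U))"
    using measurable_sets[of "inv_into U \<phi>" "restrict_space borel (\<phi> ` U)" borel B] by (simp add: space_restrict_space)
  then have "inv_into U \<phi> -` B \<inter> \<phi> ` U \<in> sets borel"
    using chart_open(2)[OF assms(1)] by (simp add: sets_restrict_space_iff)
  moreover have "\<phi> ` B = inv_into U \<phi> -` B \<inter> \<phi> ` U"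
  proof
    show "\<phi> ` B \<subseteq> inv_into U \<phi> -` B \<inter> \<phi> ` U" using assms(3) chart_open(4)[OF assms(1)] by auto
    show "inv_into U \<phi> -` B \<inter> \<phi> ` U \<subseteq> \<phi> ` B" using chart_open(4)[OF assms(1)] by auto
  qed
  ultimately show ?thesis by simp
qed

text \<open>The volume density in coordinates, set to 0 off the chart so that it is a Borel function
  on the whole space.\<close>

definition weight :: "'a set \<Rightarrow> ('a \<Rightarrow> real^'n) \<Rightarrow> real^'n \<Rightarrow> real" where
  "weight U \<phi> x = indicator (\<phi> ` U) x * sqrt (det (\<rho> (U,\<phi>) (inv_into U \<phi> x)))"

lemma weight_continuous: "(U,\<phi>) \<in> \<A> \<Longrightarrow> continuous_on (\<phi> ` U) (\<lambda>x. sqrt (det (\<rho> (U,\<phi>) (inv_into U \<phi> x))))"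
  using metric_continuous[of U \<phi>] unfolding det_def by (intro continuous_intros) auto

lemma weight_measurable: "(U,\<phi>) \<in> \<A> \<Longrightarrow> weight U \<phi> \<in> borel_measurable borel"
  using borel_measurable_continuous_on_indicator[OF _ weight_continuous[of U \<phi>]] chart_open(2)[of U \<phi>]
  unfolding weight_def[abs_def] by simp

lemma det_metric_pos: "(U,\<phi>) \<in> \<A> \<Longrightarrow> p \<in> U \<Longrightarrow> det (\<rho> (U,\<phi>) p) > 0"
  by (rule det_pos_definite) (rule metric_pos)

lemma weight_nonneg: "(U,\<phi>) \<in> \<A> \<Longrightarrow> 0 \<le> weight U \<phi> x"
  using det_metric_pos[of U \<phi> "inv_into U \<phi> x"]
  by (auto simp: weight_def indicator_def inv_into_into less_imp_le)

text \<open>Phrased through a density measure so that additivity over disjoint pieces is inherited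
  from \<open>emeasure\<close>.\<close>

definition chart_volume :: "'a set \<Rightarrow> ('a \<Rightarrow> real^'n) \<Rightarrow> 'a set \<Rightarrow> ennreal" where
  "chart_volume U \<phi> B = emeasure (density lborel (\<lambda>x. ennreal (weight U \<phi> x))) (\<phi> ` B)"

lemma chart_volume_weight:
  assumes "(U,\<phi>) \<in> \<A>" "B \<in> sets borel_M" "B \<subseteq> U"
  shows "chart_volume U \<phi> B = (\<integral>\<^sup>+x\<in>\<phi> ` B. ennreal (weight U \<phi> x) \<partial>lborel)"
  unfolding chart_volume_def
  using weight_measurable[OF assms(1)] chart_image_borel[OF assms] by (simp add: emeasure_density)

lemma chart_volume_eq:
  assumes "(U,\<phi>) \<in> \<A>" "B \<in> sets borel_M" "B \<subseteq> U"
  shows "chart_volume U \<phi> B = (\<integral>\<^sup>+x\<in>\<phi> ` B. ennreal (sqrt (det (\<rho> (U, \<phi>) (inv_into U \<phi> x)))) \<partial>lborel)"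
  unfolding chart_volume_weight[OF assms]
  by (rule nn_integral_cong) (use assms(3) in \<open>auto simp: weight_def indicator_def\<close>)

text \<open>Taking determinants in the transformation law gives \<open>det (\<rho> (U,\<phi>) p) =
  (det J)\<^sup>2 * det (\<rho> (V,\<psi>) p)\<close>, and its square root contains exactly the
  factor of the change of variables.\<close>

lemma chart_volume_consistent:
  assumes U: "(U,\<phi>) \<in> \<A>" and V: "(V,\<psi>) \<in> \<A>" and B: "B \<in> sets borel_M" "B \<subseteq> U" "B \<subseteq> V"
  shows "chart_volume U \<phi> B = chart_volume V \<psi> B"
proof -
  let ?g = "\<psi> \<circ> inv_into U \<phi>"
  let ?D = "\<lambda>x. frechet_derivative ?g (at x)"
  have g: "?g (\<phi> p) = \<psi> p" if "p \<in> B" for p using that B(2) chart_open(4)[OF U] by auto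
  then have gS: "?g ` (\<phi> ` B) = \<psi> ` B" by (simp add: image_image)
  have "(\<integral>\<^sup>+x\<in>\<phi> ` B. ennreal (weight U \<phi> x) \<partial>lborel) = (\<integral>\<^sup>+y\<in>?g ` (\<phi> ` B). ennreal (weight V \<psi> y) \<partial>lborel)"
  proof (rule nn_change_of_variables[where g' = ?D])
    show "\<phi> ` B \<in> sets borel" using chart_image_borel[OF U B(1,2)] .
    show "?g ` (\<phi> ` B) \<in> sets borel" unfolding gS using chart_image_borel[OF V B(1,3)] .
    show "inj_on ?g (\<phi> ` B)"
    proof (rule inj_onI)
      fix x y assume "x \<in> \<phi> ` B" "y \<in> \<phi> ` B" and e: "?g x = ?g y"
      then obtain p q where pq: "x = \<phi> p" "y = \<phi> q" "p \<in> B" "q \<in> B" by blast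
      then have "\<psi> p = \<psi> q" using e g[OF pq(3)] g[OF pq(4)] by simp
      then have "p = q" using inj_onD[OF chart_open(4)[OF V]] B(3) pq by blast
      then show "x = y" using pq by simp
    qed
    show "weight V \<psi> \<in> borel_measurable borel" "weight U \<phi> \<in> borel_measurable borel" "0 \<le> weight V \<psi> y" for y
      using weight_measurable weight_nonneg U V by auto
    fix x assume "x \<in> \<phi> ` B"
    then obtain p where p: "x = \<phi> p" "p \<in> B" by blast
    then have xUV: "x \<in> \<phi> ` (U \<inter> V)" and pU: "p \<in> U" "p \<in> V" using B by auto
    show "(?g has_derivative ?D x) (at x within \<phi> ` B)"
      using transition_C1(2)[OF U V xUV] frechet_derivative_works has_derivative_at_withinI by blast
    define J where "J = matrix (?D x)"
    have "\<rho> (U,\<phi>) p = Finite_Cartesian_Product.transpose J ** \<rho> (V,\<psi>) p ** J"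
      unfolding J_def p(1) by (rule metric_trans[OF U V pU])
    then have "det (\<rho> (U,\<phi>) p) = (det J)\<^sup>2 * det (\<rho> (V,\<psi>) p)"
      by (simp add: det_mul power2_eq_square)
    then have "sqrt (det (\<rho> (U,\<phi>) p)) = \<bar>det J\<bar> * sqrt (det (\<rho> (V,\<psi>) p))" by (simp add: real_sqrt_mult)
    moreover have "weight U \<phi> x = sqrt (det (\<rho> (U,\<phi>) p))" "weight V \<psi> (?g x) = sqrt (det (\<rho> (V,\<psi>) p))"
      using pU chart_open(4)[OF U] chart_open(4)[OF V] by (auto simp: weight_def p(1))
    ultimately show "weight U \<phi> x = \<bar>det (matrix (?D x))\<bar> * weight V \<psi> (?g x)" by (simp add: J_def)
  qed
  then show ?thesis unfolding chart_volume_weight[OF U B(1,2)] chart_volume_weight[OF V B(1,3)] gS .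
qed

lemma finite_partition:
  obtains c :: "nat \<Rightarrow> ('a,'n) chart" and k P where
    "\<And>i. i < k \<Longrightarrow> c i \<in> \<A>" "\<And>i. i < k \<Longrightarrow> P i \<in> sets borel_M" "\<And>i. i < k \<Longrightarrow> P i \<subseteq> fst (c i)"
    "disjoint_family P" "(\<Union>i<k. P i) = M"
proof -
  have "(\<forall>U\<in>fst ` \<A>. openin (top_of_set M) U) \<and> M \<subseteq> \<Union> (fst ` \<A>)"
    using chart_open(1) ex_chart by fastforce
  then obtain D where D: "D \<subseteq> fst ` \<A>" "finite D" "M \<subseteq> \<Union>D"
    using M_facts(2) unfolding compact_eq_openin_cover by meson
  then obtain Q where Q: "Q \<subseteq> \<A>" "finite Q" "D = fst ` Q" by (meson finite_subset_image)
  obtain c :: "nat \<Rightarrow> ('a,'n) chart" and k where ck: "Q = c ` {i. i < k}"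
    using finite_imp_nat_seg_image_inj_on[OF Q(2)] by blast
  have cA: "c i \<in> \<A>" if "i < k" for i using ck Q that by auto
  define U where "U i = (if i < k then fst (c i) else {})" for i
  define P where "P = disjointed U"
  have op: "openin (top_of_set M) (U i)" for i
    using cA[of i] chart_open(1)[of "fst (c i)" "snd (c i)"] by (auto simp: U_def)
  have Ub: "range U \<subseteq> sets borel_M" using openin_borel_M[OF op] by auto
  have "(\<Union>i. P i) = (\<Union>i. U i)" by (simp add: P_def UN_disjointed_eq)
  also have "\<dots> = M"
  proof
    show "(\<Union>i. U i) \<subseteq> M" using openin_imp_subset[OF op] by blast
    show "M \<subseteq> (\<Union>i. U i)"
    proof
      fix x assume "x \<in> M"
      then obtain q where "q \<in> Q" "x \<in> fst q" using D(3) Q(3) by blast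
      then obtain i where "i < k" "x \<in> fst (c i)" using ck by blast
      then show "x \<in> (\<Union>i. U i)" by (auto simp: U_def)
    qed
  qed
  finally have PM: "(\<Union>i. P i) = M" .
  have "P i = {}" if "\<not> i < k" for i using that disjointed_subset[of U i] by (auto simp: P_def U_def)
  then have "P i \<subseteq> (\<Union>i<k. P i)" for i by (cases "i < k") auto
  then have PM': "(\<Union>i<k. P i) = M" unfolding PM[symmetric] by blast
  show ?thesis
  proof (rule that[of k c P])
    show "P i \<in> sets borel_M" for i using sets.range_disjointed_sets[OF Ub] by (auto simp: P_def)
    show "P i \<subseteq> fst (c i)" if "i < k" for i using that disjointed_subset[of U i] by (auto simp: P_def U_def)
    show "disjoint_family P" unfolding P_def by (rule disjoint_family_disjointed)
  qed (use cA PM' in auto)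
qed

text \<open>Gives meaning to the definite description in \<open>riem_measure\<close>. Existence:
  chart volumes are summed over a finite Borel partition whose pieces lie in charts. Uniqueness: the
  values on the pieces are prescribed and add up.\<close>

lemma ex_riem_measure:
  "\<exists>!\<nu>. space \<nu> = M \<and> sets \<nu> = sets borel_M \<and>
    (\<forall>(U, \<phi>)\<in>\<A>. \<forall>B\<in>sets \<nu>. B \<subseteq> U \<longrightarrow>
       emeasure \<nu> B = (\<integral>\<^sup>+x\<in>\<phi> ` B. ennreal (sqrt (det (\<rho> (U, \<phi>) (inv_into U \<phi> x)))) \<partial>lborel))"
proof -
  obtain c :: "nat \<Rightarrow> ('a,'n) chart" and k P where
    c: "\<And>i. i < k \<Longrightarrow> c i \<in> \<A>" and P: "\<And>i. i < k \<Longrightarrow> P i \<in> sets borel_M" "\<And>i. i < k \<Longrightarrow> P i \<subseteq> fst (c i)"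
    and dP: "disjoint_family P" and UP: "(\<Union>i<k. P i) = M" using finite_partition by metis
  define F where "F i B = chart_volume (fst (c i)) (snd (c i)) (B \<inter> P i)" for i B
  define \<mu> where "\<mu> B = (\<Sum>i<k. F i B)" for B
  \<comment> \<open>On a set inside one chart the charts of the pieces can all be replaced by that
    chart, and the claim becomes additivity of a single density measure.\<close>
  have cvs: "chart_volume U \<phi> B = (\<Sum>i<k. F i B)"
    if ch: "(U,\<phi>) \<in> \<A>" and B: "B \<in> sets borel_M" "B \<subseteq> U" for U \<phi> B
  proof -
    have "F i B = emeasure (density lborel (\<lambda>x. ennreal (weight U \<phi> x))) (\<phi> ` (B \<inter> P i))" if i: "i < k" for i
    proof -
      have "F i B = chart_volume U \<phi> (B \<inter> P i)" unfolding F_def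
        by (rule chart_volume_consistent) (use c[OF i] P[OF i] ch B in auto)
      then show ?thesis by (simp add: chart_volume_def)
    qed
    then have "(\<Sum>i<k. F i B) = (\<Sum>i<k. emeasure (density lborel (\<lambda>x. ennreal (weight U \<phi> x))) (\<phi> ` (B \<inter> P i)))" by simp
    also have "\<dots> = emeasure (density lborel (\<lambda>x. ennreal (weight U \<phi> x))) (\<Union>i<k. \<phi> ` (B \<inter> P i))"
    proof (rule sum_emeasure)
      show "(\<lambda>i. \<phi> ` (B \<inter> P i)) ` {..<k} \<subseteq> sets (density lborel (\<lambda>x. ennreal (weight U \<phi> x)))"
      proof (rule image_subsetI)
        fix i assume "i \<in> {..<k}"
        then have "B \<inter> P i \<in> sets borel_M" using B(1) P(1) by (intro sets.Int) auto
        then show "\<phi> ` (B \<inter> P i) \<in> sets (density lborel (\<lambda>x. ennreal (weight U \<phi> x)))"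
          using chart_image_borel[OF ch] B(2) by auto
      qed
      show "disjoint_family_on (\<lambda>i. \<phi> ` (B \<inter> P i)) {..<k}"
        unfolding disjoint_family_on_def
      proof (intro ballI impI)
        fix m n :: nat assume "m \<noteq> n"
        then have "(B \<inter> P m) \<inter> (B \<inter> P n) = {}" using dP by (auto simp: disjoint_family_on_def)
        moreover have "\<phi> ` (B \<inter> P m) \<inter> \<phi> ` (B \<inter> P n) = \<phi> ` ((B \<inter> P m) \<inter> (B \<inter> P n))"
          using inj_on_image_Int[OF chart_open(4)[OF ch], of "B \<inter> P m" "B \<inter> P n"] B(2) by blast
        ultimately show "\<phi> ` (B \<inter> P m) \<inter> \<phi> ` (B \<inter> P n) = {}" by simp
      qed
    qed simp
    also have "(\<Union>i<k. \<phi> ` (B \<inter> P i)) = \<phi> ` B"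
    proof -
      have "B \<subseteq> (\<Union>i<k. P i)" using B unfolding UP sets_borel_M by simp
      then have "(\<Union>i<k. B \<inter> P i) = B" by blast
      then show ?thesis by (metis image_UN)
    qed
    finally show ?thesis by (simp add: chart_volume_def)
  qed
  have ca: "countably_additive (sets borel_M) \<mu>"
  proof (unfold countably_additive_def, intro allI impI)
    fix A :: "nat \<Rightarrow> 'a set"
    assume A: "range A \<subseteq> sets borel_M" "disjoint_family A" "(\<Union>i. A i) \<in> sets borel_M"
    have 1: "(\<Sum>j. F i (A j)) = F i (\<Union>j. A j)" if i: "i < k" for i
    proof -
      obtain U \<phi> where ci: "c i = (U,\<phi>)" by (cases "c i")
      have ch: "(U,\<phi>) \<in> \<A>" and PU: "P i \<subseteq> U" using c[OF i] P(2)[OF i] ci by auto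
      have "(\<Sum>j. emeasure (density lborel (\<lambda>x. ennreal (weight U \<phi> x))) (\<phi> ` (A j \<inter> P i))) =
          emeasure (density lborel (\<lambda>x. ennreal (weight U \<phi> x))) (\<Union>j. \<phi> ` (A j \<inter> P i))"
      proof (rule suminf_emeasure)
        show "range (\<lambda>j. \<phi> ` (A j \<inter> P i)) \<subseteq> sets (density lborel (\<lambda>x. ennreal (weight U \<phi> x)))"
        proof (rule image_subsetI)
          fix j
          have "A j \<in> sets borel_M" using A(1) by auto
          then have "A j \<inter> P i \<in> sets borel_M" using P(1)[OF i] by (rule sets.Int)
          then show "\<phi> ` (A j \<inter> P i) \<in> sets (density lborel (\<lambda>x. ennreal (weight U \<phi> x)))"
            using chart_image_borel[OF ch, of "A j \<inter> P i"] PU by auto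
        qed
        show "disjoint_family (\<lambda>j. \<phi> ` (A j \<inter> P i))"
          unfolding disjoint_family_on_def
        proof (intro ballI impI)
          fix m n :: nat assume "m \<noteq> n"
          then have "(A m \<inter> P i) \<inter> (A n \<inter> P i) = {}" using A(2) by (auto simp: disjoint_family_on_def)
          moreover have "\<phi> ` (A m \<inter> P i) \<inter> \<phi> ` (A n \<inter> P i) = \<phi> ` ((A m \<inter> P i) \<inter> (A n \<inter> P i))"
            using inj_on_image_Int[OF chart_open(4)[OF ch], of "A m \<inter> P i" "A n \<inter> P i"] PU by blast
          ultimately show "\<phi> ` (A m \<inter> P i) \<inter> \<phi> ` (A n \<inter> P i) = {}" by simp
        qed
      qed
      moreover have "(\<Union>j. \<phi> ` (A j \<inter> P i)) = \<phi> ` ((\<Union>j. A j) \<inter> P i)" by auto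
      ultimately show ?thesis by (simp add: F_def chart_volume_def ci)
    qed
    have "(\<Sum>j. \<mu> (A j)) = (\<Sum>i<k. \<Sum>j. F i (A j))" unfolding \<mu>_def by (rule suminf_sum) simp
    also have "\<dots> = \<mu> (\<Union>j. A j)" unfolding \<mu>_def using 1 by simp
    finally show "(\<Sum>j. \<mu> (A j)) = \<mu> (\<Union>j. A j)" .
  qed
  define \<nu>0 where "\<nu>0 = measure_of M (sets borel_M) \<mu>"
  have sub: "sets borel_M \<subseteq> Pow M" by (auto simp: sets_borel_M)
  have sa: "sigma_algebra M (sets borel_M)" using sets.sigma_algebra_axioms[of borel_M] by (simp add: space_restrict_space)
  have s0: "space \<nu>0 = M" "sets \<nu>0 = sets borel_M"
    using sub sigma_algebra.sigma_sets_eq[OF sa] by (auto simp: \<nu>0_def space_measure_of sets_measure_of)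
  have e0: "emeasure \<nu>0 B = \<mu> B" if "B \<in> sets borel_M" for B
  proof (rule emeasure_measure_of_sigma[OF sa _ ca that, folded \<nu>0_def])
    show "positive (sets borel_M) \<mu>" by (simp add: positive_def \<mu>_def F_def chart_volume_def)
  qed
  show ?thesis
  proof (rule ex1I[of _ \<nu>0], intro conjI)
    show "\<forall>(U, \<phi>)\<in>\<A>. \<forall>B\<in>sets \<nu>0. B \<subseteq> U \<longrightarrow>
       emeasure \<nu>0 B = (\<integral>\<^sup>+x\<in>\<phi> ` B. ennreal (sqrt (det (\<rho> (U, \<phi>) (inv_into U \<phi> x)))) \<partial>lborel)"
    proof (clarify)
      fix U \<phi> B assume "(U,\<phi>) \<in> \<A>" "B \<in> sets \<nu>0" "B \<subseteq> U"
      then show "emeasure \<nu>0 B = (\<integral>\<^sup>+x\<in>\<phi> ` B. ennreal (sqrt (det (\<rho> (U, \<phi>) (inv_into U \<phi> x)))) \<partial>lborel)"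
        using cvs[of U \<phi> B] chart_volume_eq[of U \<phi> B] e0[of B] s0 by (simp add: \<mu>_def)
    qed
    fix \<nu> assume \<nu>: "space \<nu> = M \<and> sets \<nu> = sets borel_M \<and>
      (\<forall>(U, \<phi>)\<in>\<A>. \<forall>B\<in>sets \<nu>. B \<subseteq> U \<longrightarrow>
       emeasure \<nu> B = (\<integral>\<^sup>+x\<in>\<phi> ` B. ennreal (sqrt (det (\<rho> (U, \<phi>) (inv_into U \<phi> x)))) \<partial>lborel))"
    show "\<nu> = \<nu>0"
    proof (rule measure_eqI)
      show "sets \<nu> = sets \<nu>0" using \<nu> s0 by simp
      fix B assume "B \<in> sets \<nu>"
      then have B: "B \<in> sets borel_M" using \<nu> by simp
      have 1: "emeasure \<nu> (B \<inter> P i) = F i B" if i: "i < k" for i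
      proof -
        obtain U \<phi> where ci: "c i = (U,\<phi>)" by (cases "c i")
        have ch: "(U,\<phi>) \<in> \<A>" and PU: "P i \<subseteq> U" using c[OF i] P(2)[OF i] ci by auto
        have BP: "B \<inter> P i \<in> sets borel_M" "B \<inter> P i \<subseteq> U" using B P(1)[OF i] PU by auto
        have "emeasure \<nu> (B \<inter> P i) = (\<integral>\<^sup>+x\<in>\<phi> ` (B \<inter> P i). ennreal (sqrt (det (\<rho> (U, \<phi>) (inv_into U \<phi> x)))) \<partial>lborel)"
          using \<nu> ch BP by blast
        then show ?thesis using chart_volume_eq[OF ch BP] by (simp add: F_def ci)
      qed
      have "(\<Sum>i<k. emeasure \<nu> (B \<inter> P i)) = emeasure \<nu> (\<Union>i<k. B \<inter> P i)"
      proof (rule sum_emeasure)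
        show "(\<lambda>i. B \<inter> P i) ` {..<k} \<subseteq> sets \<nu>" using B P(1) \<nu> by auto
        show "disjoint_family_on (\<lambda>i. B \<inter> P i) {..<k}" using dP unfolding disjoint_family_on_def by blast
      qed simp
      also have "(\<Union>i<k. B \<inter> P i) = B" using UP B sub by auto
      finally show "emeasure \<nu> B = emeasure \<nu>0 B" using 1 e0[OF B] by (simp add: \<mu>_def)
    qed
  qed (use s0 in auto)
qed

abbreviation vol :: "'a measure" where "vol \<equiv> riem_measure M \<A> \<rho>"

lemma vol_facts: "space vol = M" "sets vol = sets borel_M"
  "\<And>U \<phi> B. (U,\<phi>) \<in> \<A> \<Longrightarrow> B \<in> sets borel_M \<Longrightarrow> B \<subseteq> U \<Longrightarrow> emeasure vol B = (\<integral>\<^sup>+x\<in>\<phi> ` B. ennreal (weight U \<phi> x) \<partial>lborel)"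
proof -
  note th = theI'[OF ex_riem_measure, folded riem_measure_def]
  show 1: "space vol = M" "sets vol = sets borel_M" using th by auto
  fix U \<phi> B assume ch: "(U,\<phi>) \<in> \<A>" and B: "B \<in> sets borel_M" "B \<subseteq> U"
  have "\<forall>(U, \<phi>)\<in>\<A>. \<forall>B\<in>sets vol. B \<subseteq> U \<longrightarrow>
       emeasure vol B = (\<integral>\<^sup>+x\<in>\<phi> ` B. ennreal (sqrt (det (\<rho> (U, \<phi>) (inv_into U \<phi> x)))) \<partial>lborel)"
    using th by (elim conjE)
  from bspec[OF this ch] show "emeasure vol B = (\<integral>\<^sup>+x\<in>\<phi> ` B. ennreal (weight U \<phi> x) \<partial>lborel)"
    using B 1 chart_volume_eq[OF ch B] chart_volume_weight[OF ch B] by simp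
qed

section \<open>Ahlfors regularity\<close>

lemma mball_openin: "openin (top_of_set M) (dM.mball x s)"
  unfolding openin_iff_dst
proof (intro conjI ballI)
  fix y assume y: "y \<in> dM.mball x s"
  then have xy: "x \<in> M" "y \<in> M" "dst x y < s" by auto
  show "\<exists>e>0. \<forall>z\<in>M. dst y z < e \<longrightarrow> z \<in> dM.mball x s"
  proof (intro exI[of _ "s - dst x y"] conjI ballI impI)
    fix z assume z: "z \<in> M" "dst y z < s - dst x y"
    then show "z \<in> dM.mball x s" using dM.triangle[OF xy(1,2) z(1)] xy by auto
  qed (use xy in simp)
qed auto

lemma mball_borel: "dM.mball x s \<in> sets vol"
  using openin_borel_M[OF mball_openin] vol_facts(2) by simp

lemma chart_preimage_borel:
  assumes "(U,\<phi>) \<in> \<A>" "open T"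
  shows "{q\<in>U. \<phi> q \<in> T} \<in> sets borel_M"
  using openin_borel_M[OF chart_preimage_openin[OF assms]] .

lemma good_chart_weight:
  assumes g: "good_chart p U \<phi> r l L"
  obtains w1 w2 where "0 < w1" "0 < w2" "\<And>x. x \<in> cball (\<phi> p) (3 * r) \<Longrightarrow> w1 \<le> weight U \<phi> x \<and> weight U \<phi> x \<le> w2"
proof -
  have ch: "(U,\<phi>) \<in> \<A>" and c: "cball (\<phi> p) (3 * r) \<subseteq> \<phi> ` U" and r: "0 < r"
    using g unfolding good_chart_def by auto
  let ?f = "\<lambda>x. sqrt (det (\<rho> (U,\<phi>) (inv_into U \<phi> x)))"
  have fc: "continuous_on (cball (\<phi> p) (3 * r)) ?f" using weight_continuous[OF ch] c by (rule continuous_on_subset)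
  have ne: "cball (\<phi> p) (3 * r) \<noteq> {}" using r by simp
  obtain a where a: "a \<in> cball (\<phi> p) (3 * r)" "\<And>x. x \<in> cball (\<phi> p) (3 * r) \<Longrightarrow> ?f a \<le> ?f x"
    using continuous_attains_inf[OF compact_cball ne fc] by blast
  obtain b where b: "b \<in> cball (\<phi> p) (3 * r)" "\<And>x. x \<in> cball (\<phi> p) (3 * r) \<Longrightarrow> ?f x \<le> ?f b"
    using continuous_attains_sup[OF compact_cball ne fc] by blast
  have "inv_into U \<phi> a \<in> U" using a(1) c by (intro inv_into_into) blast
  then have "?f a > 0" using det_metric_pos[OF ch] by simp
  moreover have "weight U \<phi> x = ?f x" if "x \<in> cball (\<phi> p) (3 * r)" for x
    using c that by (simp add: weight_def indicator_def subset_iff)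
  ultimately show ?thesis using that[of "?f a" "?f b"] a b by fastforce
qed

lemma emeasure_ball_vec:
  "0 \<le> s \<Longrightarrow> emeasure lborel (ball (x::real^'n) s) = ennreal (unit_ball_vol (CARD('n)) * s ^ CARD('n))"
  by (simp add: emeasure_ball)

text \<open>Metric balls are compared with coordinate balls, whose Lebesgue measure is known, and
  the density is bounded on both sides. One parameter \<open>e\<close> stands for all constants at
  once, in the monotone form required by \<open>compact_uniform\<close>.\<close>

lemma volume_ball_local:
  assumes "p \<in> M"
  shows "\<exists>T. openin (top_of_set M) T \<and> p \<in> T \<and> (\<exists>e>0. \<forall>x\<in>T.
     (\<forall>s. 0 < s \<and> s \<le> 1 \<longrightarrow> ennreal (e * s ^ CARD('n)) \<le> emeasure vol (dM.mball x s)) \<and>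
     (\<forall>s. 0 < s \<and> s \<le> e \<longrightarrow> emeasure vol (dM.mball x s) \<le> ennreal (1 / e * s ^ CARD('n))))"
proof -
  obtain U \<phi> r l L where g: "good_chart p U \<phi> r l L" using ex_good_chart[OF assms] by metis
  obtain w1 w2 where w: "0 < w1" "0 < w2" "\<And>x. x \<in> cball (\<phi> p) (3 * r) \<Longrightarrow> w1 \<le> weight U \<phi> x \<and> weight U \<phi> x \<le> w2"
    using good_chart_weight[OF g] by metis
  have ch: "(U,\<phi>) \<in> \<A>" and c: "cball (\<phi> p) (3 * r) \<subseteq> \<phi> ` U" and r: "0 < r" "0 < l" "0 < L"
    using g unfolding good_chart_def by auto
  define \<beta> where "\<beta> = unit_ball_vol (real CARD('n))"
  have \<beta>: "0 < \<beta>" unfolding \<beta>_def by (rule unit_ball_vol_pos) simp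
  define N where "N = CARD('n)"
  \<comment> \<open>The coordinate radius for the lower bound will be
    \<open>\<kappa> / L * s\<close>. Here \<open>\<kappa> \<le> 1\<close> puts the coordinate ball
    inside the metric ball of radius \<open>s\<close>, and \<open>\<kappa> \<le> 2 * r * L\<close>
    keeps it within the good chart for all \<open>s \<le> 1\<close>.\<close>
  define \<kappa> where "\<kappa> = min 1 (2 * r * L)"
  have \<kappa>: "0 < \<kappa>" "\<kappa> \<le> 1" "\<kappa> \<le> 2 * r * L" using r by (auto simp: \<kappa>_def)
  define e1 where "e1 = w1 * \<beta> * (\<kappa> / L) ^ N"
  define e2 where "e2 = inverse (w2 * \<beta> * (1 / l) ^ N)"
  \<comment> \<open>\<open>2 * l * r\<close> is the distance up to which
    \<open>good_chart_lower\<close> applies; \<open>e1\<close> and the inverse of \<open>e2\<close>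
    are the constants of the two volume estimates.\<close>
  define e where "e = min (2 * l * r) (min e1 e2)"
  have e12: "0 < e1" "0 < e2" using w \<beta> \<kappa> r by (auto simp: e1_def e2_def)
  have e: "0 < e" "e \<le> 2 * l * r" "e \<le> e1" "e \<le> e2" using e12 r by (auto simp: e_def)
  define T where "T = {q\<in>U. \<phi> q \<in> ball (\<phi> p) r}"
  have lower: "ennreal (e * s ^ N) \<le> emeasure vol (dM.mball x s)" if x: "x \<in> T" and s: "0 < s" "s \<le> 1" for x s
  proof -
    define s' where "s' = \<kappa> / L * s"
    have "\<kappa> / L * s \<le> \<kappa> / L * 1" using s \<kappa> r by (intro mult_left_mono) auto
    moreover have "\<kappa> / L \<le> 2 * r" using \<kappa> r by (simp add: field_simps)
    moreover have "\<kappa> * s \<le> s" using \<kappa> s by simp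
    ultimately have s': "0 < s'" "s' \<le> 2 * r" "L * s' \<le> s" using \<kappa> s r by (simp_all add: s'_def)
    define Y where "Y = {q\<in>U. \<phi> q \<in> ball (\<phi> x) s'}"
    have xU: "x \<in> U" "\<phi> x \<in> ball (\<phi> p) r" using x by (auto simp: T_def)
    have b3: "ball (\<phi> x) s' \<subseteq> ball (\<phi> p) (3 * r)"
    proof
      fix y assume "y \<in> ball (\<phi> x) s'"
      then show "y \<in> ball (\<phi> p) (3 * r)" using xU(2) s'(2) dist_triangle[of "\<phi> p" y "\<phi> x"] by simp
    qed
    have Yb: "Y \<in> sets borel_M" unfolding Y_def by (rule chart_preimage_borel[OF ch]) simp
    have YU: "Y \<subseteq> U" by (auto simp: Y_def)
    have \<phi>Y: "\<phi> ` Y = ball (\<phi> x) s'"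
    proof
      show "ball (\<phi> x) s' \<subseteq> \<phi> ` Y"
      proof
        fix y assume y: "y \<in> ball (\<phi> x) s'"
        then have "y \<in> cball (\<phi> p) (3 * r)" using b3 by (auto simp: subset_iff less_imp_le)
        then obtain q where "q \<in> U" "y = \<phi> q" using c by blast
        then show "y \<in> \<phi> ` Y" using y by (auto simp: Y_def)
      qed
    qed (auto simp: Y_def)
    have "Y \<subseteq> dM.mball x s"
    proof
      fix y assume y: "y \<in> Y"
      then have yU: "y \<in> U" "\<phi> y \<in> ball (\<phi> x) s'" by (auto simp: Y_def)
      have "rd x y \<le> L * dist (\<phi> x) (\<phi> y)"
        by (rule good_chart_upper(2)[OF g]) (use xU yU b3 r in auto)
      also have "\<dots> < L * s'" using yU r by auto
      finally show "y \<in> dM.mball x s" using s' xU yU chart_open(3)[OF ch] by (auto simp: dst_def)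
    qed
    then have "emeasure vol Y \<le> emeasure vol (dM.mball x s)" using mball_borel by (intro emeasure_mono)
    moreover have "ennreal (e * s ^ N) \<le> emeasure vol Y"
    proof -
      have "e * s ^ N \<le> e1 * s ^ N" using e s by (intro mult_right_mono) auto
      also have "\<dots> = w1 * (\<beta> * s' ^ N)" by (simp add: e1_def s'_def power_mult_distrib power_divide)
      finally have "ennreal (e * s ^ N) \<le> ennreal (w1 * (\<beta> * s' ^ N))" by (rule ennreal_leI)
      also have "\<dots> = ennreal w1 * emeasure lborel (ball (\<phi> x) s')"
        using w \<beta> s' by (simp add: emeasure_ball_vec \<beta>_def N_def ennreal_mult)
      also have "\<dots> = (\<integral>\<^sup>+y\<in>ball (\<phi> x) s'. ennreal w1 \<partial>lborel)" by (simp add: nn_integral_cmult_indicator)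
      also have "\<dots> \<le> (\<integral>\<^sup>+y\<in>ball (\<phi> x) s'. ennreal (weight U \<phi> y) \<partial>lborel)"
      proof (rule nn_integral_mono)
        fix y
        show "ennreal w1 * indicator (ball (\<phi> x) s') y \<le> ennreal (weight U \<phi> y) * indicator (ball (\<phi> x) s') y"
        proof (cases "y \<in> ball (\<phi> x) s'")
          case True
          then have "y \<in> cball (\<phi> p) (3 * r)" using b3 by (auto simp: subset_iff less_imp_le)
          then show ?thesis using w(3)[of y] by (simp add: indicator_def ennreal_leI)
        qed (simp add: indicator_def)
      qed
      also have "\<dots> = emeasure vol Y" using vol_facts(3)[OF ch Yb YU] by (simp add: \<phi>Y)
      finally show ?thesis .
    qed
    ultimately show ?thesis by (rule order_trans[rotated])
  qed
  have upper: "emeasure vol (dM.mball x s) \<le> ennreal (1 / e * s ^ N)" if x: "x \<in> T" and s: "0 < s" "s \<le> e" for x s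
  proof -
    have xU: "x \<in> U" "\<phi> x \<in> ball (\<phi> p) r" using x by (auto simp: T_def)
    define Y where "Y = {q\<in>U. \<phi> q \<in> ball (\<phi> x) (s / l) \<inter> ball (\<phi> p) (3 * r)}"
    have Yb: "Y \<in> sets borel_M" unfolding Y_def by (rule chart_preimage_borel[OF ch]) auto
    have YU: "Y \<subseteq> U" by (auto simp: Y_def)
    have "dM.mball x s \<subseteq> Y"
    proof
      fix y assume y: "y \<in> dM.mball x s"
      then have yM: "x \<in> M" "y \<in> M" "rd x y < s" by (auto simp: dst_def)
      then have "rd x y < 2 * l * r" using s e by simp
      note lo = good_chart_lower[OF g xU joined_all[OF yM(1,2)] this]
      have "l * dist (\<phi> x) (\<phi> y) < s" using lo yM by simp
      then have "dist (\<phi> x) (\<phi> y) < s / l" using r by (simp add: field_simps)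
      then show "y \<in> Y" using lo by (simp add: Y_def)
    qed
    then have "emeasure vol (dM.mball x s) \<le> emeasure vol Y" using Yb vol_facts(2) by (intro emeasure_mono) auto
    also have "\<dots> = (\<integral>\<^sup>+y\<in>\<phi> ` Y. ennreal (weight U \<phi> y) \<partial>lborel)" using vol_facts(3)[OF ch Yb YU] .
    also have "\<dots> \<le> (\<integral>\<^sup>+y\<in>ball (\<phi> x) (s / l). ennreal w2 \<partial>lborel)"
    proof (rule nn_integral_mono)
      fix y
      show "ennreal (weight U \<phi> y) * indicator (\<phi> ` Y) y \<le> ennreal w2 * indicator (ball (\<phi> x) (s / l)) y"
      proof (cases "y \<in> \<phi> ` Y")
        case True
        then have "y \<in> ball (\<phi> x) (s / l)" "y \<in> cball (\<phi> p) (3 * r)" by (auto simp: Y_def)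
        then show ?thesis using w(3)[of y] True by (simp add: indicator_def ennreal_leI)
      qed simp
    qed
    also have "\<dots> = ennreal w2 * emeasure lborel (ball (\<phi> x) (s / l))" by (simp add: nn_integral_cmult_indicator)
    also have "\<dots> = ennreal (w2 * (\<beta> * (s / l) ^ N))"
      using w \<beta> s r by (simp add: emeasure_ball_vec \<beta>_def N_def ennreal_mult)
    also have "w2 * (\<beta> * (s / l) ^ N) = 1 / e2 * s ^ N"
      by (simp add: e2_def power_divide field_simps)
    also have "ennreal (1 / e2 * s ^ N) \<le> ennreal (1 / e * s ^ N)"
      using e e12 s by (intro ennreal_leI mult_right_mono divide_left_mono) auto
    finally show ?thesis .
  qed
  show ?thesis
    using good_chart_nbhd[OF g, of r] r e lower upper unfolding N_def T_def[symmetric]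
    by (intro exI[of _ T] conjI exI[of _ e] ballI allI impI) auto
qed

lemma ahlfors_regular:
  obtains c C where "0 < c" "0 < C" "finite_measure vol"
    "\<And>x s. x \<in> M \<Longrightarrow> 0 < s \<Longrightarrow> s \<le> 1 \<Longrightarrow> c * s ^ CARD('n) \<le> measure vol (dM.mball x s)"
    "\<And>x s. x \<in> M \<Longrightarrow> 0 < s \<Longrightarrow> measure vol (dM.mball x s) \<le> C * s ^ CARD('n)"
proof -
  define N where "N = CARD('n)"
  have "\<exists>e>0. \<forall>x\<in>M. (\<forall>s. 0 < s \<and> s \<le> 1 \<longrightarrow> ennreal (e * s ^ CARD('n)) \<le> emeasure vol (dM.mball x s)) \<and>
     (\<forall>s. 0 < s \<and> s \<le> e \<longrightarrow> emeasure vol (dM.mball x s) \<le> ennreal (1 / e * s ^ CARD('n)))"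
  proof (rule compact_uniform[OF M_facts(2) volume_ball_local])
    fix e e' :: real and x
    assume h: "(\<forall>s. 0 < s \<and> s \<le> 1 \<longrightarrow> ennreal (e * s ^ CARD('n)) \<le> emeasure vol (dM.mball x s)) \<and>
     (\<forall>s. 0 < s \<and> s \<le> e \<longrightarrow> emeasure vol (dM.mball x s) \<le> ennreal (1 / e * s ^ CARD('n)))" and e': "0 < e'" "e' \<le> e"
    show "(\<forall>s. 0 < s \<and> s \<le> 1 \<longrightarrow> ennreal (e' * s ^ CARD('n)) \<le> emeasure vol (dM.mball x s)) \<and>
     (\<forall>s. 0 < s \<and> s \<le> e' \<longrightarrow> emeasure vol (dM.mball x s) \<le> ennreal (1 / e' * s ^ CARD('n)))"
    proof (intro conjI allI impI)
      fix s :: real assume s: "0 < s \<and> s \<le> 1"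
      have "ennreal (e' * s ^ CARD('n)) \<le> ennreal (e * s ^ CARD('n))"
        using e' s by (intro ennreal_leI mult_right_mono) auto
      then show "ennreal (e' * s ^ CARD('n)) \<le> emeasure vol (dM.mball x s)" using h s order_trans by blast
    next
      fix s :: real assume s: "0 < s \<and> s \<le> e'"
      have "ennreal (1 / e * s ^ CARD('n)) \<le> ennreal (1 / e' * s ^ CARD('n))"
        using e' s by (intro ennreal_leI mult_right_mono divide_left_mono) auto
      moreover have "emeasure vol (dM.mball x s) \<le> ennreal (1 / e * s ^ CARD('n))" using h s e' by simp
      ultimately show "emeasure vol (dM.mball x s) \<le> ennreal (1 / e' * s ^ CARD('n))" by (rule order_trans[rotated])
    qed
  qed
  then obtain e where e: "0 < e"
    and lo: "\<And>x s. x \<in> M \<Longrightarrow> 0 < s \<Longrightarrow> s \<le> 1 \<Longrightarrow> ennreal (e * s ^ N) \<le> emeasure vol (dM.mball x s)"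
    and up: "\<And>x s. x \<in> M \<Longrightarrow> 0 < s \<Longrightarrow> s \<le> e \<Longrightarrow> emeasure vol (dM.mball x s) \<le> ennreal (1 / e * s ^ N)"
    unfolding N_def by blast
  have "(\<forall>c\<in>(\<lambda>x. dM.mball x e) ` M. openin (top_of_set M) c) \<and> M \<subseteq> \<Union> ((\<lambda>x. dM.mball x e) ` M)"
    using mball_openin e by auto
  with M_facts(2) obtain D where D: "D \<subseteq> (\<lambda>x. dM.mball x e) ` M" "finite D" "M \<subseteq> \<Union>D"
    unfolding compact_eq_openin_cover by meson
  then obtain Q where Q: "finite Q" "Q \<subseteq> M" "D = (\<lambda>x. dM.mball x e) ` Q" by (meson finite_subset_image)
  have "emeasure vol M \<le> emeasure vol (\<Union>x\<in>Q. dM.mball x e)"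
    using D(3) Q mball_borel by (intro emeasure_mono) auto
  also have "\<dots> \<le> (\<Sum>x\<in>Q. emeasure vol (dM.mball x e))"
    using Q(1) mball_borel by (intro emeasure_subadditive_finite) auto
  also have "\<dots> < \<infinity>"
  proof -
    have "emeasure vol (dM.mball x e) < \<infinity>" if "x \<in> Q" for x
      using up[of x e] that Q(2) e by (intro le_less_trans[OF up]) auto
    then show ?thesis using Q(1) by simp
  qed
  finally have fin: "finite_measure vol" by (intro finite_measureI) (simp add: vol_facts)
  interpret finite_measure vol by (rule fin)
  define C where "C = max (1 / e) (measure vol M / e ^ N)"
  have C: "0 < C" "1 / e \<le> C" "measure vol M / e ^ N \<le> C" using e by (auto simp: C_def less_max_iff_disj)
  have lo': "e * s ^ N \<le> measure vol (dM.mball x s)" if "x \<in> M" "0 < s" "s \<le> 1" for x s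
    using lo[OF that] by (simp add: emeasure_eq_measure)
  have up': "measure vol (dM.mball x s) \<le> C * s ^ N" if x: "x \<in> M" and s: "0 < s" for x s
  proof (cases "s \<le> e")
    case True
    have "measure vol (dM.mball x s) \<le> 1 / e * s ^ N"
      using up[OF x s True] e s by (simp add: emeasure_eq_measure)
    also have "\<dots> \<le> C * s ^ N" using C s by (intro mult_right_mono) auto
    finally show ?thesis .
  next
    case False
    have "measure vol (dM.mball x s) \<le> measure vol M"
      using bounded_measure[of "dM.mball x s"] by (simp add: vol_facts(1))
    also have "\<dots> = measure vol M / e ^ N * e ^ N" using e by simp
    also have "\<dots> \<le> C * s ^ N" using C False e by (intro mult_mono power_mono) (auto simp: less_imp_le)
    finally show ?thesis .
  qed
  show ?thesis by (rule that[OF e C(1) fin]) (use lo' up' in \<open>auto simp: N_def\<close>)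
qed

end

section \<open>Path distances\<close>

lemma path_dist_le: "(u, v) \<in> snd G ^^ k \<Longrightarrow> path_dist G u v \<le> k"
  unfolding path_dist_def by (rule Least_le)

lemma path_dist_relpow: "(u, v) \<in> (snd G)\<^sup>* \<Longrightarrow> (u, v) \<in> snd G ^^ path_dist G u v"
  unfolding path_dist_def by (rule LeastI_ex) (simp add: rtrancl_power)

lemma path_dist_self [simp]: "path_dist G u u = 0"
  using path_dist_le[where u = u and v = u and G = G and k = 0] by simp

lemma path_dist_triangle:
  assumes "(u, v) \<in> (snd G)\<^sup>*" "(v, w) \<in> (snd G)\<^sup>*"
  shows "path_dist G u w \<le> path_dist G u v + path_dist G v w"
  by (rule path_dist_le) (use path_dist_relpow[OF assms(1)] path_dist_relpow[OF assms(2)] in \<open>auto simp: relpow_add\<close>)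

lemma relpow_sym: "sym R \<Longrightarrow> (u, v) \<in> R ^^ k \<Longrightarrow> (v, u) \<in> R ^^ k"
proof (induction k arbitrary: v)
  case (Suc k)
  then obtain w where "(u, w) \<in> R ^^ k" "(w, v) \<in> R" by auto
  then show ?case using Suc.IH[OF Suc.prems(1)] Suc.prems(1) by (meson relpow_Suc_I2 symD)
qed simp

lemma path_dist_sym:
  assumes "sym (snd G)"
  shows "path_dist G u v = path_dist G v u"
proof -
  have "(u, v) \<in> snd G ^^ k \<longleftrightarrow> (v, u) \<in> snd G ^^ k" for k using relpow_sym[OF assms] by blast
  then show ?thesis by (simp add: path_dist_def)
qed

text \<open>Loops allow a walk to pause, so a relational power comprises all walks with at most that
  many steps.\<close>

lemma relpow_mono_refl:
  assumes "\<And>x. x \<in> V \<Longrightarrow> (x, x) \<in> R" "R \<subseteq> V \<times> V" "u \<in> V" "(u, v) \<in> R ^^ j" "j \<le> k"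
  shows "(u, v) \<in> R ^^ k"
  using assms(5)
proof (induction k rule: dec_induct)
  case (step n)
  have "v \<in> V" using assms(2-4) by (cases j) auto
  then show ?case using step.IH assms(1) by (auto intro: relpow_Suc_I)
qed (rule assms(4))

section \<open>Metric measure spaces\<close>

text \<open>What the coarse argument takes from the manifold: Ahlfors regularity and intermediate
  points. \<open>length_space\<close> is the approximate form of the latter, with strict
  inequalities in place of shortest curves.\<close>

locale mm_space = Metric_space M d + finite_measure \<nu>
  for M :: "'a set" and d :: "'a \<Rightarrow> 'a \<Rightarrow> real" and \<nu> :: "'a measure" +
  fixes N :: nat and c C :: real
  assumes M_ne: "M \<noteq> {}" and space_nu: "space \<nu> = M"
    and sets_nu: "sets \<nu> = sigma_sets M {W. openin mtopology W}"
    and N_pos: "0 < N" and c_pos: "0 < c" and C_pos: "0 < C"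
    and ball_lower: "\<And>x s. x \<in> M \<Longrightarrow> 0 < s \<Longrightarrow> s \<le> 1 \<Longrightarrow> c * s ^ N \<le> measure \<nu> (mball x s)"
    and ball_upper: "\<And>x s. x \<in> M \<Longrightarrow> 0 < s \<Longrightarrow> measure \<nu> (mball x s) \<le> C * s ^ N"
    and length_space: "\<And>x y a b. x \<in> M \<Longrightarrow> y \<in> M \<Longrightarrow> 0 < a \<Longrightarrow> 0 < b \<Longrightarrow> d x y < a + b \<Longrightarrow>
      \<exists>z\<in>M. d x z < a \<and> d z y < b"
begin

section \<open>Approximation of measurable sets by separated pairs\<close>

lemma openin_sets: "openin mtopology W \<Longrightarrow> W \<in> sets \<nu>"
  unfolding sets_nu by (rule sigma_sets.Basic) simp

lemma mball_sets [simp, intro]: "mball x s \<in> sets \<nu>"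
  by (rule openin_sets) simp

lemma sets_subset: "A \<in> sets \<nu> \<Longrightarrow> A \<subseteq> M"
  using sets.sets_into_space space_nu by blast

text \<open>Regularity of the measure with a positive gap between \<open>K\<close> and the
  complement of \<open>U\<close>. Passing to complements merely swaps the two sets, so the property
  can be proved by induction over the sigma-algebra.\<close>

definition separated_approx :: "'a set \<Rightarrow> bool" where
  "separated_approx A \<longleftrightarrow> A \<in> sets \<nu> \<and> (\<forall>e>0. \<exists>K U r. K \<in> sets \<nu> \<and> U \<in> sets \<nu> \<and> K \<subseteq> A \<and> A \<subseteq> U \<and> 0 < r \<and>
      measure \<nu> (U - K) < e \<and> (\<forall>k\<in>K. \<forall>y\<in>M. d k y < r \<longrightarrow> y \<in> U))"

lemma separated_approxD:
  assumes "separated_approx A" "0 < e"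
  obtains K U r where "K \<in> sets \<nu>" "U \<in> sets \<nu>" "K \<subseteq> A" "A \<subseteq> U" "0 < r"
      "measure \<nu> (U - K) < e" "\<And>k y. k \<in> K \<Longrightarrow> y \<in> M \<Longrightarrow> d k y < r \<Longrightarrow> y \<in> U"
  using assms unfolding separated_approx_def by meson

lemma separated_approx_open:
  assumes W: "openin mtopology W"
  shows "separated_approx W"
  unfolding separated_approx_def
proof (intro conjI allI impI)
  show Ws: "W \<in> sets \<nu>" using openin_sets[OF W] .
  fix e :: real assume e: "0 < e"
  \<comment> \<open>The inner sets collect the points at distance at least
    \<open>1 / real (Suc n)\<close> from the complement, and the outer set will be \<open>W\<close>
    itself. Openness of \<open>W\<close> makes the inner sets exhaust it.\<close>
  define Q where "Q n = M - (\<Union>x\<in>M - W. mball x (1 / real (Suc n)))" for n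
  have Qs: "Q n \<in> sets \<nu>" for n
  proof -
    have "openin mtopology (\<Union>x\<in>M - W. mball x (1 / real (Suc n)))" by (intro openin_Union) auto
    then show ?thesis using openin_sets sets.compl_sets[of _ \<nu>] by (simp add: Q_def space_nu)
  qed
  have QW: "Q n \<subseteq> W" for n unfolding Q_def by (auto simp del: of_nat_Suc)
  have inc: "incseq Q"
  proof (rule incseq_SucI)
    fix n
    have "1 / real (Suc (Suc n)) \<le> 1 / real (Suc n)" by (simp add: field_simps)
    then show "Q n \<subseteq> Q (Suc n)" unfolding Q_def using mball_subset_concentric by blast
  qed
  have UQ: "(\<Union>n. Q n) = W"
  proof
    show "W \<subseteq> (\<Union>n. Q n)"
    proof
      fix x assume x: "x \<in> W"
      then obtain r where r: "r > 0" "mball x r \<subseteq> W" "x \<in> M" using W unfolding openin_mtopology by blast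
      obtain n where n: "1 / real (Suc n) < r" using nat_approx_posE[OF r(1)] by blast
      have "x \<in> Q n" unfolding Q_def
      proof (intro DiffI notI)
        assume "x \<in> (\<Union>x\<in>M - W. mball x (1 / real (Suc n)))"
        then obtain z where z: "z \<in> M" "z \<notin> W" "d z x < 1 / real (Suc n)" by auto
        then have "z \<in> mball x r" using n r(3) by (auto simp: commute)
        then show False using r(2) z by blast
      qed (rule r(3))
      then show "x \<in> (\<Union>n. Q n)" by blast
    qed
  qed (use QW in blast)
  have "(\<lambda>n. measure \<nu> (Q n)) \<longlonglongrightarrow> measure \<nu> W"
    using finite_Lim_measure_incseq[OF _ inc] Qs UQ by auto
  then have "\<forall>\<^sub>F n in sequentially. measure \<nu> W - e < measure \<nu> (Q n)"
    by (rule order_tendstoD) (use e in simp)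
  then obtain n where n: "measure \<nu> W - e < measure \<nu> (Q n)" using eventually_happens by force
  show "\<exists>K U r. K \<in> sets \<nu> \<and> U \<in> sets \<nu> \<and> K \<subseteq> W \<and> W \<subseteq> U \<and> 0 < r \<and>
      measure \<nu> (U - K) < e \<and> (\<forall>k\<in>K. \<forall>y\<in>M. d k y < r \<longrightarrow> y \<in> U)"
  proof (rule exI[of _ "Q n"], rule exI[of _ W], rule exI[of _ "1 / real (Suc n)"], intro conjI ballI impI)
    show "measure \<nu> (W - Q n) < e" using finite_measure_Diff[OF Ws Qs QW] n by simp
    fix k y assume k: "k \<in> Q n" "y \<in> M" "d k y < 1 / real (Suc n)"
    show "y \<in> W"
    proof (rule ccontr)
      assume "y \<notin> W"
      moreover have "k \<in> mball y (1 / real (Suc n))" using k by (auto simp: Q_def commute)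
      ultimately show False using k by (auto simp: Q_def)
    qed
  qed (use Qs Ws QW in auto)
qed

lemma separated_approx_compl:
  assumes "separated_approx A"
  shows "separated_approx (M - A)"
  unfolding separated_approx_def
proof (intro conjI allI impI)
  have As: "A \<in> sets \<nu>" using assms by (simp add: separated_approx_def)
  then show "M - A \<in> sets \<nu>" using sets.compl_sets[of A \<nu>] by (simp add: space_nu)
  fix e :: real assume e: "0 < e"
  from separated_approxD[OF assms e] obtain K U r where
    KU: "K \<in> sets \<nu>" "U \<in> sets \<nu>" "K \<subseteq> A" "A \<subseteq> U" "0 < r" "measure \<nu> (U - K) < e"
      "\<And>k y. k \<in> K \<Longrightarrow> y \<in> M \<Longrightarrow> d k y < r \<Longrightarrow> y \<in> U" by metis
  have sub: "K \<subseteq> M" "U \<subseteq> M" using KU sets_subset by auto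
  have "(M - K) - (M - U) = U - K" using sub by auto
  moreover have "y \<in> M - K" if "k \<in> M - U" "y \<in> M" "d k y < r" for k y
    using that KU(7)[of y k] by (auto simp: commute)
  ultimately have *: "M - U \<in> sets \<nu> \<and> M - K \<in> sets \<nu> \<and> M - U \<subseteq> M - A \<and> M - A \<subseteq> M - K \<and> 0 < r \<and>
      measure \<nu> ((M - K) - (M - U)) < e \<and> (\<forall>k\<in>M - U. \<forall>y\<in>M. d k y < r \<longrightarrow> y \<in> M - K)"
    using KU(1-6) sets.compl_sets[of K \<nu>] sets.compl_sets[of U \<nu>] unfolding space_nu by auto
  show "\<exists>K U r. K \<in> sets \<nu> \<and> U \<in> sets \<nu> \<and> K \<subseteq> M - A \<and> M - A \<subseteq> U \<and> 0 < r \<and>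
      measure \<nu> (U - K) < e \<and> (\<forall>k\<in>K. \<forall>y\<in>M. d k y < r \<longrightarrow> y \<in> U)"
    by (rule exI[of _ "M - U"], rule exI[of _ "M - K"], rule exI[of _ r]) (rule *)
qed

lemma separated_approx_UN:
  fixes A :: "nat \<Rightarrow> 'a set"
  assumes "\<And>n. separated_approx (A n)"
  shows "separated_approx (\<Union>n. A n)"
  unfolding separated_approx_def
proof (intro conjI allI impI)
  have As: "A n \<in> sets \<nu>" for n using assms by (simp add: separated_approx_def)
  then show "(\<Union>n. A n) \<in> sets \<nu>" by auto
  fix e :: real assume e: "0 < e"
  \<comment> \<open>The errors \<open>e / 2 ^ (n + 2)\<close> add up to at most
    \<open>e / 2\<close>; the other half is reserved for the tail of the union.\<close>
  have "\<exists>K U r. K \<in> sets \<nu> \<and> U \<in> sets \<nu> \<and> K \<subseteq> A n \<and> A n \<subseteq> U \<and> 0 < r \<and>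
      measure \<nu> (U - K) < e / 2 ^ (n + 2) \<and> (\<forall>k\<in>K. \<forall>y\<in>M. d k y < r \<longrightarrow> y \<in> U)" for n
    using assms[of n] e unfolding separated_approx_def by simp
  then obtain K U r where KU: "\<And>n. K n \<in> sets \<nu> \<and> U n \<in> sets \<nu> \<and> K n \<subseteq> A n \<and> A n \<subseteq> U n \<and> 0 < (r n :: real) \<and>
      measure \<nu> (U n - K n) < e / 2 ^ (n + 2) \<and> (\<forall>k\<in>K n. \<forall>y\<in>M. d k y < r n \<longrightarrow> y \<in> U n)" by metis
  define UU where "UU = (\<Union>n. U n)"
  define V where "V m = (\<Union>n\<le>m. U n)" for m
  have s: "UU \<in> sets \<nu>" "V m \<in> sets \<nu>" for m using KU by (auto simp: UU_def V_def)
  have "(\<lambda>m. measure \<nu> (V m)) \<longlonglongrightarrow> measure \<nu> (\<Union>m. V m)"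
  proof (rule finite_Lim_measure_incseq)
    show "incseq V" unfolding incseq_def V_def by (intro allI impI UN_mono) auto
  qed (use s in auto)
  moreover have "(\<Union>m. V m) = UU" by (auto simp: V_def UU_def)
  ultimately have "(\<lambda>m. measure \<nu> (V m)) \<longlonglongrightarrow> measure \<nu> UU" by simp
  then have "\<forall>\<^sub>F m in sequentially. measure \<nu> UU - e / 2 < measure \<nu> (V m)"
    by (rule order_tendstoD) (use e in simp)
  then obtain m where m: "measure \<nu> UU - e / 2 < measure \<nu> (V m)" using eventually_happens by force
  \<comment> \<open>The outer set is the full union, but only finitely many inner sets are kept, so
    that the least of their radii is still positive.\<close>
  define KK where "KK = (\<Union>n\<le>m. K n)"
  have Ks: "KK \<in> sets \<nu>" using KU by (auto simp: KK_def)
  have VU: "V m \<subseteq> UU" by (auto simp: V_def UU_def)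
  have "UU - KK \<subseteq> (UU - V m) \<union> (\<Union>n\<le>m. U n - K n)" by (auto simp: V_def KK_def)
  moreover have d: "U n - K n \<in> sets \<nu>" for n using KU[of n] by (intro sets.Diff) auto
  then have d2: "(\<Union>n\<le>m. U n - K n) \<in> sets \<nu>" by (intro sets.finite_UN) auto
  moreover have d1: "UU - V m \<in> sets \<nu>" using s by (intro sets.Diff) auto
  ultimately have "measure \<nu> (UU - KK) \<le> measure \<nu> ((UU - V m) \<union> (\<Union>n\<le>m. U n - K n))"
    by (intro finite_measure_mono sets.Un)
  also have "\<dots> \<le> measure \<nu> (UU - V m) + measure \<nu> (\<Union>n\<le>m. U n - K n)"
    using d1 d2 by (rule measure_Un_le)
  also have "measure \<nu> (UU - V m) = measure \<nu> UU - measure \<nu> (V m)"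
    using finite_measure_Diff[OF s(1) s(2) VU] .
  also have "measure \<nu> (\<Union>n\<le>m. U n - K n) \<le> (\<Sum>n\<le>m. measure \<nu> (U n - K n))"
    using d by (intro finite_measure_subadditive_finite) auto
  also have "\<dots> \<le> (\<Sum>n\<le>m. e / 2 ^ (n + 2))" using KU by (intro sum_mono) (auto simp: less_imp_le)
  also have "\<dots> = e / 4 * (\<Sum>n\<le>m. (1/2) ^ n)" by (simp add: sum_distrib_left power_add power_one_over field_simps)
  also have "(\<Sum>n\<le>m. (1/2 :: real) ^ n) \<le> 2"
    using sum_gp_basic[of "1/2::real" m] by simp
  finally have mKK: "measure \<nu> (UU - KK) < e" using m e by simp
  have "\<exists>r0>0. \<forall>k\<in>KK. \<forall>y\<in>M. d k y < r0 \<longrightarrow> y \<in> UU"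
  proof (intro exI[of _ "Min (r ` {..m})"] conjI ballI impI)
    show "0 < Min (r ` {..m})" using KU by (subst Min_gr_iff) auto
    fix k y assume ky: "k \<in> KK" "y \<in> M" "d k y < Min (r ` {..m})"
    then obtain n where n: "n \<le> m" "k \<in> K n" by (auto simp: KK_def)
    then have "d k y < r n" using ky(3) by simp
    then have "y \<in> U n" using KU[of n] n ky(2) by blast
    then show "y \<in> UU" unfolding UU_def by blast
  qed
  then obtain r0 where r0: "0 < r0" "\<forall>k\<in>KK. \<forall>y\<in>M. d k y < r0 \<longrightarrow> y \<in> UU" by blast
  have sub: "KK \<subseteq> (\<Union>n. A n)" "(\<Union>n. A n) \<subseteq> UU" using KU by (force simp: KK_def UU_def)+
  show "\<exists>K Ua r. K \<in> sets \<nu> \<and> Ua \<in> sets \<nu> \<and> K \<subseteq> (\<Union>n. A n) \<and> (\<Union>n. A n) \<subseteq> Ua \<and> 0 < r \<and>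
      measure \<nu> (Ua - K) < e \<and> (\<forall>k\<in>K. \<forall>y\<in>M. d k y < r \<longrightarrow> y \<in> Ua)"
    by (rule exI[of _ KK], rule exI[of _ UU], rule exI[of _ r0]) (use Ks s(1) sub r0 mKK in simp)
qed

lemma separated_approx_all:
  assumes "A \<in> sets \<nu>"
  shows "separated_approx A"
  using assms unfolding sets_nu
proof (induction A rule: sigma_sets.induct)
  case (Basic W)
  then show ?case by (simp add: separated_approx_open)
next
  case Empty
  show ?case by (rule separated_approx_open) simp
next
  case (Compl A)
  then show ?case by (simp add: separated_approx_compl)
next
  case (Union A)
  then show ?case by (simp add: separated_approx_UN)
qed

end

text \<open>Only the generators are retained from the group. \<open>act_inverse\<close> makes the
  Lipschitz bound two-sided and the step graph below symmetric.\<close>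

locale mm_action = mm_space M d \<nu> N c C
  for M :: "'a set" and d \<nu> N c C +
  fixes S :: "'g set" and act :: "'g \<Rightarrow> 'a \<Rightarrow> 'a" and \<Lambda> \<Theta> :: real
  assumes finite_S: "finite S" and id_S: "\<exists>s\<in>S. \<forall>x\<in>M. act s x = x"
    and act_closed: "\<And>s x. s \<in> S \<Longrightarrow> x \<in> M \<Longrightarrow> act s x \<in> M"
    and act_inverse: "\<And>s. s \<in> S \<Longrightarrow> \<exists>s'\<in>S. \<forall>x\<in>M. act s' (act s x) = x \<and> act s (act s' x) = x"
    and Lambda: "1 \<le> \<Lambda>" and act_lipschitz: "\<And>s x y. s \<in> S \<Longrightarrow> x \<in> M \<Longrightarrow> y \<in> M \<Longrightarrow> d (act s x) (act s y) \<le> \<Lambda> * d x y"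
    and act_sets: "\<And>s A. s \<in> S \<Longrightarrow> A \<in> sets \<nu> \<Longrightarrow> act s ` A \<in> sets \<nu>"
    and Theta: "1 \<le> \<Theta>" and act_measure: "\<And>s A. s \<in> S \<Longrightarrow> A \<in> sets \<nu> \<Longrightarrow> measure \<nu> (act s ` A) \<le> \<Theta> * measure \<nu> A"
begin

section \<open>Saturations and the step graph\<close>

definition sat :: "'a set \<Rightarrow> 'a set" where "sat A = (\<Union>s\<in>S. act s ` A)"

lemma sat_sets: "A \<in> sets \<nu> \<Longrightarrow> sat A \<in> sets \<nu>"
  unfolding sat_def using finite_S act_sets by (intro sets.finite_UN) auto

lemma sat_mono: "A \<subseteq> B \<Longrightarrow> sat A \<subseteq> sat B"
  unfolding sat_def by blast

lemma sat_Un: "sat (A \<union> B) = sat A \<union> sat B"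
  unfolding sat_def by blast

lemma sat_superset: "A \<subseteq> M \<Longrightarrow> A \<subseteq> sat A"
  unfolding sat_def using id_S by (force simp: image_iff)

lemma sat_subset: "A \<subseteq> M \<Longrightarrow> sat A \<subseteq> M"
  unfolding sat_def using act_closed by auto

lemma sat_measure:
  assumes "A \<in> sets \<nu>"
  shows "measure \<nu> (sat A) \<le> card S * \<Theta> * measure \<nu> A"
proof -
  have "measure \<nu> (sat A) \<le> (\<Sum>s\<in>S. measure \<nu> (act s ` A))"
    unfolding sat_def using finite_S act_sets assms by (intro finite_measure_subadditive_finite) auto
  also have "\<dots> \<le> (\<Sum>s\<in>S. \<Theta> * measure \<nu> A)" using act_measure assms by (intro sum_mono) auto
  finally show ?thesis by simp
qed

text \<open>The graph on all of \<open>M\<close> at scale \<open>1/t\<close>: one step moves by at most \<open>1/t\<close> or jumps along a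
  generator. Its path metric is the level set \<open>M \<times> {t}\<close> of the warped cone up to bounded distortion.\<close>

definition step_graph :: "real \<Rightarrow> 'a graph" where
  "step_graph t = (M, {(x, y). x \<in> M \<and> y \<in> M \<and> (d x y \<le> 1 / t \<or> (\<exists>s\<in>S. y = act s x))})"

abbreviation steps :: "real \<Rightarrow> ('a \<times> 'a) set" where "steps t \<equiv> snd (step_graph t)"

lemma steps_iff: "(x, y) \<in> steps t \<longleftrightarrow> x \<in> M \<and> y \<in> M \<and> (d x y \<le> 1 / t \<or> (\<exists>s\<in>S. y = act s x))"
  by (simp add: step_graph_def)

lemma steps_sym: "sym (steps t)"
proof (rule symI)
  fix x y assume "(x, y) \<in> steps t"
  then show "(y, x) \<in> steps t" unfolding steps_iff using act_inverse commute by metis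
qed

lemma steps_refl: "0 < t \<Longrightarrow> x \<in> M \<Longrightarrow> (x, x) \<in> steps t"
  unfolding steps_iff by simp

lemma steps_sub: "steps t \<subseteq> M \<times> M" unfolding step_graph_def by auto

text \<open>One step of size below \<open>1 / t\<close> is split off at a time. The inequality is
  strict because intermediate points are provided only with room to spare.\<close>

lemma steps_power_dist:
  assumes t: "0 < t" and "x \<in> M" "y \<in> M" "d x y < real (Suc k) / t"
  shows "(x, y) \<in> steps t ^^ Suc k"
  using assms(2-)
proof (induction k arbitrary: y)
  case 0
  then show ?case by (simp add: steps_iff)
next
  case (Suc k)
  have "real (Suc (Suc k)) / t = real (Suc k) / t + 1 / t" by (simp add: add_divide_distrib)
  then obtain z where z: "z \<in> M" "d x z < real (Suc k) / t" "d z y < 1 / t"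
    using length_space[OF Suc.prems(1,2), of "real (Suc k) / t" "1 / t"] t Suc.prems(3) by auto
  have "(x, z) \<in> steps t ^^ Suc k" by (rule Suc.IH[OF Suc.prems(1) z(1,2)])
  moreover have "(z, y) \<in> steps t" using z Suc.prems by (simp add: steps_iff)
  ultimately show ?case by (rule relpow_Suc_I)
qed

abbreviation step_dist :: "real \<Rightarrow> 'a \<Rightarrow> 'a \<Rightarrow> nat" where "step_dist t \<equiv> path_dist (step_graph t)"

text \<open>The additive 1 comes from rounding \<open>t * d x y\<close> up to a number of steps.
  Connectedness is recorded as well, since \<open>path_dist\<close> is meaningful only between
  connected vertices.\<close>

lemma step_dist_le_dist:
  assumes "0 < t" "x \<in> M" "y \<in> M"
  shows "real (step_dist t x y) \<le> t * d x y + 1" "(x, y) \<in> (steps t)\<^sup>*"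
proof -
  define k where "k = nat \<lfloor>t * d x y\<rfloor>"
  have k: "real k \<le> t * d x y" "t * d x y < real (Suc k)"
    using assms(1) by (auto simp: k_def) linarith
  then have "d x y < real (Suc k) / t" using assms(1) by (simp add: field_simps)
  from steps_power_dist[OF assms this] have *: "(x, y) \<in> steps t ^^ Suc k" .
  then show "(x, y) \<in> (steps t)\<^sup>*" by (rule relpow_imp_rtrancl)
  show "real (step_dist t x y) \<le> t * d x y + 1" using path_dist_le[OF *] k by simp
qed

lemma step_dist_relpow: "0 < t \<Longrightarrow> x \<in> M \<Longrightarrow> y \<in> M \<Longrightarrow> (x, y) \<in> steps t ^^ step_dist t x y"
  using path_dist_relpow[OF step_dist_le_dist(2)] .

lemma step_dist_triangle:
  "0 < t \<Longrightarrow> x \<in> M \<Longrightarrow> y \<in> M \<Longrightarrow> z \<in> M \<Longrightarrow> step_dist t x z \<le> step_dist t x y + step_dist t y z"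
  by (rule path_dist_triangle) (simp_all add: step_dist_le_dist(2))

lemma step_dist_sym: "step_dist t x y = step_dist t y x"
  by (rule path_dist_sym[OF steps_sym])

lemma step_dist_act:
  assumes "s \<in> S" "x \<in> M"
  shows "step_dist t x (act s x) \<le> 1"
  by (rule path_dist_le) (use assms act_closed steps_iff[of x "act s x" t] in auto)

lemma steps_power_mono:
  "0 < t \<Longrightarrow> u \<in> M \<Longrightarrow> (u, v) \<in> steps t ^^ j \<Longrightarrow> j \<le> k \<Longrightarrow> (u, v) \<in> steps t ^^ k"
  by (rule relpow_mono_refl[OF steps_refl steps_sub])

text \<open>The infimal convolution with \<open>t d\<close> makes the step distance Lipschitz at all scales.\<close>

lemma lipschitz_step_dist:
  assumes t: "0 < t" and x0: "x0 \<in> M"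
  obtains h where "h x0 = 0"
    "\<And>x. x \<in> M \<Longrightarrow> real (step_dist t x0 x) - 1 \<le> h x" "\<And>x. x \<in> M \<Longrightarrow> 0 \<le> h x" "\<And>x. x \<in> M \<Longrightarrow> h x \<le> t * d x0 x"
    "\<And>x y. x \<in> M \<Longrightarrow> y \<in> M \<Longrightarrow> \<bar>h x - h y\<bar> \<le> t * d x y"
    "\<And>x s. x \<in> M \<Longrightarrow> s \<in> S \<Longrightarrow> \<bar>h x - h (act s x)\<bar> \<le> 2"
proof -
  define g where "g y = real (step_dist t x0 y)" for y
  define h where "h x = (INF y\<in>M. g y + t * d x y)" for x
  have nn: "0 \<le> g y + t * d x y" for x y using t by (simp add: g_def)
  have bdd: "bdd_below ((\<lambda>y. g y + t * d x y) ` M)" for x using nn by (auto intro: bdd_belowI[of _ 0])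
  have le: "h x \<le> g y + t * d x y" if "y \<in> M" for x y unfolding h_def by (rule cINF_lower[OF bdd that])
  have ge: "b \<le> h x" if "\<And>y. y \<in> M \<Longrightarrow> b \<le> g y + t * d x y" for b x
    unfolding h_def using M_ne that by (rule cINF_greatest)
  have tri: "g x \<le> g y + real (step_dist t y x)" if "x \<in> M" "y \<in> M" for x y
    using step_dist_triangle[OF t x0 that(2,1)] unfolding g_def by linarith
  have hg: "h x \<le> g x" if "x \<in> M" for x using le[OF that, of x] that by simp
  \<comment> \<open>The loss of 1 is the additive 1 in \<open>step_dist_le_dist\<close>.\<close>
  have gh: "g x - 1 \<le> h x" if x: "x \<in> M" for x
  proof (rule ge)
    fix y assume y: "y \<in> M"
    show "g x - 1 \<le> g y + t * d x y"
      using tri[OF x y] step_dist_le_dist(1)[OF t y x] by (simp add: commute)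
  qed
  have h0: "0 \<le> h x" for x using ge[of 0 x] nn by simp
  have lip: "h x \<le> h y + t * d x y" if xy: "x \<in> M" "y \<in> M" for x y
  proof -
    have "h x - t * d x y \<le> h y"
    proof (rule ge)
      fix z assume z: "z \<in> M"
      have "t * d x z \<le> t * (d x y + d y z)" using triangle[OF xy z] t by (intro mult_left_mono) auto
      then show "h x - t * d x y \<le> g z + t * d y z" using le[OF z, of x] by (simp add: algebra_simps)
    qed
    then show ?thesis by simp
  qed
  \<comment> \<open>\<open>g\<close> changes by at most 1 along a generator, and \<open>h\<close>
    lies between \<open>g - 1\<close> and \<open>g\<close>.\<close>
  have jump: "\<bar>h x - h (act s x)\<bar> \<le> 2" if x: "x \<in> M" and s: "s \<in> S" for x s
  proof -
    have a: "act s x \<in> M" using act_closed x s by simp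
    have "step_dist t x (act s x) \<le> 1" using step_dist_act[OF s x] .
    moreover have "step_dist t (act s x) x \<le> 1" using step_dist_act[OF s x] step_dist_sym by metis
    ultimately have "g x \<le> g (act s x) + 1" "g (act s x) \<le> g x + 1"
      using tri[OF x a] tri[OF a x] by linarith+
    then show ?thesis using hg[OF x] hg[OF a] gh[OF x] gh[OF a] by linarith
  qed
  show ?thesis
  proof (rule that[of h])
    show "h x0 = 0" using hg[OF x0] h0[of x0] by (simp add: g_def)
    show "h x \<le> t * d x0 x" if "x \<in> M" for x using le[OF x0, of x] by (simp add: g_def commute)
    show "\<bar>h x - h y\<bar> \<le> t * d x y" if "x \<in> M" "y \<in> M" for x y
      using lip[OF that] lip[OF that(2,1)] by (simp add: commute abs_le_iff)
  qed (use gh h0 jump in \<open>auto simp: g_def\<close>)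
qed

section \<open>Packing and nets\<close>

lemma nu_M_pos: "0 < measure \<nu> M"
proof -
  obtain x where x: "x \<in> M" using M_ne by blast
  have "0 < c * 1 ^ N" using c_pos by simp
  also have "\<dots> \<le> measure \<nu> (mball x 1)" using ball_lower[OF x, of 1] by simp
  also have "\<dots> \<le> measure \<nu> M" using bounded_measure space_nu by metis
  finally show ?thesis .
qed

lemma separated_card_measure:
  assumes "P \<subseteq> M" "finite P" "\<And>x y. x \<in> P \<Longrightarrow> y \<in> P \<Longrightarrow> x \<noteq> y \<Longrightarrow> 2 * s \<le> d x y" and s: "0 < s" "s \<le> 1"
  shows "real (card P) * (c * s ^ N) \<le> measure \<nu> (\<Union>x\<in>P. mball x s)"
proof -
  have "real (card P) * (c * s ^ N) = (\<Sum>x\<in>P. c * s ^ N)" by simp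
  also have "\<dots> \<le> (\<Sum>x\<in>P. measure \<nu> (mball x s))" using ball_lower s assms(1) by (intro sum_mono) auto
  also have "\<dots> = measure \<nu> (\<Union>x\<in>P. mball x s)"
  proof (rule finite_measure_finite_Union[symmetric])
    show "disjoint_family_on (\<lambda>x. mball x s) P"
      unfolding disjoint_family_on_def
    proof (intro ballI impI)
      fix x y assume "x \<in> P" "y \<in> P" "x \<noteq> y"
      then have "s + s \<le> d x y" using assms(3)[of x y] by simp
      then show "mball x s \<inter> mball y s = {}" using disjoint_mball unfolding disjnt_def by blast
    qed
  qed (use assms(2) in auto)
  finally show ?thesis .
qed

lemma packing_bound:
  assumes t: "1 \<le> t" and P: "P \<subseteq> M" "\<And>x y. x \<in> P \<Longrightarrow> y \<in> P \<Longrightarrow> x \<noteq> y \<Longrightarrow> 1 / t \<le> d x y" "finite P"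
    and z: "z \<in> M" "\<And>x. x \<in> P \<Longrightarrow> d z x \<le> R / t" and R: "0 \<le> R"
  shows "real (card P) \<le> C * (2 * R + 2) ^ N / c"
proof -
  \<comment> \<open>Half the separation, so balls of this radius around \<open>P\<close> are
    disjoint. As \<open>R / t = 2 * R * s\<close>, they all fit into the ball of radius
    \<open>(2 * R + 2) * s\<close> about \<open>z\<close>.\<close>
  define s where "s = 1 / (2 * t)"
  have s: "0 < s" "s \<le> 1" using t by (auto simp: s_def)
  have "real (card P) * (c * s ^ N) \<le> measure \<nu> (\<Union>x\<in>P. mball x s)"
    using P s by (intro separated_card_measure) (auto simp: s_def)
  also have "\<dots> \<le> measure \<nu> (mball z ((2 * R + 2) * s))"
  proof (rule finite_measure_mono)
    show "(\<Union>x\<in>P. mball x s) \<subseteq> mball z ((2 * R + 2) * s)"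
    proof
      fix y assume "y \<in> (\<Union>x\<in>P. mball x s)"
      then obtain x where x: "x \<in> P" "x \<in> M" "y \<in> M" "d x y < s" by auto
      have "d z y \<le> d z x + d x y" using triangle z(1) x by blast
      also have "\<dots> < R / t + s" using z(2)[OF x(1)] x(4) by simp
      also have "R / t + s \<le> (2 * R + 2) * s" using t s by (simp add: s_def field_simps)
      finally show "y \<in> mball z ((2 * R + 2) * s)" using z x by simp
    qed
  qed simp
  also have "\<dots> \<le> C * ((2 * R + 2) * s) ^ N" using z(1) R s by (intro ball_upper) auto
  also have "\<dots> = (C * (2 * R + 2) ^ N) * s ^ N" by (simp add: power_mult_distrib)
  finally have "(real (card P) * c) * s ^ N \<le> (C * (2 * R + 2) ^ N) * s ^ N" by (simp add: mult.assoc)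
  then have "real (card P) * c \<le> C * (2 * R + 2) ^ N" using s by (simp add: mult_le_cancel_right)
  then show ?thesis using c_pos by (simp add: field_simps)
qed

text \<open>A separated set of greatest cardinality is a net. Cardinalities are bounded because
  disjoint balls of a fixed radius share the finite total measure.\<close>

lemma ex_net:
  assumes t: "1 \<le> t"
  obtains P where "P \<subseteq> M" "finite P" "\<And>x y. x \<in> P \<Longrightarrow> y \<in> P \<Longrightarrow> x \<noteq> y \<Longrightarrow> 1 / t \<le> d x y"
    "\<And>x. x \<in> M \<Longrightarrow> \<exists>p\<in>P. d x p < 1 / t"
proof -
  obtain z where z: "z \<in> M" using M_ne by blast
  define Q where "Q P \<longleftrightarrow> P \<subseteq> M \<and> finite P \<and> (\<forall>x\<in>P. \<forall>y\<in>P. x \<noteq> y \<longrightarrow> 1 / t \<le> d x y)" for P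
  define s where "s = 1 / (2 * t)"
  have s: "0 < s" "s \<le> 1" using t by (auto simp: s_def)
  have bound: "real (card P) \<le> measure \<nu> M / (c * s ^ N)" if "Q P" for P
  proof -
    have "real (card P) * (c * s ^ N) \<le> measure \<nu> (\<Union>x\<in>P. mball x s)"
      using that s by (intro separated_card_measure) (auto simp: Q_def s_def)
    also have "\<dots> \<le> measure \<nu> M" using bounded_measure space_nu by metis
    finally show ?thesis using c_pos s by (simp add: field_simps)
  qed
  define B where "B = nat \<lceil>measure \<nu> M / (c * s ^ N)\<rceil>"
  have "card P \<le> B" if "Q P" for P using bound[OF that] unfolding B_def by linarith
  moreover have "Q {}" by (simp add: Q_def)
  ultimately obtain P where P: "Q P" "\<And>P'. Q P' \<Longrightarrow> card P' \<le> card P"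
    using ex_has_greatest_nat[of Q "{}" card "Suc B"] by (metis less_Suc_eq_le)
  have net: "\<exists>p\<in>P. d x p < 1 / t" if x: "x \<in> M" for x
  proof (rule ccontr)
    assume n: "\<not> ?thesis"
    then have "x \<notin> P" using x t by force
    moreover have "Q (insert x P)" using P(1) n x unfolding Q_def by (auto simp: commute not_less)
    ultimately show False using P(2)[of "insert x P"] P(1) by (simp add: Q_def)
  qed
  show ?thesis by (rule that[of P]) (use P(1) net in \<open>auto simp: Q_def\<close>)
qed

end

section \<open>From expansion in measure to expanders\<close>

text \<open>Every boundary vertex of the complement lies in \<open>W\<close> and is adjacent to a
  boundary vertex of \<open>W\<close>. This is how estimates for a small set transfer to a large
  one.\<close>

lemma vertex_boundary_compl_card:
  assumes G: "finite_simple_graph (V, E)" and deg: "\<And>v. v \<in> V \<Longrightarrow> card (E `` {v}) \<le> D" and W: "W \<subseteq> V"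
  shows "card (vertex_boundary (V, E) (V - W)) \<le> D * card (vertex_boundary (V, E) W)"
proof -
  have fin: "finite V" and E: "E \<subseteq> V \<times> V" "sym E" using G by (auto simp: finite_simple_graph_def)
  have bV: "vertex_boundary (V, E) W \<subseteq> V" using E by (auto simp: vertex_boundary_def)
  have sub: "vertex_boundary (V, E) (V - W) \<subseteq> (\<Union>v\<in>vertex_boundary (V, E) W. E `` {v})"
  proof
    fix w assume "w \<in> vertex_boundary (V, E) (V - W)"
    then obtain v where v: "v \<in> V - W" "(v, w) \<in> E" "w \<notin> V - W" by (auto simp: vertex_boundary_def)
    then have "w \<in> W" "(w, v) \<in> E" using E by (auto dest: symD)
    then have "v \<in> vertex_boundary (V, E) W" using v(1) by (auto simp: vertex_boundary_def)
    then show "w \<in> (\<Union>v\<in>vertex_boundary (V, E) W. E `` {v})" using v(2) by blast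
  qed
  have finb: "finite (vertex_boundary (V, E) W)" using bV fin finite_subset by blast
  have finE: "finite (E `` {v})" for v by (rule finite_subset[OF _ fin]) (use E in auto)
  have "card (vertex_boundary (V, E) (V - W)) \<le> card (\<Union>v\<in>vertex_boundary (V, E) W. E `` {v})"
    by (rule card_mono[OF _ sub]) (use finb finE in auto)
  also have "\<dots> \<le> (\<Sum>v\<in>vertex_boundary (V, E) W. card (E `` {v}))" by (rule card_UN_le[OF finb])
  also have "\<dots> \<le> (\<Sum>v\<in>vertex_boundary (V, E) W. D)" using deg bV by (intro sum_mono) auto
  finally show ?thesis by (simp add: mult.commute)
qed

context mm_action begin

text \<open>The centre of a neighbouring cell is within \<open>(\<Lambda> + 3) / t\<close> of the
  image of the given centre under some generator, and \<open>packing_bound\<close> counts such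
  centres for each generator.\<close>

definition degree_bound :: nat where
  "degree_bound = nat \<lceil>real (card S) * (C * (2 * (\<Lambda> + 3) + 2) ^ N / c)\<rceil>"

text \<open>The quotient of the upper bound \<open>C * (1 / t) ^ N\<close> for the measure of a cell
  by the lower bound \<open>c * (1 / (2 * t)) ^ N\<close>, in which \<open>t\<close>
  cancels.\<close>

definition cell_ratio :: real where "cell_ratio = C * 2 ^ N / c"

lemma cell_ratio_pos: "0 < cell_ratio" using C_pos c_pos by (simp add: cell_ratio_def)

lemma openin_closer: "openin mtopology {x \<in> M. d x a < d x b}" if "a \<in> M" "b \<in> M"
  unfolding openin_mtopology
proof (intro conjI allI impI)
  fix x assume "x \<in> {x \<in> M. d x a < d x b}"
  then have x: "x \<in> M" "d x a < d x b" by auto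
  show "\<exists>r>0. mball x r \<subseteq> {x \<in> M. d x a < d x b}"
  proof (intro exI[of _ "(d x b - d x a) / 2"] conjI subsetI)
    fix y assume "y \<in> mball x ((d x b - d x a) / 2)"
    then have y: "y \<in> M" "d x y < (d x b - d x a) / 2" by auto
    have "d y a \<le> d x y + d x a" "d x b \<le> d x y + d y b"
      using triangle[OF y(1) x(1) that(1)] triangle[OF x(1) y(1) that(2)] by (simp_all add: commute)
    then show "y \<in> {x \<in> M. d x a < d x b}" using y x by simp
  qed (use x in simp)
qed auto

text \<open>Voronoi cells of a maximal \<open>1/t\<close>-separated set, with ties broken by the index.\<close>

lemma voronoi_partition:
  assumes t: "1 \<le> t"
  obtains k p f where "0 < k" "\<And>i. i < k \<Longrightarrow> p i \<in> M" "\<And>i j. i < k \<Longrightarrow> j < k \<Longrightarrow> i \<noteq> j \<Longrightarrow> 1 / t \<le> d (p i) (p j)"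
    "\<And>x. x \<in> M \<Longrightarrow> f x < (k::nat)" "\<And>x. x \<in> M \<Longrightarrow> d x (p (f x)) < 1 / t" "\<And>i. i < k \<Longrightarrow> f (p i) = i"
    "\<And>i. i < k \<Longrightarrow> {x \<in> M. f x = i} \<in> sets \<nu>"
    "\<And>i. i < k \<Longrightarrow> c * (1 / (2 * t)) ^ N \<le> measure \<nu> {x \<in> M. f x = i}"
    "\<And>i. i < k \<Longrightarrow> measure \<nu> {x \<in> M. f x = i} \<le> C * (1 / t) ^ N"
proof -
  from ex_net[OF t] obtain P where P: "P \<subseteq> M" "finite P"
    "\<And>x y. x \<in> P \<Longrightarrow> y \<in> P \<Longrightarrow> x \<noteq> y \<Longrightarrow> 1 / t \<le> d x y"
    "\<And>x. x \<in> M \<Longrightarrow> \<exists>p\<in>P. d x p < 1 / t" by metis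
  define k where "k = card P"
  obtain p where p: "bij_betw p {..<k} P"
    using ex_bij_betw_nat_finite[OF P(2)] by (auto simp: k_def atLeast0LessThan)
  have pP: "p i \<in> P" if "i < k" for i using p that by (auto simp: bij_betw_def)
  have pM: "p i \<in> M" if "i < k" for i using pP[OF that] P(1) by blast
  have sep: "1 / t \<le> d (p i) (p j)" if "i < k" "j < k" "i \<noteq> j" for i j
    using P(3)[OF pP[OF that(1)] pP[OF that(2)]] p that by (auto simp: bij_betw_def inj_on_eq_iff)
  have near: "\<exists>i<k. d x (p i) < 1 / t" if "x \<in> M" for x
    using P(4)[OF that] p unfolding bij_betw_def by (metis imageE lessThan_iff)
  define mini where "mini x i \<longleftrightarrow> i < k \<and> (\<forall>j<k. d x (p i) \<le> d x (p j))" for x i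
  define f where "f x = (LEAST i. mini x i)" for x
  have ex: "\<exists>i. mini x i" if "x \<in> M" for x
  proof -
    have "{..<k} \<noteq> {}" using near[OF that] by auto
    then obtain i where "i \<in> {..<k}" "\<And>j. j \<in> {..<k} \<Longrightarrow> d x (p i) \<le> d x (p j)"
      using ex_min_if_finite[of "(\<lambda>i. d x (p i)) ` {..<k}"] by (auto simp: not_less)
    then show ?thesis by (auto simp: mini_def)
  qed
  have fm: "mini x (f x)" if "x \<in> M" for x unfolding f_def using ex[OF that] by (rule LeastI_ex)
  have fk: "f x < k" if "x \<in> M" for x using fm[OF that] by (simp add: mini_def)
  have fd: "d x (p (f x)) < 1 / t" if "x \<in> M" for x
    using fm[OF that] near[OF that] by (force simp: mini_def)
  \<comment> \<open>Every cell contains the ball of radius \<open>1 / (2 * t)\<close> about its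
    centre, whence the lower bound for its measure.\<close>
  have half: "f x = i" if i: "i < k" and x: "x \<in> M" "d (p i) x < 1 / (2 * t)" for x i
  proof (rule ccontr)
    assume ne: "f x \<noteq> i"
    have "1 / t \<le> d (p (f x)) (p i)" using sep[OF fk[OF x(1)] i ne] .
    also have "\<dots> \<le> d (p (f x)) x + d x (p i)" using triangle pM fk i x by blast
    also have "\<dots> \<le> d x (p i) + d x (p i)" using fm[OF x(1)] i by (simp add: mini_def commute)
    also have "\<dots> < 1 / (2 * t) + 1 / (2 * t)" using x(2) by (simp add: commute)
    finally show False by simp
  qed
  have Ms: "M \<in> sets \<nu>" using openin_sets[of M] by simp
  have cl: "{x \<in> M. d x (p i) \<le> d x (p j)} \<in> sets \<nu>" if "i < k" "j < k" for i j
  proof -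
    have "{x \<in> M. d x (p i) \<le> d x (p j)} = M - {x \<in> M. d x (p j) < d x (p i)}" by auto
    then show ?thesis using openin_sets[OF openin_closer[OF pM[OF that(2)] pM[OF that(1)]]] Ms by auto
  qed
  have mini_sets: "{x \<in> M. mini x i} \<in> sets \<nu>" for i
  proof (cases "i < k")
    case True
    then have "{x \<in> M. mini x i} = (\<Inter>j\<in>{..<k}. {x \<in> M. d x (p i) \<le> d x (p j)})"
      by (auto simp: mini_def)
    moreover have "(\<Inter>j\<in>{..<k}. {x \<in> M. d x (p i) \<le> d x (p j)}) \<in> sets \<nu>"
      using cl True by (intro sets.finite_INT) auto
    ultimately show ?thesis by simp
  qed (simp add: mini_def)
  have cell: "{x \<in> M. f x = i} \<in> sets \<nu>" for i
  proof -
    have "{x \<in> M. f x = i} = {x \<in> M. mini x i} - (\<Union>j<i. {x \<in> M. mini x j})"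
    proof (intro equalityI subsetI)
      fix x assume "x \<in> {x \<in> M. f x = i}"
      then have x: "x \<in> M" "f x = i" by auto
      have "\<not> mini x j" if "j < i" for j using not_less_Least[of j "mini x"] that x(2) unfolding f_def by simp
      then show "x \<in> {x \<in> M. mini x i} - (\<Union>j<i. {x \<in> M. mini x j})"
        using fm[OF x(1)] x by simp
    next
      fix x assume x: "x \<in> {x \<in> M. mini x i} - (\<Union>j<i. {x \<in> M. mini x j})"
      then have "f x \<le> i" unfolding f_def by (auto intro: Least_le)
      moreover have "\<not> f x < i" using x fm by auto
      ultimately show "x \<in> {x \<in> M. f x = i}" using x by auto
    qed
    then show ?thesis using mini_sets by auto
  qed
  show ?thesis
  proof (rule that[of k p f])
    obtain x where "x \<in> M" using M_ne by blast
    then show "0 < k" using fk[of x] by simp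
    fix i assume i: "i < k"
    show "f (p i) = i" using half[OF i pM[OF i]] pM[OF i] t by simp
    have "c * (1 / (2 * t)) ^ N \<le> measure \<nu> (mball (p i) (1 / (2 * t)))" using ball_lower[OF pM[OF i]] t by simp
    also have "\<dots> \<le> measure \<nu> {x \<in> M. f x = i}"
      by (rule finite_measure_mono) (use half[OF i] cell in auto)
    finally show "c * (1 / (2 * t)) ^ N \<le> measure \<nu> {x \<in> M. f x = i}" .
    have "{x \<in> M. f x = i} \<subseteq> mball (p i) (1 / t)" using fd pM[OF i] by (auto simp: commute)
    then have "measure \<nu> {x \<in> M. f x = i} \<le> measure \<nu> (mball (p i) (1 / t))"
      by (rule finite_measure_mono) simp
    also have "\<dots> \<le> C * (1 / t) ^ N" using ball_upper[OF pM[OF i]] t by simp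
    finally show "measure \<nu> {x \<in> M. f x = i} \<le> C * (1 / t) ^ N" .
  qed (use pM sep fk fd cell in auto)
qed

text \<open>The Cheeger condition counts vertices while the hypothesis measures sets. The bounds on
  the cell measures translate between the two up to \<open>cell_ratio\<close>, and the resulting
  constants are the same for all \<open>t\<close>.\<close>

lemma expander_graph_exists:
  assumes t: "1 \<le> t" and \<alpha>: "0 < \<alpha>"
    and ex: "\<And>A. A \<in> sets \<nu> \<Longrightarrow> measure \<nu> A \<le> measure \<nu> M / 2 \<Longrightarrow> (1 + \<alpha>) * measure \<nu> A \<le> measure \<nu> (sat A)"
  shows "\<exists>(G :: nat graph) f. finite_simple_graph G \<and> (\<forall>v\<in>fst G. card (snd G `` {v}) \<le> degree_bound) \<and>
    cheeger G \<ge> ereal (\<alpha> / (cell_ratio * (real degree_bound + 1))) \<and> measure \<nu> M / C * t \<le> real (card (fst G)) \<and>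
    f ` M = fst G \<and>
    (\<forall>x\<in>M. \<forall>y\<in>M. path_dist G (f x) (f y) \<le> step_dist t x y \<and> step_dist t x y \<le> 3 * path_dist G (f x) (f y) + 2)"
proof -
  obtain k p and f :: "'a \<Rightarrow> nat" where k: "0 < k" and pM: "\<And>i. i < k \<Longrightarrow> p i \<in> M"
    and sep: "\<And>i j. i < k \<Longrightarrow> j < k \<Longrightarrow> i \<noteq> j \<Longrightarrow> 1 / t \<le> d (p i) (p j)"
    and fk: "\<And>x. x \<in> M \<Longrightarrow> f x < k" and fd: "\<And>x. x \<in> M \<Longrightarrow> d x (p (f x)) < 1 / t" and fp: "\<And>i. i < k \<Longrightarrow> f (p i) = i"
    and Qs: "\<And>i. i < k \<Longrightarrow> {x \<in> M. f x = i} \<in> sets \<nu>"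
    and Ql: "\<And>i. i < k \<Longrightarrow> c * (1 / (2 * t)) ^ N \<le> measure \<nu> {x \<in> M. f x = i}"
    and Qu: "\<And>i. i < k \<Longrightarrow> measure \<nu> {x \<in> M. f x = i} \<le> C * (1 / t) ^ N"
    by (rule voronoi_partition[OF t]) (rule that; assumption)
  have t0: "0 < t" using t by simp
  define V where "V = {..<k}"
  define E where "E = {(i, j). i \<in> V \<and> j \<in> V \<and> i \<noteq> j \<and> (\<exists>x\<in>M. \<exists>y\<in>M. f x = i \<and> f y = j \<and> (x, y) \<in> steps t)}"
  have finV: "finite V" by (simp add: V_def)
  have symE: "sym E" using steps_sym[of t] unfolding E_def sym_def by blast
  have G: "finite_simple_graph (V, E)"
    unfolding finite_simple_graph_def using finV symE by (auto simp: E_def irrefl_def)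
  have deg: "card (E `` {i}) \<le> degree_bound" if i: "i \<in> V" for i
  proof -
    define Z where "Z s = {j \<in> V. d (act s (p i)) (p j) \<le> (\<Lambda> + 3) / t}" for s
    have ik: "i < k" using i by (simp add: V_def)
    have sub: "E `` {i} \<subseteq> (\<Union>s\<in>S. Z s)"
    proof
      fix j assume "j \<in> E `` {i}"
      then obtain x y where xy: "j \<in> V" "x \<in> M" "y \<in> M" "f x = i" "f y = j" "(x, y) \<in> steps t" by (auto simp: E_def)
      have jk: "j < k" using xy by (simp add: V_def)
      have px: "d (p i) x < 1 / t" and py: "d y (p j) < 1 / t"
        using fd[OF xy(2)] fd[OF xy(3)] xy by (auto simp: commute)
      consider "d x y \<le> 1 / t" | s where "s \<in> S" "y = act s x" using xy(6) steps_iff by blast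
      then show "j \<in> (\<Union>s\<in>S. Z s)"
      proof cases
        case 1
        \<comment> \<open>A move without a jump is filed under the generator that acts as the
          identity.\<close>
        obtain e where e: "e \<in> S" "act e (p i) = p i" using id_S pM[OF ik] by blast
        have "d (p i) (p j) \<le> d (p i) x + d x (p j)" using triangle pM ik jk xy by blast
        also have "d x (p j) \<le> d x y + d y (p j)" using triangle pM jk xy by blast
        finally have "d (p i) (p j) \<le> 3 / t" using px py 1 by (simp add: field_simps)
        also have "\<dots> \<le> (\<Lambda> + 3) / t" using t Lambda by (intro divide_right_mono) auto
        finally show ?thesis using e xy(1) by (auto simp: Z_def intro!: bexI[of _ e])
      next
        case 2
        have a: "act s (p i) \<in> M" using act_closed 2 pM ik by blast
        have "d (act s (p i)) y \<le> \<Lambda> * d (p i) x" using act_lipschitz 2 pM ik xy by blast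
        also have "\<dots> \<le> \<Lambda> * (1 / t)" using px Lambda by (intro mult_left_mono) auto
        finally have "d (act s (p i)) (p j) \<le> \<Lambda> * (1 / t) + 1 / t"
          using triangle[OF a xy(3) pM[OF jk]] py by simp
        also have "\<dots> \<le> (\<Lambda> + 3) / t" using t by (simp add: field_simps)
        finally show ?thesis using 2 xy(1) by (auto simp: Z_def)
      qed
    qed
    have Zc: "real (card (Z s)) \<le> C * (2 * (\<Lambda> + 3) + 2) ^ N / c" if s: "s \<in> S" for s
    proof -
      have Zk: "Z s \<subseteq> {..<k}" by (auto simp: Z_def V_def)
      have inj: "inj_on p (Z s)"
      proof (rule inj_onI)
        fix x y assume "x \<in> Z s" "y \<in> Z s" "p x = p y"
        then show "x = y" using fp Zk by (metis lessThan_iff subsetD)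
      qed
      have "real (card (p ` Z s)) \<le> C * (2 * (\<Lambda> + 3) + 2) ^ N / c"
      proof (rule packing_bound[OF t])
        show "p ` Z s \<subseteq> M" using pM Zk by auto
        show "1 / t \<le> d x y" if xy: "x \<in> p ` Z s" "y \<in> p ` Z s" "x \<noteq> y" for x y
        proof -
          from xy obtain i' j' where ij: "x = p i'" "y = p j'" "i' < k" "j' < k" using Zk by blast
          then have "i' \<noteq> j'" using xy(3) by auto
          then show ?thesis using sep[OF ij(3,4)] ij by simp
        qed
        show "finite (p ` Z s)" using finite_subset[OF Zk] by simp
        show "act s (p i) \<in> M" using act_closed[OF s pM[OF ik]] .
        show "d (act s (p i)) x \<le> (\<Lambda> + 3) / t" if "x \<in> p ` Z s" for x using that by (auto simp: Z_def)
      qed (use Lambda in simp)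
      then show ?thesis by (simp add: card_image[OF inj])
    qed
    have finZ: "finite (Z s)" for s using finV by (simp add: Z_def)
    have "card (E `` {i}) \<le> card (\<Union>s\<in>S. Z s)" by (rule card_mono[OF _ sub]) (use finite_S finZ in auto)
    also have "\<dots> \<le> (\<Sum>s\<in>S. card (Z s))" by (rule card_UN_le[OF finite_S])
    finally have "real (card (E `` {i})) \<le> (\<Sum>s\<in>S. real (card (Z s)))" by (metis of_nat_le_iff of_nat_sum)
    also have "\<dots> \<le> (\<Sum>s\<in>S. C * (2 * (\<Lambda> + 3) + 2) ^ N / c)" using Zc by (intro sum_mono) auto
    also have "\<dots> = real (card S) * (C * (2 * (\<Lambda> + 3) + 2) ^ N / c)" by simp
    finally show ?thesis unfolding degree_bound_def by linarith
  qed
  define a b where "a = c * (1 / (2 * t)) ^ N" and "b = C * (1 / t) ^ N"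
  have ab: "0 < a" "0 < b" "b = cell_ratio * a"
    using c_pos C_pos t by (auto simp: a_def b_def cell_ratio_def power_divide power_mult_distrib)
  define Q where "Q W = {x \<in> M. f x \<in> W}" for W
  have Qmeas: "Q W \<in> sets \<nu>" "measure \<nu> (Q W) = (\<Sum>i\<in>W. measure \<nu> {x \<in> M. f x = i})" if W: "W \<subseteq> V" for W
  proof -
    have fW: "finite W" using W finV finite_subset by blast
    have Wk: "i < k" if "i \<in> W" for i using W that by (auto simp: V_def)
    have eq: "Q W = (\<Union>i\<in>W. {x \<in> M. f x = i})" by (auto simp: Q_def)
    show "Q W \<in> sets \<nu>" unfolding eq using fW Qs Wk by (intro sets.finite_UN) auto
    show "measure \<nu> (Q W) = (\<Sum>i\<in>W. measure \<nu> {x \<in> M. f x = i})"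
      unfolding eq by (rule finite_measure_finite_Union[OF fW]) (use Qs Wk in \<open>auto simp: disjoint_family_on_def\<close>)
  qed
  have Qlow: "a * real (card W) \<le> measure \<nu> (Q W)" if W: "W \<subseteq> V" for W
  proof -
    have "a * real (card W) = (\<Sum>i\<in>W. a)" by simp
    also have "\<dots> \<le> (\<Sum>i\<in>W. measure \<nu> {x \<in> M. f x = i})" using Ql W unfolding a_def V_def by (intro sum_mono) auto
    finally show ?thesis using Qmeas[OF W] by simp
  qed
  have Qup: "measure \<nu> (Q W) \<le> b * real (card W)" if W: "W \<subseteq> V" for W
  proof -
    have "(\<Sum>i\<in>W. measure \<nu> {x \<in> M. f x = i}) \<le> (\<Sum>i\<in>W. b)" using Qu W unfolding b_def V_def by (intro sum_mono) auto
    then show ?thesis using Qmeas[OF W] by (simp add: mult.commute)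
  qed
  have bnd: "\<alpha> / cell_ratio * real (card W) \<le> real (card (vertex_boundary (V, E) W))"
    if W: "W \<subseteq> V" and m: "measure \<nu> (Q W) \<le> measure \<nu> M / 2" for W
  proof -
    let ?B = "vertex_boundary (V, E) W"
    have BV: "?B \<subseteq> V" by (auto simp: vertex_boundary_def E_def)
    \<comment> \<open>Applying a generator is a step, so a point of a cell in \<open>W\<close> ends
      in \<open>W\<close> or in an adjacent cell.\<close>
    have "sat (Q W) \<subseteq> Q W \<union> Q ?B"
    proof
      fix y assume "y \<in> sat (Q W)"
      then obtain s x where sx: "s \<in> S" "x \<in> M" "f x \<in> W" "y = act s x" by (auto simp: sat_def Q_def)
      then have y: "y \<in> M" using act_closed by blast
      have "(f x, f y) \<in> E" if "f y \<notin> W"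
      proof -
        have "(x, y) \<in> steps t" using sx y by (auto simp: steps_iff)
        moreover have "f x \<in> V" "f y \<in> V" "f x \<noteq> f y" using fk sx y that by (auto simp: V_def)
        ultimately show ?thesis unfolding E_def using sx(2) y by blast
      qed
      then show "y \<in> Q W \<union> Q ?B" using y sx by (auto simp: Q_def vertex_boundary_def)
    qed
    then have "measure \<nu> (sat (Q W)) \<le> measure \<nu> (Q W \<union> Q ?B)" using Qmeas(1)[OF W] Qmeas(1)[OF BV] by (intro finite_measure_mono) auto
    also have "\<dots> \<le> measure \<nu> (Q W) + measure \<nu> (Q ?B)" using Qmeas(1)[OF W] Qmeas(1)[OF BV] by (rule measure_Un_le)
    also have "measure \<nu> (Q ?B) \<le> b * real (card ?B)" using Qup[OF BV] .
    finally have "\<alpha> * measure \<nu> (Q W) \<le> b * real (card ?B)" using ex[OF Qmeas(1)[OF W] m] by (simp add: algebra_simps)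
    moreover have "\<alpha> * (a * real (card W)) \<le> \<alpha> * measure \<nu> (Q W)" using Qlow[OF W] \<alpha> by (intro mult_left_mono) auto
    ultimately have "a * (\<alpha> * real (card W)) \<le> a * (cell_ratio * real (card ?B))" unfolding ab(3) by (simp add: algebra_simps)
    then have "\<alpha> * real (card W) \<le> cell_ratio * real (card ?B)" using ab(1) by simp
    then show ?thesis using cell_ratio_pos by (simp add: field_simps)
  qed
  have che: "cheeger (V, E) \<ge> ereal (\<alpha> / (cell_ratio * (real degree_bound + 1)))"
    unfolding cheeger_def
  proof (rule INF_greatest)
    fix W assume "W \<in> {W. W \<noteq> {} \<and> W \<subseteq> fst (V, E) \<and> real (card W) \<le> 1 / 2 * real (card (fst (V, E)))}"
    then have W: "W \<noteq> {}" "W \<subseteq> V" "real (card W) \<le> 1 / 2 * real (card V)" by auto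
    have fW: "finite W" using W finV finite_subset by blast
    have cW: "0 < real (card W)" using W fW by (simp add: card_gt_0_iff)
    have "\<alpha> / cell_ratio * real (card W) \<le> (real degree_bound + 1) * real (card (vertex_boundary (V, E) W))"
    proof (cases "measure \<nu> (Q W) \<le> measure \<nu> M / 2")
      case True
      have "1 * real (card (vertex_boundary (V, E) W)) \<le> (real degree_bound + 1) * real (card (vertex_boundary (V, E) W))"
        by (intro mult_right_mono) auto
      then show ?thesis using bnd[OF W(2) True] by simp
    next
      \<comment> \<open>At most half of the vertices may still carry more than half of the measure.
        Then the complement is used: it has at least as many vertices as \<open>W\<close> and at
        most half of the measure, and its boundary is controlled by that of
        \<open>W\<close>.\<close>
      case False
      have VW: "V - W \<subseteq> V" by blast
      have "Q W \<union> Q (V - W) = M" "Q W \<inter> Q (V - W) = {}" using fk by (auto simp: Q_def V_def)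
      then have "measure \<nu> M = measure \<nu> (Q W) + measure \<nu> (Q (V - W))"
        using finite_measure_Union[OF Qmeas(1)[OF W(2)] Qmeas(1)[OF VW]] by simp
      then have m: "measure \<nu> (Q (V - W)) \<le> measure \<nu> M / 2" using False by simp
      have "real (card W) \<le> real (card (V - W))" using W card_Diff_subset[OF fW W(2)] card_mono[OF finV W(2)] by simp
      then have "\<alpha> / cell_ratio * real (card W) \<le> \<alpha> / cell_ratio * real (card (V - W))"
        using \<alpha> cell_ratio_pos by (intro mult_left_mono) auto
      also have "\<dots> \<le> real (card (vertex_boundary (V, E) (V - W)))" by (rule bnd[OF VW m])
      also have "\<dots> \<le> real (degree_bound * card (vertex_boundary (V, E) W))"
        using vertex_boundary_compl_card[OF G deg W(2)] by (simp only: of_nat_le_iff)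
      also have "\<dots> \<le> (real degree_bound + 1) * real (card (vertex_boundary (V, E) W))" by (simp add: algebra_simps)
      finally show ?thesis .
    qed
    moreover define Db where "Db = real degree_bound + 1"
    moreover have "0 < Db" by (simp add: Db_def)
    ultimately have "\<alpha> / (cell_ratio * (real degree_bound + 1)) \<le> real (card (vertex_boundary (V, E) W)) / real (card W)"
      unfolding Db_def[symmetric] using cW cell_ratio_pos by (simp add: field_simps)
    then show "ereal (\<alpha> / (cell_ratio * (real degree_bound + 1))) \<le> ereal (real (card (vertex_boundary (V, E) W)) / real (card W))"
      by simp
  qed
  have size: "measure \<nu> M / C * t \<le> real (card V)"
  proof -
    have "Q V = M" using fk by (auto simp: Q_def V_def)
    then have "measure \<nu> M \<le> C * (1 / t) ^ N * real (card V)" using Qup[of V] by (simp add: b_def)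
    then have "measure \<nu> M / C * t ^ N \<le> real (card V)" using C_pos t by (simp add: field_simps)
    \<comment> \<open>A linear lower bound is enough for the number of vertices to tend to infinity
      with the level.\<close>
    moreover have "t ^ 1 \<le> t ^ N" using t N_pos by (intro power_increasing) auto
    then have "measure \<nu> M / C * t \<le> measure \<nu> M / C * t ^ N" using C_pos by (intro mult_left_mono) auto
    ultimately show ?thesis by simp
  qed
  have fim: "f ` M = V"
  proof
    show "V \<subseteq> f ` M" using fp pM by (force simp: V_def)
  qed (use fk in \<open>auto simp: V_def\<close>)
  have up: "path_dist (V, E) (f x) (f y) \<le> step_dist t x y" if x: "x \<in> M" and y: "y \<in> M" for x y
  proof -
    have "\<exists>m\<le>j. (f x, f y) \<in> E ^^ m" if "(x, y) \<in> steps t ^^ j" "y \<in> M" for j y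
      using that
    proof (induction j arbitrary: y)
      case (Suc j)
      then obtain z where z: "(x, z) \<in> steps t ^^ j" "(z, y) \<in> steps t" by auto
      have zM: "z \<in> M" using z(2) steps_iff by blast
      obtain m where m: "m \<le> j" "(f x, f z) \<in> E ^^ m" using Suc.IH[OF z(1) zM] by blast
      show ?case
      proof (cases "f z = f y")
        case True
        then show ?thesis using m by (intro exI[of _ m]) auto
      next
        case False
        then have "(f z, f y) \<in> E" using z(2) zM Suc.prems(2) fk unfolding E_def V_def by auto
        then show ?thesis using m by (intro exI[of _ "Suc m"]) auto
      qed
    qed auto
    from this[OF step_dist_relpow[OF t0 x y] y] obtain m where m: "m \<le> step_dist t x y" "(f x, f y) \<in> E ^^ m" by blast
    have "path_dist (V, E) (f x) (f y) \<le> m" by (rule path_dist_le) (use m in simp)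
    then show ?thesis using m by simp
  qed
  have near: "step_dist t x (p (f x)) \<le> 1" if "x \<in> M" for x
    by (rule path_dist_le) (use fd[OF that] pM[OF fk[OF that]] that in \<open>simp add: steps_iff\<close>)
  have lo: "step_dist t x y \<le> 3 * path_dist (V, E) (f x) (f y) + 2" if x: "x \<in> M" and y: "y \<in> M" for x y
  proof -
    \<comment> \<open>From one centre to \<open>u\<close>, across to \<open>v\<close>, and on to the
      other centre: one step each.\<close>
    have e3: "step_dist t (p i) (p j) \<le> 3" if e: "(i, j) \<in> E" for i j
    proof -
      obtain u v where uv: "u \<in> M" "v \<in> M" "f u = i" "f v = j" "(u, v) \<in> steps t" using e by (auto simp: E_def)
      have ij: "p i \<in> M" "p j \<in> M" using e pM by (auto simp: E_def V_def)
      have "step_dist t (p i) (p j) \<le> step_dist t (p i) u + step_dist t u (p j)" by (rule step_dist_triangle[OF t0 ij(1) uv(1) ij(2)])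
      also have "step_dist t u (p j) \<le> step_dist t u v + step_dist t v (p j)" by (rule step_dist_triangle[OF t0 uv(1,2) ij(2)])
      also have "step_dist t u v \<le> 1" by (rule path_dist_le) (use uv in simp)
      finally show ?thesis using near[OF uv(1)] near[OF uv(2)] uv step_dist_sym[of t u "p i"] by simp
    qed
    have path: "step_dist t (p i) (p j) \<le> 3 * m" if "(i, j) \<in> E ^^ m" "i \<in> V" for i j m
      using that
    proof (induction m arbitrary: j)
      case (Suc m)
      then obtain l where l: "(i, l) \<in> E ^^ m" "(l, j) \<in> E" by auto
      have V: "p i \<in> M" "p l \<in> M" "p j \<in> M" using l(2) Suc.prems(2) pM by (auto simp: E_def V_def)
      then show ?case using step_dist_triangle[OF t0 V] Suc.IH[OF l(1) Suc.prems(2)] e3[OF l(2)] by simp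
    qed auto
    have "(f x, f y) \<in> E\<^sup>*"
    proof -
      have "(f x, f y) \<in> E\<^sup>*" if "(x, y) \<in> (steps t)\<^sup>*" "y \<in> M" for y
        using that
      proof (induction rule: rtrancl_induct)
        case (step y z)
        have yM: "y \<in> M" using step.hyps(2) steps_iff by blast
        have "f y = f z \<or> (f y, f z) \<in> E" using step.hyps(2) yM step.prems fk unfolding E_def V_def by auto
        then show ?case using step.IH[OF yM] by auto
      qed simp
      then show ?thesis using step_dist_le_dist(2)[OF t0 x y] y by blast
    qed
    then have "(f x, f y) \<in> E ^^ path_dist (V, E) (f x) (f y)" using path_dist_relpow[of "f x" "f y" "(V, E)"] by simp
    then have 1: "step_dist t (p (f x)) (p (f y)) \<le> 3 * path_dist (V, E) (f x) (f y)"
      by (rule path) (use fk[OF x] in \<open>simp add: V_def\<close>)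
    have M: "p (f x) \<in> M" "p (f y) \<in> M" using pM fk x y by auto
    have "step_dist t x y \<le> step_dist t x (p (f x)) + step_dist t (p (f x)) y" by (rule step_dist_triangle[OF t0 x M(1) y])
    also have "step_dist t (p (f x)) y \<le> step_dist t (p (f x)) (p (f y)) + step_dist t (p (f y)) y"
      by (rule step_dist_triangle[OF t0 M y])
    finally show ?thesis using 1 near[OF x] near[OF y] step_dist_sym[of t y "p (f y)"] by simp
  qed
  show ?thesis
    by (rule exI[of _ "(V, E)"], rule exI[of _ f]) (use G deg che size fim up lo in auto)
qed

lemma expanding_imp_family:
  assumes \<alpha>: "0 < \<alpha>"
    and ex: "\<And>A. A \<in> sets \<nu> \<Longrightarrow> measure \<nu> A \<le> measure \<nu> M / 2 \<Longrightarrow> (1 + \<alpha>) * measure \<nu> A \<le> measure \<nu> (sat A)"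
    and \<delta>: "\<And>t x y. 1 \<le> t \<Longrightarrow> x \<in> M \<Longrightarrow> y \<in> M \<Longrightarrow> \<delta> (x, t) (y, t) \<le> real (step_dist t x y)"
      "\<And>t x y. 1 \<le> t \<Longrightarrow> x \<in> M \<Longrightarrow> y \<in> M \<Longrightarrow> real (step_dist t x y) \<le> K * \<delta> (x, t) (y, t) + 1"
      "\<And>t x y. 1 \<le> t \<Longrightarrow> x \<in> M \<Longrightarrow> y \<in> M \<Longrightarrow> 0 \<le> \<delta> (x, t) (y, t)"
    and t: "level_sequence t"
  shows "forms_expander_family (\<lambda>n. M \<times> {t n}) (\<lambda>n. \<delta>)"
proof -
  have t1: "1 \<le> t n" for n using t by (simp add: level_sequence_def)
  let ?P = "\<lambda>n (G :: nat graph) f. finite_simple_graph G \<and> (\<forall>v\<in>fst G. card (snd G `` {v}) \<le> degree_bound) \<and>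
    cheeger G \<ge> ereal (\<alpha> / (cell_ratio * (real degree_bound + 1))) \<and> measure \<nu> M / C * t n \<le> real (card (fst G)) \<and>
    f ` M = fst G \<and>
    (\<forall>x\<in>M. \<forall>y\<in>M. path_dist G (f x) (f y) \<le> step_dist (t n) x y \<and> step_dist (t n) x y \<le> 3 * path_dist G (f x) (f y) + 2)"
  have "\<forall>n. \<exists>G f. ?P n G f" using expander_graph_exists[OF t1 \<alpha> ex] by blast
  then obtain G f where Gf: "\<And>n. ?P n (G n) (f n)" by metis
  have "filterlim (\<lambda>n. card (fst (G n))) at_top sequentially"
  proof -
    have "filterlim (\<lambda>n. measure \<nu> M / C * t n) at_top sequentially"
      using t nu_M_pos C_pos by (intro filterlim_tendsto_pos_mult_at_top[OF tendsto_const]) (auto simp: level_sequence_def)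
    then have "filterlim (\<lambda>n. real (card (fst (G n)))) at_top sequentially"
      by (rule filterlim_at_top_mono) (use Gf in auto)
    then show ?thesis by (simp add: filterlim_real_sequentially filterlim_sequentially_iff_filterlim_real)
  qed
  moreover have "0 < \<alpha> / (cell_ratio * (real degree_bound + 1))" using \<alpha> cell_ratio_pos by simp
  ultimately have fam: "expander_family G"
    unfolding expander_family_def
    by (intro conjI allI exI[of _ degree_bound] exI[of _ "\<alpha> / (cell_ratio * (real degree_bound + 1))"]) (use Gf in auto)
  define L where "L = max 3 K"
  have L: "3 \<le> L" "K \<le> L" by (auto simp: L_def)
  have q: "1 / L * \<delta> (x, t n) (y, t n) - 1 \<le> real (path_dist (G n) (f n x) (f n y)) \<and>
      real (path_dist (G n) (f n x) (f n y)) \<le> L * \<delta> (x, t n) (y, t n) + 1" if xy: "x \<in> M" "y \<in> M" for n x y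
  proof
    note \<delta>' = \<delta>(1)[OF t1[of n] xy] \<delta>(2)[OF t1[of n] xy] \<delta>(3)[OF t1[of n] xy]
    have pd: "path_dist (G n) (f n x) (f n y) \<le> step_dist (t n) x y" "step_dist (t n) x y \<le> 3 * path_dist (G n) (f n x) (f n y) + 2"
      using Gf[of n] xy by auto
    have "real (step_dist (t n) x y) \<le> real (3 * path_dist (G n) (f n x) (f n y) + 2)" using pd(2) by (simp only: of_nat_le_iff)
    \<comment> \<open>Enlarging the additive 2 to 3 makes the bound a multiple of
      \<open>path_dist\<close> plus 1, so the additive constant of the quasi-isometry is 1 after
      division by \<open>L\<close>.\<close>
    also have "\<dots> \<le> 3 * (real (path_dist (G n) (f n x) (f n y)) + 1)" by simp
    finally have "\<delta> (x, t n) (y, t n) \<le> 3 * (real (path_dist (G n) (f n x) (f n y)) + 1)" using \<delta>'(1) by (rule order_trans[rotated])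
    also have "\<dots> \<le> L * (real (path_dist (G n) (f n x) (f n y)) + 1)" using L by (intro mult_right_mono) auto
    finally show "1 / L * \<delta> (x, t n) (y, t n) - 1 \<le> real (path_dist (G n) (f n x) (f n y))" using L by (simp add: field_simps)
    have "K * \<delta> (x, t n) (y, t n) \<le> L * \<delta> (x, t n) (y, t n)" using L \<delta>'(3) by (intro mult_right_mono)
    moreover have "real (path_dist (G n) (f n x) (f n y)) \<le> real (step_dist (t n) x y)" using pd(1) by (simp only: of_nat_le_iff)
    ultimately show "real (path_dist (G n) (f n x) (f n y)) \<le> L * \<delta> (x, t n) (y, t n) + 1" using \<delta>'(2) by simp
  qed
  show ?thesis
    unfolding forms_expander_family_def
  proof (rule exI[of _ G], intro conjI, rule fam, rule exI[of _ L], intro conjI, goal_cases)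
    case 2
    show ?case
    proof (rule exI[of _ "1::real"], intro conjI, simp, rule exI[of _ "\<lambda>n z. f n (fst z)"], intro allI conjI)
    fix n
    show "(\<lambda>z. f n (fst z)) ` (M \<times> {t n}) \<subseteq> fst (G n)" using Gf[of n] by auto
    show "\<forall>x\<in>M \<times> {t n}. \<forall>x'\<in>M \<times> {t n}.
        1 / L * \<delta> x x' - 1 \<le> real (path_dist (G n) (f n (fst x)) (f n (fst x'))) \<and>
        real (path_dist (G n) (f n (fst x)) (f n (fst x'))) \<le> L * \<delta> x x' + 1" using q by auto
    show "\<forall>v\<in>fst (G n). \<exists>x\<in>M \<times> {t n}. real (path_dist (G n) v (f n (fst x))) \<le> 1"
    proof
      fix v assume "v \<in> fst (G n)"
      then obtain x where x: "x \<in> M" "v = f n x" using Gf[of n] by blast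
      then show "\<exists>x\<in>M \<times> {t n}. real (path_dist (G n) v (f n (fst x))) \<le> 1" by (intro bexI[of _ "(x, t n)"]) auto
    qed
    qed
  qed (use L in simp)
qed

end

section \<open>From expanders to expansion in measure\<close>

text \<open>A component and its complement both have empty boundary, and one of them has at most
  half of the vertices. Connectedness is what makes \<open>path_dist\<close> a metric on the
  expander.\<close>

lemma cheeger_connected:
  assumes G: "finite_simple_graph (V, E)" and "0 < e" and ch: "ereal e \<le> cheeger (V, E)" and uv: "u \<in> V" "v \<in> V"
  shows "(u, v) \<in> E\<^sup>*"
proof (rule ccontr)
  assume n: "(u, v) \<notin> E\<^sup>*"
  have fin: "finite V" and E: "E \<subseteq> V \<times> V" "sym E" using G by (auto simp: finite_simple_graph_def)
  define W where "W = E\<^sup>* `` {u}"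
  have WV: "W \<subseteq> V" using E uv(1) unfolding W_def by (auto elim: rtranclE)
  have uW: "u \<in> W" and vW: "v \<in> V - W" using n uv by (auto simp: W_def)
  have "E `` W \<subseteq> W" unfolding W_def by (auto intro: rtrancl_into_rtrancl)
  then have b1: "vertex_boundary (V, E) W = {}" by (auto simp: vertex_boundary_def)
  have b2: "vertex_boundary (V, E) (V - W) = {}"
  proof -
    have "w \<in> W \<Longrightarrow> (x, w) \<in> E \<Longrightarrow> x \<in> W" for x w using \<open>E `` W \<subseteq> W\<close> E(2)[unfolded sym_def] by blast
    then show ?thesis using E(1) by (auto simp: vertex_boundary_def)
  qed
  have no: False if X: "X \<noteq> {}" "X \<subseteq> V" "real (card X) \<le> 1 / 2 * real (card V)" "vertex_boundary (V, E) X = {}" for X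
  proof -
    have "cheeger (V, E) \<le> ereal (real (card (vertex_boundary (V, E) X)) / real (card X))"
      unfolding cheeger_def by (rule INF_lower) (use X in auto)
    then show False using X(4) ch \<open>0 < e\<close> by (metis card.empty div_0 ereal_less_eq(3) not_less of_nat_0 order_trans)
  qed
  have "real (card (V - W)) = real (card V) - real (card W)"
    using card_Diff_subset[OF finite_subset[OF WV fin] WV] card_mono[OF fin WV] by simp
  then have "real (card W) \<le> 1 / 2 * real (card V) \<or> real (card (V - W)) \<le> 1 / 2 * real (card V)" by linarith
  then show False using no[of W] no[of "V - W"] b1 b2 WV uW vW by auto
qed

text \<open>A form of the Cheeger inequality for sets of any size. The factor \<open>D + 1\<close>
  covers both cases, that of a large \<open>W\<close> through
  \<open>vertex_boundary_compl_card\<close>.\<close>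

lemma cheeger_min:
  assumes G: "finite_simple_graph (V, E)" and ch: "ereal e \<le> cheeger (V, E)" "0 < e"
    and deg: "\<And>v. v \<in> V \<Longrightarrow> card (E `` {v}) \<le> D" and W: "W \<subseteq> V"
  shows "e * min (real (card W)) (real (card (V - W))) \<le> (real D + 1) * real (card (vertex_boundary (V, E) W))"
proof -
  have fin: "finite V" using G by (auto simp: finite_simple_graph_def)
  have low: "e * real (card X) \<le> real (card (vertex_boundary (V, E) X))"
    if X: "X \<subseteq> V" "real (card X) \<le> 1 / 2 * real (card V)" for X
  proof (cases "X = {}")
    case False
    then have "0 < real (card X)" using X fin finite_subset by (auto simp: card_gt_0_iff)
    have "cheeger (V, E) \<le> ereal (real (card (vertex_boundary (V, E) X)) / real (card X))"
      unfolding cheeger_def by (rule INF_lower) (use X False in auto)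
    from order_trans[OF ch(1) this] have "ereal e \<le> ereal (real (card (vertex_boundary (V, E) X)) / real (card X))" .
    then show ?thesis using \<open>0 < real (card X)\<close> by (simp add: field_simps)
  qed simp
  show ?thesis
  proof (cases "real (card W) \<le> 1 / 2 * real (card V)")
    case True
    have "e * min (real (card W)) (real (card (V - W))) \<le> e * real (card W)" using ch by (intro mult_left_mono) auto
    also have "\<dots> \<le> 1 * real (card (vertex_boundary (V, E) W))" using low[OF W True] by simp
    also have "\<dots> \<le> (real D + 1) * real (card (vertex_boundary (V, E) W))" by (intro mult_right_mono) auto
    finally show ?thesis .
  next
    case False
    then have "real (card (V - W)) \<le> 1 / 2 * real (card V)"
      using card_Diff_subset[OF finite_subset[OF W fin] W] card_mono[OF fin W] by simp
    note l = low[OF Diff_subset this]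
    have "e * min (real (card W)) (real (card (V - W))) \<le> e * real (card (V - W))" using ch by (intro mult_left_mono) auto
    also have "\<dots> \<le> real (card (vertex_boundary (V, E) (V - W)))" using l .
    also have "\<dots> \<le> real (D * card (vertex_boundary (V, E) W))"
      using vertex_boundary_compl_card[OF G deg W] by (simp only: of_nat_le_iff)
    also have "\<dots> \<le> (real D + 1) * real (card (vertex_boundary (V, E) W))" by (simp add: algebra_simps)
    finally show ?thesis .
  qed
qed

lemma graph_ball_card:
  assumes G: "finite_simple_graph (V, E)" and conn: "\<And>u v. u \<in> V \<Longrightarrow> v \<in> V \<Longrightarrow> (u, v) \<in> E\<^sup>*"
    and deg: "\<And>v. v \<in> V \<Longrightarrow> card (E `` {v}) \<le> D" and u: "u \<in> V"
  shows "card {v \<in> V. path_dist (V, E) u v \<le> k} \<le> (D + 1) ^ k"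
proof (induction k)
  case 0
  have "{v \<in> V. path_dist (V, E) u v \<le> 0} \<subseteq> {u}"
    using path_dist_relpow[of u _ "(V, E)"] conn[OF u] by fastforce
  then have "card {v \<in> V. path_dist (V, E) u v \<le> 0} \<le> card {u}" by (intro card_mono) auto
  then show ?case by simp
next
  case (Suc k)
  have fin: "finite V" and E: "E \<subseteq> V \<times> V" using G by (auto simp: finite_simple_graph_def)
  let ?B = "{v \<in> V. path_dist (V, E) u v \<le> k}"
  have finE: "finite (E `` {v})" for v by (rule finite_subset[OF _ fin]) (use E in auto)
  have "{v \<in> V. path_dist (V, E) u v \<le> Suc k} \<subseteq> ?B \<union> (\<Union>w\<in>?B. E `` {w})"
  proof
    fix v assume "v \<in> {v \<in> V. path_dist (V, E) u v \<le> Suc k}"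
    then have v: "v \<in> V" "path_dist (V, E) u v \<le> Suc k" by auto
    show "v \<in> ?B \<union> (\<Union>w\<in>?B. E `` {w})"
    proof (cases "path_dist (V, E) u v \<le> k")
      case False
      then have "path_dist (V, E) u v = Suc k" using v by simp
      then have "(u, v) \<in> E ^^ Suc k" using path_dist_relpow[of u v "(V, E)"] conn[OF u v(1)] by simp
      then obtain w where w: "(u, w) \<in> E ^^ k" "(w, v) \<in> E" by auto
      then have "path_dist (V, E) u w \<le> k" by (intro path_dist_le) simp
      then have "w \<in> ?B" using w E by auto
      then show ?thesis using w by blast
    qed (use v in auto)
  qed
  then have "card {v \<in> V. path_dist (V, E) u v \<le> Suc k} \<le> card (?B \<union> (\<Union>w\<in>?B. E `` {w}))"
    by (rule card_mono[rotated]) (use fin finE in auto)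
  also have "\<dots> \<le> card ?B + card (\<Union>w\<in>?B. E `` {w})" by (rule card_Un_le)
  also have "card (\<Union>w\<in>?B. E `` {w}) \<le> (\<Sum>w\<in>?B. card (E `` {w}))" by (rule card_UN_le) (use fin in auto)
  also have "\<dots> \<le> (\<Sum>w\<in>?B. D)" using deg by (intro sum_mono) auto
  finally have "card {v \<in> V. path_dist (V, E) u v \<le> Suc k} \<le> (D + 1) * card ?B" by (simp add: mult.commute)
  also have "\<dots> \<le> (D + 1) * (D + 1) ^ k" using Suc.IH by (rule mult_le_mono2)
  finally show ?case by simp
qed

text \<open>Integrate the number of sets that contain a point; it is at most \<open>k\<close> on
  \<open>Z\<close> and 0 elsewhere.\<close>

lemma (in finite_measure) sum_measure_overlap:
  assumes I: "finite I" and B: "\<And>i. i \<in> I \<Longrightarrow> B i \<in> sets M" "\<And>i. i \<in> I \<Longrightarrow> B i \<subseteq> Z" and Z: "Z \<in> sets M"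
    and ov: "\<And>x. x \<in> Z \<Longrightarrow> card {i \<in> I. x \<in> B i} \<le> k"
  shows "(\<Sum>i\<in>I. measure M (B i)) \<le> real k * measure M Z"
proof -
  have int: "integrable M (\<lambda>x. indicator (B i) x :: real)" if "i \<in> I" for i
    by (rule integrable_real_indicator[OF B(1)[OF that]]) (simp add: less_top[symmetric])
  have iZ: "integrable M (\<lambda>x. indicator Z x :: real)"
    by (rule integrable_real_indicator[OF Z]) (simp add: less_top[symmetric])
  have "measure M (B i) = (\<integral>x. indicator (B i) x \<partial>M)" if "i \<in> I" for i
    using sets.sets_into_space[OF B(1)[OF that]] by (simp add: Int_absorb2)
  then have "(\<Sum>i\<in>I. measure M (B i)) = (\<Sum>i\<in>I. \<integral>x. indicator (B i) x \<partial>M)" by (intro sum.cong) auto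
  also have "\<dots> = (\<integral>x. (\<Sum>i\<in>I. indicator (B i) x) \<partial>M)"
    using int by (intro Bochner_Integration.integral_sum[symmetric]) auto
  also have "\<dots> \<le> (\<integral>x. real k * indicator Z x \<partial>M)"
  proof (rule integral_mono)
    show "integrable M (\<lambda>x. \<Sum>i\<in>I. indicator (B i) x :: real)" using int by (intro Bochner_Integration.integrable_sum) auto
    show "integrable M (\<lambda>x. real k * indicator Z x)" using iZ by simp
    fix x
    have "(\<Sum>i\<in>I. indicator (B i) x :: real) = real (card {i \<in> I. x \<in> B i})"
      using I by (simp add: indicator_def sum.If_cases Int_def)
    moreover have "{i \<in> I. x \<in> B i} = {}" if "x \<notin> Z" using B(2) that by blast
    ultimately show "(\<Sum>i\<in>I. indicator (B i) x) \<le> real k * indicator Z x"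
      using ov[of x] by (cases "x \<in> Z") auto
  qed
  also have "\<dots> = real k * measure M Z" using Z sets.sets_into_space by (simp add: Int_absorb2)
  finally show ?thesis .
qed

context mm_action begin

section \<open>Iterated saturations and walks\<close>

lemma sat_power_sets: "A \<in> sets \<nu> \<Longrightarrow> (sat ^^ m) A \<in> sets \<nu>"
  by (induction m) (auto intro: sat_sets)

lemma sat_power_mono: "A \<subseteq> B \<Longrightarrow> (sat ^^ m) A \<subseteq> (sat ^^ m) B"
  by (induction m) (auto intro: sat_mono[THEN subsetD])

lemma sat_power_subset: "A \<subseteq> M \<Longrightarrow> (sat ^^ m) A \<subseteq> M"
  by (induction m) (use sat_subset in auto)

lemma sat_power_Un: "(sat ^^ m) (A \<union> B) = (sat ^^ m) A \<union> (sat ^^ m) B"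
  by (induction m) (auto simp: sat_Un)

lemma sat_power_measure: "A \<in> sets \<nu> \<Longrightarrow> measure \<nu> ((sat ^^ m) A) \<le> (card S * \<Theta>) ^ m * measure \<nu> A"
proof (induction m)
  case (Suc m)
  have "measure \<nu> ((sat ^^ Suc m) A) \<le> card S * \<Theta> * measure \<nu> ((sat ^^ m) A)"
    using sat_measure[OF sat_power_sets[OF Suc.prems]] by simp
  also have "\<dots> \<le> card S * \<Theta> * ((card S * \<Theta>) ^ m * measure \<nu> A)"
    using Suc Theta by (intro mult_left_mono) auto
  finally show ?case by simp
qed simp

text \<open>A point that is new after \<open>Suc m\<close> saturations is reached from one that was
  new after \<open>m\<close>, or is new after a single one. The first kind is controlled by
  \<open>sat_measure\<close>, whence the geometric sum.\<close>

lemma sat_power_growth: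
  assumes A: "A \<in> sets \<nu>"
  shows "measure \<nu> ((sat ^^ m) A - A) \<le> (\<Sum>i<m. (card S * \<Theta>) ^ i) * measure \<nu> (sat A - A)"
proof (induction m)
  case (Suc m)
  let ?X = "(sat ^^ m) A"
  have X: "?X \<in> sets \<nu>" "sat A \<in> sets \<nu>" using sat_power_sets A sat_sets by auto
  have "(sat ^^ Suc m) A \<subseteq> sat (?X - A) \<union> sat A" by (simp add: sat_Un[symmetric] sat_mono)
  then have "(sat ^^ Suc m) A - A \<subseteq> sat (?X - A) \<union> (sat A - A)" by blast
  then have "measure \<nu> ((sat ^^ Suc m) A - A) \<le> measure \<nu> (sat (?X - A) \<union> (sat A - A))"
    using X A sat_sets by (intro finite_measure_mono) auto
  also have "\<dots> \<le> measure \<nu> (sat (?X - A)) + measure \<nu> (sat A - A)"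
    using X A sat_sets by (intro measure_Un_le) auto
  also have "measure \<nu> (sat (?X - A)) \<le> card S * \<Theta> * measure \<nu> (?X - A)" using X A by (intro sat_measure) auto
  also have "\<dots> \<le> card S * \<Theta> * ((\<Sum>i<m. (card S * \<Theta>) ^ i) * measure \<nu> (sat A - A))"
    using Suc Theta by (intro mult_left_mono) auto
  finally have "measure \<nu> ((sat ^^ Suc m) A - A) \<le> (card S * \<Theta> * (\<Sum>i<m. (card S * \<Theta>) ^ i) + 1) * measure \<nu> (sat A - A)"
    by (simp add: algebra_simps)
  also have "card S * \<Theta> * (\<Sum>i<m. (card S * \<Theta>) ^ i) + 1 = (\<Sum>i<Suc m. (card S * \<Theta>) ^ i)"
    by (subst sum.lessThan_Suc_shift) (simp add: sum_distrib_left)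
  finally show ?case .
qed simp

text \<open>The displacement, in units of \<open>1 / t\<close>, by which the end of a walk of
  \<open>m\<close> steps may miss the points reached by jumps alone. A jump multiplies it by at most
  \<open>\<Lambda>\<close>, a move adds 1, and the recursion allows for both.\<close>

fun spread :: "nat \<Rightarrow> real" where
  "spread 0 = 0"
| "spread (Suc m) = \<Lambda> * spread m + 1"

lemma spread_nonneg: "0 \<le> spread m"
  using Lambda by (induction m) auto

lemma steps_power_sat:
  assumes t: "0 < t" and x: "x \<in> M" and "(x, z) \<in> steps t ^^ m"
  shows "\<exists>y\<in>(sat ^^ m) {x}. d z y \<le> spread m / t"
  using assms(3)
proof (induction m arbitrary: z)
  case 0
  then show ?case using x by simp
next
  case (Suc m)
  then obtain z' where z': "(x, z') \<in> steps t ^^ m" "(z', z) \<in> steps t" by auto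
  obtain y where y: "y \<in> (sat ^^ m) {x}" "d z' y \<le> spread m / t" using Suc.IH[OF z'(1)] by blast
  have yM: "y \<in> M" using y(1) sat_power_subset[of "{x}" m] x by blast
  have zM: "z' \<in> M" "z \<in> M" using z'(2) steps_iff by blast+
  consider "d z' z \<le> 1 / t" | s where "s \<in> S" "z = act s z'" using z'(2) steps_iff by blast
  then show ?case
  proof cases
    case 1
    have "d z y \<le> d z z' + d z' y" using triangle zM yM by blast
    also have "\<dots> \<le> 1 / t + spread m / t" using 1 y(2) by (simp add: commute)
    also have "\<dots> \<le> spread (Suc m) / t"
    proof -
      have "1 * spread m \<le> \<Lambda> * spread m" using Lambda spread_nonneg by (intro mult_right_mono) auto
      then show ?thesis using t by (simp add: add_divide_distrib[symmetric] divide_right_mono)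
    qed
    finally have "d z y \<le> spread (Suc m) / t" .
    moreover have "y \<in> (sat ^^ Suc m) {x}" using sat_superset[OF sat_power_subset[of "{x}" m]] x y(1) by auto
    ultimately show ?thesis by blast
  next
    case 2
    have "d z (act s y) \<le> \<Lambda> * d z' y" unfolding 2(2) by (rule act_lipschitz[OF 2(1) zM(1) yM])
    also have "\<dots> \<le> \<Lambda> * (spread m / t)" using y(2) Lambda by (intro mult_left_mono) auto
    also have "\<dots> \<le> spread (Suc m) / t" using t by (simp add: field_simps)
    finally have "d z (act s y) \<le> spread (Suc m) / t" .
    moreover have "act s y \<in> sat ((sat ^^ m) {x})" using 2(1) y(1) unfolding sat_def[of "(sat ^^ m) {x}"] by blast
    then have "act s y \<in> (sat ^^ Suc m) {x}" by simp
    ultimately show ?thesis by blast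
  qed
qed

text \<open>The jumps are undone by inverse generators, so a displacement after them becomes a
  displacement of the starting point, at the cost of a factor \<open>\<Lambda>\<close> per
  jump.\<close>

lemma sat_power_pullback:
  assumes "x \<in> M" "y \<in> (sat ^^ m) {x}" "z \<in> M"
  shows "\<exists>x'\<in>M. z \<in> (sat ^^ m) {x'} \<and> d x x' \<le> \<Lambda> ^ m * d y z"
  using assms(2,3)
proof (induction m arbitrary: y z)
  case (Suc m)
  then have "y \<in> sat ((sat ^^ m) {x})" by simp
  then obtain s y1 where s: "s \<in> S" "y1 \<in> (sat ^^ m) {x}" "y = act s y1"
    unfolding sat_def[of "(sat ^^ m) {x}"] by blast
  obtain s' where s': "s' \<in> S" "\<And>x. x \<in> M \<Longrightarrow> act s' (act s x) = x \<and> act s (act s' x) = x" using act_inverse[OF s(1)] by blast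
  have y1: "y1 \<in> M" "y \<in> M" using sat_power_subset[of "{x}" m] assms(1) s act_closed by auto
  have z1: "act s' z \<in> M" using act_closed s'(1) Suc.prems(2) by blast
  obtain x' where x': "x' \<in> M" "act s' z \<in> (sat ^^ m) {x'}" "d x x' \<le> \<Lambda> ^ m * d y1 (act s' z)"
    using Suc.IH[OF s(2) z1] by blast
  have "d y1 (act s' z) = d (act s' y) (act s' z)" using s'(2)[OF y1(1)] s(3) by simp
  also have "\<dots> \<le> \<Lambda> * d y z" by (rule act_lipschitz[OF s'(1) y1(2) Suc.prems(2)])
  finally have "\<Lambda> ^ m * d y1 (act s' z) \<le> \<Lambda> ^ m * (\<Lambda> * d y z)" using Lambda by (intro mult_left_mono) auto
  then have "d x x' \<le> \<Lambda> ^ Suc m * d y z" using x'(3) by (simp add: algebra_simps)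
  moreover have "z = act s (act s' z)" using s'(2)[OF Suc.prems(2)] by simp
  then have "z \<in> sat ((sat ^^ m) {x'})" using x'(2) s(1) unfolding sat_def[of "(sat ^^ m) {x'}"] by blast
  then have "z \<in> (sat ^^ Suc m) {x'}" by simp
  ultimately show ?case using x'(1) by blast
qed (use assms in auto)

lemma sat_power_card:
  assumes "x \<in> M"
  shows "finite ((sat ^^ m) {x})" "card ((sat ^^ m) {x}) \<le> card S ^ m"
proof (induction m)
  case (Suc m)
  case 1
  show ?case using Suc finite_S by (simp add: sat_def)
  case 2
  have "card ((sat ^^ Suc m) {x}) \<le> (\<Sum>s\<in>S. card (act s ` (sat ^^ m) {x}))"
    using card_UN_le[OF finite_S, of "\<lambda>s. act s ` (sat ^^ m) {x}"] by (simp add: sat_def[of "(sat ^^ m) {x}"])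
  also have "\<dots> \<le> (\<Sum>s\<in>S. card S ^ m)"
    using Suc by (intro sum_mono) (meson card_image_le order_trans)
  finally show ?case by simp
qed auto

text \<open>A walk of at most \<open>m\<close> steps from \<open>K\<close> amounts to a short
  displacement followed by jumps. Once the level is so high that the displacement is below
  \<open>r\<close>, it stays in \<open>U\<close>, and the jumps lead into the saturation of
  \<open>U\<close>.\<close>

lemma separated_steps:
  assumes t: "0 < t" and K: "K \<subseteq> M" "k \<in> K" and sep: "\<And>k y. k \<in> K \<Longrightarrow> y \<in> M \<Longrightarrow> d k y < r \<Longrightarrow> y \<in> U"
    and st: "(k, z) \<in> steps t ^^ j" "j \<le> m" "z \<in> M" and small: "\<Lambda> ^ m * (spread m / t) < r"
  shows "z \<in> (sat ^^ m) U"
proof -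
  have kM: "k \<in> M" using K by blast
  have "(k, z) \<in> steps t ^^ m" by (rule steps_power_mono[OF t kM st(1,2)])
  then obtain y where y: "y \<in> (sat ^^ m) {k}" "d z y \<le> spread m / t" using steps_power_sat[OF t kM] by blast
  obtain x' where x': "x' \<in> M" "z \<in> (sat ^^ m) {x'}" "d k x' \<le> \<Lambda> ^ m * d y z"
    using sat_power_pullback[OF kM y(1) st(3)] by blast
  have "\<Lambda> ^ m * d y z \<le> \<Lambda> ^ m * (spread m / t)" using y(2) Lambda by (intro mult_left_mono) (auto simp: commute)
  then have "x' \<in> U" using sep[OF K(2) x'(1)] x'(3) small by simp
  then show ?thesis using x'(2) sat_power_mono[of "{x'}" U m] by blast
qed

text \<open>Points with the same image under \<open>F\<close> are at most \<open>H\<close> steps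
  apart, so a fibre lies in at most \<open>card S ^ H\<close> balls of radius proportional to
  \<open>1 / t\<close>. This bounds the measure of a set by the number of vertices it meets.\<close>

lemma fibre_cover:
  assumes t: "1 \<le> t" and V: "finite V" "F ` M \<subseteq> V"
    and q: "\<And>x y. x \<in> M \<Longrightarrow> y \<in> M \<Longrightarrow> F x = F y \<Longrightarrow> step_dist t x y \<le> H"
    and Y: "Y \<in> sets \<nu>"
  shows "measure \<nu> Y \<le> real (card (F ` Y)) * (real (card S ^ H) * C * (spread H + 1) ^ N * (1 / t) ^ N)"
proof -
  have t0: "0 < t" using t by simp
  have YM: "Y \<subseteq> M" using sets_subset[OF Y] .
  have fin: "finite (F ` Y)" using V YM by (meson finite_subset image_mono order_trans)
  define xv where "xv v = (SOME x. x \<in> M \<and> F x = v)" for v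
  have xv: "xv v \<in> M \<and> F (xv v) = v" if "v \<in> F ` Y" for v
    unfolding xv_def by (rule someI_ex) (use that YM in auto)
  \<comment> \<open>One more than \<open>spread H\<close> because the balls are open.\<close>
  define R where "R = (spread H + 1) / t"
  have R: "0 < R" "spread H / t < R" using spread_nonneg[of H] t0 by (auto simp: R_def divide_strict_right_mono)
  define Z where "Z v = (\<Union>y\<in>(sat ^^ H) {xv v}. mball y R)" for v
  have Zs: "Z v \<in> sets \<nu>" if "v \<in> F ` Y" for v
    unfolding Z_def using sat_power_card(1) xv[OF that] by (intro sets.finite_UN) auto
  have Zm: "measure \<nu> (Z v) \<le> real (card S ^ H) * C * (spread H + 1) ^ N * (1 / t) ^ N" if v: "v \<in> F ` Y" for v
  proof -
    have x: "xv v \<in> M" using xv[OF v] by blast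
    have "measure \<nu> (Z v) \<le> (\<Sum>y\<in>(sat ^^ H) {xv v}. measure \<nu> (mball y R))"
      unfolding Z_def by (rule finite_measure_subadditive_finite) (use sat_power_card(1)[OF x] in auto)
    also have "\<dots> \<le> (\<Sum>y\<in>(sat ^^ H) {xv v}. C * R ^ N)"
      using ball_upper R sat_power_subset[of "{xv v}" H] x by (intro sum_mono) auto
    also have "\<dots> = real (card ((sat ^^ H) {xv v})) * (C * R ^ N)" by simp
    also have "\<dots> \<le> real (card S ^ H) * (C * R ^ N)"
      using sat_power_card(2)[OF x, of H] C_pos R by (intro mult_right_mono) (auto simp only: of_nat_le_iff, auto)
    also have "\<dots> = real (card S ^ H) * C * (spread H + 1) ^ N * (1 / t) ^ N"
      by (simp add: R_def power_divide)
    finally show ?thesis .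
  qed
  have "Y \<subseteq> (\<Union>v\<in>F ` Y. Z v)"
  proof
    fix y assume y: "y \<in> Y"
    define v where "v = F y"
    have v: "v \<in> F ` Y" using y by (simp add: v_def)
    have x: "xv v \<in> M" "F (xv v) = F y" "y \<in> M" using xv[OF v] y YM by (auto simp: v_def)
    have "(xv v, y) \<in> steps t ^^ H"
      by (rule steps_power_mono[OF t0 x(1) step_dist_relpow[OF t0 x(1,3)] q[OF x(1,3,2)]])
    then obtain z where z: "z \<in> (sat ^^ H) {xv v}" "d y z \<le> spread H / t" using steps_power_sat[OF t0 x(1)] by blast
    have "z \<in> M" using z(1) sat_power_subset[of "{xv v}" H] x by auto
    then have "y \<in> mball z R" using z(2) R x by (simp add: commute)
    then show "y \<in> (\<Union>v\<in>F ` Y. Z v)" using v z(1) by (auto simp: Z_def)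
  qed
  then have "measure \<nu> Y \<le> measure \<nu> (\<Union>v\<in>F ` Y. Z v)" using fin Zs by (intro finite_measure_mono sets.finite_UN) auto
  also have "\<dots> \<le> (\<Sum>v\<in>F ` Y. measure \<nu> (Z v))" using fin Zs by (intro finite_measure_subadditive_finite) auto
  also have "\<dots> \<le> (\<Sum>v\<in>F ` Y. real (card S ^ H) * C * (spread H + 1) ^ N * (1 / t) ^ N)" using Zm by (rule sum_mono)
  finally show ?thesis by simp
qed

text \<open>The core estimate: a separated pair \<open>K \<subseteq> U\<close> is turned into a vertex set of an expander that is
  quasi-isometric to the step graph; balls around the boundary vertices lie in \<open>S\<^sup>m U - K\<close>.\<close>

lemma expander_separated_bound:
  assumes t: "1 \<le> t" and G: "finite_simple_graph (V, E)" and deg: "\<And>v. v \<in> V \<Longrightarrow> card (E `` {v}) \<le> D"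
    and ch: "ereal e \<le> cheeger (V, E)" "0 < e" and F: "F ` M \<subseteq> V"
    and q1: "\<And>x y. x \<in> M \<Longrightarrow> y \<in> M \<Longrightarrow> path_dist (V, E) (F x) (F y) \<le> H * (step_dist t x y + 1)"
    and q2: "\<And>x y. x \<in> M \<Longrightarrow> y \<in> M \<Longrightarrow> step_dist t x y \<le> H * (path_dist (V, E) (F x) (F y) + 1)"
    and q3: "\<And>v. v \<in> V \<Longrightarrow> \<exists>x\<in>M. path_dist (V, E) v (F x) \<le> H"
    and KU: "K \<in> sets \<nu>" "U \<in> sets \<nu>" and sep: "\<And>k y. k \<in> K \<Longrightarrow> y \<in> M \<Longrightarrow> d k y < r \<Longrightarrow> y \<in> U"
    and m: "m = H * (4 * H + 2) + 1" and small: "\<Lambda> ^ m * (spread m / t) < r"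
    and C': "C' = real (card S ^ H) * C * (spread H + 1) ^ N"
  shows "e * c * min (measure \<nu> K) (measure \<nu> (M - (sat ^^ m) U)) \<le>
    C' * (real D + 1) * real ((D + 1) ^ (3 * H)) * measure \<nu> ((sat ^^ m) U - K)"
proof -
  have t0: "0 < t" using t by simp
  have finV: "finite V" and E: "E \<subseteq> V \<times> V" "sym E" using G by (auto simp: finite_simple_graph_def)
  have conn: "(u, v) \<in> E\<^sup>*" if "u \<in> V" "v \<in> V" for u v by (rule cheeger_connected[OF G ch(2,1) that])
  let ?q = "path_dist (V, E)"
  have qtri: "?q u w \<le> ?q u v + ?q v w" if "u \<in> V" "v \<in> V" "w \<in> V" for u v w
    by (rule path_dist_triangle) (use conn that in auto)
  have qsym: "?q u v = ?q v u" for u v by (rule path_dist_sym) (use E in simp)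
  have FV: "F x \<in> V" if "x \<in> M" for x using F that by blast
  have KM: "K \<subseteq> M" using sets_subset KU by blast
  \<comment> \<open>The radius \<open>3 * H\<close> makes the balls around boundary vertices avoid
    \<open>K\<close>: the image of such a ball stays within \<open>3 * H\<close> of its vertex, so a
    point of \<open>K\<close> in the ball would put the vertex into \<open>W\<close>.\<close>
  define W where "W = {v \<in> V. \<exists>k\<in>K. ?q (F k) v \<le> 3 * H}"
  have WV: "W \<subseteq> V" by (auto simp: W_def)
  define Z where "Z = (sat ^^ m) U - K"
  have Us: "(sat ^^ m) U \<in> sets \<nu>" using sat_power_sets KU by blast
  have Zs: "Z \<in> sets \<nu>" using Us KU by (auto simp: Z_def)
  have inU: "z \<in> (sat ^^ m) U" if k: "k \<in> K" and z: "z \<in> M" and st: "step_dist t k z \<le> m" for k z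
    by (rule separated_steps[OF t0 KM k sep step_dist_relpow[OF t0 subsetD[OF KM k] z] st z small])
  have C'0: "0 \<le> C'" unfolding C' using C_pos spread_nonneg[of H] by simp
  have tN: "0 < (1 / t) ^ N" using t0 by simp
  have qH: "step_dist t x y \<le> H" if "x \<in> M" "y \<in> M" "F x = F y" for x y using q2[OF that(1,2)] that(3) by simp
  have A1: "measure \<nu> K \<le> C' * (1 / t) ^ N * real (card W)"
  proof -
    have "F ` K \<subseteq> W" using KM FV by (force simp: W_def)
    then have "real (card (F ` K)) \<le> real (card W)" using finite_subset[OF WV finV] by (simp add: card_mono)
    then have le: "real (card (F ` K)) * (C' * (1 / t) ^ N) \<le> real (card W) * (C' * (1 / t) ^ N)"
      using C'0 tN by (intro mult_right_mono) auto
    have "measure \<nu> K \<le> real (card (F ` K)) * (C' * (1 / t) ^ N)"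
      unfolding C' by (rule fibre_cover[OF t finV F qH KU(1)])
    from order_trans[OF this le] show ?thesis by (subst mult.commute)
  qed
  have A2: "measure \<nu> (M - (sat ^^ m) U) \<le> C' * (1 / t) ^ N * real (card (V - W))"
  proof -
    have Ys: "M - (sat ^^ m) U \<in> sets \<nu>" using sets.compl_sets[OF Us] by (simp add: space_nu)
    have "F ` (M - (sat ^^ m) U) \<subseteq> V - W"
    proof (rule image_subsetI)
      fix z assume z: "z \<in> M - (sat ^^ m) U"
      have "F z \<notin> W"
      proof
        assume "F z \<in> W"
        then obtain k where k: "k \<in> K" "?q (F k) (F z) \<le> 3 * H" by (auto simp: W_def)
        have "step_dist t k z \<le> H * (?q (F k) (F z) + 1)" using q2 k(1) KM z by blast
        also have "\<dots> \<le> H * (4 * H + 2)" using k(2) by (intro mult_le_mono) auto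
        also have "\<dots> \<le> m" by (simp add: m)
        finally show False using inU[OF k(1)] z by blast
      qed
      then show "F z \<in> V - W" using FV z by blast
    qed
    then have "real (card (F ` (M - (sat ^^ m) U))) \<le> real (card (V - W))" using finV by (simp add: card_mono)
    then have le: "real (card (F ` (M - (sat ^^ m) U))) * (C' * (1 / t) ^ N) \<le> real (card (V - W)) * (C' * (1 / t) ^ N)"
      using C'0 tN by (intro mult_right_mono) auto
    have "measure \<nu> (M - (sat ^^ m) U) \<le> real (card (F ` (M - (sat ^^ m) U))) * (C' * (1 / t) ^ N)"
      unfolding C' by (rule fibre_cover[OF t finV F qH Ys])
    from order_trans[OF this le] show ?thesis by (subst mult.commute)
  qed
  define B where "B = vertex_boundary (V, E) W"
  have BV: "B \<subseteq> V" using E by (auto simp: B_def vertex_boundary_def)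
  define xv where "xv v = (SOME x. x \<in> M \<and> ?q v (F x) \<le> H)" for v
  have xv: "xv v \<in> M \<and> ?q v (F (xv v)) \<le> H" if "v \<in> V" for v
    unfolding xv_def by (rule someI_ex) (use q3[OF that] in auto)
  have one: "step_dist t (xv v) y \<le> 1" if "v \<in> V" "y \<in> mball (xv v) (1 / t)" for v y
    by (rule path_dist_le) (use that in \<open>auto simp: steps_iff\<close>)
  \<comment> \<open>\<open>H\<close> for the way between the vertex and the image of its point
    \<open>xv v\<close>, and \<open>2 * H\<close> for the image of a single step.\<close>
  have near: "?q (F y) v \<le> 3 * H" if v: "v \<in> V" and y: "y \<in> mball (xv v) (1 / t)" for v y
  proof -
    have yM: "y \<in> M" using y by auto
    have x: "xv v \<in> M" "?q v (F (xv v)) \<le> H" using xv[OF v] by auto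
    have "?q (F (xv v)) (F y) \<le> H * (step_dist t (xv v) y + 1)" using q1 x yM by blast
    also have "\<dots> \<le> H * 2" using one[OF v y] by (intro mult_le_mono) auto
    finally have "?q v (F y) \<le> 3 * H" using qtri[OF v FV[OF x(1)] FV[OF yM]] x(2) by simp
    then show ?thesis using qsym by simp
  qed
  have sub: "mball (xv v) (1 / t) \<subseteq> Z" if v: "v \<in> B" for v
  proof
    fix y assume y: "y \<in> mball (xv v) (1 / t)"
    then have yM: "y \<in> M" by auto
    have vV: "v \<in> V" "v \<notin> W" using v BV by (auto simp: B_def vertex_boundary_def)
    obtain w where w: "w \<in> W" "(w, v) \<in> E" using v by (auto simp: B_def vertex_boundary_def)
    obtain k where k: "k \<in> K" "?q (F k) w \<le> 3 * H" and wV: "w \<in> V" using w(1) by (auto simp: W_def)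
    have kM: "k \<in> M" using k KM by blast
    have x: "xv v \<in> M" "?q v (F (xv v)) \<le> H" using xv[OF vV(1)] by auto
    have "?q w v \<le> 1" by (rule path_dist_le) (use w in simp)
    then have "?q (F k) v \<le> 3 * H + 1" using qtri[OF FV[OF kM] wV vV(1)] k(2) by simp
    \<comment> \<open>The way from \<open>F k\<close> takes \<open>3 * H\<close> to reach
      \<open>w\<close>, one edge to \<open>v\<close>, and \<open>H\<close> to the image of
      \<open>xv v\<close>. By \<open>q2\<close> this becomes at most \<open>H * (4 * H + 2)\<close>
      steps, and the step from \<open>xv v\<close> to \<open>y\<close> accounts for the last 1 in
      \<open>m\<close>.\<close>
    then have "?q (F k) (F (xv v)) \<le> 4 * H + 1" using qtri[OF FV[OF kM] vV(1) FV[OF x(1)]] x(2) by simp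
    then have "H * (?q (F k) (F (xv v)) + 1) \<le> H * (4 * H + 2)" by (intro mult_le_mono) auto
    then have "step_dist t k (xv v) \<le> H * (4 * H + 2)" using q2[OF kM x(1)] by simp
    then have "step_dist t k y \<le> m" using step_dist_triangle[OF t0 kM x(1) yM] one[OF vV(1) y] by (simp add: m)
    then have "y \<in> (sat ^^ m) U" using inU[OF k(1) yM] by blast
    moreover have "y \<notin> K" using near[OF vV(1) y] vV by (auto simp: W_def)
    ultimately show "y \<in> Z" by (simp add: Z_def)
  qed
  \<comment> \<open>The balls may overlap, but a point lies only in balls whose vertices are within
    \<open>3 * H\<close> of its image, and the degree bound limits their number.\<close>
  have ov: "card {v \<in> B. y \<in> mball (xv v) (1 / t)} \<le> (D + 1) ^ (3 * H)" if y: "y \<in> Z" for y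
  proof -
    have yM: "y \<in> M" using y sat_power_subset[of U m] sets_subset KU by (auto simp: Z_def)
    have "{v \<in> B. y \<in> mball (xv v) (1 / t)} \<subseteq> {v \<in> V. ?q (F y) v \<le> 3 * H}" using near BV by blast
    then have "card {v \<in> B. y \<in> mball (xv v) (1 / t)} \<le> card {v \<in> V. ?q (F y) v \<le> 3 * H}"
      by (rule card_mono[rotated]) (use finV in simp)
    also have "\<dots> \<le> (D + 1) ^ (3 * H)" by (rule graph_ball_card[OF G conn deg FV[OF yM]])
    finally show ?thesis .
  qed
  have "real (card B) * (c * (1 / t) ^ N) = (\<Sum>v\<in>B. c * (1 / t) ^ N)" by simp
  also have "\<dots> \<le> (\<Sum>v\<in>B. measure \<nu> (mball (xv v) (1 / t)))"
    using ball_lower[of _ "1 / t"] xv BV t by (intro sum_mono) auto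
  also have "\<dots> \<le> real ((D + 1) ^ (3 * H)) * measure \<nu> Z"
    by (rule sum_measure_overlap[OF finite_subset[OF BV finV] _ sub Zs ov]) auto
  finally have A3: "real (card B) * (c * (1 / t) ^ N) \<le> real ((D + 1) ^ (3 * H)) * measure \<nu> Z" .
  define T where "T = (1 / t) ^ N"
  have "min (measure \<nu> K) (measure \<nu> (M - (sat ^^ m) U)) \<le> C' * T * min (real (card W)) (real (card (V - W)))"
  proof (cases "real (card W) \<le> real (card (V - W))")
    case True
    then show ?thesis using A1 by (simp add: T_def min_def)
  next
    case False
    then show ?thesis using A2 by (simp add: T_def min_def)
  qed
  then have "e * c * min (measure \<nu> K) (measure \<nu> (M - (sat ^^ m) U)) \<le> e * c * (C' * T * min (real (card W)) (real (card (V - W))))"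
    using ch c_pos by (intro mult_left_mono) auto
  also have "\<dots> = C' * T * c * (e * min (real (card W)) (real (card (V - W))))" by (simp add: mult_ac)
  also have "\<dots> \<le> C' * T * c * ((real D + 1) * real (card B))"
    unfolding B_def using cheeger_min[OF G ch deg WV] C'0 tN c_pos by (intro mult_left_mono) (auto simp: T_def)
  also have "\<dots> = C' * (real D + 1) * (real (card B) * (c * T))" by (simp add: mult_ac)
  also have "\<dots> \<le> C' * (real D + 1) * (real ((D + 1) ^ (3 * H)) * measure \<nu> Z)"
    using A3 C'0 by (intro mult_left_mono) (auto simp: T_def)
  finally show ?thesis by (simp only: Z_def mult.assoc)
qed

lemma family_imp_expanding:
  assumes \<delta>: "\<And>t x y. 1 \<le> t \<Longrightarrow> x \<in> M \<Longrightarrow> y \<in> M \<Longrightarrow> \<delta> (x, t) (y, t) \<le> real (step_dist t x y)"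
      "\<And>t x y. 1 \<le> t \<Longrightarrow> x \<in> M \<Longrightarrow> y \<in> M \<Longrightarrow> real (step_dist t x y) \<le> K0 * \<delta> (x, t) (y, t) + 1"
    and K0: "0 \<le> K0" and t: "level_sequence t"
    and fam: "forms_expander_family (\<lambda>n. M \<times> {t n}) (\<lambda>n. \<delta>)"
  shows "\<exists>\<alpha>>0. \<forall>A\<in>sets \<nu>. measure \<nu> A \<le> measure \<nu> M / 2 \<longrightarrow> (1 + \<alpha>) * measure \<nu> A \<le> measure \<nu> (sat A)"
proof -
  have t1: "1 \<le> t n" for n using t by (simp add: level_sequence_def)
  obtain G L A0 f where ef: "expander_family (G :: nat \<Rightarrow> nat graph)" and LA: "1 \<le> (L :: real)" "0 \<le> (A0 :: real)"
    and f: "\<And>n. f n ` (M \<times> {t n}) \<subseteq> fst (G n) \<and>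
          (\<forall>x\<in>M \<times> {t n}. \<forall>x'\<in>M \<times> {t n}.
             1 / L * \<delta> x x' - A0 \<le> real (path_dist (G n) (f n x) (f n x')) \<and>
             real (path_dist (G n) (f n x) (f n x')) \<le> L * \<delta> x x' + A0) \<and>
          (\<forall>v\<in>fst (G n). \<exists>x\<in>M \<times> {t n}. real (path_dist (G n) v (f n x)) \<le> A0)"
    using fam unfolding forms_expander_family_def by auto
  obtain D e where e: "0 < (e :: real)" and De: "\<And>n. (\<forall>v\<in>fst (G n). card (snd (G n) `` {v}) \<le> D) \<and> cheeger (G n) \<ge> ereal e"
    and Gs: "\<And>n. finite_simple_graph (G n)" using ef unfolding expander_family_def by auto
  define F where "F n x = f n (x, t n)" for n x
  \<comment> \<open>One integer that majorises all constants arising when the quasi-isometry to the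
    expander is composed with the comparison of \<open>\<delta>\<close> and the step
    distance.\<close>
  define H where "H = nat \<lceil>max (max L A0) (max (K0 * L) (K0 * L * A0 + 1))\<rceil>"
  have H: "L \<le> real H" "A0 \<le> real H" "K0 * L \<le> real H" "K0 * L * A0 + 1 \<le> real H" unfolding H_def by linarith+
  have q1: "path_dist (G n) (F n x) (F n y) \<le> H * (step_dist (t n) x y + 1)" if "x \<in> M" "y \<in> M" for n x y
  proof -
    have "real (path_dist (G n) (F n x) (F n y)) \<le> L * \<delta> (x, t n) (y, t n) + A0" using f[of n] that by (auto simp: F_def)
    also have "\<dots> \<le> L * real (step_dist (t n) x y) + A0" using \<delta>(1)[OF t1 that] LA by (simp add: mult_left_mono)
    also have "\<dots> \<le> real H * real (step_dist (t n) x y) + real H" using H by (intro add_mono mult_right_mono) auto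
    also have "\<dots> = real (H * (step_dist (t n) x y + 1))" by (simp add: algebra_simps)
    finally show ?thesis by (simp only: of_nat_le_iff)
  qed
  have q2: "step_dist (t n) x y \<le> H * (path_dist (G n) (F n x) (F n y) + 1)" if "x \<in> M" "y \<in> M" for n x y
  proof -
    have "1 / L * \<delta> (x, t n) (y, t n) - A0 \<le> real (path_dist (G n) (F n x) (F n y))" using f[of n] that by (auto simp: F_def)
    then have "\<delta> (x, t n) (y, t n) \<le> L * (real (path_dist (G n) (F n x) (F n y)) + A0)" using LA by (simp add: field_simps)
    then have "K0 * \<delta> (x, t n) (y, t n) \<le> K0 * (L * (real (path_dist (G n) (F n x) (F n y)) + A0))" using K0 by (rule mult_left_mono)
    then have "real (step_dist (t n) x y) \<le> K0 * L * real (path_dist (G n) (F n x) (F n y)) + (K0 * L * A0 + 1)"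
      using \<delta>(2)[OF t1[of n] that] by (simp add: algebra_simps)
    also have "\<dots> \<le> real H * real (path_dist (G n) (F n x) (F n y)) + real H" using H by (intro add_mono mult_right_mono) auto
    also have "\<dots> = real (H * (path_dist (G n) (F n x) (F n y) + 1))" by (simp add: algebra_simps)
    finally show ?thesis by (simp only: of_nat_le_iff)
  qed
  have q3: "\<exists>x\<in>M. path_dist (G n) v (F n x) \<le> H" if "v \<in> fst (G n)" for n v
  proof -
    from that f[of n] obtain x where x: "x \<in> M" "real (path_dist (G n) v (f n (x, t n))) \<le> A0" by auto
    then have "real (path_dist (G n) v (F n x)) \<le> real H" using H by (simp add: F_def)
    then show ?thesis using x(1) by auto
  qed
  define m where "m = H * (4 * H + 2) + 1"
  define C' where "C' = real (card S ^ H) * C * (spread H + 1) ^ N"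
  \<comment> \<open>The factor in \<open>expander_separated_bound\<close>, solved for the minimum.
    It depends neither on the set nor on the level.\<close>
  define \<kappa> where "\<kappa> = C' * (real D + 1) * real ((D + 1) ^ (3 * H)) / (e * c)"
  have C'0: "0 \<le> C'" unfolding C'_def using C_pos spread_nonneg[of H] by simp
  then have \<kappa>0: "0 \<le> \<kappa>" using e c_pos by (simp add: \<kappa>_def)
  define g where "g = (\<Sum>i<m. (card S * \<Theta>) ^ i)"
  define b where "b = (card S * \<Theta>) ^ m"
  have gb: "0 \<le> g" "0 \<le> b" using Theta by (auto simp: g_def b_def intro!: sum_nonneg)
  \<comment> \<open>Read off from the final estimate that bounds the measure of \<open>A\<close> by
    \<open>(\<kappa> + 1) * g\<close> times its growth; the added 1 keeps the denominator
    positive.\<close>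
  define \<alpha> where "\<alpha> = 1 / ((\<kappa> + 1) * g + 1)"
  have den: "0 < (\<kappa> + 1) * g + 1" using \<kappa>0 gb by (simp add: add_nonneg_pos)
  then have \<alpha>: "0 < \<alpha>" by (simp add: \<alpha>_def)
  have main: "measure \<nu> A \<le> (\<kappa> + 1) * (g * measure \<nu> (sat A - A) + (1 + b) * \<epsilon>) + \<epsilon>"
    if A: "A \<in> sets \<nu>" "measure \<nu> A \<le> measure \<nu> M / 2" and \<epsilon>: "0 < \<epsilon>" for A \<epsilon>
  proof -
    obtain K U r where KU: "K \<in> sets \<nu>" "U \<in> sets \<nu>" "K \<subseteq> A" "A \<subseteq> U" "0 < r" "measure \<nu> (U - K) < \<epsilon>"
      and sep: "\<And>k y. k \<in> K \<Longrightarrow> y \<in> M \<Longrightarrow> d k y < r \<Longrightarrow> y \<in> U"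
      using separated_approxD[OF separated_approx_all[OF A(1)] \<epsilon>] by metis
    have "\<forall>\<^sub>F n in sequentially. \<Lambda> ^ m * spread m / r + 1 \<le> t n"
      using t by (auto simp: level_sequence_def filterlim_at_top)
    \<comment> \<open>The level is chosen after the separation \<open>r\<close>, hence depends on
      \<open>A\<close> and \<open>\<epsilon>\<close>, whereas \<open>m\<close> and
      \<open>\<kappa>\<close> do not. Unboundedness of the given sequence provides such a
      level.\<close>
    then obtain n where n: "\<Lambda> ^ m * spread m / r + 1 \<le> t n" using eventually_happens by force
    have small: "\<Lambda> ^ m * (spread m / t n) < r"
    proof -
      have "\<Lambda> ^ m * spread m / r < t n" using n by simp
      then show ?thesis using KU(5) t1[of n] by (simp add: field_simps)
    qed
    obtain V E where VE: "G n = (V, E)" by (cases "G n")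
    have bd: "e * c * min (measure \<nu> K) (measure \<nu> (M - (sat ^^ m) U)) \<le>
      C' * (real D + 1) * real ((D + 1) ^ (3 * H)) * measure \<nu> ((sat ^^ m) U - K)"
    proof (rule expander_separated_bound[OF t1[of n], where F = "F n" and V = V and E = E and H = H and r = r])
      show "finite_simple_graph (V, E)" "ereal e \<le> cheeger (V, E)" "\<And>v. v \<in> V \<Longrightarrow> card (E `` {v}) \<le> D"
        using Gs[of n] De[of n] by (auto simp: VE)
      show "F n ` M \<subseteq> V" using f[of n] by (auto simp: VE F_def)
      show "path_dist (V, E) (F n x) (F n y) \<le> H * (step_dist (t n) x y + 1)" if "x \<in> M" "y \<in> M" for x y
        using q1[OF that, of n] by (simp add: VE)
      show "step_dist (t n) x y \<le> H * (path_dist (V, E) (F n x) (F n y) + 1)" if "x \<in> M" "y \<in> M" for x y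
        using q2[OF that, of n] by (simp add: VE)
      show "\<exists>x\<in>M. path_dist (V, E) v (F n x) \<le> H" if "v \<in> V" for v
        using q3[of v n] that by (simp add: VE)
    qed (use KU sep e small m_def C'_def in auto)
    define X where "X = measure \<nu> ((sat ^^ m) U - K)"
    have mn: "min (measure \<nu> K) (measure \<nu> (M - (sat ^^ m) U)) \<le> \<kappa> * X"
      using bd e c_pos by (simp add: \<kappa>_def X_def field_simps)
    have Us: "(sat ^^ m) U \<in> sets \<nu>" "(sat ^^ m) A \<in> sets \<nu>" "(sat ^^ m) (U - A) \<in> sets \<nu>"
      using sat_power_sets KU A by auto
    have UA: "measure \<nu> (U - A) \<le> \<epsilon>"
      using finite_measure_mono[of "U - A" "U - K"] KU A by force
    have AK: "measure \<nu> (A - K) \<le> \<epsilon>"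
      using finite_measure_mono[of "A - K" "U - K"] KU A by force
    \<comment> \<open>The layer \<open>(sat ^^ m) U - K\<close> splits into the growth of
      \<open>A\<close>, the inner error \<open>A - K\<close>, and the saturation of the outer error
      \<open>U - A\<close>.\<close>
    have X: "X \<le> g * measure \<nu> (sat A - A) + (1 + b) * \<epsilon>"
    proof -
      have "U = A \<union> (U - A)" using KU by blast
      then have "(sat ^^ m) U = (sat ^^ m) A \<union> (sat ^^ m) (U - A)" using sat_power_Un[of m A "U - A"] by simp
      then have "(sat ^^ m) U - K \<subseteq> (((sat ^^ m) A - A) \<union> (A - K)) \<union> (sat ^^ m) (U - A)" by blast
      then have "X \<le> measure \<nu> ((((sat ^^ m) A - A) \<union> (A - K)) \<union> (sat ^^ m) (U - A))"
        unfolding X_def using Us KU A by (intro finite_measure_mono) auto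
      also have "\<dots> \<le> measure \<nu> (((sat ^^ m) A - A) \<union> (A - K)) + measure \<nu> ((sat ^^ m) (U - A))"
        using Us KU A by (intro measure_Un_le) auto
      also have "measure \<nu> (((sat ^^ m) A - A) \<union> (A - K)) \<le> measure \<nu> ((sat ^^ m) A - A) + measure \<nu> (A - K)"
        using Us KU A by (intro measure_Un_le) auto
      also have "measure \<nu> ((sat ^^ m) A - A) \<le> g * measure \<nu> (sat A - A)" using sat_power_growth[OF A(1)] by (simp add: g_def)
      also have "measure \<nu> ((sat ^^ m) (U - A)) \<le> b * measure \<nu> (U - A)" unfolding b_def using KU A by (intro sat_power_measure) auto
      also have "b * measure \<nu> (U - A) \<le> b * \<epsilon>" using UA gb by (intro mult_left_mono)
      finally show ?thesis using AK by (simp add: algebra_simps)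
    qed
    have K1: "measure \<nu> A - \<epsilon> \<le> measure \<nu> K" using finite_measure_Diff[OF A(1) KU(1,3)] AK by simp
    \<comment> \<open>Here the bound by half of the total measure enters: the saturation of
      \<open>U\<close> has measure at most that of \<open>A\<close> plus \<open>X\<close>, and the
      complement of \<open>A\<close> is at least as large as \<open>A\<close>.\<close>
    have K2: "measure \<nu> A - X \<le> measure \<nu> (M - (sat ^^ m) U)"
    proof -
      have sub: "(sat ^^ m) U \<subseteq> M" using sat_power_subset sets_subset KU by blast
      have "measure \<nu> ((sat ^^ m) U) \<le> measure \<nu> (K \<union> ((sat ^^ m) U - K))" using Us KU by (intro finite_measure_mono) auto
      also have "\<dots> \<le> measure \<nu> K + X" unfolding X_def using Us KU by (intro measure_Un_le) auto
      also have "measure \<nu> K \<le> measure \<nu> A" using KU A by (intro finite_measure_mono) auto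
      finally have "measure \<nu> ((sat ^^ m) U) \<le> measure \<nu> A + X" by simp
      moreover have "measure \<nu> (M - (sat ^^ m) U) = measure \<nu> M - measure \<nu> ((sat ^^ m) U)"
        using finite_measure_Diff[of M "(sat ^^ m) U"] Us sub sets.top[of \<nu>] by (simp add: space_nu)
      ultimately show ?thesis using A(2) by linarith
    qed
    have X0: "0 \<le> X" by (simp add: X_def)
    have "measure \<nu> A - \<epsilon> - X \<le> \<kappa> * X" using mn K1 K2 X0 \<epsilon> by (auto simp: min_def split: if_splits)
    then have "measure \<nu> A \<le> (\<kappa> + 1) * X + \<epsilon>" by (simp add: algebra_simps)
    also have "\<dots> \<le> (\<kappa> + 1) * (g * measure \<nu> (sat A - A) + (1 + b) * \<epsilon>) + \<epsilon>"
      using X \<kappa>0 by (intro add_right_mono mult_left_mono) auto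
    finally show ?thesis .
  qed
  show ?thesis
  proof (intro exI[of _ \<alpha>] conjI \<alpha> ballI impI)
    fix A assume A: "A \<in> sets \<nu>" "measure \<nu> A \<le> measure \<nu> M / 2"
    define y where "y = measure \<nu> (sat A - A)"
    have y0: "0 \<le> y" by (simp add: y_def)
    have "measure \<nu> A \<le> (\<kappa> + 1) * g * y"
    proof (rule field_le_epsilon)
      fix z :: real assume z: "0 < z"
      \<comment> \<open>The total coefficient of the approximation error in \<open>main\<close>, so
        that the choice \<open>z / w\<close> makes the error exactly \<open>z\<close>.\<close>
      define w where "w = (\<kappa> + 1) * (1 + b) + 1"
      have w: "0 < w" using \<kappa>0 gb by (simp add: w_def add_nonneg_pos)
      define q where "q = z / w"
      have "measure \<nu> A \<le> (\<kappa> + 1) * (g * y + (1 + b) * q) + q" using main[OF A, of q] z w by (simp add: y_def q_def)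
      also have "\<dots> = (\<kappa> + 1) * g * y + w * q" by (simp add: w_def algebra_simps)
      also have "w * q = z" using w by (simp add: q_def)
      finally show "measure \<nu> A \<le> (\<kappa> + 1) * g * y + z" .
    qed
    also have "\<dots> \<le> ((\<kappa> + 1) * g + 1) * y" using y0 by (simp add: algebra_simps)
    finally have "\<alpha> * measure \<nu> A \<le> y" using den by (simp add: \<alpha>_def field_simps)
    moreover have "y = measure \<nu> (sat A) - measure \<nu> A" unfolding y_def
      using finite_measure_Diff[OF sat_sets[OF A(1)] A(1) sat_superset[OF sets_subset[OF A(1)]]] .
    ultimately show "(1 + \<alpha>) * measure \<nu> A \<le> measure \<nu> (sat A)" by (simp add: algebra_simps)
  qed
qed

end

section \<open>Warped cones\<close>

context riem_manifold begin

section \<open>The manifold as a metric measure space with action\<close>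

lemma openin_mtopology_iff: "openin dM.mtopology W \<longleftrightarrow> openin (top_of_set M) W"
proof -
  have "(\<exists>r>0. dM.mball x r \<subseteq> W) \<longleftrightarrow> (\<exists>e>0. \<forall>y\<in>M. dst x y < e \<longrightarrow> y \<in> W)" if "x \<in> M" for x
    using that by (auto simp: subset_iff)
  then show ?thesis unfolding dM.openin_mtopology openin_iff_dst by (auto simp: subset_iff)
qed

lemma sets_vol: "sets vol = sigma_sets M {W. openin dM.mtopology W}"
proof
  show "sigma_sets M {W. openin dM.mtopology W} \<subseteq> sets vol"
    using sets.sigma_sets_subset[of "{W. openin dM.mtopology W}" vol] openin_borel_M
    by (auto simp: openin_mtopology_iff vol_facts)
  have "M \<inter> A \<in> sigma_sets M {W. openin dM.mtopology W}" if "A \<in> sigma_sets UNIV {A. open A}" for A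
    using that
  proof (induction A rule: sigma_sets.induct)
    case (Basic A)
    then show ?case by (intro sigma_sets.Basic) (auto simp: openin_mtopology_iff openin_open)
  next
    case (Compl A)
    have "M \<inter> (UNIV - A) = M - (M \<inter> A)" by blast
    then show ?case using sigma_sets.Compl[OF Compl.IH] by simp
  next
    case (Union A)
    have "M \<inter> (\<Union>i. A i) = (\<Union>i. M \<inter> A i)" by blast
    then show ?case using sigma_sets.Union[OF Union.IH] by simp
  qed (simp add: sigma_sets.Empty)
  then show "sets vol \<subseteq> sigma_sets M {W. openin dM.mtopology W}"
    unfolding vol_facts sets_restrict_space by (auto simp: borel_def)
qed

lemma ex_mm_space: "\<exists>c C. mm_space M dst vol CARD('n) c C"
proof -
  obtain c C where cC: "0 < c" "0 < C" and fin: "finite_measure vol"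
    and lo: "\<And>x s. x \<in> M \<Longrightarrow> 0 < s \<Longrightarrow> s \<le> 1 \<Longrightarrow> c * s ^ CARD('n) \<le> measure vol (dM.mball x s)"
    and up: "\<And>x s. x \<in> M \<Longrightarrow> 0 < s \<Longrightarrow> measure vol (dM.mball x s) \<le> C * s ^ CARD('n)"
    by (rule ahlfors_regular) (rule that; assumption)
  interpret finite_measure vol by (rule fin)
  have "mm_space M dst vol CARD('n) c C"
  proof unfold_locales
    show "\<exists>z\<in>M. dst x z < a \<and> dst z y < b"
      if "x \<in> M" "y \<in> M" "0 < a" "0 < b" "dst x y < a + b" for x y a b
      using dst_length_space[OF that] by metis
  qed (use cC lo up M_facts(1) vol_facts(1) sets_vol in auto)
  then show ?thesis by blast
qed

lemma dst_bounded:
  obtains B where "1 \<le> B" "\<And>x y. dst x y \<le> B"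
proof -
  obtain x0 where x0: "x0 \<in> M" using M_facts(1) by blast
  have "M \<subseteq> \<Union> (range (\<lambda>n. dM.mball x0 (real n)))"
  proof
    fix x assume "x \<in> M"
    moreover obtain n where "dst x0 x < real n" using reals_Archimedean2 by blast
    ultimately show "x \<in> \<Union> (range (\<lambda>n. dM.mball x0 (real n)))" using x0 by auto
  qed
  moreover have "\<forall>c\<in>range (\<lambda>n. dM.mball x0 (real n)). openin (top_of_set M) c" using mball_openin by blast
  ultimately obtain D where D: "D \<subseteq> range (\<lambda>n. dM.mball x0 (real n))" "finite D" "M \<subseteq> \<Union>D"
    using M_facts(2) unfolding compact_eq_openin_cover by meson
  then obtain Q where Q: "finite Q" "D = (\<lambda>n. dM.mball x0 (real n)) ` Q" by (meson finite_subset_image)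
  define R where "R = real (Max (insert 0 Q))"
  have R: "0 \<le> R" by (simp add: R_def)
  have bd: "dst x0 x \<le> R" if x: "x \<in> M" for x
  proof -
    obtain q where q: "q \<in> Q" "x \<in> dM.mball x0 (real q)" using D(3) Q x by blast
    have "real q \<le> R" unfolding R_def using Q q by (simp add: le_max_iff_disj Max_ge)
    then show ?thesis using q by auto
  qed
  have "dst x y \<le> 2 * R" for x y
  proof (cases "x \<in> M \<and> y \<in> M")
    case True
    then have "dst x y \<le> dst x x0 + dst x0 y" using dM.triangle x0 by blast
    then show ?thesis using bd[of x] bd[of y] True dM.commute[of x x0] by simp
  qed (use R in \<open>auto simp: dst_def\<close>)
  then show ?thesis using that[of "max 1 (2 * R)"] by (meson max.cobounded1 max.coboundedI2)
qed

lemma homeomorphism_image_sets: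
  assumes "homeomorphism M M f f'" "A \<in> sets vol"
  shows "f ` A \<in> sets vol"
proof -
  have A: "A \<in> sets borel" "A \<subseteq> M" using assms(2) unfolding vol_facts sets_borel_M by auto
  have "f' \<in> borel_measurable borel_M"
    by (rule borel_measurable_continuous_on_restrict) (use assms(1) in \<open>simp add: homeomorphism_def\<close>)
  from measurable_sets[OF this A(1)] have "f' -` A \<inter> M \<in> sets borel_M" by (simp add: space_restrict_space)
  moreover have "f ` A = f' -` A \<inter> M"
  proof
    show "f ` A \<subseteq> f' -` A \<inter> M" using assms(1) A(2) unfolding homeomorphism_def by auto
    show "f' -` A \<inter> M \<subseteq> f ` A"
    proof
      fix y assume y: "y \<in> f' -` A \<inter> M"
      then have "f (f' y) = y" using assms(1) by (simp add: homeomorphism_def)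
      then show "y \<in> f ` A" using y by (metis IntD1 imageI vimageE)
    qed
  qed
  ultimately show ?thesis by (simp add: vol_facts)
qed

text \<open>Volume comparison: a quasi-symmetric map sends the ball of radius \<open>d(x,y)\<close> around \<open>x\<close> into a ball
  of radius comparable to \<open>d(f x, f y)\<close>, so with bounded measure distortion its inverse is Lipschitz.\<close>

lemma quasi_symmetric_inverse_lipschitz:
  assumes qs: "quasi_symmetric M rd f" and bmd: "bounded_measure_distortion vol f"
  shows "\<exists>L\<ge>1. \<forall>x\<in>M. \<forall>y\<in>M. dst x y \<le> L * dst (f x) (f y)"
proof -
  obtain f' where h: "homeomorphism M M f f'" using qs unfolding quasi_symmetric_def by blast
  then have fM: "f x \<in> M" if "x \<in> M" for x using that unfolding homeomorphism_def by blast
  have inj: "f x = f y \<Longrightarrow> x = y" if "x \<in> M" "y \<in> M" for x y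
    using h that unfolding homeomorphism_def by metis
  obtain \<eta> \<eta>' where \<eta>: "homeomorphism {0::real..} {0::real..} \<eta> \<eta>'" "strict_mono_on {0..} \<eta>"
    and q: "\<forall>x\<in>M. \<forall>y\<in>M. \<forall>z\<in>M. z \<noteq> x \<and> x \<noteq> y \<longrightarrow> rd (f x) (f y) / rd (f x) (f z) \<le> \<eta> (rd x y / rd x z)"
    using qs unfolding quasi_symmetric_def by blast
  have "0 \<le> \<eta> 0" using \<eta>(1) unfolding homeomorphism_def by auto
  moreover have "\<eta> 0 < \<eta> 1" using \<eta>(2) by (rule strict_mono_onD) auto
  ultimately have \<eta>1: "0 < \<eta> 1" by simp
  obtain \<Theta> where \<Theta>: "1 \<le> \<Theta>" "\<And>A. A \<in> sets vol \<Longrightarrow> 1 / \<Theta> * measure vol A \<le> measure vol (f ` A)"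
    using bmd unfolding bounded_measure_distortion_def by blast
  obtain c C where "mm_space M dst vol CARD('n) c C" using ex_mm_space by blast
  then interpret mm: mm_space M dst vol "CARD('n)" c C .
  obtain B where B: "1 \<le> B" "\<And>x y. dst x y \<le> B" using dst_bounded by blast
  \<comment> \<open>A majorant of \<open>\<Theta> * C / c\<close> that is at least 1 is bounded by
    its own \<open>CARD('n)\<close>-th power, so the volume inequality becomes a comparison of two
    such powers.\<close>
  define l where "l = max 1 (\<Theta> * C / c)"
  have l: "1 \<le> l" "\<Theta> * C / c \<le> l" by (auto simp: l_def)
  have main: "dst x y \<le> B * (l * (2 * \<eta> 1)) * dst (f x) (f y)" if xy: "x \<in> M" "y \<in> M" "x \<noteq> y" for x y
  proof -
    define r where "r = dst x y"
    \<comment> \<open>Quasi-symmetry gives a bound by \<open>\<eta> 1\<close> times the distance of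
      the images; the factor 2 makes it strict, as the balls are open.\<close>
    define R where "R = 2 * \<eta> 1 * dst (f x) (f y)"
    have r: "0 < r" using xy dM.mdist_pos_less by (simp add: r_def)
    have fxy: "0 < dst (f x) (f y)" using inj xy fM dM.mdist_pos_less by metis
    have R: "0 < R" using \<eta>1 fxy by (simp add: R_def)
    \<comment> \<open>The lower volume bound holds for radii up to 1; the diameter bound
      \<open>B\<close> recovers \<open>r\<close> from \<open>r0\<close> at the end.\<close>
    define r0 where "r0 = min r 1"
    have r0: "0 < r0" "r0 \<le> 1" "r0 \<le> r" using r by (auto simp: r0_def)
    have sub: "f ` dM.mball x r0 \<subseteq> dM.mball (f x) R"
    proof (rule image_subsetI)
      fix z assume "z \<in> dM.mball x r0"
      then have z: "z \<in> M" "dst x z < r" using r0 by auto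
      show "f z \<in> dM.mball (f x) R"
      proof (cases "z = x")
        case True
        then show ?thesis using R fM xy by simp
      next
        case False
        have "rd (f x) (f z) / rd (f x) (f y) \<le> \<eta> (rd x z / rd x y)"
          by (rule q[rule_format, OF xy(1) z(1) xy(2)]) (use xy False in auto)
        then have "dst (f x) (f z) / dst (f x) (f y) \<le> \<eta> (dst x z / dst x y)"
          using xy z(1) fM by (simp add: dst_def)
        also have "\<dots> \<le> \<eta> 1"
        proof -
          have "0 \<le> dst x z / dst x y" by simp
          moreover have "dst x z / dst x y < 1" using z(2) r by (simp add: r_def)
          ultimately show ?thesis using strict_mono_onD[OF \<eta>(2), of "dst x z / dst x y" 1] by simp
        qed
        finally have "dst (f x) (f z) \<le> \<eta> 1 * dst (f x) (f y)" using fxy by (simp add: field_simps)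
        also have "\<dots> < R" using \<eta>1 fxy by (simp add: R_def)
        finally show ?thesis using fM xy z by simp
      qed
    qed
    have "c * r0 ^ CARD('n) \<le> measure vol (dM.mball x r0)" using mm.ball_lower xy r0 by blast
    also have "\<dots> \<le> \<Theta> * measure vol (f ` dM.mball x r0)"
      using \<Theta>(2)[OF mm.mball_sets[of x r0]] \<Theta>(1) by (simp add: field_simps)
    also have "measure vol (f ` dM.mball x r0) \<le> measure vol (dM.mball (f x) R)"
      by (rule mm.finite_measure_mono[OF sub]) simp
    also have "\<dots> \<le> C * R ^ CARD('n)" using mm.ball_upper[OF fM[OF xy(1)] R] .
    finally have "c * r0 ^ CARD('n) \<le> \<Theta> * (C * R ^ CARD('n))" using \<Theta>(1) by simp
    then have "r0 ^ CARD('n) \<le> \<Theta> * C / c * R ^ CARD('n)" using mm.c_pos by (simp add: field_simps)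
    also have "\<dots> \<le> l ^ CARD('n) * R ^ CARD('n)"
    proof (rule mult_right_mono)
      have "l ^ 1 \<le> l ^ CARD('n)" using l by (intro power_increasing) auto
      then show "\<Theta> * C / c \<le> l ^ CARD('n)" using l by simp
    qed (use R in simp)
    finally have "r0 ^ CARD('n) \<le> (l * R) ^ CARD('n)" by (simp add: power_mult_distrib)
    moreover have "0 \<le> l * R" using l R by simp
    ultimately have lR: "r0 \<le> l * R" using power_mono_iff[of r0 "l * R" "CARD('n)"] r0 by simp
    have "r \<le> B * r0"
    proof (cases "r \<le> 1")
      case True
      then have "1 * r \<le> B * r" using B r by (intro mult_right_mono) auto
      then show ?thesis using True by (simp add: r0_def)
    next
      case False
      then show ?thesis using B(2)[of x y] by (simp add: r0_def r_def)
    qed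
    also have "\<dots> \<le> B * (l * R)" using lR B by (intro mult_left_mono) auto
    finally show ?thesis by (simp add: r_def R_def algebra_simps)
  qed
  define L where "L = max 1 (B * (l * (2 * \<eta> 1)))"
  have "dst x y \<le> L * dst (f x) (f y)" if xy: "x \<in> M" "y \<in> M" for x y
  proof (cases "x = y")
    case False
    have "B * (l * (2 * \<eta> 1)) * dst (f x) (f y) \<le> L * dst (f x) (f y)" by (intro mult_right_mono) (auto simp: L_def)
    then show ?thesis using main[OF xy False] by simp
  qed (use xy fM in simp)
  then show ?thesis by (intro exI[of _ L]) (auto simp: L_def)
qed

text \<open>The Lipschitz bound for a generator comes from
  \<open>quasi_symmetric_inverse_lipschitz\<close> applied to its inverse. Maxima over the finite
  set \<open>S\<close> make the constants common to all generators.\<close>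

lemma ex_mm_action:
  fixes G :: "('g, 'z) monoid_scheme" and act :: "'g \<Rightarrow> 'a \<Rightarrow> 'a"
  assumes grp: "group G" and S: "finite_symmetric_generating_set G S" and ga: "group_action G M act"
    and qs: "\<And>g. g \<in> carrier G \<Longrightarrow> quasi_symmetric M rd (act g)"
    and bmd: "\<And>g. g \<in> carrier G \<Longrightarrow> bounded_measure_distortion vol (act g)"
  shows "\<exists>c C \<Lambda> \<Theta>. mm_action M dst vol CARD('n) c C S act \<Lambda> \<Theta>"
proof -
  have finS: "finite S" and Sc: "S \<subseteq> carrier G" and one: "\<one>\<^bsub>G\<^esub> \<in> S" and invS: "\<And>s. s \<in> S \<Longrightarrow> inv\<^bsub>G\<^esub> s \<in> S"
    using S unfolding finite_symmetric_generating_set_def by auto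
  interpret G: group G by (rule grp)
  interpret group_action G M act by (rule ga)
  have closed: "act g x \<in> M" if "g \<in> carrier G" "x \<in> M" for g x using element_image[OF that] by simp
  have inv1: "act (inv\<^bsub>G\<^esub> g) (act g x) = x" if "g \<in> carrier G" "x \<in> M" for g x
    using orbit_sym_aux[OF that] by simp
  have inv2: "act g (act (inv\<^bsub>G\<^esub> g) x) = x" if "g \<in> carrier G" "x \<in> M" for g x
    using inv1[of "inv\<^bsub>G\<^esub> g" x] that by simp
  have "\<forall>s\<in>S. \<exists>L\<ge>1. \<forall>x\<in>M. \<forall>y\<in>M. dst (act s x) (act s y) \<le> L * dst x y"
  proof
    fix s assume s: "s \<in> S"
    then have sc: "s \<in> carrier G" "inv\<^bsub>G\<^esub> s \<in> carrier G" using Sc by auto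
    obtain L where L: "L \<ge> 1" "\<forall>x\<in>M. \<forall>y\<in>M. dst x y \<le> L * dst (act (inv\<^bsub>G\<^esub> s) x) (act (inv\<^bsub>G\<^esub> s) y)"
      using quasi_symmetric_inverse_lipschitz[OF qs[OF sc(2)] bmd[OF sc(2)]] by blast
    have "dst (act s x) (act s y) \<le> L * dst x y" if "x \<in> M" "y \<in> M" for x y
      using L(2) closed[OF sc(1)] inv1[OF sc(1)] that by metis
    then show "\<exists>L\<ge>1. \<forall>x\<in>M. \<forall>y\<in>M. dst (act s x) (act s y) \<le> L * dst x y" using L(1) by blast
  qed
  then obtain Lf where Lf: "\<And>s. s \<in> S \<Longrightarrow> Lf s \<ge> 1"
    "\<And>s x y. s \<in> S \<Longrightarrow> x \<in> M \<Longrightarrow> y \<in> M \<Longrightarrow> dst (act s x) (act s y) \<le> Lf s * dst x y" by metis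
  have "\<forall>s\<in>S. \<exists>T::real\<ge>1. \<forall>A\<in>sets vol. measure vol (act s ` A) \<le> T * measure vol A"
    using bmd Sc unfolding bounded_measure_distortion_def by (meson subsetD)
  then obtain Tf where Tf: "\<And>s. s \<in> S \<Longrightarrow> (Tf s :: real) \<ge> 1"
    "\<And>s A. s \<in> S \<Longrightarrow> A \<in> sets vol \<Longrightarrow> measure vol (act s ` A) \<le> Tf s * measure vol A" by metis
  define \<Lambda> where "\<Lambda> = Max (Lf ` S)"
  define \<Theta> where "\<Theta> = Max (Tf ` S)"
  have \<Lambda>: "Lf s \<le> \<Lambda>" and \<Theta>: "Tf s \<le> \<Theta>" if "s \<in> S" for s using finS that by (auto simp: \<Lambda>_def \<Theta>_def)
  obtain c C where "mm_space M dst vol CARD('n) c C" using ex_mm_space by blast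
  then interpret mm: mm_space M dst vol "CARD('n)" c C .
  have "mm_action M dst vol CARD('n) c C S act \<Lambda> \<Theta>"
  proof unfold_locales
    show "\<exists>s\<in>S. \<forall>x\<in>M. act s x = x" using one id_eq_one by (metis restrict_apply')
    show "act s x \<in> M" if "s \<in> S" "x \<in> M" for s x using closed Sc that by blast
    show "\<exists>s'\<in>S. \<forall>x\<in>M. act s' (act s x) = x \<and> act s (act s' x) = x" if "s \<in> S" for s
      using inv1 inv2 invS Sc that by blast
    show "1 \<le> \<Lambda>" using \<Lambda>[OF one] Lf(1)[OF one] by simp
    show "1 \<le> \<Theta>" using \<Theta>[OF one] Tf(1)[OF one] by simp
    show "dst (act s x) (act s y) \<le> \<Lambda> * dst x y" if "s \<in> S" "x \<in> M" "y \<in> M" for s x y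
      using Lf(2)[OF that] mult_right_mono[OF \<Lambda>[OF that(1)] dM.nonneg[of x y]] by linarith
    show "act s ` A \<in> sets vol" if sA: "s \<in> S" "A \<in> sets vol" for s A
    proof -
      have "quasi_symmetric M rd (act s)" using qs[of s] Sc sA(1) by blast
      then obtain f' where "homeomorphism M M (act s) f'" unfolding quasi_symmetric_def by blast
      then show ?thesis using homeomorphism_image_sets sA(2) by blast
    qed
    show "measure vol (act s ` A) \<le> \<Theta> * measure vol A" if "s \<in> S" "A \<in> sets vol" for s A
      using Tf(2)[OF that] mult_right_mono[OF \<Theta>[OF that(1)] measure_nonneg[of vol A]] by linarith
  qed (rule finS)
  then show ?thesis by blast
qed

section \<open>The warped metric on a level and the step distance\<close>

definition warped_metrics :: "'g set \<Rightarrow> ('g \<Rightarrow> 'a \<Rightarrow> 'a) \<Rightarrow> ('a \<times> real \<Rightarrow> 'a \<times> real \<Rightarrow> real) set" where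
  "warped_metrics S act = {D. Metric_space (open_cone M) D \<and>
      (\<forall>p\<in>open_cone M. \<forall>q\<in>open_cone M. D p q \<le> cd p q) \<and>
      (\<forall>x t. (x, t) \<in> open_cone M \<longrightarrow> (\<forall>s\<in>S. D (x, t) (act s x, t) \<le> 1))}"

lemma warped_dist_eq: "warped_dist M \<A> \<rho> S act z w = Sup ((\<lambda>D. D z w) ` warped_metrics S act)"
  unfolding warped_dist_def warped_metrics_def by (rule arg_cong[of _ _ Sup]) auto

text \<open>A function on \<open>M\<close> that is Lipschitz at the scale of the level \<open>T\<close> is extended to the cone by a
  cutoff that vanishes below level \<open>T/2\<close>; a cone curve either stays above \<open>T/2\<close> or is long.\<close>

lemma warped_metric_exists:
  assumes act: "\<And>s x. s \<in> S \<Longrightarrow> x \<in> M \<Longrightarrow> act s x \<in> M" and T: "1 \<le> T"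
    and B: "1 \<le> B" "\<And>x y. dst x y \<le> B"
    and h: "\<And>x. x \<in> M \<Longrightarrow> 0 \<le> h x" "\<And>x. x \<in> M \<Longrightarrow> h x \<le> T * B"
      "\<And>x y. x \<in> M \<Longrightarrow> y \<in> M \<Longrightarrow> \<bar>h x - h y\<bar> \<le> T * dst x y"
      "\<And>x s. x \<in> M \<Longrightarrow> s \<in> S \<Longrightarrow> \<bar>h x - h (act s x)\<bar> \<le> 2"
  obtains D where "D \<in> warped_metrics S act"
    "\<And>x y. x \<in> M \<Longrightarrow> y \<in> M \<Longrightarrow> \<bar>h x - h y\<bar> \<le> 2 * (4 * B + 2) * D (x, T) (y, T)"
proof -
  \<comment> \<open>The Lipschitz constant of the extended function: \<open>2 * B\<close> from the
    variation of the cutoff and \<open>2 * B + 2\<close> from that of \<open>h\<close>.\<close>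
  define K where "K = 4 * B + 2"
  have K: "2 \<le> K" "0 < K" using B by (auto simp: K_def)
  define \<phi> where "\<phi> u = max 0 (min 1 (2 * u / T - 1))" for u
  define H where "H p = \<phi> (snd p) * h (fst p)" for p
  \<comment> \<open>Makes \<open>D\<close> separate points. Since a jump does not change the height,
    capping the distance in \<open>M\<close> at 1 keeps the cost of a jump at most 1.\<close>
  define D0 where "D0 p q = max \<bar>snd p - snd q\<bar> (min 1 (dst (fst p) (fst q)))" for p q :: "'a \<times> real"
  \<comment> \<open>Both terms are at most the cone distance and at most 1 along generators, hence
    so is their average; the halving returns as a factor 2 in the conclusion. The value 0 off the
    cone keeps \<open>D\<close> nonnegative and symmetric everywhere, as \<open>Metric_space\<close>
    demands.\<close>
  define D where "D p q = (if p \<in> open_cone M \<and> q \<in> open_cone M then (D0 p q + \<bar>H p - H q\<bar> / K) / 2 else 0)" for p q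
  have cone: "p \<in> open_cone M \<longleftrightarrow> fst p \<in> M \<and> 1 \<le> snd p" for p by (cases p) (auto simp: open_cone_def)
  have \<phi>01: "0 \<le> \<phi> u" "\<phi> u \<le> 1" for u by (auto simp: \<phi>_def)
  have \<phi>lip: "\<bar>\<phi> u - \<phi> v\<bar> \<le> 2 / T * \<bar>u - v\<bar>" for u v
  proof -
    have "\<bar>\<phi> u - \<phi> v\<bar> \<le> \<bar>2 * u / T - 2 * v / T\<bar>" unfolding \<phi>_def by linarith
    also have "2 * u / T - 2 * v / T = 2 / T * (u - v)" by (simp add: diff_divide_distrib right_diff_distrib)
    also have "\<bar>2 / T * (u - v)\<bar> = 2 / T * \<bar>u - v\<bar>" unfolding abs_mult using T by simp
    finally show ?thesis .
  qed
  have D0nn: "0 \<le> D0 p q" for p q unfolding D0_def by simp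
  have ms: "Metric_space (open_cone M) D"
  proof
    fix p q
    show "0 \<le> D p q" using D0nn K by (simp add: D_def)
    show "D p q = D q p" by (simp add: D_def D0_def dM.commute abs_minus_commute)
    assume p: "p \<in> open_cone M" and q: "q \<in> open_cone M"
    show "D p q = 0 \<longleftrightarrow> p = q"
    proof
      assume "D p q = 0"
      then have "D0 p q + \<bar>H p - H q\<bar> / K = 0" using p q by (simp add: D_def)
      moreover have "0 \<le> \<bar>H p - H q\<bar> / K" using K by simp
      ultimately have "D0 p q = 0" using D0nn[of p q] by linarith
      then have "\<bar>snd p - snd q\<bar> \<le> 0" "min 1 (dst (fst p) (fst q)) \<le> 0" unfolding D0_def by linarith+
      then have "snd p = snd q" "dst (fst p) (fst q) \<le> 0" by (auto simp: min_def split: if_splits)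
      moreover from this have "dst (fst p) (fst q) = 0" using dM.nonneg[of "fst p" "fst q"] by linarith
      ultimately show "p = q" using p q by (simp add: cone prod_eq_iff)
    next
      assume "p = q"
      then show "D p q = 0" using p by (simp add: D_def D0_def cone)
    qed
    fix w assume w: "w \<in> open_cone M"
    have "min 1 (dst (fst p) (fst w)) \<le> min 1 (dst (fst p) (fst q)) + min 1 (dst (fst q) (fst w))"
    proof -
      have "dst (fst p) (fst w) \<le> dst (fst p) (fst q) + dst (fst q) (fst w)"
        using dM.triangle p q w unfolding cone by blast
      then show ?thesis using dM.nonneg[of "fst p" "fst q"] dM.nonneg[of "fst q" "fst w"] by linarith
    qed
    then have "D0 p w \<le> D0 p q + D0 q w" unfolding D0_def by linarith
    moreover have "\<bar>H p - H w\<bar> / K \<le> \<bar>H p - H q\<bar> / K + \<bar>H q - H w\<bar> / K"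
      unfolding add_divide_distrib[symmetric] using K by (intro divide_right_mono) auto
    ultimately have "(D0 p w + \<bar>H p - H w\<bar> / K) / 2 \<le>
        ((D0 p q + D0 q w) + (\<bar>H p - H q\<bar> / K + \<bar>H q - H w\<bar> / K)) / 2"
      by (intro divide_right_mono add_mono) auto
    also have "\<dots> = (D0 p q + \<bar>H p - H q\<bar> / K) / 2 + (D0 q w + \<bar>H q - H w\<bar> / K) / 2" by (simp add: add_divide_distrib)
    finally show "D p w \<le> D p q + D q w" using p q w by (simp add: D_def)
  qed
  have Hb: "\<bar>H p - H q\<bar> \<le> K * cd p q \<and> D0 p q \<le> cd p q" if pq: "p \<in> open_cone M" "q \<in> open_cone M" for p q
  proof -
    obtain x u y v where p: "p = (x, u)" and q: "q = (y, v)" by (cases p, cases q) auto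
    have M: "x \<in> M" "y \<in> M" "1 \<le> u" "1 \<le> v" using pq by (auto simp: cone p q)
    have est: "\<bar>H p - H q\<bar> \<le> K * (cd p q + e) \<and> D0 p q \<le> cd p q + e" if e: "0 < e" for e
    proof -
      obtain m where m: "1 \<le> m" "m \<le> u" "m \<le> v" "m * dst x y \<le> cd p q + e" "(u - m) + (v - m) \<le> cd p q + e"
        using cone_dist_lower[OF M e] unfolding p q by blast
      define len where "len = cd p q + e"
      have len: "0 \<le> len" using m unfolding len_def by linarith
      have uv: "\<bar>u - v\<bar> \<le> len" using m unfolding len_def by linarith
      have "1 * dst x y \<le> m * dst x y" using m by (intro mult_right_mono) auto
      then have dl: "dst x y \<le> len" using m unfolding len_def by linarith
      have A: "\<bar>\<phi> u - \<phi> v\<bar> * h x \<le> 2 * B * len"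
      proof -
        have "\<bar>\<phi> u - \<phi> v\<bar> * h x \<le> (2 / T * \<bar>u - v\<bar>) * (T * B)"
          using \<phi>lip h(1,2)[OF M(1)] T by (intro mult_mono) auto
        also have "\<dots> = 2 * B * \<bar>u - v\<bar>" using T by simp
        also have "\<dots> \<le> 2 * B * len" using uv B by (intro mult_left_mono) auto
        finally show ?thesis .
      qed
      have Bb: "\<phi> v * \<bar>h x - h y\<bar> \<le> (2 * B + 2) * len"
      proof (cases "T / 2 \<le> m")
        case True
        have "\<phi> v * \<bar>h x - h y\<bar> \<le> 1 * (T * dst x y)" using \<phi>01 h(3)[OF M(1,2)] by (intro mult_mono) auto
        also have "T * dst x y \<le> (2 * m) * dst x y" using True by (intro mult_right_mono) auto
        also have "1 * ((2 * m) * dst x y) \<le> 2 * len" using m unfolding len_def by simp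
        also have "\<dots> \<le> (2 * B + 2) * len" using B len by (intro mult_right_mono) auto
        finally show ?thesis by simp
      next
        \<comment> \<open>A curve that descends below \<open>T / 2\<close> has length at least
          \<open>v - m\<close> up to the error, and the cutoff at \<open>v\<close> is at most
          \<open>2 / T\<close> times \<open>v - m\<close>. This outweighs the possible variation
          \<open>T * B\<close> of \<open>h\<close>.\<close>
        case False
        have "2 * v / T - 1 \<le> 2 / T * (v - m)" using False T by (simp add: field_simps)
        moreover have "0 \<le> 2 / T * (v - m)" using T m by simp
        ultimately have "\<phi> v \<le> 2 / T * (v - m)" unfolding \<phi>_def by linarith
        then have "\<phi> v * \<bar>h x - h y\<bar> \<le> (2 / T * (v - m)) * (T * B)"
          using h(3)[OF M(1,2)] B(2)[of x y] T m \<phi>01 B(1)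
          by (intro mult_mono) (auto intro: order_trans mult_left_mono)
        also have "\<dots> = 2 * B * (v - m)" using T by simp
        also have "\<dots> \<le> 2 * B * len" using m B unfolding len_def by (intro mult_left_mono) auto
        also have "\<dots> \<le> (2 * B + 2) * len" using len by (intro mult_right_mono) auto
        finally show ?thesis .
      qed
      have "H p - H q = (\<phi> u - \<phi> v) * h x + \<phi> v * (h x - h y)" by (simp add: H_def p q algebra_simps)
      then have "\<bar>H p - H q\<bar> \<le> \<bar>(\<phi> u - \<phi> v) * h x\<bar> + \<bar>\<phi> v * (h x - h y)\<bar>" by (metis abs_triangle_ineq)
      also have "\<dots> = \<bar>\<phi> u - \<phi> v\<bar> * h x + \<phi> v * \<bar>h x - h y\<bar>" using h(1)[OF M(1)] \<phi>01 by (simp add: abs_mult)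
      also have "\<dots> \<le> 2 * B * len + (2 * B + 2) * len" using A Bb by (rule add_mono)
      also have "\<dots> = K * len" by (simp add: K_def algebra_simps)
      finally have "\<bar>H p - H q\<bar> \<le> K * len" .
      moreover have "D0 p q \<le> len" using uv dl by (simp add: D0_def p q)
      ultimately show ?thesis by (simp add: len_def)
    qed
    have "D0 p q \<le> cd p q" by (rule field_le_epsilon) (use est in blast)
    moreover have "\<bar>H p - H q\<bar> \<le> K * cd p q"
    proof (rule field_le_epsilon)
      fix e :: real assume "0 < e"
      then have "\<bar>H p - H q\<bar> \<le> K * (cd p q + e / K)" using est[of "e / K"] K by simp
      then show "\<bar>H p - H q\<bar> \<le> K * cd p q + e" using K by (simp add: distrib_left)
    qed
    ultimately show ?thesis by blast
  qed
  have Dcd: "D p q \<le> cd p q" if pq: "p \<in> open_cone M" "q \<in> open_cone M" for p q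
  proof -
    have "\<bar>H p - H q\<bar> / K \<le> cd p q" using Hb[OF pq] K by (simp add: field_simps)
    then show ?thesis using Hb[OF pq] pq by (simp add: D_def)
  qed
  have jump: "D (x, t) (act s x, t) \<le> 1" if xt: "(x, t) \<in> open_cone M" and s: "s \<in> S" for x t s
  proof -
    have x: "x \<in> M" "1 \<le> t" using xt by (auto simp: cone)
    have "\<bar>H (x, t) - H (act s x, t)\<bar> = \<phi> t * \<bar>h x - h (act s x)\<bar>"
      using \<phi>01 by (simp add: H_def right_diff_distrib[symmetric] abs_mult)
    also have "\<dots> \<le> 1 * 2" using \<phi>01 h(4)[OF x(1) s] by (intro mult_mono) auto
    finally have "\<bar>H (x, t) - H (act s x, t)\<bar> / K \<le> 2 / 2" using K by (intro frac_le) auto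
    moreover have "D0 (x, t) (act s x, t) \<le> 1" by (simp add: D0_def)
    ultimately show ?thesis by (auto simp: D_def)
  qed
  have \<phi>T: "\<phi> T = 1" using T by (simp add: \<phi>_def)
  show ?thesis
  proof (rule that[of D])
    show "D \<in> warped_metrics S act" unfolding warped_metrics_def using ms Dcd jump by simp
    fix x y assume "x \<in> M" "y \<in> M"
    then have "D (x, T) (y, T) = (D0 (x, T) (y, T) + \<bar>h x - h y\<bar> / K) / 2"
      using T by (simp add: D_def cone H_def \<phi>T)
    then have "\<bar>h x - h y\<bar> / K \<le> 2 * D (x, T) (y, T)" using D0nn[of "(x, T)" "(y, T)"] by simp
    then have "\<bar>h x - h y\<bar> \<le> 2 * K * D (x, T) (y, T)" using K by (simp add: field_simps)
    then show "\<bar>h x - h y\<bar> \<le> 2 * (4 * B + 2) * D (x, T) (y, T)" unfolding K_def .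
  qed
qed

text \<open>Every competitor is at most 1 along a step, so the supremum is at most the number of
  steps. For the reverse bound one good competitor per pair of points is enough; it is built from
  the smoothed step distance to \<open>x\<close>.\<close>

lemma warped_dist_step_dist:
  assumes "mm_action M dst vol N c C S act \<Lambda> \<Theta>"
  obtains K where "0 \<le> K"
    "\<And>t x y. 1 \<le> t \<Longrightarrow> x \<in> M \<Longrightarrow> y \<in> M \<Longrightarrow> warped_dist M \<A> \<rho> S act (x, t) (y, t) \<le> real (mm_action.step_dist M dst S act t x y)"
    "\<And>t x y. 1 \<le> t \<Longrightarrow> x \<in> M \<Longrightarrow> y \<in> M \<Longrightarrow>
       real (mm_action.step_dist M dst S act t x y) \<le> K * warped_dist M \<A> \<rho> S act (x, t) (y, t) + 1"
    "\<And>t x y. 1 \<le> t \<Longrightarrow> x \<in> M \<Longrightarrow> y \<in> M \<Longrightarrow> 0 \<le> warped_dist M \<A> \<rho> S act (x, t) (y, t)"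
proof -
  interpret A: mm_action M dst vol N c C S act \<Lambda> \<Theta> by (rule assms)
  obtain B where B: "1 \<le> B" "\<And>x y. dst x y \<le> B" using dst_bounded by blast
  have up: "D (x, t) (y, t) \<le> real k" if D: "D \<in> warped_metrics S act" and t: "1 \<le> t" and x: "x \<in> M"
    and st: "(x, y) \<in> A.steps t ^^ k" for D t x y k
  proof -
    interpret D: Metric_space "open_cone M" D using D by (simp add: warped_metrics_def)
    have cone: "(z, t) \<in> open_cone M" if "z \<in> M" for z using that t by (simp add: open_cone_def)
    have one: "D (z, t) (w, t) \<le> 1" if "(z, w) \<in> A.steps t" for z w
    proof -
      have zw: "z \<in> M" "w \<in> M" "dst z w \<le> 1 / t \<or> (\<exists>s\<in>S. w = act s z)" using that unfolding A.steps_iff by auto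
      from zw(3) show ?thesis
      proof
        assume d: "dst z w \<le> 1 / t"
        have "D (z, t) (w, t) \<le> cd (z, t) (w, t)" using D cone[OF zw(1)] cone[OF zw(2)] by (simp add: warped_metrics_def)
        also have "\<dots> \<le> t * dst z w" by (rule cone_dist_level[OF zw(1,2) t])
        also have "\<dots> \<le> 1" using d t by (simp add: field_simps)
        finally show ?thesis .
      next
        assume "\<exists>s\<in>S. w = act s z"
        then show ?thesis using D cone[OF zw(1)] by (auto simp: warped_metrics_def)
      qed
    qed
    show ?thesis using st
    proof (induction k arbitrary: y)
      case 0
      then show ?case using cone[OF x] by simp
    next
      case (Suc k)
      then obtain z where z: "(x, z) \<in> A.steps t ^^ k" "(z, y) \<in> A.steps t" by auto
      then have "z \<in> M" "y \<in> M" unfolding A.steps_iff by auto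
      then have "D (x, t) (y, t) \<le> D (x, t) (z, t) + D (z, t) (y, t)" using D.triangle cone x by blast
      then show ?case using Suc.IH[OF z(1)] one[OF z(2)] by simp
    qed
  qed
  have upw: "D (x, t) (y, t) \<le> real (A.step_dist t x y)"
    if "D \<in> warped_metrics S act" "1 \<le> t" "x \<in> M" "y \<in> M" for D t x y
    by (rule up[OF that(1,2,3)]) (use A.step_dist_relpow[of t x y] that in simp)
  have ex: "\<exists>D\<in>warped_metrics S act. real (A.step_dist t x y) \<le> 2 * (4 * B + 2) * D (x, t) (y, t) + 1"
    if t: "1 \<le> t" and xy: "x \<in> M" "y \<in> M" for t x y
  proof -
    have t0: "0 < t" using t by simp
    obtain h where h: "h x = 0" "\<And>z. z \<in> M \<Longrightarrow> real (A.step_dist t x z) - 1 \<le> h z" "\<And>z. z \<in> M \<Longrightarrow> 0 \<le> h z"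
      "\<And>z. z \<in> M \<Longrightarrow> h z \<le> t * dst x z" "\<And>z w. z \<in> M \<Longrightarrow> w \<in> M \<Longrightarrow> \<bar>h z - h w\<bar> \<le> t * dst z w"
      "\<And>z s. z \<in> M \<Longrightarrow> s \<in> S \<Longrightarrow> \<bar>h z - h (act s z)\<bar> \<le> 2"
      by (rule A.lipschitz_step_dist[OF t0 xy(1)]) (rule that; assumption)
    have hB: "h z \<le> t * B" if "z \<in> M" for z
      using h(4)[OF that] mult_left_mono[OF B(2)[of x z], of t] t0 by linarith
    have "\<exists>D\<in>warped_metrics S act. \<forall>x\<in>M. \<forall>y\<in>M. \<bar>h x - h y\<bar> \<le> 2 * (4 * B + 2) * D (x, t) (y, t)"
      by (rule warped_metric_exists[OF A.act_closed t B h(3) hB h(5,6)]) blast+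
    then obtain D where D: "D \<in> warped_metrics S act"
      "\<And>x y. x \<in> M \<Longrightarrow> y \<in> M \<Longrightarrow> \<bar>h x - h y\<bar> \<le> 2 * (4 * B + 2) * D (x, t) (y, t)" by blast
    have "real (A.step_dist t x y) - 1 \<le> \<bar>h x - h y\<bar>" using h(1) h(2)[OF xy(2)] by simp
    then show ?thesis using D(2)[OF xy] D(1) by (intro bexI[of _ D]) auto
  qed
  have bdd: "bdd_above ((\<lambda>D. D (x, t) (y, t)) ` warped_metrics S act)" if "1 \<le> t" "x \<in> M" "y \<in> M" for t x y
    using upw that by (auto intro!: bdd_aboveI[of _ "real (A.step_dist t x y)"])
  \<comment> \<open>The competitors just built also show that the supremum is taken over a nonempty
    set.\<close>
  have ne: "warped_metrics S act \<noteq> {}" using ex[of 1] M_facts(1) by blast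
  have sup: "D (x, t) (y, t) \<le> warped_dist M \<A> \<rho> S act (x, t) (y, t)"
    if "D \<in> warped_metrics S act" "1 \<le> t" "x \<in> M" "y \<in> M" for D t x y
    unfolding warped_dist_eq by (rule cSUP_upper[OF that(1) bdd[OF that(2-)]])
  show ?thesis
  proof (rule that[of "2 * (4 * B + 2)"])
    show "0 \<le> 2 * (4 * B + 2)" using B by simp
    fix t x y assume t: "(1::real) \<le> t" and xy: "x \<in> M" "y \<in> M"
    show "warped_dist M \<A> \<rho> S act (x, t) (y, t) \<le> real (A.step_dist t x y)"
      unfolding warped_dist_eq by (rule cSUP_least[OF ne]) (use upw t xy in blast)
    obtain D where D: "D \<in> warped_metrics S act" "real (A.step_dist t x y) \<le> 2 * (4 * B + 2) * D (x, t) (y, t) + 1"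
      using ex[OF t xy] by blast
    note s = sup[OF D(1) t xy]
    have "2 * (4 * B + 2) * D (x, t) (y, t) \<le> 2 * (4 * B + 2) * warped_dist M \<A> \<rho> S act (x, t) (y, t)"
      using s B by (intro mult_left_mono) auto
    then show "real (A.step_dist t x y) \<le> 2 * (4 * B + 2) * warped_dist M \<A> \<rho> S act (x, t) (y, t) + 1" using D(2) by simp
    have "0 \<le> D (x, t) (y, t)" using D(1) Metric_space.nonneg by (force simp: warped_metrics_def)
    then show "0 \<le> warped_dist M \<A> \<rho> S act (x, t) (y, t)" using s by simp
  qed
qed

end

theorem theoremB:
  fixes M :: "'a::t2_space set"
    and \<A> :: "('a, 'n::finite) chart set"
    and \<rho> :: "('a, 'n) chart \<Rightarrow> 'a \<Rightarrow> real^'n^'n"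
    and G :: "('g, 'z) monoid_scheme"
    and S :: "'g set"
    and act :: "'g \<Rightarrow> 'a \<Rightarrow> 'a"
  assumes "compact_riemannian_manifold M \<A> \<rho>"
    and "group G"
    and "finite_symmetric_generating_set G S"
    and "group_action G M act"
    and "\<And>g. g \<in> carrier G \<Longrightarrow> quasi_symmetric M (riem_dist M \<A> \<rho>) (act g)"
    and "\<And>g. g \<in> carrier G \<Longrightarrow> bounded_measure_distortion (riem_measure M \<A> \<rho>) (act g)"
  shows "((\<exists>t. level_sequence t \<and>
             forms_expander_family (\<lambda>n. M \<times> {t n}) (\<lambda>n. warped_dist M \<A> \<rho> S act))
           \<longleftrightarrow> expanding_in_measure (riem_measure M \<A> \<rho>) S act) \<and>
         ((\<forall>t. level_sequence t \<longrightarrow>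
             forms_expander_family (\<lambda>n. M \<times> {t n}) (\<lambda>n. warped_dist M \<A> \<rho> S act))
           \<longleftrightarrow> expanding_in_measure (riem_measure M \<A> \<rho>) S act)"
proof -
  interpret riem_manifold M \<A> \<rho> by unfold_locales (rule assms(1))
  obtain c C \<Lambda> \<Theta> where mm: "mm_action M dst vol CARD('n) c C S act \<Lambda> \<Theta>"
    using ex_mm_action[OF assms(2-4)] assms(5,6) by blast
  interpret A: mm_action M dst vol "CARD('n)" c C S act \<Lambda> \<Theta> by (rule mm)
  let ?\<delta> = "warped_dist M \<A> \<rho> S act"
  obtain K where K: "0 \<le> K" "\<And>t x y. 1 \<le> t \<Longrightarrow> x \<in> M \<Longrightarrow> y \<in> M \<Longrightarrow> ?\<delta> (x, t) (y, t) \<le> real (A.step_dist t x y)"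
    "\<And>t x y. 1 \<le> t \<Longrightarrow> x \<in> M \<Longrightarrow> y \<in> M \<Longrightarrow> real (A.step_dist t x y) \<le> K * ?\<delta> (x, t) (y, t) + 1"
    "\<And>t x y. 1 \<le> t \<Longrightarrow> x \<in> M \<Longrightarrow> y \<in> M \<Longrightarrow> 0 \<le> ?\<delta> (x, t) (y, t)"
    by (rule warped_dist_step_dist[OF mm]) (rule that; assumption)
  let ?fam = "\<lambda>t. forms_expander_family (\<lambda>n. M \<times> {t n}) (\<lambda>n. ?\<delta>)"
  have exp_iff: "expanding_in_measure vol S act \<longleftrightarrow>
      (\<exists>\<alpha>>0. \<forall>A\<in>sets vol. measure vol A \<le> measure vol M / 2 \<longrightarrow> (1 + \<alpha>) * measure vol A \<le> measure vol (A.sat A))"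
    by (simp add: expanding_in_measure_def A.sat_def vol_facts(1))
  have 1: "?fam t" if ex: "expanding_in_measure vol S act" and t: "level_sequence t" for t
  proof -
    obtain \<alpha> where \<alpha>: "0 < \<alpha>"
      "\<And>A. A \<in> sets vol \<Longrightarrow> measure vol A \<le> measure vol M / 2 \<Longrightarrow> (1 + \<alpha>) * measure vol A \<le> measure vol (A.sat A)"
      using ex unfolding exp_iff by blast
    show ?thesis by (rule A.expanding_imp_family[OF \<alpha> K(2-4) t])
  qed
  have 2: "expanding_in_measure vol S act" if t: "level_sequence t" and fam: "?fam t" for t
    unfolding exp_iff by (rule A.family_imp_expanding[OF K(2,3,1) t fam])
  \<comment> \<open>Some level sequence has to exist; otherwise the statement about all of them
    would be vacuous and could not imply expansion.\<close>
  have "filterlim (\<lambda>n. 1 + real n) at_top sequentially"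
    by (intro filterlim_tendsto_add_at_top[OF tendsto_const] filterlim_real_sequentially)
  then have "level_sequence (\<lambda>n. 1 + real n)" by (simp add: level_sequence_def)
  then show ?thesis using 1 2 by blast
qed

end
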